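(* Let $\mathsf{k}$ be a field. There is an isomorphism of props $$\mathsf{Corel}\,\mathsf{Mat}\,\mathsf{k}[s,s^{-1}]\;\cong\;\mathbb{IH}^{\mathsf{Cor}},$$ where $\mathbb{IH}^{\mathsf{Cor}}$ is the prop presented by the symmetric monoidal theory described in the context.
   Context: A prop is a strict symmetric monoidal category whose objects are the natural numbers with monoidal product on objects given by addition; morphisms of props are identity-on-objects strict symmetric monoidal functors. A symmetric monoidal theory is a pair $(\Sigma,E)$ of a set $\Sigma$ of generators $\sigma\colon m\to n$ and a set $E$ of equations between $\Sigma$-terms of equal type ($\Sigma$-terms are built from generators, $\mathrm{id}\colon1\to1$ and the symmetry $\mathrm{tw}\colon 2\to2$ by composition $;$, in diagrammatic order, and $\oplus$). The prop it presents has as arrows the $\Sigma$-terms modulo the smallest congruence containing the laws of symmetric monoidal categories and $E$. $\mathsf{Mat}\,\mathsf{k}[s,s^{-1}]$ is the prop whose arrows $m\to n$ are $n\times m$ matrices over $\mathsf{k}[s,s^{-1}]$ (composition: matrix multiplication; monoidal product: block-diagonal sum; symmetries: permutation matrices). Every morphism in it factors as an epi followed by a split mono; these classes form a factorisation system with split monos stable under pushout. The prop $\mathsf{Corel}\,\mathsf{Mat}\,\mathsf{k}[s,s^{-1}]$ has as morphisms $m\to n$ the isomorphism classes of jointly-epic cospans $m\xrightarrow{A} d\xleftarrow{B} n$, i.e. with $[A\ B]\colon m+n\to d$ an epimorphism in $\mathsf{Mat}\,\mathsf{k}[s,s^{-1}]$. Composition: compose by pushout, then replace the resulting cospan by the epi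 part of the epi–split mono factorisation of its copairing. The monoidal product is induced by that of matrices. Generators of $\mathbb{IH}^{\mathsf{Cor}}$: $\mathrm{add}\colon2\to1$, $\mathrm{zero}\colon0\to1$, $\mathrm{copy}\colon1\to2$, $\mathrm{disc}\colon1\to0$, $s\colon1\to1$, $a\colon 1\to1$ for each $a\in \mathsf{k}$, together with their mirror images $\mathrm{add}^{op}\colon1\to2$, $\mathrm{zero}^{op}\colon1\to0$, $\mathrm{copy}^{op}\colon2\to1$, $\mathrm{disc}^{op}\colon0\to1$, $s^{op}\colon1\to1$, $a^{op}\colon1\to1$. The mirror image $\tau^{op}$ of a term $\tau$ is obtained by reversing the order of all compositions and swapping each generator with its mirror image (so $(s^{op})^{op}=s$, etc.). Equations. (1) Equations of $\mathbb{HA}_{\mathsf{k}[s,s^{-1}]}$: - $(\mathrm{add},\mathrm{zero})$ is a commutative monoid and $(\mathrm{copy},\mathrm{disc})$ is a cocommutative comonoid. - Bimonoid laws: $\mathrm{add};\mathrm{copy}=(\mathrm{copy}\oplus\mathrm{copy});(\mathrm{id}\oplus\mathrm{tw}\oplus\mathrm{id});(\mathrm{add}\oplus\mathrm{add})$, $\mathrm{zero};\mathrm{copy}=\mathrm{zero}\oplus\mathrm{zero}$, $\mathrm{add};\mathrm{disc}=\mathrm{disc}\oplus\mathrm{disc}$, $\mathrm{zero};\mathrm{disc}=\mathrm{id}_0$. - For $r=s$ and for $r=a$ with $a\in \mathsf{k}$: $r;\mathrm{copy}=\mathrm{copy};(r\oplus r)$, $r;\mathrm{disc}=\mathrm{disc}$,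 $(r\oplus r);\mathrm{add}=\mathrm{add};r$, $\mathrm{zero};r=\mathrm{zero}$. - $s;s^{op}=\mathrm{id}=s^{op};s$. - For $a,b\in \mathsf{k}$: $a;b=ab$ (the generator for the product), $\mathrm{copy};(a\oplus b);\mathrm{add}=a+b$ (the generator for the sum), the generator $1$ equals $\mathrm{id}$, the generator $0$ equals $\mathrm{disc};\mathrm{zero}$, and $a;s=s;a$. (2) The mirror images of all the equations in (1). (3) Interaction equations (together with (1) and (2) these present $\mathsf{Cospan}\,\mathsf{Mat}\,\mathsf{k}[s,s^{-1}]$; this theory is called $\mathbb{IH}^{\mathsf{Csp}}$): - White Frobenius: $(\mathrm{id}\oplus\mathrm{add}^{op});(\mathrm{add}\oplus\mathrm{id})=\mathrm{add};\mathrm{add}^{op}=(\mathrm{add}^{op}\oplus\mathrm{id});(\mathrm{id}\oplus\mathrm{add})$. - Black Frobenius: $(\mathrm{copy}\oplus\mathrm{id});(\mathrm{id}\oplus\mathrm{copy}^{op})=\mathrm{copy}^{op};\mathrm{copy}=(\mathrm{id}\oplus\mathrm{copy});(\mathrm{copy}^{op}\oplus\mathrm{id})$. - $\mathrm{disc}^{op};\mathrm{copy}=\mathrm{zero};\mathrm{add}^{op};((-1)\oplus\mathrm{id})$ and $\mathrm{copy}^{op};\mathrm{disc}=((-1)\oplus\mathrm{id});\mathrm{add};\mathrm{zero}^{op}$. - Black bone: $\mathrm{disc}^{op};\mathrm{disc}=\mathrm{id}_0$. - $p^{op};p=\mathrm{id}$ for each nonzero $p\in \mathsf{k}[s,s^{-1}]$,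 where for $p=\sum_{i=u}^v a_is^i$ the term $p\colon1\to1$ is the evident term built from the generators in (1), with $s^{-1}$ rendered by $s^{op}$: copy the input, apply $s^i$ then $a_i$ on the branch for $i$, and add the results. The term $p^{op}$ is its mirror image. (4) White bone law: $\mathrm{zero};\mathrm{zero}^{op}=\mathrm{id}_0$. *)

theory Defs
  imports "HOL-Library.Poly_Mapping" "Jordan_Normal_Form.Matrix"
begin

section \<open>Props\<close>

text \<open>Composition is written in diagrammatic order throughout.\<close>

record 'a prop_cat =
  hom :: "nat \<Rightarrow> nat \<Rightarrow> 'a set"
  ide :: "nat \<Rightarrow> 'a"
  seq :: "'a \<Rightarrow> 'a \<Rightarrow> 'a" (infixl \<open>\<fatsemi>\<index>\<close> 60)
  tens :: "'a \<Rightarrow> 'a \<Rightarrow> 'a" (infixr \<open>\<boxplus>\<index>\<close> 65)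
  braid :: "nat \<Rightarrow> nat \<Rightarrow> 'a"

text \<open>Arrows carry their type (hom-sets are disjoint), so composition and monoidal product need
  no object arguments. The second hexagon and the unit coherence of the symmetry follow from
  the axioms listed.\<close>

locale is_prop =
  fixes P :: "'a prop_cat" (structure)
  assumes hom_unique:
      "f \<in> hom P m n \<Longrightarrow> f \<in> hom P m' n' \<Longrightarrow> m = m' \<and> n = n'"
    and ide_hom: "ide P m \<in> hom P m m"
    and seq_hom: "f \<in> hom P m n \<Longrightarrow> g \<in> hom P n k \<Longrightarrow> f \<fatsemi> g \<in> hom P m k"
    and tens_hom: "f \<in> hom P m n \<Longrightarrow> g \<in> hom P m' n' \<Longrightarrow> f \<boxplus> g \<in> hom P (m + m') (n + n')"
    and braid_hom: "braid P m n \<in> hom P (m + n) (n + m)"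
    and ide_left: "f \<in> hom P m n \<Longrightarrow> ide P m \<fatsemi> f = f"
    and ide_right: "f \<in> hom P m n \<Longrightarrow> f \<fatsemi> ide P n = f"
    and seq_assoc: "f \<in> hom P m n \<Longrightarrow> g \<in> hom P n k \<Longrightarrow> h \<in> hom P k l
      \<Longrightarrow> (f \<fatsemi> g) \<fatsemi> h = f \<fatsemi> (g \<fatsemi> h)"
    and tens_ide: "ide P m \<boxplus> ide P n = ide P (m + n)"
    and interchange: "f \<in> hom P m n \<Longrightarrow> g \<in> hom P n k \<Longrightarrow> f' \<in> hom P m' n' \<Longrightarrow> g' \<in> hom P n' k'
      \<Longrightarrow> (f \<fatsemi> g) \<boxplus> (f' \<fatsemi> g') = (f \<boxplus> f') \<fatsemi> (g \<boxplus> g')"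
    and tens_unit_left: "f \<in> hom P m n \<Longrightarrow> ide P 0 \<boxplus> f = f"
    and tens_unit_right: "f \<in> hom P m n \<Longrightarrow> f \<boxplus> ide P 0 = f"
    and tens_assoc: "f \<in> hom P m n \<Longrightarrow> g \<in> hom P m' n' \<Longrightarrow> h \<in> hom P m'' n''
      \<Longrightarrow> (f \<boxplus> g) \<boxplus> h = f \<boxplus> (g \<boxplus> h)"
    and braid_natural: "f \<in> hom P m n \<Longrightarrow> g \<in> hom P m' n'
      \<Longrightarrow> (f \<boxplus> g) \<fatsemi> braid P n n' = braid P m m' \<fatsemi> (g \<boxplus> f)"
    and braid_inverse: "braid P m n \<fatsemi> braid P n m = ide P (m + n)"
    and hexagon: "braid P m (n + k) = (braid P m n \<boxplus> ide P k) \<fatsemi> (ide P n \<boxplus> braid P m k)"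

definition prop_morphism :: "'a prop_cat \<Rightarrow> 'b prop_cat \<Rightarrow> ('a \<Rightarrow> 'b) \<Rightarrow> bool" where
  "prop_morphism P Q F \<longleftrightarrow> is_prop P \<and> is_prop Q \<and>
     (\<forall>m n. \<forall>f \<in> hom P m n. F f \<in> hom Q m n) \<and>
     (\<forall>m. F (ide P m) = ide Q m) \<and>
     (\<forall>m n k. \<forall>f \<in> hom P m n. \<forall>g \<in> hom P n k. F (f \<fatsemi>\<^bsub>P\<^esub> g) = F f \<fatsemi>\<^bsub>Q\<^esub> F g) \<and>
     (\<forall>m n m' n'. \<forall>f \<in> hom P m n. \<forall>g \<in> hom P m' n'. F (f \<boxplus>\<^bsub>P\<^esub> g) = F f \<boxplus>\<^bsub>Q\<^esub> F g) \<and>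
     (\<forall>m n. F (braid P m n) = braid Q m n)"

definition props_isomorphic :: "'a prop_cat \<Rightarrow> 'b prop_cat \<Rightarrow> bool" where
  "props_isomorphic P Q \<longleftrightarrow> (\<exists>F G. prop_morphism P Q F \<and> prop_morphism Q P G \<and>
     (\<forall>m n. \<forall>f \<in> hom P m n. G (F f) = f) \<and> (\<forall>m n. \<forall>g \<in> hom Q m n. F (G g) = g))"

definition is_epi :: "'a prop_cat \<Rightarrow> nat \<Rightarrow> nat \<Rightarrow> 'a \<Rightarrow> bool" where
  "is_epi P m n f \<longleftrightarrow> f \<in> hom P m n \<and>
     (\<forall>k. \<forall>g \<in> hom P n k. \<forall>h \<in> hom P n k. f \<fatsemi>\<^bsub>P\<^esub> g = f \<fatsemi>\<^bsub>P\<^esub> h \<longrightarrow> g = h)"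

definition is_split_mono :: "'a prop_cat \<Rightarrow> nat \<Rightarrow> nat \<Rightarrow> 'a \<Rightarrow> bool" where
  "is_split_mono P m n f \<longleftrightarrow> f \<in> hom P m n \<and> (\<exists>r \<in> hom P n m. f \<fatsemi>\<^bsub>P\<^esub> r = ide P m)"

definition is_iso :: "'a prop_cat \<Rightarrow> nat \<Rightarrow> nat \<Rightarrow> 'a \<Rightarrow> bool" where
  "is_iso P m n f \<longleftrightarrow> f \<in> hom P m n \<and>
     (\<exists>g \<in> hom P n m. f \<fatsemi>\<^bsub>P\<^esub> g = ide P m \<and> g \<fatsemi>\<^bsub>P\<^esub> f = ide P n)"

text \<open>The cospan \<open>p : d \<rightarrow> e\<close>, \<open>q : d' \<rightarrow> e\<close> is a pushout of the span \<open>f : n \<rightarrow> d\<close>, \<open>g : n \<rightarrow> d'\<close>.\<close>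

definition is_pushout ::
    "'a prop_cat \<Rightarrow> nat \<Rightarrow> nat \<Rightarrow> nat \<Rightarrow> nat \<Rightarrow> 'a \<Rightarrow> 'a \<Rightarrow> 'a \<Rightarrow> 'a \<Rightarrow> bool" where
  "is_pushout P n d d' e f g p q \<longleftrightarrow>
     f \<in> hom P n d \<and> g \<in> hom P n d' \<and> p \<in> hom P d e \<and> q \<in> hom P d' e \<and>
     f \<fatsemi>\<^bsub>P\<^esub> p = g \<fatsemi>\<^bsub>P\<^esub> q \<and>
     (\<forall>x. \<forall>p' \<in> hom P d x. \<forall>q' \<in> hom P d' x. f \<fatsemi>\<^bsub>P\<^esub> p' = g \<fatsemi>\<^bsub>P\<^esub> q' \<longrightarrow>
        (\<exists>!u. u \<in> hom P e x \<and> p \<fatsemi>\<^bsub>P\<^esub> u = p' \<and> q \<fatsemi>\<^bsub>P\<^esub> u = q'))"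


section \<open>Matrices and corelations\<close>

text \<open>The group ring of the integers, i.e. the ring of Laurent polynomials \<open>k[s, s\<^sup>-\<^sup>1]\<close>:
  multiplication on \<^typ>\<open>int \<Rightarrow>\<^sub>0 'k\<close> is convolution.\<close>

type_synonym 'k laurent = "int \<Rightarrow>\<^sub>0 'k"

definition Mat :: "'r::comm_ring_1 mat prop_cat" where
  "Mat = \<lparr> hom = (\<lambda>m n. carrier_mat n m),
           ide = (\<lambda>m. 1\<^sub>m m),
           seq = (\<lambda>A B. B * A),
           tens = (\<lambda>A B. four_block_mat A (0\<^sub>m (dim_row A) (dim_col B))
                                          (0\<^sub>m (dim_row B) (dim_col A)) B),
           braid = (\<lambda>m n. four_block_mat (0\<^sub>m n m) (1\<^sub>m n) (1\<^sub>m m) (0\<^sub>m m n)) \<rparr>"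

text \<open>The copairing \<open>[A B]\<close>.\<close>

definition copair :: "'r::comm_ring_1 mat \<Rightarrow> 'r mat \<Rightarrow> 'r mat" where
  "copair A B = four_block_mat A B (0\<^sub>m 0 (dim_col A)) (0\<^sub>m 0 (dim_col B))"

text \<open>A cospan is the pair of its legs; its feet are the numbers of columns.\<close>

type_synonym 'r cospan = "'r mat \<times> 'r mat"

definition jointly_epic_cospans :: "nat \<Rightarrow> nat \<Rightarrow> 'r::comm_ring_1 cospan set" where
  "jointly_epic_cospans m n = {(A, B). \<exists>d. A \<in> hom Mat m d \<and> B \<in> hom Mat n d \<and>
     is_epi Mat (m + n) d (copair A B)}"

definition cospan_iso :: "('r::comm_ring_1 cospan \<times> 'r cospan) set" where
  "cospan_iso = {((A, B), (A', B')). \<exists>m n d d' U.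
     A \<in> hom Mat m d \<and> B \<in> hom Mat n d \<and> is_iso Mat d d' U \<and>
     A' = A \<fatsemi>\<^bsub>Mat\<^esub> U \<and> B' = B \<fatsemi>\<^bsub>Mat\<^esub> U}"

text \<open>\<open>(C, D)\<close> is a composite of the corelations \<open>(A, B) : m \<rightarrow> n\<close> and \<open>(A', B') : n \<rightarrow> k\<close>:
  for some pushout \<open>(P, Q)\<close> of \<open>B\<close> and \<open>A'\<close>, the copairing \<open>[C D]\<close> is the epi part of an
  epi -- split mono factorisation, with mono part \<open>M\<close>, of \<open>[A;P  B';Q]\<close>.\<close>

definition is_corel_composite ::
    "'r::comm_ring_1 cospan \<Rightarrow> 'r cospan \<Rightarrow> 'r cospan \<Rightarrow> bool" where
  "is_corel_composite = (\<lambda>(A, B) (A', B') (C, D).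
     \<exists>m n k d d' e c P Q M.
       A \<in> hom Mat m d \<and> B' \<in> hom Mat k d' \<and>
       is_pushout Mat n d d' e B A' P Q \<and>
       C \<in> hom Mat m c \<and> D \<in> hom Mat k c \<and>
       is_epi Mat (m + k) c (copair C D) \<and> is_split_mono Mat c e M \<and>
       copair C D \<fatsemi>\<^bsub>Mat\<^esub> M = copair (A \<fatsemi>\<^bsub>Mat\<^esub> P) (B' \<fatsemi>\<^bsub>Mat\<^esub> Q))"

text \<open>Composites are unique up to isomorphism of cospans, so the set of all composites of
  representatives is a single isomorphism class.\<close>

definition Corel_Mat :: "'r::comm_ring_1 cospan set prop_cat" where
  "Corel_Mat = \<lparr>
     hom = (\<lambda>m n. jointly_epic_cospans m n // cospan_iso),
     ide = (\<lambda>m. cospan_iso `` {(ide Mat m, ide Mat m)}),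
     seq = (\<lambda>X Y. {z. \<exists>x \<in> X. \<exists>y \<in> Y. is_corel_composite x y z}),
     tens = (\<lambda>X Y. \<Union>(A, B) \<in> X. \<Union>(A', B') \<in> Y.
               cospan_iso `` {(A \<boxplus>\<^bsub>Mat\<^esub> A', B \<boxplus>\<^bsub>Mat\<^esub> B')}),
     braid = (\<lambda>m n. cospan_iso `` {(braid Mat m n, ide Mat (n + m))}) \<rparr>"


section \<open>Props presented by symmetric monoidal theories\<close>

text \<open>\<open>Id\<^sub>0\<close> is the empty term \<open>0 \<rightarrow> 0\<close>.\<close>

datatype 'g smterm =
    Gen 'g
  | Id\<^sub>0
  | Id
  | Tw
  | Seq "'g smterm" "'g smterm" (infixr \<open>;;\<close> 60)
  | Tens "'g smterm" "'g smterm" (infixr \<open>\<oplus>\<^sub>t\<close> 65)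

inductive has_type :: "('g \<Rightarrow> nat \<times> nat) \<Rightarrow> 'g smterm \<Rightarrow> nat \<Rightarrow> nat \<Rightarrow> bool"
  for ar :: "'g \<Rightarrow> nat \<times> nat" where
  "ar g = (m, n) \<Longrightarrow> has_type ar (Gen g) m n"
| "has_type ar Id\<^sub>0 0 0"
| "has_type ar Id 1 1"
| "has_type ar Tw 2 2"
| "has_type ar t m n \<Longrightarrow> has_type ar u n k \<Longrightarrow> has_type ar (t ;; u) m k"
| "has_type ar t m n \<Longrightarrow> has_type ar u m' n' \<Longrightarrow> has_type ar (t \<oplus>\<^sub>t u) (m + m') (n + n')"

fun id_term :: "nat \<Rightarrow> 'g smterm" where
  "id_term 0 = Id\<^sub>0"
| "id_term (Suc n) = Id \<oplus>\<^sub>t id_term n"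

text \<open>The symmetry \<open>1 + n \<rightarrow> n + 1\<close>.\<close>

fun braid1_term :: "nat \<Rightarrow> 'g smterm" where
  "braid1_term 0 = Id"
| "braid1_term (Suc n) = (Tw \<oplus>\<^sub>t id_term n) ;; (Id \<oplus>\<^sub>t braid1_term n)"

fun braid_term :: "nat \<Rightarrow> nat \<Rightarrow> 'g smterm" where
  "braid_term 0 n = id_term n"
| "braid_term (Suc m) n = (Id \<oplus>\<^sub>t braid_term m n) ;; (braid1_term n \<oplus>\<^sub>t id_term m)"

text \<open>The smallest congruence on well-typed terms containing the laws of strict symmetric
  monoidal categories and the equations \<open>E\<close>; \<open>m\<close> and \<open>n\<close> are the common type of the two terms.\<close>

inductive sm_cong ::
    "('g \<Rightarrow> nat \<times> nat) \<Rightarrow> ('g smterm \<times> 'g smterm) set \<Rightarrow> nat \<Rightarrow> nat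
      \<Rightarrow> 'g smterm \<Rightarrow> 'g smterm \<Rightarrow> bool"
  for ar :: "'g \<Rightarrow> nat \<times> nat" and E :: "('g smterm \<times> 'g smterm) set" where
  eqn: "(t, u) \<in> E \<Longrightarrow> has_type ar t m n \<Longrightarrow> has_type ar u m n \<Longrightarrow> sm_cong ar E m n t u"
| refl: "has_type ar t m n \<Longrightarrow> sm_cong ar E m n t t"
| sym: "sm_cong ar E m n t u \<Longrightarrow> sm_cong ar E m n u t"
| trans: "sm_cong ar E m n t u \<Longrightarrow> sm_cong ar E m n u v \<Longrightarrow> sm_cong ar E m n t v"
| seq_cong: "sm_cong ar E m n t t' \<Longrightarrow> sm_cong ar E n k u u'
    \<Longrightarrow> sm_cong ar E m k (t ;; u) (t' ;; u')"
| tens_cong: "sm_cong ar E m n t t' \<Longrightarrow> sm_cong ar E m' n' u u'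
    \<Longrightarrow> sm_cong ar E (m + m') (n + n') (t \<oplus>\<^sub>t u) (t' \<oplus>\<^sub>t u')"
| ide_left: "has_type ar t m n \<Longrightarrow> sm_cong ar E m n (id_term m ;; t) t"
| ide_right: "has_type ar t m n \<Longrightarrow> sm_cong ar E m n (t ;; id_term n) t"
| seq_assoc: "has_type ar t m n \<Longrightarrow> has_type ar u n k \<Longrightarrow> has_type ar v k l
    \<Longrightarrow> sm_cong ar E m l ((t ;; u) ;; v) (t ;; (u ;; v))"
| tens_ide: "sm_cong ar E (m + n) (m + n) (id_term m \<oplus>\<^sub>t id_term n) (id_term (m + n))"
| interchange: "has_type ar t m n \<Longrightarrow> has_type ar u n k
    \<Longrightarrow> has_type ar t' m' n' \<Longrightarrow> has_type ar u' n' k'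
    \<Longrightarrow> sm_cong ar E (m + m') (k + k') ((t ;; u) \<oplus>\<^sub>t (t' ;; u')) ((t \<oplus>\<^sub>t t') ;; (u \<oplus>\<^sub>t u'))"
| tens_unit_left: "has_type ar t m n \<Longrightarrow> sm_cong ar E m n (Id\<^sub>0 \<oplus>\<^sub>t t) t"
| tens_unit_right: "has_type ar t m n \<Longrightarrow> sm_cong ar E m n (t \<oplus>\<^sub>t Id\<^sub>0) t"
| tens_assoc: "has_type ar t m n \<Longrightarrow> has_type ar u m' n' \<Longrightarrow> has_type ar v m'' n''
    \<Longrightarrow> sm_cong ar E (m + m' + m'') (n + n' + n'') ((t \<oplus>\<^sub>t u) \<oplus>\<^sub>t v) (t \<oplus>\<^sub>t (u \<oplus>\<^sub>t v))"
| braid_natural: "has_type ar t m n \<Longrightarrow> has_type ar u m' n'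
    \<Longrightarrow> sm_cong ar E (m + m') (n' + n)
          ((t \<oplus>\<^sub>t u) ;; braid_term n n') (braid_term m m' ;; (u \<oplus>\<^sub>t t))"
| braid_inverse: "sm_cong ar E (m + n) (m + n) (braid_term m n ;; braid_term n m) (id_term (m + n))"
| hexagon: "sm_cong ar E (m + (n + k)) (n + k + m) (braid_term m (n + k))
    ((braid_term m n \<oplus>\<^sub>t id_term k) ;; (id_term n \<oplus>\<^sub>t braid_term m k))"

definition cong_rel ::
    "('g \<Rightarrow> nat \<times> nat) \<Rightarrow> ('g smterm \<times> 'g smterm) set \<Rightarrow> ('g smterm \<times> 'g smterm) set" where
  "cong_rel ar E = {(t, u). \<exists>m n. sm_cong ar E m n t u}"

definition presented_prop ::
    "('g \<Rightarrow> nat \<times> nat) \<Rightarrow> ('g smterm \<times> 'g smterm) set \<Rightarrow> 'g smterm set prop_cat" where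
  "presented_prop ar E = \<lparr>
     hom = (\<lambda>m n. {t. has_type ar t m n} // cong_rel ar E),
     ide = (\<lambda>m. cong_rel ar E `` {id_term m}),
     seq = (\<lambda>X Y. \<Union>t \<in> X. \<Union>u \<in> Y. cong_rel ar E `` {t ;; u}),
     tens = (\<lambda>X Y. \<Union>t \<in> X. \<Union>u \<in> Y. cong_rel ar E `` {t \<oplus>\<^sub>t u}),
     braid = (\<lambda>m n. cong_rel ar E `` {braid_term m n}) \<rparr>"


section \<open>The theory \<open>IH\<^sup>C\<^sup>o\<^sup>r\<close>\<close>

datatype 'k base_gen = Add | Zero | Copy | Disc | Shift | Scalar 'k

datatype 'k ih_gen = Fwd "'k base_gen" | Op "'k base_gen"

fun base_arity :: "'k base_gen \<Rightarrow> nat \<times> nat" where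
  "base_arity Add = (2, 1)"
| "base_arity Zero = (0, 1)"
| "base_arity Copy = (1, 2)"
| "base_arity Disc = (1, 0)"
| "base_arity Shift = (1, 1)"
| "base_arity (Scalar a) = (1, 1)"

fun ih_arity :: "'k ih_gen \<Rightarrow> nat \<times> nat" where
  "ih_arity (Fwd g) = base_arity g"
| "ih_arity (Op g) = prod.swap (base_arity g)"

fun mirror_gen :: "'k ih_gen \<Rightarrow> 'k ih_gen" where
  "mirror_gen (Fwd g) = Op g"
| "mirror_gen (Op g) = Fwd g"

fun mirror :: "'k ih_gen smterm \<Rightarrow> 'k ih_gen smterm" where
  "mirror (Gen g) = Gen (mirror_gen g)"
| "mirror Id\<^sub>0 = Id\<^sub>0"
| "mirror Id = Id"
| "mirror Tw = Tw"
| "mirror (t ;; u) = mirror u ;; mirror t"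
| "mirror (t \<oplus>\<^sub>t u) = mirror t \<oplus>\<^sub>t mirror u"

abbreviation add_t :: "'k ih_gen smterm" where "add_t \<equiv> Gen (Fwd Add)"
abbreviation zero_t :: "'k ih_gen smterm" where "zero_t \<equiv> Gen (Fwd Zero)"
abbreviation copy_t :: "'k ih_gen smterm" where "copy_t \<equiv> Gen (Fwd Copy)"
abbreviation disc_t :: "'k ih_gen smterm" where "disc_t \<equiv> Gen (Fwd Disc)"
abbreviation s_t :: "'k ih_gen smterm" where "s_t \<equiv> Gen (Fwd Shift)"
abbreviation scal_t :: "'k \<Rightarrow> 'k ih_gen smterm" where "scal_t a \<equiv> Gen (Fwd (Scalar a))"
abbreviation add_op :: "'k ih_gen smterm" where "add_op \<equiv> Gen (Op Add)"
abbreviation zero_op :: "'k ih_gen smterm" where "zero_op \<equiv> Gen (Op Zero)"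
abbreviation copy_op :: "'k ih_gen smterm" where "copy_op \<equiv> Gen (Op Copy)"
abbreviation disc_op :: "'k ih_gen smterm" where "disc_op \<equiv> Gen (Op Disc)"
abbreviation s_op :: "'k ih_gen smterm" where "s_op \<equiv> Gen (Op Shift)"

inductive_set HA_eqs :: "('k::field ih_gen smterm \<times> 'k ih_gen smterm) set" where
  add_assoc: "((add_t \<oplus>\<^sub>t Id) ;; add_t, (Id \<oplus>\<^sub>t add_t) ;; add_t) \<in> HA_eqs"
| add_comm: "(Tw ;; add_t, add_t) \<in> HA_eqs"
| add_unit_left: "((zero_t \<oplus>\<^sub>t Id) ;; add_t, Id) \<in> HA_eqs"
| add_unit_right: "((Id \<oplus>\<^sub>t zero_t) ;; add_t, Id) \<in> HA_eqs"
| copy_assoc: "(copy_t ;; (copy_t \<oplus>\<^sub>t Id), copy_t ;; (Id \<oplus>\<^sub>t copy_t)) \<in> HA_eqs"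
| copy_comm: "(copy_t ;; Tw, copy_t) \<in> HA_eqs"
| copy_unit_left: "(copy_t ;; (disc_t \<oplus>\<^sub>t Id), Id) \<in> HA_eqs"
| copy_unit_right: "(copy_t ;; (Id \<oplus>\<^sub>t disc_t), Id) \<in> HA_eqs"
| add_copy: "(add_t ;; copy_t,
    (copy_t \<oplus>\<^sub>t copy_t) ;; (Id \<oplus>\<^sub>t Tw \<oplus>\<^sub>t Id) ;; (add_t \<oplus>\<^sub>t add_t)) \<in> HA_eqs"
| zero_copy: "(zero_t ;; copy_t, zero_t \<oplus>\<^sub>t zero_t) \<in> HA_eqs"
| add_disc: "(add_t ;; disc_t, disc_t \<oplus>\<^sub>t disc_t) \<in> HA_eqs"
| zero_disc: "(zero_t ;; disc_t, Id\<^sub>0) \<in> HA_eqs"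
| map_copy: "r = s_t \<or> r = scal_t a \<Longrightarrow> (r ;; copy_t, copy_t ;; (r \<oplus>\<^sub>t r)) \<in> HA_eqs"
| map_disc: "r = s_t \<or> r = scal_t a \<Longrightarrow> (r ;; disc_t, disc_t) \<in> HA_eqs"
| map_add: "r = s_t \<or> r = scal_t a \<Longrightarrow> ((r \<oplus>\<^sub>t r) ;; add_t, add_t ;; r) \<in> HA_eqs"
| map_zero: "r = s_t \<or> r = scal_t a \<Longrightarrow> (zero_t ;; r, zero_t) \<in> HA_eqs"
| s_s_op: "(s_t ;; s_op, Id) \<in> HA_eqs"
| s_op_s: "(s_op ;; s_t, Id) \<in> HA_eqs"
| scal_mult: "(scal_t a ;; scal_t b, scal_t (a * b)) \<in> HA_eqs"
| scal_add: "(copy_t ;; (scal_t a \<oplus>\<^sub>t scal_t b) ;; add_t, scal_t (a + b)) \<in> HA_eqs"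
| scal_one: "(scal_t 1, Id) \<in> HA_eqs"
| scal_zero: "(scal_t 0, disc_t ;; zero_t) \<in> HA_eqs"
| scal_s: "(scal_t a ;; s_t, s_t ;; scal_t a) \<in> HA_eqs"

definition mirror_eqs ::
    "('k ih_gen smterm \<times> 'k ih_gen smterm) set \<Rightarrow> ('k ih_gen smterm \<times> 'k ih_gen smterm) set" where
  "mirror_eqs E = (\<lambda>(t, u). (mirror t, mirror u)) ` E"

fun pow_term :: "'g smterm \<Rightarrow> nat \<Rightarrow> 'g smterm" where
  "pow_term t 0 = Id"
| "pow_term t (Suc n) = t ;; pow_term t n"

definition s_pow :: "int \<Rightarrow> 'k ih_gen smterm" where
  "s_pow i = (if 0 \<le> i then pow_term s_t (nat i) else pow_term s_op (nat (- i)))"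

fun sum_term :: "'k ih_gen smterm list \<Rightarrow> 'k ih_gen smterm" where
  "sum_term [] = disc_t ;; zero_t"
| "sum_term [t] = t"
| "sum_term (t # t' # ts) = copy_t ;; (t \<oplus>\<^sub>t sum_term (t' # ts)) ;; add_t"

text \<open>The term for \<open>p\<close> written as a sum over the exponents \<open>u, \<dots>, v\<close>.\<close>

definition laurent_term :: "'k::field laurent \<Rightarrow> int \<Rightarrow> int \<Rightarrow> 'k ih_gen smterm" where
  "laurent_term p u v = sum_term (map (\<lambda>i. s_pow i ;; scal_t (Poly_Mapping.lookup p i)) [u..v])"

text \<open>In \<open>poly_op_poly\<close>, every way of writing \<open>p\<close> as a sum over an interval of exponents
  is admitted; coefficients inside the interval may be zero.\<close>

inductive_set interaction_eqs :: "('k::field ih_gen smterm \<times> 'k ih_gen smterm) set" where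
  white_frob_left:
    "((Id \<oplus>\<^sub>t add_op) ;; (add_t \<oplus>\<^sub>t Id), add_t ;; add_op) \<in> interaction_eqs"
| white_frob_right:
    "(add_t ;; add_op, (add_op \<oplus>\<^sub>t Id) ;; (Id \<oplus>\<^sub>t add_t)) \<in> interaction_eqs"
| black_frob_left:
    "((copy_t \<oplus>\<^sub>t Id) ;; (Id \<oplus>\<^sub>t copy_op), copy_op ;; copy_t) \<in> interaction_eqs"
| black_frob_right:
    "(copy_op ;; copy_t, (Id \<oplus>\<^sub>t copy_t) ;; (copy_op \<oplus>\<^sub>t Id)) \<in> interaction_eqs"
| cup: "(disc_op ;; copy_t, zero_t ;; add_op ;; (scal_t (-1) \<oplus>\<^sub>t Id)) \<in> interaction_eqs"
| cap: "(copy_op ;; disc_t, (scal_t (-1) \<oplus>\<^sub>t Id) ;; add_t ;; zero_op) \<in> interaction_eqs"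
| black_bone: "(disc_op ;; disc_t, Id\<^sub>0) \<in> interaction_eqs"
| poly_op_poly: "p \<noteq> 0 \<Longrightarrow> Poly_Mapping.keys p \<subseteq> {u..v}
    \<Longrightarrow> (mirror (laurent_term p u v) ;; laurent_term p u v, Id) \<in> interaction_eqs"

definition IH_Csp_eqs :: "('k::field ih_gen smterm \<times> 'k ih_gen smterm) set" where
  "IH_Csp_eqs = HA_eqs \<union> mirror_eqs HA_eqs \<union> interaction_eqs"

definition IH_Cor_eqs :: "('k::field ih_gen smterm \<times> 'k ih_gen smterm) set" where
  "IH_Cor_eqs = IH_Csp_eqs \<union> {(zero_t ;; zero_op, Id\<^sub>0)}"

definition IH_Cor :: "'k::field ih_gen smterm set prop_cat" where
  "IH_Cor = presented_prop ih_arity IH_Cor_eqs"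

end

theory Submission
  imports Defs
begin

text \<open>A jointly epic cospan \<open>(A, B)\<close> of matrices over \<open>R = k[s, s\<^sup>-\<^sup>1]\<close> is determined up to isomorphism by
  the row space of \<open>[A B]\<close>, a submodule of \<open>R\<^sup>m\<^sup>+\<^sup>n\<close>. Under this reading corelations compose as relations, so
  both props are compared with the prop of linear relations.

  The relational semantics of \<open>IH\<^sup>C\<^sup>o\<^sup>r\<close> is sound, and it is full because every submodule has a finite
  basis. For completeness, bending wires reduces arrows \<open>m \<rightarrow> n\<close> to arrows \<open>0 \<rightarrow> m + n\<close>, and each of the
  latter is equal to one that is built from a list of row vectors. That arrow depends only on the span
  of the vectors: elementary row operations are absorbed by copies of \<open>zero\<close>, and rows that vanish are
  removed by the white bone law. The spans are closed under the generators because Euclidean division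
  reduces the first column of a list of vectors to a single pivot, which the law \<open>p\<^sup>o\<^sup>p ; p = id\<close> then
  eliminates.\<close>


section \<open>Calculating in props\<close>

text \<open>Matrices act on row vectors, so the generators that denote functions are the mirror
  images of those of the matrix theory, together with \<open>s\<close>. Their completeness needs no
  syntactic matrix form: in any model, the arrows to one wire that the mirror image of
  \<open>add\<close> can copy form a module, the identity is the tuple of the coordinate
  projections, and a function term acts on tuples by the same operations as on coefficient vectors.
  Hence it is determined by its matrix (\<open>eval_fn_eq\<close>). The obstacle is composition. A
  nonzero Laurent polynomial need not be invertible, and only one of its two composites with its
  mirror image is known to be the identity. The Frobenius equations reduce every other generator to
  function terms, the arbitrary value \<open>zero\<close> and the test for zero \<open>disc\<close>,
  so only this test demands real work. For it the law on \<open>p\<close> says that p u = 0 forces u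
  = 0. This can be exploited once a single vector carries the whole first coordinate, which is what
  the Euclidean algorithm achieves.\<close>

context is_prop
begin

abbreviation ide_arrow (\<open>\<I>\<close>) where "\<I> \<equiv> ide P"
abbreviation braid_arrow (\<open>\<X>\<close>) where "\<X> \<equiv> braid P"

text \<open>Hom-sets are disjoint, so source and target are functions of the arrow. With them typing
  conditions become equations that the simplifier solves, whereas membership in
  \<open>hom P m n\<close> would leave intermediate objects to be guessed.\<close>

definition arr :: "'a \<Rightarrow> bool" where "arr f \<longleftrightarrow> (\<exists>m n. f \<in> hom P m n)"
definition src :: "'a \<Rightarrow> nat" where "src f = (THE m. \<exists>n. f \<in> hom P m n)"
definition tgt :: "'a \<Rightarrow> nat" where "tgt f = (THE n. \<exists>m. f \<in> hom P m n)"

lemma hom_iff: "f \<in> hom P m n \<longleftrightarrow> arr f \<and> src f = m \<and> tgt f = n"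
proof -
  have "src f = m \<and> tgt f = n" if "f \<in> hom P m n" for m n
    using that hom_unique[OF that] unfolding src_def tgt_def by (blast intro: the_equality)
  then show ?thesis unfolding arr_def by blast
qed

lemma ide_type[simp]: "arr (\<I> n)" "src (\<I> n) = n" "tgt (\<I> n) = n"
  using ide_hom[of n] by (simp_all add: hom_iff)

lemma braid_type[simp]: "arr (\<X> m n)" "src (\<X> m n) = m + n" "tgt (\<X> m n) = n + m"
  using braid_hom[of m n] by (simp_all add: hom_iff)

lemma seq_type[simp]:
  assumes "arr f" "arr g" "tgt f = src g"
  shows "arr (f \<fatsemi> g)" "src (f \<fatsemi> g) = src f" "tgt (f \<fatsemi> g) = tgt g"
  using seq_hom[of f "src f" "tgt f" g "tgt g"] assms by (simp_all add: hom_iff)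

lemma tens_type[simp]:
  assumes "arr f" "arr g"
  shows "arr (f \<boxplus> g)" "src (f \<boxplus> g) = src f + src g" "tgt (f \<boxplus> g) = tgt f + tgt g"
  using tens_hom[of f "src f" "tgt f" g "src g" "tgt g"] assms by (simp_all add: hom_iff)

lemma idl[simp]: "arr f \<Longrightarrow> src f = m \<Longrightarrow> \<I> m \<fatsemi> f = f"
  and idr[simp]: "arr f \<Longrightarrow> tgt f = n \<Longrightarrow> f \<fatsemi> \<I> n = f"
  and unitl[simp]: "arr f \<Longrightarrow> \<I> 0 \<boxplus> f = f"
  and unitr[simp]: "arr f \<Longrightarrow> f \<boxplus> \<I> 0 = f"
  using ide_left ide_right tens_unit_left tens_unit_right by (auto simp: hom_iff)

lemma seq_seq: "arr f \<Longrightarrow> arr g \<Longrightarrow> arr h \<Longrightarrow> tgt f = src g \<Longrightarrow> tgt g = src h \<Longrightarrow>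
    (f \<fatsemi> g) \<fatsemi> h = f \<fatsemi> (g \<fatsemi> h)"
  using seq_assoc[of f "src f" "tgt f" g "tgt g" h "tgt h"] by (simp add: hom_iff)

lemma tens_tens: "arr f \<Longrightarrow> arr g \<Longrightarrow> arr h \<Longrightarrow> (f \<boxplus> g) \<boxplus> h = f \<boxplus> (g \<boxplus> h)"
  using tens_assoc[of f "src f" "tgt f" g "src g" "tgt g" h "src h" "tgt h"] by (simp add: hom_iff)

lemma tens_seq: "arr f \<Longrightarrow> arr g \<Longrightarrow> arr f' \<Longrightarrow> arr g' \<Longrightarrow> tgt f = src g \<Longrightarrow> tgt f' = src g' \<Longrightarrow>
    (f \<boxplus> f') \<fatsemi> (g \<boxplus> g') = (f \<fatsemi> g) \<boxplus> (f' \<fatsemi> g')"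
  using interchange[of f "src f" "tgt f" g "tgt g" f' "src f'" "tgt f'" g' "tgt g'"]
  by (simp add: hom_iff)

lemma braid_nat: "arr f \<Longrightarrow> arr g \<Longrightarrow> src f = m \<Longrightarrow> src g = m' \<Longrightarrow> tgt f = n \<Longrightarrow> tgt g = n' \<Longrightarrow>
    (f \<boxplus> g) \<fatsemi> \<X> n n' = \<X> m m' \<fatsemi> (g \<boxplus> f)"
  using braid_natural[of f m n g m' n'] by (simp add: hom_iff)

text \<open>The hexagon makes this arrow idempotent, and it is invertible, so it is an
  identity.\<close>

lemma braid_0_right[simp]: "\<X> m 0 = \<I> m"
proof -
  have "\<X> m 0 = \<X> m 0 \<fatsemi> \<X> m 0"
    using hexagon[of m 0 0] by simp
  then have "\<X> m 0 \<fatsemi> \<X> 0 m = (\<X> m 0 \<fatsemi> \<X> m 0) \<fatsemi> \<X> 0 m" by simp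
  also have "\<dots> = \<X> m 0 \<fatsemi> (\<X> m 0 \<fatsemi> \<X> 0 m)" by (rule seq_seq) auto
  finally show ?thesis by (simp add: braid_inverse)
qed

lemma braid_0_left[simp]: "\<X> 0 m = \<I> m"
  using braid_inverse[of m 0] by simp

text \<open>The second hexagon: by the first one, both sides are inverse to
  \<open>\<X> k (m + n)\<close>.\<close>

lemma hexagon': "\<X> (m + n) k = (\<I> m \<boxplus> \<X> n k) \<fatsemi> (\<X> m k \<boxplus> \<I> n)"
proof -
  let ?L = "(\<I> m \<boxplus> \<X> n k) \<fatsemi> (\<X> m k \<boxplus> \<I> n)"
  have "\<X> k (m + n) \<fatsemi> ?L = (\<X> k m \<boxplus> \<I> n) \<fatsemi> ((\<I> m \<boxplus> \<X> k n) \<fatsemi> (\<I> m \<boxplus> \<X> n k)) \<fatsemi> (\<X> m k \<boxplus> \<I> n)"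
    by (simp add: hexagon seq_seq add_ac)
  also have "\<dots> = (\<X> k m \<boxplus> \<I> n) \<fatsemi> (\<X> m k \<boxplus> \<I> n)"
    by (simp add: tens_seq braid_inverse tens_ide add_ac)
  also have "\<dots> = \<I> (k + (m + n))"
    by (simp add: tens_seq braid_inverse tens_ide add_ac)
  finally have *: "\<X> k (m + n) \<fatsemi> ?L = \<I> (k + (m + n))" .
  have "?L = (\<X> (m + n) k \<fatsemi> \<X> k (m + n)) \<fatsemi> ?L"
    by (simp add: braid_inverse add_ac)
  also have "\<dots> = \<X> (m + n) k \<fatsemi> (\<X> k (m + n) \<fatsemi> ?L)"
    by (rule seq_seq) (auto simp: add_ac)
  also have "\<dots> = \<X> (m + n) k" by (simp add: * add_ac)
  finally show ?thesis by simp
qed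

end

section \<open>Transport of prop structure along a bijection\<close>

lemma prop_morphismI:
  assumes "is_prop P" "is_prop Q"
    and "\<And>m n f. f \<in> hom P m n \<Longrightarrow> F f \<in> hom Q m n"
    and "\<And>m. F (ide P m) = ide Q m"
    and "\<And>m n k f g. f \<in> hom P m n \<Longrightarrow> g \<in> hom P n k \<Longrightarrow> F (f \<fatsemi>\<^bsub>P\<^esub> g) = F f \<fatsemi>\<^bsub>Q\<^esub> F g"
    and "\<And>m n m' n' f g. f \<in> hom P m n \<Longrightarrow> g \<in> hom P m' n' \<Longrightarrow> F (f \<boxplus>\<^bsub>P\<^esub> g) = F f \<boxplus>\<^bsub>Q\<^esub> F g"
    and "\<And>m n. F (braid P m n) = braid Q m n"
  shows "prop_morphism P Q F"
  using assms unfolding prop_morphism_def by blast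

text \<open>Of \<open>P\<close> only well-typed operations are required. As \<open>F\<close> is
  injective on hom-sets and preserves the operations, each prop law is pulled back from
  \<open>Q\<close>. In this way corelations become a prop without any associativity argument for
  pushouts.\<close>

locale prop_transport =
  Q: is_prop Q for Q :: "'b prop_cat" (structure) +
  fixes P :: "'a prop_cat" and F :: "'a \<Rightarrow> 'b"
  assumes F_bij: "bij_betw F (hom P m n) (hom Q m n)"
    and P_ide: "ide P m \<in> hom P m m"
    and P_seq: "f \<in> hom P m n \<Longrightarrow> g \<in> hom P n k \<Longrightarrow> f \<fatsemi>\<^bsub>P\<^esub> g \<in> hom P m k"
    and P_tens: "f \<in> hom P m n \<Longrightarrow> g \<in> hom P m' n' \<Longrightarrow> f \<boxplus>\<^bsub>P\<^esub> g \<in> hom P (m + m') (n + n')"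
    and P_braid: "braid P m n \<in> hom P (m + n) (n + m)"
    and F_ide: "F (ide P m) = ide Q m"
    and F_seq: "f \<in> hom P m n \<Longrightarrow> g \<in> hom P n k \<Longrightarrow> F (f \<fatsemi>\<^bsub>P\<^esub> g) = F f \<fatsemi> F g"
    and F_tens: "f \<in> hom P m n \<Longrightarrow> g \<in> hom P m' n' \<Longrightarrow> F (f \<boxplus>\<^bsub>P\<^esub> g) = F f \<boxplus> F g"
    and F_braid: "F (braid P m n) = braid Q m n"
begin

lemma F_hom: "f \<in> hom P m n \<Longrightarrow> F f \<in> hom Q m n"
  using F_bij bij_betwE by blast

lemma F_inj: "f \<in> hom P m n \<Longrightarrow> g \<in> hom P m n \<Longrightarrow> F f = F g \<Longrightarrow> f = g"
  using F_bij[of m n] unfolding bij_betw_def inj_on_def by blast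

lemma P_prop: "is_prop P"
proof
  show "m = m' \<and> n = n'" if "f \<in> hom P m n" "f \<in> hom P m' n'" for f m n m' n'
    using that F_hom Q.hom_unique by blast
  show "ide P m \<fatsemi>\<^bsub>P\<^esub> f = f" if f: "f \<in> hom P m n" for f m n
    by (rule F_inj[OF P_seq[OF P_ide f] f])
      (simp add: F_seq[OF P_ide f] F_ide Q.ide_left[OF F_hom[OF f]])
  show "f \<fatsemi>\<^bsub>P\<^esub> ide P n = f" if f: "f \<in> hom P m n" for f m n
    by (rule F_inj[OF P_seq[OF f P_ide] f])
      (simp add: F_seq[OF f P_ide] F_ide Q.ide_right[OF F_hom[OF f]])
  show "(f \<fatsemi>\<^bsub>P\<^esub> g) \<fatsemi>\<^bsub>P\<^esub> h = f \<fatsemi>\<^bsub>P\<^esub> (g \<fatsemi>\<^bsub>P\<^esub> h)"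
    if f: "f \<in> hom P m n" and g: "g \<in> hom P n k" and h: "h \<in> hom P k l" for f g h m n k l
    by (rule F_inj[OF P_seq[OF P_seq[OF f g] h] P_seq[OF f P_seq[OF g h]]])
      (simp add: F_seq[OF P_seq[OF f g] h] F_seq[OF f g] F_seq[OF f P_seq[OF g h]] F_seq[OF g h]
        Q.seq_assoc[OF F_hom[OF f] F_hom[OF g] F_hom[OF h]])
  show "ide P m \<boxplus>\<^bsub>P\<^esub> ide P n = ide P (m + n)" for m n
    by (rule F_inj[OF P_tens[OF P_ide P_ide] P_ide]) (simp add: F_tens[OF P_ide P_ide] F_ide Q.tens_ide)
  show "(f \<fatsemi>\<^bsub>P\<^esub> g) \<boxplus>\<^bsub>P\<^esub> (f' \<fatsemi>\<^bsub>P\<^esub> g') = (f \<boxplus>\<^bsub>P\<^esub> f') \<fatsemi>\<^bsub>P\<^esub> (g \<boxplus>\<^bsub>P\<^esub> g')"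
    if f: "f \<in> hom P m n" and g: "g \<in> hom P n k" and f': "f' \<in> hom P m' n'" and g': "g' \<in> hom P n' k'"
    for f g f' g' m n k m' n' k'
    by (rule F_inj[OF P_tens[OF P_seq[OF f g] P_seq[OF f' g']] P_seq[OF P_tens[OF f f'] P_tens[OF g g']]])
      (simp add: F_tens[OF P_seq[OF f g] P_seq[OF f' g']] F_seq[OF f g] F_seq[OF f' g']
        F_seq[OF P_tens[OF f f'] P_tens[OF g g']] F_tens[OF f f'] F_tens[OF g g']
        Q.interchange[OF F_hom[OF f] F_hom[OF g] F_hom[OF f'] F_hom[OF g']])
  show "ide P 0 \<boxplus>\<^bsub>P\<^esub> f = f" if f: "f \<in> hom P m n" for f m n
  proof (rule F_inj)
    show "ide P 0 \<boxplus>\<^bsub>P\<^esub> f \<in> hom P m n" using P_tens[OF P_ide f, of 0] by simp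
  qed (use f in \<open>simp_all add: F_tens[OF P_ide f] F_ide Q.tens_unit_left[OF F_hom[OF f]]\<close>)
  show "f \<boxplus>\<^bsub>P\<^esub> ide P 0 = f" if f: "f \<in> hom P m n" for f m n
  proof (rule F_inj)
    show "f \<boxplus>\<^bsub>P\<^esub> ide P 0 \<in> hom P m n" using P_tens[OF f P_ide, of 0] by simp
  qed (use f in \<open>simp_all add: F_tens[OF f P_ide] F_ide Q.tens_unit_right[OF F_hom[OF f]]\<close>)
  show "(f \<boxplus>\<^bsub>P\<^esub> g) \<boxplus>\<^bsub>P\<^esub> h = f \<boxplus>\<^bsub>P\<^esub> (g \<boxplus>\<^bsub>P\<^esub> h)"
    if f: "f \<in> hom P m n" and g: "g \<in> hom P m' n'" and h: "h \<in> hom P m'' n''"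
    for f g h m n m' n' m'' n''
  proof (rule F_inj)
    show "f \<boxplus>\<^bsub>P\<^esub> g \<boxplus>\<^bsub>P\<^esub> h \<in> hom P (m + m' + m'') (n + n' + n'')"
      using P_tens[OF f P_tens[OF g h]] by (simp add: add_ac)
  qed (use P_tens[OF P_tens[OF f g] h] in \<open>simp_all add: F_tens[OF P_tens[OF f g] h] F_tens[OF f g]
        F_tens[OF f P_tens[OF g h]] F_tens[OF g h] Q.tens_assoc[OF F_hom[OF f] F_hom[OF g] F_hom[OF h]]\<close>)
  show "(f \<boxplus>\<^bsub>P\<^esub> g) \<fatsemi>\<^bsub>P\<^esub> braid P n n' = braid P m m' \<fatsemi>\<^bsub>P\<^esub> (g \<boxplus>\<^bsub>P\<^esub> f)"
    if f: "f \<in> hom P m n" and g: "g \<in> hom P m' n'" for f g m n m' n'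
    by (rule F_inj[OF P_seq[OF P_tens[OF f g] P_braid] P_seq[OF P_braid P_tens[OF g f]]])
      (simp add: F_seq[OF P_tens[OF f g] P_braid] F_seq[OF P_braid P_tens[OF g f]] F_tens[OF f g]
        F_tens[OF g f] F_braid Q.braid_natural[OF F_hom[OF f] F_hom[OF g]])
  show "braid P m n \<fatsemi>\<^bsub>P\<^esub> braid P n m = ide P (m + n)" for m n
    by (rule F_inj[OF P_seq[OF P_braid P_braid] P_ide])
      (simp add: F_seq[OF P_braid P_braid] F_braid F_ide Q.braid_inverse)
  show "braid P m (n + k) = (braid P m n \<boxplus>\<^bsub>P\<^esub> ide P k) \<fatsemi>\<^bsub>P\<^esub> (ide P n \<boxplus>\<^bsub>P\<^esub> braid P m k)" for m n k
  proof -
    have 1: "braid P m n \<boxplus>\<^bsub>P\<^esub> ide P k \<in> hom P (m + (n + k)) (n + (m + k))"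
      using P_tens[OF P_braid[of m n] P_ide[of k]] by (simp add: add_ac)
    have 2: "ide P n \<boxplus>\<^bsub>P\<^esub> braid P m k \<in> hom P (n + (m + k)) (n + k + m)"
      using P_tens[OF P_ide[of n] P_braid[of m k]] by (simp add: add_ac)
    show ?thesis
      by (rule F_inj[OF P_braid P_seq[OF 1 2]])
        (simp add: F_seq[OF 1 2] F_tens[OF P_braid P_ide] F_tens[OF P_ide P_braid] F_braid F_ide
          Q.hexagon)
  qed
qed (fact P_ide P_seq P_tens P_braid)+

lemma F_morphism: "prop_morphism P Q F"
  by (rule prop_morphismI) (fact P_prop Q.is_prop_axioms F_hom F_ide F_seq F_tens F_braid)+

text \<open>One inverse for all types at once: the hom-sets of \<open>Q\<close> are disjoint, so
  \<open>F\<close> is injective across types as well.\<close>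

definition Finv :: "'b \<Rightarrow> 'a" where
  "Finv g = (THE f. F f = g \<and> (\<exists>m n. f \<in> hom P m n))"

lemma Finv_F: "f \<in> hom P m n \<Longrightarrow> Finv (F f) = f"
proof -
  assume f: "f \<in> hom P m n"
  have "f' = f" if "F f' = F f" "f' \<in> hom P m' n'" for f' m' n'
    using F_hom[OF f] F_hom[OF that(2)] that f F_inj Q.hom_unique by metis
  then show ?thesis unfolding Finv_def using f by (blast intro: the_equality)
qed

lemma Finv: "g \<in> hom Q m n \<Longrightarrow> Finv g \<in> hom P m n \<and> F (Finv g) = g"
  using F_bij[of m n] Finv_F unfolding bij_betw_def by force

lemma Finv_morphism: "prop_morphism Q P Finv"
proof (rule prop_morphismI)
  show "Finv (f \<fatsemi> g) = Finv f \<fatsemi>\<^bsub>P\<^esub> Finv g" if "f \<in> hom Q m n" "g \<in> hom Q n k" for f g m n k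
  proof -
    have fg: "Finv f \<in> hom P m n" "Finv g \<in> hom P n k" using Finv that by blast+
    have "F (Finv f \<fatsemi>\<^bsub>P\<^esub> Finv g) = f \<fatsemi> g"
      using F_seq[OF fg] Finv[OF that(1)] Finv[OF that(2)] by simp
    then show ?thesis using Finv_F[OF P_seq[OF fg]] by simp
  qed
  show "Finv (f \<boxplus> g) = Finv f \<boxplus>\<^bsub>P\<^esub> Finv g" if "f \<in> hom Q m n" "g \<in> hom Q m' n'" for f g m n m' n'
  proof -
    have fg: "Finv f \<in> hom P m n" "Finv g \<in> hom P m' n'" using Finv that by blast+
    have "F (Finv f \<boxplus>\<^bsub>P\<^esub> Finv g) = f \<boxplus> g"
      using F_tens[OF fg] Finv[OF that(1)] Finv[OF that(2)] by simp
    then show ?thesis using Finv_F[OF P_tens[OF fg]] by simp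
  qed
  show "Finv (ide Q m) = ide P m" for m
    using Finv_F[OF P_ide, of m] by (simp add: F_ide)
  show "Finv (braid Q m n) = braid P m n" for m n
    using Finv_F[OF P_braid, of m n] by (simp add: F_braid)
qed (use P_prop Q.is_prop_axioms Finv in blast)+

lemma isomorphic: "props_isomorphic P Q"
  unfolding props_isomorphic_def using F_morphism Finv_morphism Finv_F Finv by blast

end

lemma props_isomorphic_sym: "props_isomorphic P Q \<Longrightarrow> props_isomorphic Q P"
  unfolding props_isomorphic_def by blast

lemma prop_morphismD:
  assumes "prop_morphism P Q F"
  shows "is_prop P" "is_prop Q"
    and "f \<in> hom P m n \<Longrightarrow> F f \<in> hom Q m n"
    and "F (ide P m) = ide Q m"
    and "f \<in> hom P m n \<Longrightarrow> g \<in> hom P n k \<Longrightarrow> F (f \<fatsemi>\<^bsub>P\<^esub> g) = F f \<fatsemi>\<^bsub>Q\<^esub> F g"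
    and "f \<in> hom P m n \<Longrightarrow> g \<in> hom P m' n' \<Longrightarrow> F (f \<boxplus>\<^bsub>P\<^esub> g) = F f \<boxplus>\<^bsub>Q\<^esub> F g"
    and "F (braid P m n) = braid Q m n"
  using assms by (auto simp: prop_morphism_def)

lemma prop_morphism_comp:
  assumes "prop_morphism P Q F" "prop_morphism Q S G"
  shows "prop_morphism P S (G \<circ> F)"
  by (rule prop_morphismI)
    (simp_all add: prop_morphismD[OF assms(1)] prop_morphismD[OF assms(2)]
      prop_morphismD(5)[OF assms(2) prop_morphismD(3)[OF assms(1)] prop_morphismD(3)[OF assms(1)]]
      prop_morphismD(6)[OF assms(2) prop_morphismD(3)[OF assms(1)] prop_morphismD(3)[OF assms(1)]])

lemma props_isomorphic_trans:
  assumes "props_isomorphic P Q" "props_isomorphic Q S"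
  shows "props_isomorphic P S"
proof -
  obtain F G where FG: "prop_morphism P Q F" "prop_morphism Q P G"
    "\<And>m n f. f \<in> hom P m n \<Longrightarrow> G (F f) = f" "\<And>m n g. g \<in> hom Q m n \<Longrightarrow> F (G g) = g"
    using assms(1) unfolding props_isomorphic_def by blast
  obtain F' G' where FG': "prop_morphism Q S F'" "prop_morphism S Q G'"
    "\<And>m n f. f \<in> hom Q m n \<Longrightarrow> G' (F' f) = f" "\<And>m n g. g \<in> hom S m n \<Longrightarrow> F' (G' g) = g"
    using assms(2) unfolding props_isomorphic_def by blast
  note hom = prop_morphismD(3)[OF FG(1)] prop_morphismD(3)[OF FG'(2)]
  have "\<forall>m n. \<forall>f\<in>hom P m n. (G \<circ> G') ((F' \<circ> F) f) = f"
    using FG(3) FG'(3)[OF hom(1)] by simp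
  moreover have "\<forall>m n. \<forall>g\<in>hom S m n. (F' \<circ> F) ((G \<circ> G') g) = g"
    using FG'(4) FG(4)[OF hom(2)] by simp
  ultimately show ?thesis
    unfolding props_isomorphic_def
    using prop_morphism_comp[OF FG(1) FG'(1)] prop_morphism_comp[OF FG'(2) FG(2)] by blast
qed


section \<open>Models of symmetric monoidal theories\<close>

primrec eval :: "'a prop_cat \<Rightarrow> ('g \<Rightarrow> 'a) \<Rightarrow> 'g smterm \<Rightarrow> 'a" where
  "eval P \<gamma> (Gen g) = \<gamma> g"
| "eval P \<gamma> Id\<^sub>0 = ide P 0"
| "eval P \<gamma> Id = ide P 1"
| "eval P \<gamma> Tw = braid P 1 1"
| "eval P \<gamma> (t ;; u) = eval P \<gamma> t \<fatsemi>\<^bsub>P\<^esub> eval P \<gamma> u"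
| "eval P \<gamma> (t \<oplus>\<^sub>t u) = eval P \<gamma> t \<boxplus>\<^bsub>P\<^esub> eval P \<gamma> u"

inductive_cases has_type_elims:
  "has_type ar (Gen g) m n" "has_type ar Id\<^sub>0 m n" "has_type ar Id m n" "has_type ar Tw m n"
  "has_type ar (t ;; u) m n" "has_type ar (t \<oplus>\<^sub>t u) m n"

lemma has_type_simps[simp]:
  "has_type ar (Gen g) m n \<longleftrightarrow> ar g = (m, n)"
  "has_type ar Id\<^sub>0 m n \<longleftrightarrow> m = 0 \<and> n = 0"
  "has_type ar Id m n \<longleftrightarrow> m = 1 \<and> n = 1"
  "has_type ar Tw m n \<longleftrightarrow> m = 2 \<and> n = 2"
  "has_type ar (t ;; u) m n \<longleftrightarrow> (\<exists>k. has_type ar t m k \<and> has_type ar u k n)"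
  "has_type ar (t \<oplus>\<^sub>t u) m n \<longleftrightarrow>
    (\<exists>a b c d. has_type ar t a b \<and> has_type ar u c d \<and> m = a + c \<and> n = b + d)"
proof -
  show "has_type ar Id m n \<longleftrightarrow> m = 1 \<and> n = 1"
    using has_type.intros(3) by (auto elim: has_type_elims)
  show "has_type ar (t \<oplus>\<^sub>t u) m n \<longleftrightarrow>
      (\<exists>a b c d. has_type ar t a b \<and> has_type ar u c d \<and> m = a + c \<and> n = b + d)"
    by (auto intro: has_type.intros elim!: has_type_elims(6))
qed (auto intro: has_type.intros elim: has_type_elims)

lemma has_type_unique: "has_type ar t m n \<Longrightarrow> has_type ar t m' n' \<Longrightarrow> m = m' \<and> n = n'"
  by (induction t arbitrary: m n m' n') (force, force, force, force, fastforce, fastforce)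

lemma has_type_id_term[simp]: "has_type ar (id_term n) m k \<longleftrightarrow> m = n \<and> k = n"
  by (induction n arbitrary: m k) auto

lemma has_type_braid1: "has_type ar (braid1_term n) (1 + n) (n + 1)"
proof (induction n)
  case (Suc n)
  have "has_type ar (Tw \<oplus>\<^sub>t id_term n) (1 + Suc n) (1 + (1 + n))" by auto
  moreover have "has_type ar (Id \<oplus>\<^sub>t braid1_term n) (1 + (1 + n)) (Suc n + 1)"
    using has_type.intros(6)[OF has_type.intros(3) Suc] by simp
  ultimately show ?case unfolding braid1_term.simps by (rule has_type.intros)
qed simp

lemma has_type_braid: "has_type ar (braid_term m n) (m + n) (n + m)"
proof (induction m)
  case (Suc m)
  have "has_type ar (Id \<oplus>\<^sub>t braid_term m n) (Suc m + n) (1 + (n + m))"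
    using has_type.intros(6)[OF has_type.intros(3) Suc] by simp
  moreover have "has_type ar (braid1_term n \<oplus>\<^sub>t id_term m) (1 + (n + m)) (n + Suc m)"
    using has_type.intros(6)[OF has_type_braid1[of ar n], of "id_term m" m m] by simp
  ultimately show ?case unfolding braid_term.simps by (rule has_type.intros)
qed simp

lemma sm_cong_type: "sm_cong ar E m n t u \<Longrightarrow> has_type ar t m n \<and> has_type ar u m n"
proof (induction rule: sm_cong.induct)
  case (braid_natural t m n u m' n')
  then show ?case
    using has_type_braid[of ar n n'] has_type_braid[of ar m m']
      has_type.intros(6)[of ar t m n u m' n'] has_type.intros(6)[of ar u m' n' t m n]
    by (blast intro: has_type.intros(5))
next
  case (braid_inverse m n)
  then show ?case
    using has_type_braid[of ar n m] has_type_braid[of ar m n] by auto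
next
  case (hexagon m n k)
  have "has_type ar (braid_term m n \<oplus>\<^sub>t id_term k) (m + (n + k)) (n + (m + k))"
    using has_type.intros(6)[OF has_type_braid[of ar m n], of "id_term k" k k] by (simp add: add_ac)
  moreover have "has_type ar (id_term n \<oplus>\<^sub>t braid_term m k) (n + (m + k)) (n + k + m)"
    using has_type.intros(6)[OF _ has_type_braid[of ar m k], of "id_term n" n n] by (simp add: add_ac)
  ultimately show ?case
    using has_type_braid[of ar m "n + k"] by (blast intro: has_type.intros)
qed (auto intro: has_type.intros simp del: has_type_simps, (fastforce simp: add_ac)+)

locale prop_model = is_prop P for P :: "'a prop_cat" (structure) +
  fixes ar :: "'g \<Rightarrow> nat \<times> nat" and \<gamma> :: "'g \<Rightarrow> 'a"
  assumes gen_hom: "\<gamma> g \<in> hom P (fst (ar g)) (snd (ar g))"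
begin

abbreviation ev (\<open>\<lbrakk>_\<rbrakk>\<close>) where "\<lbrakk>t\<rbrakk> \<equiv> eval P \<gamma> t"

lemma eval_hom: "has_type ar t m n \<Longrightarrow> \<lbrakk>t\<rbrakk> \<in> hom P m n"
proof (induction rule: has_type.induct)
  case (1 g m n)
  then show ?case using gen_hom[of g] by simp
next
  case 4
  then show ?case using braid_hom[of 1 1] by (simp add: numeral_2_eq_2)
qed (use ide_hom[of 0] ide_hom[of 1] seq_hom tens_hom in simp_all)

lemma eval_type: "has_type ar t m n \<Longrightarrow> arr \<lbrakk>t\<rbrakk> \<and> src \<lbrakk>t\<rbrakk> = m \<and> tgt \<lbrakk>t\<rbrakk> = n"
  using eval_hom by (simp add: hom_iff)

lemma eval_id_term[simp]: "\<lbrakk>id_term n\<rbrakk> = \<I> n"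
  by (induction n) (simp_all add: tens_ide)

lemma eval_braid1: "\<lbrakk>braid1_term n\<rbrakk> = \<X> 1 n"
proof (induction n)
  case (Suc n)
  then show ?case using hexagon[of 1 1 n] by simp
qed simp

lemma eval_braid[simp]: "\<lbrakk>braid_term m n\<rbrakk> = \<X> m n"
proof (induction m)
  case (Suc m)
  then show ?case using hexagon'[of 1 m n] by (simp add: eval_braid1)
qed simp

text \<open>Only \<open>E\<close> has to be checked; every other rule generating the congruence is a
  prop law or compatibility with an operation, and holds in \<open>P\<close> already.\<close>

lemma eval_cong:
  assumes E: "\<And>t u m n. (t, u) \<in> E \<Longrightarrow> has_type ar t m n \<Longrightarrow> has_type ar u m n \<Longrightarrow> \<lbrakk>t\<rbrakk> = \<lbrakk>u\<rbrakk>"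
  shows "sm_cong ar E m n t u \<Longrightarrow> \<lbrakk>t\<rbrakk> = \<lbrakk>u\<rbrakk>"
proof (induction rule: sm_cong.induct)
  case (ide_left t m n) then show ?case using eval_type by simp
next
  case (ide_right t m n) then show ?case using eval_type by simp
next
  case (seq_assoc t m n u k v l)
  then show ?case using eval_type[of t m n] eval_type[of u n k] eval_type[of v k l]
    by (simp add: seq_seq)
next
  case (interchange t m n u k t' m' n' u' k')
  then show ?case
    using eval_type[of t m n] eval_type[of u n k] eval_type[of t' m' n'] eval_type[of u' n' k']
    by (simp add: tens_seq)
next
  case (tens_unit_left t m n) then show ?case using eval_type by simp
next
  case (tens_unit_right t m n) then show ?case using eval_type by simp
next
  case (tens_assoc t m n u m' n' v m'' n'')
  then show ?case using eval_type[of t m n] eval_type[of u m' n'] eval_type[of v m'' n'']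
    by (simp add: tens_tens)
next
  case (braid_natural t m n u m' n') then show ?case by (simp add: eval_hom is_prop.braid_natural[OF is_prop_axioms])
next
  case (braid_inverse m n) then show ?case by (simp add: is_prop.braid_inverse[OF is_prop_axioms])
next
  case (hexagon m n k) then show ?case by (simp add: is_prop.hexagon[OF is_prop_axioms])
next
  case (eqn t u m n) then show ?case using E by blast
qed (simp_all add: is_prop.tens_ide[OF is_prop_axioms])

end


subsection \<open>Presented props\<close>

text \<open>Operations on classes are defined as unions over all representatives. Once the result is
  independent of the representatives, the union is a single class.\<close>

lemma UN2_const:
  assumes "a \<in> A" "b \<in> B" "\<And>x y. x \<in> A \<Longrightarrow> y \<in> B \<Longrightarrow> f x y = C"
  shows "(\<Union>x \<in> A. \<Union>y \<in> B. f x y) = C"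
  using assms by blast

context
  fixes ar :: "'g \<Rightarrow> nat \<times> nat" and E :: "('g smterm \<times> 'g smterm) set"
begin

definition term_class :: "'g smterm \<Rightarrow> 'g smterm set" where
  "term_class t = cong_rel ar E `` {t}"

lemma mem_term_class: "u \<in> term_class t \<longleftrightarrow> (\<exists>m n. sm_cong ar E m n t u)"
  by (simp add: term_class_def cong_rel_def)

text \<open>\<open>cong_rel\<close> forgets the type under which two terms are congruent; uniqueness
  of types recovers it.\<close>

lemma mem_term_class_typed: "has_type ar t m n \<Longrightarrow> u \<in> term_class t \<longleftrightarrow> sm_cong ar E m n t u"
  unfolding mem_term_class using has_type_unique sm_cong_type by metis

lemma term_class_eqI: "sm_cong ar E m n t u \<Longrightarrow> term_class t = term_class u"
proof -
  assume tu: "sm_cong ar E m n t u"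
  then have ty: "has_type ar t m n" "has_type ar u m n" using sm_cong_type by blast+
  have "sm_cong ar E m n t v \<longleftrightarrow> sm_cong ar E m n u v" for v
    using tu sm_cong.sym sm_cong.trans by metis
  then show ?thesis by (simp add: set_eq_iff mem_term_class_typed[OF ty(1)] mem_term_class_typed[OF ty(2)])
qed

lemma term_class_eqD: "has_type ar t m n \<Longrightarrow> term_class t = term_class u \<Longrightarrow> sm_cong ar E m n t u"
  by (metis mem_term_class mem_term_class_typed sm_cong.refl sm_cong.sym sm_cong_type)

lemma presented_hom: "hom (presented_prop ar E) m n = term_class ` {t. has_type ar t m n}"
  by (auto simp: presented_prop_def quotient_def term_class_def)

lemma presented_seq:
  assumes "has_type ar t m n" "has_type ar u n k"
  shows "term_class t \<fatsemi>\<^bsub>presented_prop ar E\<^esub> term_class u = term_class (t ;; u)"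
proof -
  have "term_class (t' ;; u') = term_class (t ;; u)" if "t' \<in> term_class t" "u' \<in> term_class u" for t' u'
  proof -
    have "sm_cong ar E m n t t'" "sm_cong ar E n k u u'"
      using that assms by (simp_all add: mem_term_class_typed)
    then show ?thesis by (rule term_class_eqI[OF sm_cong.seq_cong, symmetric])
  qed
  moreover have "t \<in> term_class t" "u \<in> term_class u"
    using assms by (auto simp: mem_term_class_typed simp del: has_type_simps intro: sm_cong.refl)
  ultimately have "(\<Union>t' \<in> term_class t. \<Union>u' \<in> term_class u. term_class (t' ;; u')) = term_class (t ;; u)"
    by (intro UN2_const)
  then show ?thesis by (simp add: presented_prop_def term_class_def)
qed

lemma presented_tens:
  assumes "has_type ar t m n" "has_type ar u m' n'"
  shows "term_class t \<boxplus>\<^bsub>presented_prop ar E\<^esub> term_class u = term_class (t \<oplus>\<^sub>t u)"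
proof -
  have "term_class (t' \<oplus>\<^sub>t u') = term_class (t \<oplus>\<^sub>t u)" if "t' \<in> term_class t" "u' \<in> term_class u" for t' u'
  proof -
    have "sm_cong ar E m n t t'" "sm_cong ar E m' n' u u'"
      using that assms by (simp_all add: mem_term_class_typed)
    then show ?thesis by (rule term_class_eqI[OF sm_cong.tens_cong, symmetric])
  qed
  moreover have "t \<in> term_class t" "u \<in> term_class u"
    using assms by (auto simp: mem_term_class_typed simp del: has_type_simps intro: sm_cong.refl)
  ultimately have "(\<Union>t' \<in> term_class t. \<Union>u' \<in> term_class u. term_class (t' \<oplus>\<^sub>t u')) = term_class (t \<oplus>\<^sub>t u)"
    by (intro UN2_const)
  then show ?thesis by (simp add: presented_prop_def term_class_def)
qed

lemma presented_ide: "ide (presented_prop ar E) m = term_class (id_term m)"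
  and presented_braid: "braid (presented_prop ar E) m n = term_class (braid_term m n)"
  by (simp_all add: presented_prop_def term_class_def)

lemma presented_homE:
  assumes "X \<in> hom (presented_prop ar E) m n"
  obtains t where "has_type ar t m n" "X = term_class t"
  using assms by (auto simp: presented_hom)

lemma presented_is_prop: "is_prop (presented_prop ar E)"
proof
  show "ide (presented_prop ar E) m \<in> hom (presented_prop ar E) m m" for m
    by (auto simp: presented_ide presented_hom)
  show "braid (presented_prop ar E) m n \<in> hom (presented_prop ar E) (m + n) (n + m)" for m n
    using has_type_braid by (auto simp: presented_braid presented_hom)
  show "m = m' \<and> n = n'" if "X \<in> hom (presented_prop ar E) m n" "X \<in> hom (presented_prop ar E) m' n'"
    for X m n m' n'
    using that by (metis presented_homE has_type_unique term_class_eqD sm_cong_type)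
  show "X \<fatsemi>\<^bsub>presented_prop ar E\<^esub> Y \<in> hom (presented_prop ar E) m k"
    if "X \<in> hom (presented_prop ar E) m n" "Y \<in> hom (presented_prop ar E) n k" for X Y m n k
    using that by (elim presented_homE)
      (simp add: presented_seq[of _ m n _ k] presented_hom has_type.intros(5) del: has_type_simps)
  show "X \<boxplus>\<^bsub>presented_prop ar E\<^esub> Y \<in> hom (presented_prop ar E) (m + m') (n + n')"
    if "X \<in> hom (presented_prop ar E) m n" "Y \<in> hom (presented_prop ar E) m' n'" for X Y m n m' n'
    using that by (elim presented_homE)
      (simp add: presented_tens[of _ m n _ m' n'] presented_hom has_type.intros(6) del: has_type_simps)
  show "ide (presented_prop ar E) m \<fatsemi>\<^bsub>presented_prop ar E\<^esub> X = X"
    if "X \<in> hom (presented_prop ar E) m n" for X m n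
    using that by (elim presented_homE)
      (simp add: presented_ide presented_seq[where n = m and m = m] term_class_eqI[OF sm_cong.ide_left])
  show "X \<fatsemi>\<^bsub>presented_prop ar E\<^esub> ide (presented_prop ar E) n = X"
    if "X \<in> hom (presented_prop ar E) m n" for X m n
    using that by (elim presented_homE)
      (simp add: presented_ide presented_seq[where n = n and k = n] term_class_eqI[OF sm_cong.ide_right])
  show "(X \<fatsemi>\<^bsub>presented_prop ar E\<^esub> Y) \<fatsemi>\<^bsub>presented_prop ar E\<^esub> Z =
      X \<fatsemi>\<^bsub>presented_prop ar E\<^esub> (Y \<fatsemi>\<^bsub>presented_prop ar E\<^esub> Z)"
    if "X \<in> hom (presented_prop ar E) m n" "Y \<in> hom (presented_prop ar E) n k"
      "Z \<in> hom (presented_prop ar E) k l" for X Y Z m n k l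
    using that
    by (elim presented_homE)
      (simp add: presented_seq[of _ m n _ k] presented_seq[of _ m k _ l] presented_seq[of _ n k _ l]
        presented_seq[of _ m n _ l] has_type.intros(5) term_class_eqI[OF sm_cong.seq_assoc]
        del: has_type_simps)
  show "ide (presented_prop ar E) m \<boxplus>\<^bsub>presented_prop ar E\<^esub> ide (presented_prop ar E) n =
      ide (presented_prop ar E) (m + n)" for m n
    by (simp add: presented_ide presented_tens[of _ m m _ n n] term_class_eqI[OF sm_cong.tens_ide])
  show "(X \<fatsemi>\<^bsub>presented_prop ar E\<^esub> Y) \<boxplus>\<^bsub>presented_prop ar E\<^esub> (X' \<fatsemi>\<^bsub>presented_prop ar E\<^esub> Y') =
      (X \<boxplus>\<^bsub>presented_prop ar E\<^esub> X') \<fatsemi>\<^bsub>presented_prop ar E\<^esub> (Y \<boxplus>\<^bsub>presented_prop ar E\<^esub> Y')"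
    if "X \<in> hom (presented_prop ar E) m n" "Y \<in> hom (presented_prop ar E) n k"
      "X' \<in> hom (presented_prop ar E) m' n'" "Y' \<in> hom (presented_prop ar E) n' k'"
    for X Y X' Y' m n k m' n' k'
    using that
    by (elim presented_homE)
      (simp add: presented_seq[of _ m n _ k] presented_seq[of _ m' n' _ k'] presented_tens[of _ m k _ m' k']
        presented_tens[of _ m n _ m' n'] presented_tens[of _ n k _ n' k']
        presented_seq[of _ "m + m'" "n + n'" _ "k + k'"]
        has_type.intros(5,6) term_class_eqI[OF sm_cong.interchange] del: has_type_simps)
  show "ide (presented_prop ar E) 0 \<boxplus>\<^bsub>presented_prop ar E\<^esub> X = X"
    if "X \<in> hom (presented_prop ar E) m n" for X m n
    using that by (elim presented_homE)
      (simp add: presented_ide presented_tens[of _ 0 0 _ m n] term_class_eqI[OF sm_cong.tens_unit_left])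
  show "X \<boxplus>\<^bsub>presented_prop ar E\<^esub> ide (presented_prop ar E) 0 = X"
    if "X \<in> hom (presented_prop ar E) m n" for X m n
    using that by (elim presented_homE)
      (simp add: presented_ide presented_tens[of _ m n _ 0 0] term_class_eqI[OF sm_cong.tens_unit_right])
  show "(X \<boxplus>\<^bsub>presented_prop ar E\<^esub> Y) \<boxplus>\<^bsub>presented_prop ar E\<^esub> Z =
      X \<boxplus>\<^bsub>presented_prop ar E\<^esub> (Y \<boxplus>\<^bsub>presented_prop ar E\<^esub> Z)"
    if "X \<in> hom (presented_prop ar E) m n" "Y \<in> hom (presented_prop ar E) m' n'"
      "Z \<in> hom (presented_prop ar E) m'' n''" for X Y Z m n m' n' m'' n''
    using that
    by (elim presented_homE)
      (simp add: presented_tens[of _ m n _ m' n'] presented_tens[of _ "m + m'" "n + n'" _ m'' n'']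
        presented_tens[of _ m' n' _ m'' n''] presented_tens[of _ m n _ "m' + m''" "n' + n''"]
        has_type.intros(6) term_class_eqI[OF sm_cong.tens_assoc] del: has_type_simps)
  show "(X \<boxplus>\<^bsub>presented_prop ar E\<^esub> Y) \<fatsemi>\<^bsub>presented_prop ar E\<^esub> braid (presented_prop ar E) n n' =
      braid (presented_prop ar E) m m' \<fatsemi>\<^bsub>presented_prop ar E\<^esub> (Y \<boxplus>\<^bsub>presented_prop ar E\<^esub> X)"
    if "X \<in> hom (presented_prop ar E) m n" "Y \<in> hom (presented_prop ar E) m' n'" for X Y m n m' n'
    using that
    by (elim presented_homE)
      (simp add: presented_tens[of _ m n _ m' n'] presented_tens[of _ m' n' _ m n] presented_braid
        presented_seq[of _ "m + m'" "n + n'" _ "n' + n"] presented_seq[of _ "m + m'" "m' + m" _ "n' + n"]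
        has_type.intros(6) has_type_braid term_class_eqI[OF sm_cong.braid_natural] del: has_type_simps)
  show "braid (presented_prop ar E) m n \<fatsemi>\<^bsub>presented_prop ar E\<^esub> braid (presented_prop ar E) n m =
      ide (presented_prop ar E) (m + n)" for m n
    by (simp add: presented_ide presented_braid presented_seq[OF has_type_braid has_type_braid]
        term_class_eqI[OF sm_cong.braid_inverse])
  show "braid (presented_prop ar E) m (n + k) =
      (braid (presented_prop ar E) m n \<boxplus>\<^bsub>presented_prop ar E\<^esub> ide (presented_prop ar E) k)
      \<fatsemi>\<^bsub>presented_prop ar E\<^esub>
      (ide (presented_prop ar E) n \<boxplus>\<^bsub>presented_prop ar E\<^esub> braid (presented_prop ar E) m k)" for m n k
  proof -
    have 1: "has_type ar (braid_term m n \<oplus>\<^sub>t id_term k) (m + n + k) (n + (m + k))"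
      using has_type.intros(6)[OF has_type_braid[of ar m n], of "id_term k" k k] by (simp add: add_ac)
    have 2: "has_type ar (id_term n \<oplus>\<^sub>t braid_term m k) (n + (m + k)) (n + (k + m))"
      by (rule has_type.intros) (simp_all add: has_type_braid)
    show ?thesis
      by (simp add: presented_ide presented_braid presented_tens[OF has_type_braid, of "id_term k" k k]
          presented_tens[OF _ has_type_braid, of "id_term n" n n] presented_seq[OF 1 2]
          term_class_eqI[OF sm_cong.hexagon])
  qed
qed

end

section \<open>Linear relations\<close>

text \<open>\<open>map2\<close> truncates to the shorter list, so commutativity and associativity
  will hold without length assumptions.\<close>

definition vadd :: "'r::comm_ring_1 list \<Rightarrow> 'r list \<Rightarrow> 'r list" where "vadd = map2 (+)"
definition vscale :: "'r::comm_ring_1 \<Rightarrow> 'r list \<Rightarrow> 'r list" where "vscale a = map ((*) a)"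
definition vzero :: "nat \<Rightarrow> 'r::comm_ring_1 list" where "vzero n = replicate n 0"

lemma vec_simps[simp]:
  "vadd [] y = []" "vadd (a # x) (b # y) = (a + b) # vadd x y"
  "vscale c [] = []" "vscale c (a # x) = (c * a) # vscale c x"
  "vzero 0 = []" "vzero (Suc n) = 0 # vzero n"
  "length (vadd x y) = min (length x) (length y)" "length (vscale c x) = length x"
  "length (vzero n) = n"
  "vscale c (vzero n) = vzero n" "vadd (vzero n) (vzero n) = vzero n"
  "vscale c (x @ y) = vscale c x @ vscale c y"
  by (simp_all add: vadd_def vscale_def vzero_def list_eq_iff_nth_eq)

lemma vadd_append[simp]: "length x = length x' \<Longrightarrow> vadd (x @ y) (x' @ y') = vadd x x' @ vadd y y'"
  by (simp add: vadd_def)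

lemma vzero_append[simp]: "vzero m @ vzero n = vzero (m + n)"
  by (simp add: vzero_def replicate_add)

lemma vadd_vzero[simp]: "length x = n \<Longrightarrow> vadd x (vzero n) = x" "length x = n \<Longrightarrow> vadd (vzero n) x = x"
  by (simp_all add: vadd_def vzero_def list_eq_iff_nth_eq)

definition linrel :: "nat \<Rightarrow> nat \<Rightarrow> ('r::comm_ring_1 list \<times> 'r list) set \<Rightarrow> bool" where
  "linrel m n S \<longleftrightarrow> (\<forall>(x, y) \<in> S. length x = m \<and> length y = n) \<and> (vzero m, vzero n) \<in> S \<and>
     (\<forall>(x, y) \<in> S. \<forall>(x', y') \<in> S. (vadd x x', vadd y y') \<in> S) \<and>
     (\<forall>a. \<forall>(x, y) \<in> S. (vscale a x, vscale a y) \<in> S)"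

lemma linrelI:
  assumes "\<And>x y. (x, y) \<in> S \<Longrightarrow> length x = m \<and> length y = n" "(vzero m, vzero n) \<in> S"
    "\<And>x y x' y'. (x, y) \<in> S \<Longrightarrow> (x', y') \<in> S \<Longrightarrow> (vadd x x', vadd y y') \<in> S"
    "\<And>a x y. (x, y) \<in> S \<Longrightarrow> (vscale a x, vscale a y) \<in> S"
  shows "linrel m n S"
  using assms unfolding linrel_def by auto

lemma linrelD:
  assumes "linrel m n S"
  shows "(x, y) \<in> S \<Longrightarrow> length x = m" "(x, y) \<in> S \<Longrightarrow> length y = n" "(vzero m, vzero n) \<in> S"
    "(x, y) \<in> S \<Longrightarrow> (x', y') \<in> S \<Longrightarrow> (vadd x x', vadd y y') \<in> S"
    "(x, y) \<in> S \<Longrightarrow> (vscale a x, vscale a y) \<in> S"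
  using assms unfolding linrel_def by auto

definition LinRel :: "('r::comm_ring_1 list \<times> 'r list) set prop_cat" where
  "LinRel = \<lparr>
     hom = (\<lambda>m n. {S. linrel m n S}),
     ide = (\<lambda>m. {(x, x) |x. length x = m}),
     seq = (O),
     tens = (\<lambda>S T. {(x @ x', y @ y') |x y x' y'. (x, y) \<in> S \<and> (x', y') \<in> T}),
     braid = (\<lambda>m n. {(x @ y, y @ x) |x y. length x = m \<and> length y = n}) \<rparr>"

lemma LinRel_hom: "S \<in> hom LinRel m n \<longleftrightarrow> linrel m n S"
  and LinRel_ide: "ide LinRel m = {(x, x) |x. length x = m}"
  and LinRel_seq: "S \<fatsemi>\<^bsub>LinRel\<^esub> T = S O T"
  and LinRel_tens: "S \<boxplus>\<^bsub>LinRel\<^esub> T = {(x @ x', y @ y') |x y x' y'. (x, y) \<in> S \<and> (x', y') \<in> T}"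
  and LinRel_braid: "braid LinRel m n = {(x @ y, y @ x) |x y. length x = m \<and> length y = n}"
  by (simp_all add: LinRel_def)

lemmas LinRel_simps = LinRel_hom LinRel_ide LinRel_seq LinRel_tens LinRel_braid

lemma length_addE:
  assumes "length x = m + n" obtains y z where "x = y @ z" "length y = m" "length z = n"
  using assms that[of "take m x" "drop m x"] by simp

lemma linrel_relcomp:
  assumes S: "linrel m n S" and T: "linrel n k T" shows "linrel m k (S O T)"
proof (rule linrelI)
  show "(vadd x x', vadd y y') \<in> S O T" if "(x, y) \<in> S O T" "(x', y') \<in> S O T" for x y x' y'
    using that linrelD(4)[OF S] linrelD(4)[OF T] by blast
  show "(vscale a x, vscale a y) \<in> S O T" if "(x, y) \<in> S O T" for a x y
    using that linrelD(5)[OF S] linrelD(5)[OF T] by blast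
  show "length x = m \<and> length y = k" if "(x, y) \<in> S O T" for x y
    using that linrelD(1)[OF S] linrelD(2)[OF T] by blast
  show "(vzero m, vzero k) \<in> S O T"
    using linrelD(3)[OF S] linrelD(3)[OF T] by blast
qed

lemma LinRel_is_prop: "is_prop (LinRel :: ('r::comm_ring_1 list \<times> 'r list) set prop_cat)"
proof (unfold_locales, unfold LinRel_simps)
  fix m n k l m' n' k' m'' n'' :: nat and f g h f' g' :: "('r list \<times> 'r list) set"
  show "m = m' \<and> n = n'" if "linrel m n f" "linrel m' n' f"
    using linrelD(1)[OF that(2) linrelD(3)[OF that(1)]] linrelD(2)[OF that(2) linrelD(3)[OF that(1)]] by simp
  show "linrel m m {(x :: 'r list, x) |x. length x = m}"
    by (rule linrelI) auto
  show "linrel m n f \<Longrightarrow> linrel n k g \<Longrightarrow> linrel m k (f O g)"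
    by (rule linrel_relcomp)
  show "linrel (m + m') (n + n') {(x @ x', y @ y') |x y x' y'. (x, y) \<in> f \<and> (x', y') \<in> g}"
    if f: "linrel m n f" and g: "linrel m' n' g"
  proof (rule linrelI)
    show "(vzero (m + m'), vzero (n + n')) \<in> {(x @ x', y @ y') |x y x' y'. (x, y) \<in> f \<and> (x', y') \<in> g}"
      using linrelD(3)[OF f] linrelD(3)[OF g] by (auto simp flip: vzero_append)
    show "(vadd x x', vadd y y') \<in> {(x @ x', y @ y') |x y x' y'. (x, y) \<in> f \<and> (x', y') \<in> g}"
      if "(x, y) \<in> {(x @ x', y @ y') |x y x' y'. (x, y) \<in> f \<and> (x', y') \<in> g}"
        "(x', y') \<in> {(x @ x', y @ y') |x y x' y'. (x, y) \<in> f \<and> (x', y') \<in> g}" for x y x' y'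
    proof -
      obtain a b c d where 1: "(a, b) \<in> f" "(c, d) \<in> g" "x = a @ c" "y = b @ d"
        using \<open>(x, y) \<in> _\<close> by blast
      obtain a' b' c' d' where 2: "(a', b') \<in> f" "(c', d') \<in> g" "x' = a' @ c'" "y' = b' @ d'"
        using \<open>(x', y') \<in> _\<close> by blast
      have "vadd x x' = vadd a a' @ vadd c c'" "vadd y y' = vadd b b' @ vadd d d'"
        using 1 2 linrelD(1,2)[OF f] by simp_all
      then show ?thesis using linrelD(4)[OF f 1(1) 2(1)] linrelD(4)[OF g 1(2) 2(2)] by blast
    qed
    show "(vscale a x, vscale a y) \<in> {(x @ x', y @ y') |x y x' y'. (x, y) \<in> f \<and> (x', y') \<in> g}"
      if xy: "(x, y) \<in> {(x @ x', y @ y') |x y x' y'. (x, y) \<in> f \<and> (x', y') \<in> g}" for a x y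
    proof -
      obtain b c d e where 1: "(b, c) \<in> f" "(d, e) \<in> g" "x = b @ d" "y = c @ e"
        using xy by blast
      have "(vscale a b, vscale a c) \<in> f" "(vscale a d, vscale a e) \<in> g"
        using linrelD(5)[OF f 1(1)] linrelD(5)[OF g 1(2)] by auto
      then show ?thesis using 1(3,4) by auto
    qed
  qed (use linrelD(1,2)[OF f] linrelD(1,2)[OF g] in auto)
  show "linrel (m + n) (n + m) {(x @ y, y @ x) |x y :: 'r list. length x = m \<and> length y = n}"
  proof (rule linrelI)
    show "(vzero (m + n), vzero (n + m)) \<in> {(x @ y, y @ x) |x y :: 'r list. length x = m \<and> length y = n}"
      by (rule CollectI, intro exI[of _ "vzero m"] exI[of _ "vzero n"]) simp
  qed (auto, (metis length_addE vadd_append vec_simps(7) min.idem), (metis vec_simps(8,12)))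
  show "{(x, x) |x. length x = m} O f = f" if "linrel m n f"
    using linrelD(1)[OF that] by (auto simp: relcomp_unfold)
  show "f O {(x, x) |x. length x = n} = f" if "linrel m n f"
    using linrelD(2)[OF that] by (auto simp: relcomp_unfold)
  show "(f O g) O h = f O (g O h)" by blast
  show "{(x @ x', y @ y') |x y x' y'. (x, y) \<in> {(x :: 'r list, x) |x. length x = m} \<and>
      (x', y') \<in> {(x, x) |x. length x = n}} = {(x, x) |x. length x = m + n}"
    by (auto elim!: length_addE)
  show "{(x @ x', y @ y') |x y x' y'. (x, y) \<in> f O g \<and> (x', y') \<in> f' O g'} =
    {(x @ x', y @ y') |x y x' y'. (x, y) \<in> f \<and> (x', y') \<in> f'} O
    {(x @ x', y @ y') |x y x' y'. (x, y) \<in> g \<and> (x', y') \<in> g'}" (is "?L = ?R")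
    if f: "linrel m n f" and g: "linrel n k g" and f': "linrel m' n' f'" and g': "linrel n' k' g'"
  proof
    show "?L \<subseteq> ?R" by blast
    show "?R \<subseteq> ?L"
    proof clarify
      fix x y z x' y' a b c d
      assume 1: "(x, a) \<in> f" "(x', b) \<in> f'" "(c, y) \<in> g" "(d, y') \<in> g'" "a @ b = c @ d"
      \<comment> \<open>The middle vector is split in two ways; the lengths prescribed by
        \<open>f\<close> and \<open>g\<close> force the splittings to agree.\<close>
      then have "a = c" "b = d" using linrelD(2)[OF f 1(1)] linrelD(1)[OF g 1(3)] by simp_all
      then show "\<exists>xa ya x'a y'a. (x @ x', y @ y') = (xa @ x'a, ya @ y'a) \<and> (xa, ya) \<in> f O g \<and> (x'a, y'a) \<in> f' O g'"
        using 1 by blast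
    qed
  qed
  show "{(x @ x', y @ y') |x y x' y'. (x, y) \<in> {(x :: 'r list, x) |x. length x = 0} \<and> (x', y') \<in> f} = f"
    "{(x @ x', y @ y') |x y x' y'. (x, y) \<in> f \<and> (x', y') \<in> {(x :: 'r list, x) |x. length x = 0}} = f"
    by auto
  show "{(x @ x', y @ y') |x y x' y'. (x, y) \<in> {(x @ x', y @ y') |x y x' y'. (x, y) \<in> f \<and> (x', y') \<in> g} \<and> (x', y') \<in> h} =
     {(x @ x', y @ y') |x y x' y'. (x, y) \<in> f \<and> (x', y') \<in> {(x @ x', y @ y') |x y x' y'. (x, y) \<in> g \<and> (x', y') \<in> h}}"
    (is "?L = ?R")
  proof
    show "?L \<subseteq> ?R" by clarsimp (metis append.assoc)
    show "?R \<subseteq> ?L" by clarsimp (metis append.assoc)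
  qed
  show "{(x @ x', y @ y') |x y x' y'. (x, y) \<in> f \<and> (x', y') \<in> g} O {(x @ y, y @ x) |x y. length x = n \<and> length y = n'} =
     {(x @ y, y @ x) |x y. length x = m \<and> length y = m'} O {(x @ x', y @ y') |x y x' y'. (x, y) \<in> g \<and> (x', y') \<in> f}"
    (is "?L = ?R")
    if f: "linrel m n f" and g: "linrel m' n' g"
  proof -
    \<comment> \<open>Both sides of naturality are compared with this description, in which the
      middle vector no longer occurs.\<close>
    let ?M = "{(x @ x', y' @ y) |x y x' y'. (x, y) \<in> f \<and> (x', y') \<in> g}"
    have LM: "?L \<subseteq> ?M"
    proof
      fix z assume "z \<in> ?L"
      then obtain x y x' y' a b where 1: "z = (x @ x', b @ a)" "(x, y) \<in> f" "(x', y') \<in> g"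
        "y @ y' = a @ b" "length a = n" "length b = n'" by blast
      then have "a = y" "b = y'" using linrelD(2)[OF f 1(2)] by simp_all
      then show "z \<in> ?M" using 1 by blast
    qed
    have M: "z \<in> ?L \<and> z \<in> ?R" if z: "z \<in> ?M" for z
    proof -
      obtain x y x' y' where 1: "z = (x @ x', y' @ y)" "(x, y) \<in> f" "(x', y') \<in> g"
        using z by blast
      have len: "length x = m" "length y = n" "length x' = m'" "length y' = n'"
        using linrelD(1,2)[OF f 1(2)] linrelD(1,2)[OF g 1(3)] by auto
      have "(x @ x', y' @ y) \<in> ?L"
        by (rule relcompI[of _ "y @ y'"]) (use 1 len in blast)+
      moreover have "(x @ x', y' @ y) \<in> ?R"
        by (rule relcompI[of _ "x' @ x"]) (use 1 len in blast)+
      ultimately show ?thesis using 1(1) by simp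
    qed
    have RM: "?R \<subseteq> ?M"
    proof
      fix z assume "z \<in> ?R"
      then obtain x y x' y' a b where 1: "z = (a @ b, y @ y')" "(x, y) \<in> g" "(x', y') \<in> f"
        "b @ a = x @ x'" "length a = m" "length b = m'" by blast
      then have "a = x'" "b = x" using linrelD(1)[OF g 1(2)] by simp_all
      then show "z \<in> ?M" using 1 by blast
    qed
    show ?thesis
    proof (rule subset_antisym)
      show "?L \<subseteq> ?R" by (rule subset_trans[OF LM subsetI[OF M[THEN conjunct2]]])
      show "?R \<subseteq> ?L" by (rule subset_trans[OF RM subsetI[OF M[THEN conjunct1]]])
    qed
  qed
  show "{(x @ y, y @ x) |x y. length x = m \<and> length y = n} O {(x @ y, y @ x) |x y. length x = n \<and> length y = m} =
      {(x :: 'r list, x) |x. length x = m + n}" (is "?L = ?R")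
  proof
    show "?L \<subseteq> ?R"
    proof
      fix z assume "z \<in> ?L"
      then obtain p q r where z: "z = (p, r)"
        and p: "(p, q) \<in> {(x @ y, y @ x) |x y :: 'r list. length x = m \<and> length y = n}"
        and q: "(q, r) \<in> {(x @ y, y @ x) |x y :: 'r list. length x = n \<and> length y = m}"
        by (rule relcompE)
      obtain x y where 2: "p = x @ y" "q = y @ x" "length x = m" "length y = n" using p by blast
      obtain a b where 3: "q = a @ b" "r = b @ a" "length a = n" "length b = m" using q by blast
      have 1: "z = (x @ y, b @ a)" "y @ x = a @ b"
        "length x = m" "length y = n" "length a = n" "length b = m" using z 2 3 by auto
      then show "z \<in> ?R" by simp
    qed
    show "?R \<subseteq> ?L"
    proof
      fix z assume "z \<in> ?R"
      then obtain x where 1: "z = (x, x)" "length x = m + n" by blast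
      from 1(2) obtain a b where 2: "x = a @ b" "length a = m" "length b = n" by (rule length_addE)
      have "(a @ b, a @ b) \<in> ?L"
        by (rule relcompI[of _ "b @ a"]) (use 2 in blast)+
      then show "z \<in> ?L" using 1(1) 2(1) by simp
    qed
  qed
  show "{(x @ y, y @ x) |x y :: 'r list. length x = m \<and> length y = n + k} =
     {(x @ x', y @ y') |x y x' y'. (x, y) \<in> {(x @ y, y @ x) |x y. length x = m \<and> length y = n} \<and>
        (x', y') \<in> {(x, x) |x. length x = k}} O
     {(x @ x', y @ y') |x y x' y'. (x, y) \<in> {(x, x) |x. length x = n} \<and>
        (x', y') \<in> {(x @ y, y @ x) |x y. length x = m \<and> length y = k}}" (is "?L = ?R")
  proof
    show "?L \<subseteq> ?R"
    proof
      fix z assume "z \<in> ?L"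
      then obtain x y where 1: "z = (x @ y, y @ x)" "length x = m" "length y = n + k" by blast
      from 1(3) obtain a b where 2: "y = a @ b" "length a = n" "length b = k" by (rule length_addE)
      have h1: "((x @ a) @ b, (a @ x) @ b) \<in> {(x @ x', y @ y') |x y x' y'.
          (x, y) \<in> {(x @ y, y @ x) |x y. length x = m \<and> length y = n} \<and> (x', y') \<in> {(x, x) |x. length x = k}}"
        using 1 2 by blast
      have h2: "(a @ x @ b, a @ b @ x) \<in> {(x @ x', y @ y') |x y x' y'.
          (x, y) \<in> {(x, x) |x. length x = n} \<and> (x', y') \<in> {(x @ y, y @ x) |x y. length x = m \<and> length y = k}}"
        using 1 2 by blast
      show "z \<in> ?R"
        using relcompI[OF h1[unfolded append_assoc] h2] unfolding 1(1) 2(1) append_assoc .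
    qed
    show "?R \<subseteq> ?L"
    proof
      fix z assume "z \<in> ?R"
      then obtain p q r where z: "z = (p, r)"
        and p: "(p, q) \<in> {(x @ x', y @ y') |x y x' y'.
          (x, y) \<in> {(x @ y, y @ x) |x y :: 'r list. length x = m \<and> length y = n} \<and> (x', y') \<in> {(x, x) |x. length x = k}}"
        and q: "(q, r) \<in> {(x @ x', y @ y') |x y x' y'.
          (x, y) \<in> {(x :: 'r list, x) |x. length x = n} \<and> (x', y') \<in> {(x @ y, y @ x) |x y. length x = m \<and> length y = k}}"
        by (rule relcompE)
      obtain a b c where 2: "p = (a @ b) @ c" "q = (b @ a) @ c" "length a = m" "length b = n" "length c = k"
        using p by blast
      obtain d e f where 3: "q = d @ e @ f" "r = d @ f @ e" "length d = n" "length e = m" "length f = k"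
        using q by blast
      have 1: "z = ((a @ b) @ c, d @ f @ e)" "(b @ a) @ c = d @ e @ f"
        "length a = m" "length b = n" "length c = k" "length d = n" "length e = m" "length f = k"
        using z 2 3 by auto
      then have "z = (a @ (b @ c), (b @ c) @ a)" by simp
      then show "z \<in> ?L" using 1 by force
    qed
  qed
qed

subsection \<open>The relations denoted by terms\<close>

abbreviation cst :: "'k::field \<Rightarrow> 'k laurent" where "cst \<equiv> Poly_Mapping.single 0"
abbreviation spow :: "int \<Rightarrow> 'k::field laurent" where "spow i \<equiv> Poly_Mapping.single i 1"

lemma cst_simps[simp]:
  "cst 0 = 0" "cst 1 = 1" "cst (a * b) = cst a * cst b" "cst (a + b) = cst a + cst b" "cst (- a) = - cst a"
  by (simp_all add: mult_single single_add single_uminus)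

lemma spow_simps[simp]: "spow 1 * (spow (- 1) * p) = p" "spow (- 1) * (spow 1 * p) = p"
  by (simp_all add: mult_single flip: mult.assoc)

lemma spow_surj[simp]: "\<exists>u. p = u * spow 1"
  by (rule exI[of _ "p * spow (- 1)"]) (simp add: mult.assoc mult_single)

lemma spow_nonzero[simp]: "spow i \<noteq> 0"
  by (metis lookup_single_eq lookup_zero zero_neq_one)

text \<open>Matrices act on row vectors from the right: the cospan of \<open>add\<close> is \<open>([1 1], [1])\<close>, so the relation of
  its mirror image duplicates its argument, while that of the mirror image of \<open>copy\<close> adds.\<close>

fun base_rel :: "'k::field base_gen \<Rightarrow> ('k laurent list \<times> 'k laurent list) set" where
  "base_rel Add = {([u], [u, u]) |u. True}"
| "base_rel Zero = {([u], []) |u. True}"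
| "base_rel Copy = {([u, v], [u + v]) |u v. True}"
| "base_rel Disc = {([], [0])}"
| "base_rel Shift = {([u], [spow 1 * u]) |u. True}"
| "base_rel (Scalar a) = {([u], [cst a * u]) |u. True}"

fun gen_rel :: "'k::field ih_gen \<Rightarrow> ('k laurent list \<times> 'k laurent list) set" where
  "gen_rel (Fwd g) = (base_rel g)\<inverse>"
| "gen_rel (Op g) = base_rel g"

abbreviation sem :: "'k::field ih_gen smterm \<Rightarrow> ('k laurent list \<times> 'k laurent list) set" where
  "sem \<equiv> eval LinRel gen_rel"

lemma linrel_converse: "linrel m n S \<Longrightarrow> linrel n m (S\<inverse>)"
  unfolding linrel_def by auto

lemma linrel_base: "base_arity g = (m, n) \<Longrightarrow> linrel n m (base_rel g)"
  by (cases g) (auto simp: linrel_def algebra_simps numeral_2_eq_2 vzero_def)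

lemma gen_rel_hom: "gen_rel g \<in> hom LinRel (fst (ih_arity g)) (snd (ih_arity g))"
  by (cases g) (auto simp: LinRel_hom intro!: linrel_base linrel_converse)

lemma sem_model: "prop_model LinRel ih_arity gen_rel"
  by (intro prop_model.intro LinRel_is_prop prop_model_axioms.intro gen_rel_hom)

lemma sem_linrel: "has_type ih_arity t m n \<Longrightarrow> linrel m n (sem t)"
  using prop_model.eval_hom[OF sem_model] by (simp add: LinRel_hom)

lemma ide_small: "ide LinRel (Suc 0) = {([a], [a]) |a. True}" "ide LinRel 0 = {([], [])}"
  by (auto simp: LinRel_ide length_Suc_conv)

lemma braid_small: "braid LinRel (Suc 0) (Suc 0) = {([a, b], [b, a]) |a b. True}"
proof -
  have "\<exists>x y. [a, b] = x @ y \<and> [b, a] = y @ x \<and> length x = Suc 0 \<and> length y = Suc 0" for a b :: 'a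
    by (intro exI[of _ "[a]"] exI[of _ "[b]"]) simp
  then show ?thesis by (auto simp: LinRel_braid length_Suc_conv)
qed

text \<open>Thanks to this, soundness of the mirror-image equations follows from that of the
  originals.\<close>

lemma sem_mirror: "sem (mirror t) = (sem t)\<inverse>"
proof (induction t)
  case (Gen g)
  show ?case by (cases g) auto
next
  case (Seq t u)
  then show ?case by (simp add: LinRel_seq converse_relcomp)
next
  case (Tens t u)
  then show ?case by (simp add: LinRel_tens) blast
qed (auto simp: LinRel_ide LinRel_braid)

lemma sem_eqI:
  assumes "\<And>x y. (x, y) \<in> sem t \<longleftrightarrow> (x, y) \<in> sem u" shows "sem t = sem u"
  using assms by auto

lemma mem_seq: "(x, z) \<in> S \<fatsemi>\<^bsub>LinRel\<^esub> T \<longleftrightarrow> (\<exists>y. (x, y) \<in> S \<and> (y, z) \<in> T)"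
  by (auto simp: LinRel_seq)

lemma mem_tens: "(x, y) \<in> S \<boxplus>\<^bsub>LinRel\<^esub> T \<longleftrightarrow>
    (\<exists>a b. (a, b) \<in> S \<and> (\<exists>c d. (c, d) \<in> T \<and> x = a @ c \<and> y = b @ d))"
  by (auto simp: LinRel_tens)

text \<open>The simplifier does not find one-point witnesses below nested quantifiers, so existential
  quantifiers over a generating relation are eliminated by explicit rules.\<close>

lemma ex_rel:
  "(\<exists>x y. (x, y) \<in> (gen_rel (Op Add)) \<and> Q x y) \<longleftrightarrow> (\<exists>u. Q [u] [u, u])"
  "(\<exists>y. (z, y) \<in> (gen_rel (Op Add)) \<and> q y) \<longleftrightarrow> (\<exists>u. z = [u] \<and> q [u, u])"
  "(\<exists>x y. (x, y) \<in> (gen_rel (Op Zero)) \<and> Q x y) \<longleftrightarrow> (\<exists>u. Q [u] [])"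
  "(\<exists>y. (z, y) \<in> (gen_rel (Op Zero)) \<and> q y) \<longleftrightarrow> (\<exists>u. z = [u] \<and> q [])"
  "(\<exists>x y. (x, y) \<in> (gen_rel (Op Copy)) \<and> Q x y) \<longleftrightarrow> (\<exists>u v. Q [u, v] [u + v])"
  "(\<exists>y. (z, y) \<in> (gen_rel (Op Copy)) \<and> q y) \<longleftrightarrow> (\<exists>u v. z = [u, v] \<and> q [u + v])"
  "(\<exists>x y. (x, y) \<in> (gen_rel (Op Shift)) \<and> Q x y) \<longleftrightarrow> (\<exists>u. Q [u] [spow 1 * u])"
  "(\<exists>y. (z, y) \<in> (gen_rel (Op Shift)) \<and> q y) \<longleftrightarrow> (\<exists>u. z = [u] \<and> q [spow 1 * u])"
  "(\<exists>x y. (x, y) \<in> (gen_rel (Op (Scalar r))) \<and> Q x y) \<longleftrightarrow> (\<exists>u. Q [u] [cst r * u])"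
  "(\<exists>y. (z, y) \<in> (gen_rel (Op (Scalar r))) \<and> q y) \<longleftrightarrow> (\<exists>u. z = [u] \<and> q [cst r * u])"
  "(\<exists>x y. (x, y) \<in> (gen_rel (Fwd Add)) \<and> Q x y) \<longleftrightarrow> (\<exists>u. Q [u, u] [u])"
  "(\<exists>y. (z, y) \<in> (gen_rel (Fwd Add)) \<and> q y) \<longleftrightarrow> (\<exists>u. z = [u, u] \<and> q [u])"
  "(\<exists>x y. (x, y) \<in> (gen_rel (Fwd Zero)) \<and> Q x y) \<longleftrightarrow> (\<exists>u. Q [] [u])"
  "(\<exists>y. (z, y) \<in> (gen_rel (Fwd Zero)) \<and> q y) \<longleftrightarrow> (\<exists>u. z = [] \<and> q [u])"
  "(\<exists>x y. (x, y) \<in> (gen_rel (Fwd Copy)) \<and> Q x y) \<longleftrightarrow> (\<exists>u v. Q [u + v] [u, v])"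
  "(\<exists>y. (z, y) \<in> (gen_rel (Fwd Copy)) \<and> q y) \<longleftrightarrow> (\<exists>u v. z = [u + v] \<and> q [u, v])"
  "(\<exists>x y. (x, y) \<in> (gen_rel (Fwd Shift)) \<and> Q x y) \<longleftrightarrow> (\<exists>u. Q [spow 1 * u] [u])"
  "(\<exists>y. (z, y) \<in> (gen_rel (Fwd Shift)) \<and> q y) \<longleftrightarrow> (\<exists>u. z = [spow 1 * u] \<and> q [u])"
  "(\<exists>x y. (x, y) \<in> (gen_rel (Fwd (Scalar r))) \<and> Q x y) \<longleftrightarrow> (\<exists>u. Q [cst r * u] [u])"
  "(\<exists>y. (z, y) \<in> (gen_rel (Fwd (Scalar r))) \<and> q y) \<longleftrightarrow> (\<exists>u. z = [cst r * u] \<and> q [u])"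
  "(\<exists>x y. (x, y) \<in> (ide LinRel 1) \<and> Q x y) \<longleftrightarrow> (\<exists>u. Q [u] [u])"
  "(\<exists>y. (z, y) \<in> (ide LinRel 1) \<and> q y) \<longleftrightarrow> (\<exists>u. z = [u] \<and> q [u])"
  "(\<exists>x y. (x, y) \<in> (braid LinRel 1 1) \<and> Q x y) \<longleftrightarrow> (\<exists>u v. Q [u, v] [v, u])"
  "(\<exists>y. (z, y) \<in> (braid LinRel 1 1) \<and> q y) \<longleftrightarrow> (\<exists>u v. z = [u, v] \<and> q [v, u])"
  "(\<exists>x y. (x, y) \<in> (gen_rel (Op Disc)) \<and> Q x y) \<longleftrightarrow> Q [] [0]"
  "(\<exists>y. (z, y) \<in> (gen_rel (Op Disc)) \<and> q y) \<longleftrightarrow> z = [] \<and> q [0]"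
  "(\<exists>x y. (x, y) \<in> (gen_rel (Fwd Disc)) \<and> Q x y) \<longleftrightarrow> Q [0] []"
  "(\<exists>y. (z, y) \<in> (gen_rel (Fwd Disc)) \<and> q y) \<longleftrightarrow> z = [0] \<and> q []"
  "(\<exists>x y. (x, y) \<in> (ide LinRel 0) \<and> Q x y) \<longleftrightarrow> Q [] []"
  "(\<exists>y. (z, y) \<in> (ide LinRel 0) \<and> q y) \<longleftrightarrow> z = [] \<and> q []"
  "(\<exists>x y. (x, y) \<in> S \<boxplus>\<^bsub>LinRel\<^esub> T \<and> Q x y) \<longleftrightarrow>
    (\<exists>a b. (a, b) \<in> S \<and> (\<exists>c d. (c, d) \<in> T \<and> Q (a @ c) (b @ d)))"
  "(\<exists>y. (z, y) \<in> S \<boxplus>\<^bsub>LinRel\<^esub> T \<and> q y) \<longleftrightarrow>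
    (\<exists>a b. (a, b) \<in> S \<and> (\<exists>c d. (c, d) \<in> T \<and> z = a @ c \<and> q (b @ d)))"
  "(\<exists>y. (z, y) \<in> S \<fatsemi>\<^bsub>LinRel\<^esub> T \<and> q y) \<longleftrightarrow> (\<exists>y. (z, y) \<in> S \<and> (\<exists>w. (y, w) \<in> T \<and> q w))"
  "(\<exists>x y. (x, y) \<in> S \<fatsemi>\<^bsub>LinRel\<^esub> T \<and> Q x y) \<longleftrightarrow>
    (\<exists>x y. (x, y) \<in> S \<and> (\<exists>w. (y, w) \<in> T \<and> Q x w))"
  by (simp_all add: ide_small braid_small LinRel_tens LinRel_seq relcomp_unfold; blast)+

lemmas rel_simps = eval.simps mem_seq mem_tens ex_rel
lemmas rel_final = ide_small braid_small algebra_simps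

section \<open>Soundness of the equations for linear relations\<close>

lemma HA_sound: "(t, u) \<in> HA_eqs \<Longrightarrow> sem t = sem u"
  apply (rule sem_eqI, erule HA_eqs.cases; (elim disjE)?; hypsubst)
  subgoal by (simp only: rel_simps) (auto simp: rel_final)
  subgoal by (simp only: rel_simps) (auto simp: rel_final)
  subgoal by (simp only: rel_simps) (auto simp: rel_final)
  subgoal by (simp only: rel_simps) (auto simp: rel_final)
  subgoal by (simp only: rel_simps) (auto simp: rel_final)
  subgoal by (simp only: rel_simps) (auto simp: rel_final)
  subgoal by (simp only: rel_simps) (auto simp: rel_final)
  subgoal by (simp only: rel_simps) (auto simp: rel_final)
  subgoal by (simp only: rel_simps) (auto simp: rel_final)
  subgoal by (simp only: rel_simps) (auto simp: rel_final)
  subgoal by (simp only: rel_simps) (auto simp: rel_final)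
  subgoal by (simp only: rel_simps) (auto simp: rel_final)
  subgoal by (simp only: rel_simps) (auto simp: rel_final)
  subgoal by (simp only: rel_simps) (auto simp: rel_final)
  subgoal by (simp only: rel_simps) (auto simp: rel_final)
  subgoal by (simp only: rel_simps) (auto simp: rel_final)
  subgoal by (simp only: rel_simps) (auto simp: rel_final)
  subgoal by (simp only: rel_simps) (auto simp: rel_final)
  subgoal by (simp only: rel_simps) (auto simp: rel_final)
  subgoal by (simp only: rel_simps) (auto simp: rel_final)
  subgoal by (simp only: rel_simps) (auto simp: rel_final)
  subgoal by (simp only: rel_simps) (auto simp: rel_final)
  subgoal by (simp only: rel_simps) (auto simp: rel_final)
  subgoal by (simp only: rel_simps) (auto simp: rel_final)
  subgoal by (simp only: rel_simps) (auto simp: rel_final)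
  subgoal by (simp only: rel_simps) (auto simp: rel_final)
  subgoal by (simp only: rel_simps) (auto simp: rel_final)
  done

text \<open>The graph of multiplication by \<open>c\<close> read backwards, because the forward
  generators denote converses of functions.\<close>

definition mulrel :: "'r::comm_ring_1 \<Rightarrow> ('r list \<times> 'r list) set" where
  "mulrel c = {([c * u], [u]) |u. True}"

lemma mulrel_seq: "mulrel c \<fatsemi>\<^bsub>LinRel\<^esub> mulrel d = mulrel (c * d)"
  by (auto simp: LinRel_seq mulrel_def relcomp_unfold mult.assoc)

lemma sem_pow: "sem t = mulrel c \<Longrightarrow> sem (pow_term t n) = mulrel (c ^ n)"
  by (induction n) (auto simp: mulrel_seq, auto simp: mulrel_def ide_small)

lemma spow_power: "spow 1 ^ n = spow (int n)" "spow (- 1) ^ n = spow (- int n)"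
  by (induction n) (auto simp: mult_single)

text \<open>As \<open>s\<close> is a unit, the graph of multiplication by it is the reversed graph
  of multiplication by its inverse. This lets negative exponents be treated like positive
  ones.\<close>

lemma sem_s_op: "sem s_op = mulrel (spow (- 1))"
proof -
  have "([u], [spow 1 * u]) \<in> mulrel (spow (- 1))" for u :: "'a laurent"
    unfolding mulrel_def by (rule CollectI, rule exI[of _ "spow 1 * u"]) simp
  then show ?thesis by (auto simp: mulrel_def)
qed

lemma sem_s_pow: "sem (s_pow i) = mulrel (spow i)"
proof (cases "0 \<le> i")
  case True
  have "sem (s_t :: 'a ih_gen smterm) = mulrel (spow 1)" by (auto simp: mulrel_def)
  from sem_pow[OF this] True show ?thesis by (simp add: s_pow_def spow_power)
next
  case False
  from sem_pow[OF sem_s_op, where 'a = 'a] False show ?thesis by (simp add: s_pow_def spow_power)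
qed

lemma sem_sum_term:
  "list_all2 (\<lambda>t c. sem t = mulrel c) ts cs \<Longrightarrow> sem (sum_term ts) = mulrel (sum_list cs)"
proof (induction ts arbitrary: cs rule: sum_term.induct)
  case 1
  then show ?case by (auto simp: mulrel_def LinRel_seq relcomp_unfold)
next
  case (2 t)
  then show ?case by (cases cs) simp_all
next
  case (3 t t' ts)
  from "3.prems" obtain c cs' where cs: "cs = c # cs'" "sem t = mulrel c"
    and rest: "list_all2 (\<lambda>t c. sem t = mulrel c) (t' # ts) cs'"
    by (cases cs) simp_all
  have IH: "sem (sum_term (t' # ts)) = mulrel (sum_list cs')" by (rule "3.IH"[OF rest])
  have ex: "(\<exists>x y. (x, y) \<in> mulrel c \<and> Q x y) \<longleftrightarrow> (\<exists>u. Q [c * u] [u])" for Q and c :: "'a laurent"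
    by (auto simp: mulrel_def)
  have "(x, y) \<in> sem (sum_term (t # t' # ts)) \<longleftrightarrow> (x, y) \<in> mulrel (sum_list cs)" for x y
    unfolding sum_term.simps by (simp only: rel_simps IH cs ex) (auto simp: rel_final mulrel_def)
  then show ?case by auto
qed

lemma sem_laurent_term:
  assumes "Poly_Mapping.keys p \<subseteq> {u..v}" shows "sem (laurent_term p u v) = mulrel p"
proof -
  have "sem (laurent_term p u v) = mulrel (\<Sum>i\<leftarrow>[u..v]. spow i * cst (Poly_Mapping.lookup p i))"
    unfolding laurent_term_def
  proof (rule sem_sum_term)
    have "sem (scal_t a) = mulrel (cst a)" for a :: 'a by (auto simp: mulrel_def)
    then show "list_all2 (\<lambda>t c. sem t = mulrel c) (map (\<lambda>i. s_pow i ;; scal_t (Poly_Mapping.lookup p i)) [u..v])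
        (map (\<lambda>i. spow i * cst (Poly_Mapping.lookup p i)) [u..v])"
      by (simp add: list_all2_conv_all_nth sem_s_pow mulrel_seq del: eval.simps(1))
  qed
  also have "(\<Sum>i\<leftarrow>[u..v]. spow i * cst (Poly_Mapping.lookup p i)) =
      (\<Sum>i\<in>{u..v}. Poly_Mapping.single i (Poly_Mapping.lookup p i))"
    by (simp add: sum_list_distinct_conv_sum_set mult_single)
  also have "\<dots> = p"
  proof (rule poly_mapping_eqI)
    fix k
    have "Poly_Mapping.lookup (\<Sum>i\<in>{u..v}. Poly_Mapping.single i (Poly_Mapping.lookup p i)) k
        = (\<Sum>i\<in>{u..v}. if i = k then Poly_Mapping.lookup p k else 0)"
      by (simp add: lookup_sum lookup_single when_def)
    also have "\<dots> = Poly_Mapping.lookup p k"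
      using assms by (auto simp: in_keys_iff subset_iff)
    finally show "Poly_Mapping.lookup (\<Sum>i\<in>{u..v}. Poly_Mapping.single i (Poly_Mapping.lookup p i)) k
        = Poly_Mapping.lookup p k" .
  qed
  finally show ?thesis .
qed

lemma interaction_sound: "(t, u) \<in> interaction_eqs \<Longrightarrow> sem t = sem u"
proof (erule interaction_eqs.cases)
  fix p :: "'a laurent" and a b
  assume "p \<noteq> 0" "Poly_Mapping.keys p \<subseteq> {a..b}"
    and tu: "t = mirror (laurent_term p a b) ;; laurent_term p a b" "u = Id"
  \<comment> \<open>The composite relates u to v iff p u = p v. It is the identity because Laurent
    polynomials over a field have no zero divisors.\<close>
  then show "sem t = sem u"
    by (auto simp: sem_mirror LinRel_seq sem_laurent_term mulrel_def ide_small relcomp_unfold)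
next
  assume tu: "t = disc_op ;; copy_t" "u = zero_t ;; add_op ;; (scal_t (- 1) \<oplus>\<^sub>t Id)"
  have "sem t = {([], [- v, v]) |v. True}"
    unfolding tu by (auto simp: LinRel_seq eq_neg_iff_add_eq_0)
  moreover have "(x, y) \<in> sem u \<longleftrightarrow> (x, y) \<in> {([], [- v, v]) |v. True}" for x y
    unfolding tu by (simp only: rel_simps) (auto simp: rel_final)
  ultimately show "sem t = sem u" by auto
next
  assume tu: "t = copy_op ;; disc_t" "u = (scal_t (- 1) \<oplus>\<^sub>t Id) ;; add_t ;; zero_op"
  have "sem t = {([- v, v], []) |v. True}"
    unfolding tu by (auto simp: LinRel_seq eq_neg_iff_add_eq_0)
  moreover have "(x, y) \<in> sem u \<longleftrightarrow> (x, y) \<in> {([- v, v], []) |v. True}" for x y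
    unfolding tu by (simp only: rel_simps) (auto simp: rel_final)
  ultimately show "sem t = sem u" by auto
next
  assume tu: "t = (Id \<oplus>\<^sub>t add_op) ;; (add_t \<oplus>\<^sub>t Id)" "u = add_t ;; add_op"
  show "sem t = sem u" unfolding tu by (intro sem_eqI) (simp only: rel_simps, auto simp: rel_final)
next
  assume tu: "t = add_t ;; add_op" "u = (add_op \<oplus>\<^sub>t Id) ;; (Id \<oplus>\<^sub>t add_t)"
  show "sem t = sem u" unfolding tu by (intro sem_eqI) (simp only: rel_simps, auto simp: rel_final)
next
  assume tu: "t = (copy_t \<oplus>\<^sub>t Id) ;; (Id \<oplus>\<^sub>t copy_op)" "u = copy_op ;; copy_t"
  have "(x, y) \<in> sem t" if xy: "(x, y) \<in> sem u" for x y
  proof -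
    obtain a b c d where ab: "x = [a, b]" "y = [c, d]" "a + b = c + d"
      using xy unfolding tu by (simp only: rel_simps) (auto simp: rel_final)
    \<comment> \<open>The witness splits a into c and a - c; then (a - c) + b = d because a + b = c
      + d.\<close>
    show ?thesis unfolding tu
      by (simp only: rel_simps, intro exI[of _ "[c, a - c, b]"])
        (use ab in \<open>auto simp: rel_final eq_diff_eq intro!: exI[of _ "a - c"]\<close>)
  qed
  moreover have "(x, y) \<in> sem u" if "(x, y) \<in> sem t" for x y
    using that unfolding tu by (simp only: rel_simps) (auto simp: rel_final)
  ultimately show "sem t = sem u" by auto
next
  assume tu: "t = copy_op ;; copy_t" "u = (Id \<oplus>\<^sub>t copy_t) ;; (copy_op \<oplus>\<^sub>t Id)"
  have "(x, y) \<in> sem u" if xy: "(x, y) \<in> sem t" for x y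
  proof -
    obtain a b c d where ab: "x = [a, b]" "y = [c, d]" "a + b = c + d"
      using xy unfolding tu by (simp only: rel_simps) (auto simp: rel_final)
    show ?thesis unfolding tu
      by (simp only: rel_simps, intro exI[of _ "[a, b - d, d]"])
        (use ab in \<open>auto simp: rel_final eq_diff_eq intro!: exI[of _ "b - d"]\<close>)
  qed
  moreover have "(x, y) \<in> sem t" if "(x, y) \<in> sem u" for x y
    using that unfolding tu by (simp only: rel_simps) (auto simp: rel_final)
  ultimately show "sem t = sem u" by auto
next
  assume tu: "t = disc_op ;; disc_t" "u = Id\<^sub>0"
  show "sem t = sem u" unfolding tu by (intro sem_eqI) (simp only: rel_simps, auto simp: rel_final)
qed

theorem soundness: "sm_cong ih_arity IH_Cor_eqs m n t u \<Longrightarrow> sem t = sem u"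
proof (erule prop_model.eval_cong[OF sem_model, rotated])
  fix t u :: "'a ih_gen smterm" and m n
  have "sem zero_t \<fatsemi>\<^bsub>LinRel\<^esub> sem zero_op = sem Id\<^sub>0"
    by (auto simp: LinRel_seq ide_small relcomp_unfold)
  moreover assume "(t, u) \<in> IH_Cor_eqs"
  ultimately show "sem t = sem u"
    unfolding IH_Cor_eqs_def IH_Csp_eqs_def mirror_eqs_def
    by (auto simp: sem_mirror HA_sound interaction_sound)
qed

section \<open>Cocommutative comonoids in a prop\<close>

context is_prop
begin

lemma tens_ide_ide: "arr f \<Longrightarrow> \<I> m \<boxplus> (\<I> n \<boxplus> f) = \<I> (m + n) \<boxplus> f"
  by (simp add: tens_ide flip: tens_tens)

lemma tens_split1: "arr f \<Longrightarrow> arr g \<Longrightarrow> f \<boxplus> g = (f \<boxplus> \<I> (src g)) \<fatsemi> (\<I> (tgt f) \<boxplus> g)"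
  and tens_split2: "arr f \<Longrightarrow> arr g \<Longrightarrow> f \<boxplus> g = (\<I> (src f) \<boxplus> g) \<fatsemi> (f \<boxplus> \<I> (tgt g))"
  by (simp_all add: tens_seq)

definition comonoid :: "nat \<Rightarrow> 'a \<Rightarrow> 'a \<Rightarrow> bool" where
  "comonoid n \<delta> \<epsilon> \<longleftrightarrow> \<delta> \<in> hom P n (n + n) \<and> \<epsilon> \<in> hom P n 0 \<and>
     \<delta> \<fatsemi> (\<delta> \<boxplus> \<I> n) = \<delta> \<fatsemi> (\<I> n \<boxplus> \<delta>) \<and> \<delta> \<fatsemi> (\<epsilon> \<boxplus> \<I> n) = \<I> n \<and> \<delta> \<fatsemi> \<X> n n = \<delta>"

lemma comonoidD:
  assumes "comonoid n \<delta> \<epsilon>"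
  shows "arr \<delta>" "src \<delta> = n" "tgt \<delta> = n + n" "arr \<epsilon>" "src \<epsilon> = n" "tgt \<epsilon> = 0"
    and "\<delta> \<fatsemi> (\<delta> \<boxplus> \<I> n) = \<delta> \<fatsemi> (\<I> n \<boxplus> \<delta>)" "\<delta> \<fatsemi> (\<epsilon> \<boxplus> \<I> n) = \<I> n" "\<delta> \<fatsemi> \<X> n n = \<delta>"
  using assms by (simp_all add: comonoid_def hom_iff)

text \<open>Cocommutativity turns the left counit law into the right one.\<close>

lemma comonoid_counit_right:
  assumes "comonoid n \<delta> \<epsilon>" shows "\<delta> \<fatsemi> (\<I> n \<boxplus> \<epsilon>) = \<I> n"
proof -
  note c[simp] = comonoidD(1-6)[OF assms]
  have "\<delta> \<fatsemi> (\<I> n \<boxplus> \<epsilon>) = (\<delta> \<fatsemi> \<X> n n) \<fatsemi> (\<I> n \<boxplus> \<epsilon>)" by (simp add: comonoidD(9)[OF assms])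
  also have "\<dots> = \<delta> \<fatsemi> (\<X> n n \<fatsemi> (\<I> n \<boxplus> \<epsilon>))" by (simp add: seq_seq)
  also have "\<X> n n \<fatsemi> (\<I> n \<boxplus> \<epsilon>) = \<epsilon> \<boxplus> \<I> n"
    using braid_nat[of \<epsilon> "\<I> n" n n 0 n] by simp
  finally show ?thesis by (simp add: comonoidD(8)[OF assms])
qed

text \<open>The usual comultiplication on a tensor product: of the four blocks a, a, b, b the middle
  two are crossed, giving a, b, a, b.\<close>

definition tens_dup :: "nat \<Rightarrow> 'a \<Rightarrow> nat \<Rightarrow> 'a \<Rightarrow> 'a" where
  "tens_dup a d b D = (d \<boxplus> D) \<fatsemi> (\<I> a \<boxplus> (\<X> a b \<boxplus> \<I> b))"

lemma comonoid_tens: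
  assumes d: "comonoid a d e" and D: "comonoid b D E"
  shows "comonoid (a + b) (tens_dup a d b D) (e \<boxplus> E)"
proof -
  note c[simp] = comonoidD(1-6)[OF d] comonoidD(1-6)[OF D]
  let ?M = "\<I> a \<boxplus> (\<X> a b \<boxplus> \<I> b)"
  have ty[simp]: "arr (tens_dup a d b D)" "src (tens_dup a d b D) = a + b"
    "tgt (tens_dup a d b D) = (a + b) + (a + b)"
    by (simp_all add: tens_dup_def)
  have "?M \<fatsemi> ((e \<boxplus> E) \<boxplus> \<I> (a + b)) = ?M \<fatsemi> (e \<boxplus> ((E \<boxplus> \<I> a) \<boxplus> \<I> b))"
    by (simp add: tens_tens flip: tens_ide)
  also have "\<dots> = e \<boxplus> ((\<X> a b \<fatsemi> (E \<boxplus> \<I> a)) \<boxplus> \<I> b)" by (simp add: tens_seq)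
  also have "\<X> a b \<fatsemi> (E \<boxplus> \<I> a) = \<I> a \<boxplus> E"
    using braid_nat[of "\<I> a" E a b a 0] by simp
  also have "e \<boxplus> ((\<I> a \<boxplus> E) \<boxplus> \<I> b) = (e \<boxplus> \<I> a) \<boxplus> (E \<boxplus> \<I> b)" by (simp add: tens_tens)
  finally have counit: "?M \<fatsemi> ((e \<boxplus> E) \<boxplus> \<I> (a + b)) = (e \<boxplus> \<I> a) \<boxplus> (E \<boxplus> \<I> b)" .
  have 1: "tens_dup a d b D \<fatsemi> ((e \<boxplus> E) \<boxplus> \<I> (a + b)) = \<I> (a + b)"
    unfolding tens_dup_def
    by (subst seq_seq) (simp_all add: counit tens_seq comonoidD(8)[OF d] comonoidD(8)[OF D] tens_ide)

  \<comment> \<open>The hexagons split the crossing of two blocks \<open>a + b\<close> into four.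
    \<open>?M\<close> cancels the one of \<open>b\<close> with \<open>a\<close>; what remains are
    the crossings of equal blocks, absorbed by cocommutativity, and again \<open>?M\<close>.\<close>
  have "?M \<fatsemi> \<X> (a + b) (a + b) =
    ?M \<fatsemi> ((\<I> a \<boxplus> ((\<X> b a \<boxplus> \<I> b) \<fatsemi> (\<I> a \<boxplus> \<X> b b))) \<fatsemi> (((\<X> a a \<boxplus> \<I> b) \<fatsemi> (\<I> a \<boxplus> \<X> a b)) \<boxplus> \<I> b))"
    by (simp only: hexagon'[of a b "a + b"] hexagon[of b a b] hexagon[of a a b])
  also have "\<dots> = ?M \<fatsemi> (((\<I> a \<boxplus> (\<X> b a \<boxplus> \<I> b)) \<fatsemi> (\<I> a \<boxplus> (\<I> a \<boxplus> \<X> b b))) \<fatsemi>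
      (((\<X> a a \<boxplus> \<I> b) \<boxplus> \<I> b) \<fatsemi> ?M))"
    by (simp add: tens_seq flip: tens_tens[of "\<I> a" "\<X> a b" "\<I> b"])
  also have "\<dots> = (?M \<fatsemi> (\<I> a \<boxplus> (\<X> b a \<boxplus> \<I> b))) \<fatsemi> (((\<I> a \<boxplus> (\<I> a \<boxplus> \<X> b b)) \<fatsemi> ((\<X> a a \<boxplus> \<I> b) \<boxplus> \<I> b)) \<fatsemi> ?M)"
    by (simp add: seq_seq add_ac)
  also have "?M \<fatsemi> (\<I> a \<boxplus> (\<X> b a \<boxplus> \<I> b)) = \<I> ((a + a) + (b + b))"
    by (simp add: tens_seq braid_inverse tens_ide add_ac)
  also have "(\<I> a \<boxplus> (\<I> a \<boxplus> \<X> b b)) \<fatsemi> ((\<X> a a \<boxplus> \<I> b) \<boxplus> \<I> b) = \<X> a a \<boxplus> \<X> b b"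
    by (simp add: tens_tens tens_ide_ide tens_ide tens_seq)
  finally have comm: "?M \<fatsemi> \<X> (a + b) (a + b) = (\<X> a a \<boxplus> \<X> b b) \<fatsemi> ?M"
    by (simp add: add_ac)
  have "tens_dup a d b D \<fatsemi> \<X> (a + b) (a + b) = (d \<boxplus> D) \<fatsemi> ((\<X> a a \<boxplus> \<X> b b) \<fatsemi> ?M)"
    unfolding tens_dup_def by (subst seq_seq) (simp_all add: comm)
  also have "\<dots> = ((d \<boxplus> D) \<fatsemi> (\<X> a a \<boxplus> \<X> b b)) \<fatsemi> ?M" by (simp add: seq_seq)
  also have "\<dots> = tens_dup a d b D"
    by (simp add: tens_seq comonoidD(9)[OF d] comonoidD(9)[OF D] tens_dup_def)
  finally have 2: "tens_dup a d b D \<fatsemi> \<X> (a + b) (a + b) = tens_dup a d b D" .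

  let ?bb = "b + b" and ?aa = "a + a"
  \<comment> \<open>Coassociativity: naturality moves \<open>?M\<close> past the second
    comultiplication on either side (\<open>l1\<close>, \<open>r1\<close>). This leaves an identity
    between permutations of blocks, settled by \<open>L\<close>, \<open>R\<close> and
    \<open>swap\<close>.\<close>
  have "?M \<fatsemi> ((d \<boxplus> D) \<boxplus> \<I> (a + b)) = ?M \<fatsemi> (d \<boxplus> ((D \<boxplus> \<I> a) \<boxplus> \<I> b))"
    by (simp add: tens_tens flip: tens_ide)
  also have "\<dots> = d \<boxplus> ((\<X> a b \<fatsemi> (D \<boxplus> \<I> a)) \<boxplus> \<I> b)" by (simp add: tens_seq)
  also have "\<X> a b \<fatsemi> (D \<boxplus> \<I> a) = (\<I> a \<boxplus> D) \<fatsemi> \<X> a ?bb"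
    using braid_nat[of "\<I> a" D a b a ?bb] by simp
  also have "d \<boxplus> (((\<I> a \<boxplus> D) \<fatsemi> \<X> a ?bb) \<boxplus> \<I> b) = (d \<boxplus> ((\<I> a \<boxplus> D) \<boxplus> \<I> b)) \<fatsemi> (\<I> ?aa \<boxplus> (\<X> a ?bb \<boxplus> \<I> b))"
    by (simp add: tens_seq)
  also have "d \<boxplus> ((\<I> a \<boxplus> D) \<boxplus> \<I> b) = (d \<boxplus> \<I> a) \<boxplus> (D \<boxplus> \<I> b)" by (simp add: tens_tens)
  finally have l1: "?M \<fatsemi> ((d \<boxplus> D) \<boxplus> \<I> (a + b)) = ((d \<boxplus> \<I> a) \<boxplus> (D \<boxplus> \<I> b)) \<fatsemi> (\<I> ?aa \<boxplus> (\<X> a ?bb \<boxplus> \<I> b))" .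
  have "?M \<fatsemi> (\<I> (a + b) \<boxplus> (d \<boxplus> D)) = ?M \<fatsemi> (\<I> a \<boxplus> ((\<I> b \<boxplus> d) \<boxplus> D))"
    by (simp add: tens_tens flip: tens_ide)
  also have "\<dots> = \<I> a \<boxplus> ((\<X> a b \<fatsemi> (\<I> b \<boxplus> d)) \<boxplus> D)" by (simp add: tens_seq)
  also have "\<X> a b \<fatsemi> (\<I> b \<boxplus> d) = (d \<boxplus> \<I> b) \<fatsemi> \<X> ?aa b"
    using braid_nat[of d "\<I> b" a b ?aa b] by simp
  also have "\<I> a \<boxplus> (((d \<boxplus> \<I> b) \<fatsemi> \<X> ?aa b) \<boxplus> D) = (\<I> a \<boxplus> ((d \<boxplus> \<I> b) \<boxplus> D)) \<fatsemi> (\<I> a \<boxplus> (\<X> ?aa b \<boxplus> \<I> ?bb))"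
    by (simp add: tens_seq)
  also have "\<I> a \<boxplus> ((d \<boxplus> \<I> b) \<boxplus> D) = (\<I> a \<boxplus> d) \<boxplus> (\<I> b \<boxplus> D)" by (simp add: tens_tens)
  finally have r1: "?M \<fatsemi> (\<I> (a + b) \<boxplus> (d \<boxplus> D)) = ((\<I> a \<boxplus> d) \<boxplus> (\<I> b \<boxplus> D)) \<fatsemi> (\<I> a \<boxplus> (\<X> ?aa b \<boxplus> \<I> ?bb))" .
  have M1: "?M \<boxplus> \<I> (a + b) = \<I> a \<boxplus> (\<X> a b \<boxplus> \<I> (b + (a + b)))"
    and M2: "\<I> (a + b) \<boxplus> ?M = \<I> (a + b + a) \<boxplus> (\<X> a b \<boxplus> \<I> b)"
    by (simp_all add: tens_tens tens_ide tens_ide_ide add_ac)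
  have "\<I> ?aa \<boxplus> (\<X> a ?bb \<boxplus> \<I> b) = \<I> ?aa \<boxplus> ((\<X> a b \<boxplus> \<I> ?bb) \<fatsemi> (\<I> b \<boxplus> (\<X> a b \<boxplus> \<I> b)))"
  proof -
    have "\<X> a ?bb \<boxplus> \<I> b = ((\<X> a b \<boxplus> \<I> b) \<boxplus> \<I> b) \<fatsemi> ((\<I> b \<boxplus> \<X> a b) \<boxplus> \<I> b)"
      by (simp add: hexagon tens_seq)
    then show ?thesis by (simp add: tens_tens tens_ide)
  qed
  also have "\<dots> = (\<I> ?aa \<boxplus> (\<X> a b \<boxplus> \<I> ?bb)) \<fatsemi> (\<I> (?aa + b) \<boxplus> (\<X> a b \<boxplus> \<I> b))"
    by (simp add: tens_seq flip: tens_ide_ide)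
  finally have L: "\<I> ?aa \<boxplus> (\<X> a ?bb \<boxplus> \<I> b) = (\<I> ?aa \<boxplus> (\<X> a b \<boxplus> \<I> ?bb)) \<fatsemi> (\<I> (?aa + b) \<boxplus> (\<X> a b \<boxplus> \<I> b))" .
  have "\<I> a \<boxplus> (\<X> ?aa b \<boxplus> \<I> ?bb) = \<I> a \<boxplus> ((\<I> a \<boxplus> (\<X> a b \<boxplus> \<I> ?bb)) \<fatsemi> (\<X> a b \<boxplus> \<I> (a + ?bb)))"
  proof -
    have "\<X> ?aa b \<boxplus> \<I> ?bb = ((\<I> a \<boxplus> \<X> a b) \<boxplus> \<I> ?bb) \<fatsemi> ((\<X> a b \<boxplus> \<I> a) \<boxplus> \<I> ?bb)"
      by (simp add: hexagon' tens_seq)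
    then show ?thesis by (simp add: tens_tens tens_ide)
  qed
  also have "\<dots> = (\<I> ?aa \<boxplus> (\<X> a b \<boxplus> \<I> ?bb)) \<fatsemi> (\<I> a \<boxplus> (\<X> a b \<boxplus> \<I> (a + ?bb)))"
    by (simp add: tens_seq flip: tens_ide_ide)
  finally have R: "\<I> a \<boxplus> (\<X> ?aa b \<boxplus> \<I> ?bb) = (\<I> ?aa \<boxplus> (\<X> a b \<boxplus> \<I> ?bb)) \<fatsemi> (\<I> a \<boxplus> (\<X> a b \<boxplus> \<I> (a + ?bb)))" .
  \<comment> \<open>The two crossings act on disjoint blocks, so they commute: both orders equal the
    tensor of the two.\<close>
  have "(\<I> (?aa + b) \<boxplus> (\<X> a b \<boxplus> \<I> b)) \<fatsemi> (\<I> a \<boxplus> (\<X> a b \<boxplus> \<I> (b + (a + b))))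
      = \<I> a \<boxplus> (\<X> a b \<boxplus> (\<X> a b \<boxplus> \<I> b))"
  proof -
    have "\<I> (?aa + b) \<boxplus> (\<X> a b \<boxplus> \<I> b) = \<I> a \<boxplus> (\<I> (a + b) \<boxplus> (\<X> a b \<boxplus> \<I> b))"
      by (simp add: tens_ide_ide add_ac)
    moreover have "\<I> (b + (a + b)) = \<I> ((b + a) + b)" by (simp add: add_ac)
    ultimately show ?thesis by (simp add: tens_seq)
  qed
  also have "\<dots> = (\<I> a \<boxplus> (\<X> a b \<boxplus> \<I> (a + ?bb))) \<fatsemi> (\<I> (a + b + a) \<boxplus> (\<X> a b \<boxplus> \<I> b))"
  proof -
    have "\<I> (a + b + a) \<boxplus> (\<X> a b \<boxplus> \<I> b) = \<I> a \<boxplus> (\<I> (b + a) \<boxplus> (\<X> a b \<boxplus> \<I> b))"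
      by (simp add: tens_ide_ide add_ac)
    moreover have "\<I> (a + ?bb) = \<I> ((a + b) + b)" by (simp add: add_ac)
    ultimately show ?thesis by (simp add: tens_seq)
  qed
  finally have swap: "(\<I> (?aa + b) \<boxplus> (\<X> a b \<boxplus> \<I> b)) \<fatsemi> (\<I> a \<boxplus> (\<X> a b \<boxplus> \<I> (b + (a + b))))
      = (\<I> a \<boxplus> (\<X> a b \<boxplus> \<I> (a + ?bb))) \<fatsemi> (\<I> (a + b + a) \<boxplus> (\<X> a b \<boxplus> \<I> b))" .

  let ?dd = "tens_dup a d b D"
  have 3: "?dd \<fatsemi> (?dd \<boxplus> \<I> (a + b)) = ?dd \<fatsemi> (\<I> (a + b) \<boxplus> ?dd)"
  proof -
    have "?dd \<boxplus> \<I> (a + b) = ((d \<boxplus> D) \<boxplus> \<I> (a + b)) \<fatsemi> (?M \<boxplus> \<I> (a + b))"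
      by (simp add: tens_dup_def tens_seq)
    then have "?dd \<fatsemi> (?dd \<boxplus> \<I> (a + b)) = (d \<boxplus> D) \<fatsemi> ((?M \<fatsemi> ((d \<boxplus> D) \<boxplus> \<I> (a + b))) \<fatsemi> (?M \<boxplus> \<I> (a + b)))"
      by (simp add: tens_dup_def seq_seq add_ac)
    also have "\<dots> = ((d \<boxplus> D) \<fatsemi> ((d \<boxplus> \<I> a) \<boxplus> (D \<boxplus> \<I> b))) \<fatsemi> ((\<I> ?aa \<boxplus> (\<X> a ?bb \<boxplus> \<I> b)) \<fatsemi> (?M \<boxplus> \<I> (a + b)))"
      unfolding l1 by (simp add: seq_seq add_ac)
    also have "(\<I> ?aa \<boxplus> (\<X> a ?bb \<boxplus> \<I> b)) \<fatsemi> (?M \<boxplus> \<I> (a + b)) = (\<I> ?aa \<boxplus> (\<X> a b \<boxplus> \<I> ?bb)) \<fatsemi>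
       ((\<I> (?aa + b) \<boxplus> (\<X> a b \<boxplus> \<I> b)) \<fatsemi> (\<I> a \<boxplus> (\<X> a b \<boxplus> \<I> (b + (a + b)))))"
      unfolding L M1 by (simp add: seq_seq add_ac)
    also have "\<dots> = (\<I> a \<boxplus> (\<X> ?aa b \<boxplus> \<I> ?bb)) \<fatsemi> (\<I> (a + b) \<boxplus> ?M)"
      unfolding swap R M2 by (simp add: seq_seq add_ac)
    also have "(d \<boxplus> D) \<fatsemi> ((d \<boxplus> \<I> a) \<boxplus> (D \<boxplus> \<I> b)) = (d \<boxplus> D) \<fatsemi> ((\<I> a \<boxplus> d) \<boxplus> (\<I> b \<boxplus> D))"
      by (simp add: tens_seq comonoidD(7)[OF d] comonoidD(7)[OF D])
    also have "((d \<boxplus> D) \<fatsemi> ((\<I> a \<boxplus> d) \<boxplus> (\<I> b \<boxplus> D))) \<fatsemi> ((\<I> a \<boxplus> (\<X> ?aa b \<boxplus> \<I> ?bb)) \<fatsemi> (\<I> (a + b) \<boxplus> ?M))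
      = (d \<boxplus> D) \<fatsemi> ((?M \<fatsemi> (\<I> (a + b) \<boxplus> (d \<boxplus> D))) \<fatsemi> (\<I> (a + b) \<boxplus> ?M))"
      unfolding r1 by (simp add: seq_seq add_ac)
    also have "\<dots> = ?dd \<fatsemi> (\<I> (a + b) \<boxplus> ?dd)"
    proof -
      have "\<I> (a + b) \<boxplus> ?dd = (\<I> (a + b) \<boxplus> (d \<boxplus> D)) \<fatsemi> (\<I> (a + b) \<boxplus> ?M)"
        by (simp add: tens_dup_def tens_seq)
      then show ?thesis by (simp add: tens_dup_def seq_seq add_ac)
    qed
    finally show ?thesis .
  qed
  from 1 2 3 show ?thesis by (simp add: comonoid_def hom_iff)
qed

end

section \<open>Function terms\<close>

text \<open>Mirror images of the generators of \<open>HA\<close>, and the inverse \<open>s\<close> of \<open>s\<^sup>o\<^sup>p\<close>, denote functions.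
  A function term acts on lists of elements of any \<open>k[s, s\<^sup>-\<^sup>1]\<close>-module.\<close>

record ('k, 'v) module_ops =
  madd :: "'v \<Rightarrow> 'v \<Rightarrow> 'v"
  mzero :: 'v
  mscale :: "'k \<Rightarrow> 'v \<Rightarrow> 'v"
  mshift :: "'v \<Rightarrow> 'v"
  munshift :: "'v \<Rightarrow> 'v"

primrec fn_term :: "'k ih_gen smterm \<Rightarrow> bool" where
  "fn_term (Gen g) \<longleftrightarrow> (\<exists>b. g = Op b) \<or> g = Fwd Shift"
| "fn_term Id\<^sub>0 \<longleftrightarrow> True"
| "fn_term Id \<longleftrightarrow> True"
| "fn_term Tw \<longleftrightarrow> True"
| "fn_term (t ;; u) \<longleftrightarrow> fn_term t \<and> fn_term u"
| "fn_term (t \<oplus>\<^sub>t u) \<longleftrightarrow> fn_term t \<and> fn_term u"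

text \<open>Read off the term alone, so that \<open>act\<close> can split its argument list at a
  tensor without a typing derivation.\<close>

primrec term_src :: "'k ih_gen smterm \<Rightarrow> nat" where
  "term_src (Gen g) = fst (ih_arity g)"
| "term_src Id\<^sub>0 = 0"
| "term_src Id = 1"
| "term_src Tw = 2"
| "term_src (t ;; u) = term_src t"
| "term_src (t \<oplus>\<^sub>t u) = term_src t + term_src u"

fun act_gen :: "('k, 'v) module_ops \<Rightarrow> 'k ih_gen \<Rightarrow> 'v list \<Rightarrow> 'v list" where
  "act_gen M (Op Add) [x] = [x, x]"
| "act_gen M (Op Zero) [x] = []"
| "act_gen M (Op Copy) [x, y] = [madd M x y]"
| "act_gen M (Op Disc) [] = [mzero M]"
| "act_gen M (Op Shift) [x] = [mshift M x]"
| "act_gen M (Op (Scalar a)) [x] = [mscale M a x]"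
| "act_gen M (Fwd Shift) [x] = [munshift M x]"
| "act_gen M _ _ = []"

primrec act :: "('k, 'v) module_ops \<Rightarrow> 'k ih_gen smterm \<Rightarrow> 'v list \<Rightarrow> 'v list" where
  "act M (Gen g) xs = act_gen M g xs"
| "act M Id\<^sub>0 xs = []"
| "act M Id xs = xs"
| "act M Tw xs = rev xs"
| "act M (t ;; u) xs = act M u (act M t xs)"
| "act M (t \<oplus>\<^sub>t u) xs = act M t (take (term_src t) xs) @ act M u (drop (term_src t) xs)"

lemma term_src: "has_type ih_arity t m n \<Longrightarrow> term_src t = m"
  by (induction t arbitrary: m n) auto

lemma fn_term_id_term[simp]: "fn_term (id_term n)"
  by (induction n) auto

lemma act_id_term[simp]: "length xs = n \<Longrightarrow> act M (id_term n) xs = xs"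
proof (induction n arbitrary: xs)
  case (Suc n) then show ?case by (cases xs) auto
qed simp

lemma has_type_tensE:
  assumes "has_type ar (t \<oplus>\<^sub>t u) m n" "length xs = m"
  obtains a b c d ys zs where "has_type ar t a b" "has_type ar u c d" "m = a + c" "n = b + d"
    "xs = ys @ zs" "length ys = a" "length zs = c"
proof -
  obtain a b c d where *: "has_type ar t a b" "has_type ar u c d" "m = a + c" "n = b + d"
    using assms(1) by auto
  with assms(2) have "xs = take a xs @ drop a xs" "length (take a xs) = a" "length (drop a xs) = c" by auto
  with * that show ?thesis by blast
qed

lemma act_tens: "has_type ih_arity t (length xs) n \<Longrightarrow> act M (t \<oplus>\<^sub>t u) (xs @ ys) = act M t xs @ act M u ys"
  by (simp add: term_src)

lemma fn_gen_cases:
  assumes "fn_term (Gen g)" "ih_arity g = (length xs, n)"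
  obtains x where "g = Op Add" "xs = [x]" "n = 2" | x where "g = Op Zero" "xs = [x]" "n = 0"
  | x y where "g = Op Copy" "xs = [x, y]" "n = 1" | "g = Op Disc" "xs = []" "n = 1"
  | x where "g = Op Shift" "xs = [x]" "n = 1" | a x where "g = Op (Scalar a)" "xs = [x]" "n = 1"
  | x where "g = Fwd Shift" "xs = [x]" "n = 1"
proof -
  consider b where "g = Op b" | "g = Fwd Shift" using assms(1) by auto
  then show ?thesis
  proof cases
    case 1
    show ?thesis
    proof (cases b)
      case Add
      with assms(2) 1 obtain x where "xs = [x]" "n = 2" by (auto simp: numeral_2_eq_2 Suc_length_conv)
      then show ?thesis using that(1) Add 1 by simp
    next
      case Zero
      with assms(2) 1 obtain x where "xs = [x]" "n = 0" by (auto simp: numeral_2_eq_2 Suc_length_conv)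
      then show ?thesis using that(2) Zero 1 by simp
    next
      case Copy
      with assms(2) 1 obtain x y where "xs = [x, y]" "n = 1"
        by (auto simp: numeral_2_eq_2 Suc_length_conv length_Suc_conv)
      then show ?thesis using that(3) Copy 1 by simp
    next
      case Disc
      then show ?thesis using that(4) 1 assms(2) by simp
    next
      case Shift
      with assms(2) 1 obtain x where "xs = [x]" "n = 1" by (auto simp: numeral_2_eq_2 Suc_length_conv)
      then show ?thesis using that(5) Shift 1 by simp
    next
      case (Scalar a)
      with assms(2) 1 obtain x where "xs = [x]" "n = 1" by (auto simp: numeral_2_eq_2 Suc_length_conv)
      then show ?thesis using that(6) Scalar 1 by simp
    qed
  next
    case 2
    with assms(2) obtain x where "xs = [x]" "n = 1" by (auto simp: Suc_length_conv)
    then show ?thesis using that(7) 2 by simp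
  qed
qed

lemma length_act: "fn_term t \<Longrightarrow> has_type ih_arity t m n \<Longrightarrow> length xs = m \<Longrightarrow> length (act M t xs) = n"
proof (induction t arbitrary: m n xs)
  case (Gen g)
  from Gen(2,3) have "ih_arity g = (length xs, n)" by simp
  from fn_gen_cases[OF Gen(1) this] show ?case by cases simp_all
next
  case (Tens t u)
  from Tens.prems(2,3) show ?case
    by (rule has_type_tensE) (use Tens.IH Tens.prems(1) in \<open>simp add: term_src\<close>)
next
  case (Seq t u)
  then show ?case by fastforce
qed auto

text \<open>Function terms use nothing but the module operations, so their action commutes with
  every map preserving these. It is applied to the coordinates of coefficient vectors and to
  \<open>functional_of\<close>.\<close>

lemma act_hom:
  assumes "\<And>x y. h (madd M x y) = madd N (h x) (h y)" "h (mzero M) = mzero N"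
    "\<And>a x. h (mscale M a x) = mscale N a (h x)" "\<And>x. h (mshift M x) = mshift N (h x)"
    "\<And>x. h (munshift M x) = munshift N (h x)"
  shows "fn_term t \<Longrightarrow> has_type ih_arity t m n \<Longrightarrow> length xs = m \<Longrightarrow> map h (act M t xs) = act N t (map h xs)"
proof (induction t arbitrary: m n xs)
  case (Gen g)
  from Gen(2,3) have "ih_arity g = (length xs, n)" by simp
  from fn_gen_cases[OF Gen(1) this] show ?case by cases (simp_all add: assms)
next
  case (Tens t u)
  from Tens.prems(2,3) show ?case
    by (rule has_type_tensE) (use Tens.IH Tens.prems(1) in \<open>simp add: term_src\<close>)
next
  case (Seq t u)
  then obtain k where "has_type ih_arity t m k" "has_type ih_arity u k n" by auto
  then show ?case using Seq length_act[of t m k xs M] by simp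
qed (auto simp: rev_map)


section \<open>Calculating in models of \<open>IH\<^sup>C\<^sup>o\<^sup>r\<close>\<close>

locale ih_model = prop_model P ih_arity \<gamma> for P :: "'a prop_cat" (structure)
    and \<gamma> :: "'k::field ih_gen \<Rightarrow> 'a" +
  assumes eqs: "(t, u) \<in> IH_Cor_eqs \<Longrightarrow> has_type ih_arity t m n \<Longrightarrow> has_type ih_arity u m n \<Longrightarrow> \<lbrakk>t\<rbrakk> = \<lbrakk>u\<rbrakk>"
begin

text \<open>Names follow the relational reading, in which mirroring exchanges the expected roles:
  the mirror image of \<open>add\<close> duplicates a value and that of \<open>copy\<close> adds
  two.\<close>

abbreviation "dup \<equiv> \<gamma> (Op Add)"
abbreviation "del \<equiv> \<gamma> (Op Zero)"
abbreviation "merge \<equiv> \<gamma> (Op Copy)"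
abbreviation "nil \<equiv> \<gamma> (Op Disc)"
abbreviation "shift \<equiv> \<gamma> (Op Shift)"
abbreviation "unshift \<equiv> \<gamma> (Fwd Shift)"
abbreviation "scale a \<equiv> \<gamma> (Op (Scalar a))"

lemma gen_type: "arr (\<gamma> g)" "src (\<gamma> g) = fst (ih_arity g)" "tgt (\<gamma> g) = snd (ih_arity g)"
  using gen_hom[of g] by (simp_all add: hom_iff)

lemma gen_types[simp]:
  "arr (\<gamma> g)" "src dup = 1" "tgt dup = 2" "src del = 1" "tgt del = 0" "src merge = 2" "tgt merge = 1"
  "src nil = 0" "tgt nil = 1" "src shift = 1" "tgt shift = 1" "src unshift = 1" "tgt unshift = 1"
  "src (scale a) = 1" "tgt (scale a) = 1"
  by (simp_all add: gen_type)

lemma HA: "(t, u) \<in> HA_eqs \<Longrightarrow> has_type ih_arity t m n \<Longrightarrow> has_type ih_arity u m n \<Longrightarrow> \<lbrakk>t\<rbrakk> = \<lbrakk>u\<rbrakk>"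
  using eqs by (auto simp: IH_Cor_eqs_def IH_Csp_eqs_def)

lemma HA_mirror: "(t, u) \<in> HA_eqs \<Longrightarrow> has_type ih_arity (mirror t) m n \<Longrightarrow> has_type ih_arity (mirror u) m n
    \<Longrightarrow> \<lbrakk>mirror t\<rbrakk> = \<lbrakk>mirror u\<rbrakk>"
proof (rule eqs)
  assume "(t, u) \<in> HA_eqs"
  then have "(mirror t, mirror u) \<in> mirror_eqs HA_eqs"
    unfolding mirror_eqs_def by (rule rev_image_eqI) simp
  then show "(mirror t, mirror u) \<in> IH_Cor_eqs" by (simp add: IH_Cor_eqs_def IH_Csp_eqs_def)
qed

lemma interaction: "(t, u) \<in> interaction_eqs \<Longrightarrow> has_type ih_arity t m n \<Longrightarrow> has_type ih_arity u m n \<Longrightarrow> \<lbrakk>t\<rbrakk> = \<lbrakk>u\<rbrakk>"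
  using eqs by (auto simp: IH_Cor_eqs_def IH_Csp_eqs_def)

lemma dup_eqs:
  "dup \<fatsemi> (dup \<boxplus> \<I> 1) = dup \<fatsemi> (\<I> 1 \<boxplus> dup)" "dup \<fatsemi> (del \<boxplus> \<I> 1) = \<I> 1" "dup \<fatsemi> \<X> 1 1 = dup"
  using HA_mirror[OF HA_eqs.add_assoc, of 1 3] HA_mirror[OF HA_eqs.add_unit_left, of 1 1]
    HA_mirror[OF HA_eqs.add_comm, of 1 2] by simp_all

lemma add_eqs:
  "(merge \<boxplus> \<I> 1) \<fatsemi> merge = (\<I> 1 \<boxplus> merge) \<fatsemi> merge" "(nil \<boxplus> \<I> 1) \<fatsemi> merge = \<I> 1" "\<X> 1 1 \<fatsemi> merge = merge"
  using HA_mirror[OF HA_eqs.copy_assoc, of 3 1] HA_mirror[OF HA_eqs.copy_unit_left, of 1 1]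
    HA_mirror[OF HA_eqs.copy_comm, of 2 1] by simp_all

lemma bialgebra_eqs:
  "merge \<fatsemi> dup = ((dup \<boxplus> dup) \<fatsemi> (\<I> 1 \<boxplus> (\<X> 1 1 \<boxplus> \<I> 1))) \<fatsemi> (merge \<boxplus> merge)"
  "nil \<fatsemi> dup = nil \<boxplus> nil" "merge \<fatsemi> del = del \<boxplus> del" "nil \<fatsemi> del = \<I> 0"
  using HA_mirror[OF HA_eqs.add_copy, of 2 2] HA_mirror[OF HA_eqs.add_disc, of 0 2]
    HA_mirror[OF HA_eqs.zero_copy, of 2 0] HA_mirror[OF HA_eqs.zero_disc, of 0 0]
  by (force simp: numeral_eq_Suc)+

text \<open>Endomorphisms of the bimonoid carried by one wire.\<close>

definition linear :: "'a \<Rightarrow> bool" where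
  "linear r \<longleftrightarrow> arr r \<and> src r = 1 \<and> tgt r = 1 \<and> merge \<fatsemi> r = (r \<boxplus> r) \<fatsemi> merge \<and> nil \<fatsemi> r = nil \<and>
     r \<fatsemi> dup = dup \<fatsemi> (r \<boxplus> r) \<and> r \<fatsemi> del = del"

lemma linearD:
  assumes "linear r"
  shows "arr r" "src r = 1" "tgt r = 1" "merge \<fatsemi> r = (r \<boxplus> r) \<fatsemi> merge" "nil \<fatsemi> r = nil"
    "r \<fatsemi> dup = dup \<fatsemi> (r \<boxplus> r)" "r \<fatsemi> del = del"
  using assms by (simp_all add: linear_def)

lemma linear_shift: "linear shift"
  using HA_mirror[OF HA_eqs.map_copy[of s_t undefined], of 2 1] HA_mirror[OF HA_eqs.map_disc[of s_t undefined], of 0 1]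
    HA_mirror[OF HA_eqs.map_add[of s_t undefined], of 1 2] HA_mirror[OF HA_eqs.map_zero[of s_t undefined], of 1 0]
  by (simp add: linear_def numeral_eq_Suc)

lemma linear_scale: "linear (scale a)"
  using HA_mirror[OF HA_eqs.map_copy[of "scal_t a" a], of 2 1] HA_mirror[OF HA_eqs.map_disc[of "scal_t a" a], of 0 1]
    HA_mirror[OF HA_eqs.map_add[of "scal_t a" a], of 1 2] HA_mirror[OF HA_eqs.map_zero[of "scal_t a" a], of 1 0]
  by (simp add: linear_def numeral_eq_Suc)

lemma shift_unshift: "shift \<fatsemi> unshift = \<I> 1" "unshift \<fatsemi> shift = \<I> 1"
  using HA[OF HA_eqs.s_op_s, of 1 1] HA[OF HA_eqs.s_s_op, of 1 1] by simp_all

text \<open>The equations state the compatibility of \<open>s\<close> with the forward structure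
  only. Its compatibility with \<open>dup\<close> and \<open>merge\<close> is inherited from
  \<open>shift\<close>, whose inverse it is.\<close>

lemma linear_unshift: "linear unshift"
proof -
  note s = linearD[OF linear_shift]
  have "merge \<fatsemi> unshift = (((unshift \<boxplus> unshift) \<fatsemi> (shift \<boxplus> shift)) \<fatsemi> merge) \<fatsemi> unshift"
    by (simp add: tens_seq shift_unshift tens_ide)
  also have "\<dots> = ((unshift \<boxplus> unshift) \<fatsemi> (merge \<fatsemi> shift)) \<fatsemi> unshift"
    by (simp add: s(4) seq_seq)
  also have "\<dots> = (unshift \<boxplus> unshift) \<fatsemi> merge"
    by (simp add: seq_seq shift_unshift)
  finally have 1: "merge \<fatsemi> unshift = (unshift \<boxplus> unshift) \<fatsemi> merge" .
  have "nil \<fatsemi> unshift = (nil \<fatsemi> shift) \<fatsemi> unshift" by (simp add: s(5))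
  also have "\<dots> = nil" by (simp add: seq_seq shift_unshift)
  finally have 2: "nil \<fatsemi> unshift = nil" .
  have "unshift \<fatsemi> dup = (unshift \<fatsemi> dup) \<fatsemi> ((shift \<boxplus> shift) \<fatsemi> (unshift \<boxplus> unshift))"
    by (simp add: tens_seq shift_unshift tens_ide)
  also have "\<dots> = unshift \<fatsemi> ((shift \<fatsemi> dup) \<fatsemi> (unshift \<boxplus> unshift))"
    by (simp add: s(6) seq_seq)
  also have "\<dots> = (unshift \<fatsemi> shift) \<fatsemi> (dup \<fatsemi> (unshift \<boxplus> unshift))"
    by (simp add: seq_seq)
  also have "\<dots> = dup \<fatsemi> (unshift \<boxplus> unshift)"
    by (simp add: shift_unshift)
  finally have 3: "unshift \<fatsemi> dup = dup \<fatsemi> (unshift \<boxplus> unshift)" .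
  have "unshift \<fatsemi> del = unshift \<fatsemi> (shift \<fatsemi> del)" by (simp add: s(7))
  also have "\<dots> = (unshift \<fatsemi> shift) \<fatsemi> del" by (simp add: seq_seq)
  also have "\<dots> = del" by (simp add: shift_unshift)
  finally show ?thesis using 1 2 3 by (simp add: linear_def)
qed

lemma scale_eqs:
  "scale b \<fatsemi> scale a = scale (a * b)" "(dup \<fatsemi> (scale a \<boxplus> scale b)) \<fatsemi> merge = scale (a + b)"
  "scale 1 = \<I> 1" "scale 0 = del \<fatsemi> nil" "shift \<fatsemi> scale a = scale a \<fatsemi> shift"
  using HA_mirror[OF HA_eqs.scal_mult[of a b], of 1 1] HA_mirror[OF HA_eqs.scal_add[of a b], of 1 1]
    HA_mirror[OF HA_eqs.scal_one, of 1 1] HA_mirror[OF HA_eqs.scal_zero, of 1 1]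
    HA_mirror[OF HA_eqs.scal_s[of a], of 1 1]
  by (force simp: numeral_eq_Suc)+


subsection \<open>Tuples of functionals\<close>

primrec dups :: "nat \<Rightarrow> 'a" where
  "dups 0 = \<I> 0"
| "dups (Suc n) = tens_dup 1 dup n (dups n)"

primrec dels :: "nat \<Rightarrow> 'a" where
  "dels 0 = \<I> 0"
| "dels (Suc n) = del \<boxplus> dels n"

lemma comonoid_1: "comonoid 1 dup del"
  by (simp add: comonoid_def dup_eqs[simplified] hom_iff numeral_2_eq_2)

lemma comonoid_wires: "comonoid n (dups n) (dels n)"
proof (induction n)
  case 0 then show ?case by (simp add: comonoid_def hom_iff)
next
  case (Suc n)
  from comonoid_tens[OF comonoid_1 this] show ?case by simp
qed

lemma wires_type[simp]: "arr (dups n)" "src (dups n) = n" "tgt (dups n) = n + n"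
  "arr (dels n)" "src (dels n) = n" "tgt (dels n) = 0"
  by (rule comonoidD[OF comonoid_wires])+

definition pair :: "nat \<Rightarrow> 'a \<Rightarrow> 'a \<Rightarrow> 'a" where
  "pair w x y = dups w \<fatsemi> (x \<boxplus> y)"

lemma pair_type[simp]:
  assumes "arr x" "arr y" "src x = w" "src y = w"
  shows "arr (pair w x y)" "src (pair w x y) = w" "tgt (pair w x y) = tgt x + tgt y"
  using assms by (simp_all add: pair_def)

lemma pair_seq: "arr x \<Longrightarrow> arr y \<Longrightarrow> src x = w \<Longrightarrow> src y = w \<Longrightarrow> arr f \<Longrightarrow> arr g \<Longrightarrow> tgt x = src f \<Longrightarrow> tgt y = src g
    \<Longrightarrow> pair w x y \<fatsemi> (f \<boxplus> g) = pair w (x \<fatsemi> f) (y \<fatsemi> g)"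
  by (simp add: pair_def seq_seq tens_seq)

lemma pair_assoc:
  assumes [simp]: "arr x" "arr y" "arr z" "src x = w" "src y = w" "src z = w"
  shows "pair w (pair w x y) z = pair w x (pair w y z)"
proof -
  have "(dups w \<fatsemi> (x \<boxplus> y)) \<boxplus> z = (dups w \<boxplus> \<I> w) \<fatsemi> ((x \<boxplus> y) \<boxplus> z)"
    and r: "x \<boxplus> (dups w \<fatsemi> (y \<boxplus> z)) = (\<I> w \<boxplus> dups w) \<fatsemi> (x \<boxplus> (y \<boxplus> z))"
    by (simp_all add: tens_seq)
  then have "pair w (pair w x y) z = (dups w \<fatsemi> (dups w \<boxplus> \<I> w)) \<fatsemi> ((x \<boxplus> y) \<boxplus> z)"
    by (simp add: pair_def seq_seq)
  also have "\<dots> = (dups w \<fatsemi> (\<I> w \<boxplus> dups w)) \<fatsemi> (x \<boxplus> (y \<boxplus> z))"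
    by (simp add: comonoidD(7)[OF comonoid_wires] tens_tens)
  also have "\<dots> = pair w x (pair w y z)" by (simp add: pair_def r seq_seq)
  finally show ?thesis .
qed

lemma pair_swap:
  assumes [simp]: "arr x" "arr y" "src x = w" "src y = w" and "tgt x = m" "tgt y = n"
  shows "pair w x y \<fatsemi> \<X> m n = pair w y x"
proof -
  have "pair w x y \<fatsemi> \<X> m n = dups w \<fatsemi> ((x \<boxplus> y) \<fatsemi> \<X> m n)" by (simp add: pair_def seq_seq assms)
  also have "\<dots> = (dups w \<fatsemi> \<X> w w) \<fatsemi> (y \<boxplus> x)" by (simp add: braid_nat[of x y w w] assms seq_seq)
  finally show ?thesis by (simp add: comonoidD(9)[OF comonoid_wires] pair_def)
qed

lemma pair_dels:
  assumes [simp]: "arr x" "src x = w"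
  shows "pair w (dels w) x = x" "pair w x (dels w) = x"
proof -
  have "dels w \<boxplus> x = (dels w \<boxplus> \<I> w) \<fatsemi> x" "x \<boxplus> dels w = (\<I> w \<boxplus> dels w) \<fatsemi> x"
    using tens_seq[of "dels w" "\<I> 0" "\<I> w" x] tens_seq[of "\<I> w" x "dels w" "\<I> 0"] by simp_all
  then show "pair w (dels w) x = x" "pair w x (dels w) = x"
    unfolding pair_def
    by (simp_all add: comonoidD(8)[OF comonoid_wires] comonoid_counit_right[OF comonoid_wires] flip: seq_seq)
qed

primrec tuple :: "nat \<Rightarrow> 'a list \<Rightarrow> 'a" where
  "tuple w [] = dels w"
| "tuple w (x # xs) = pair w x (tuple w xs)"

text \<open>The comonoid homomorphisms from \<open>w\<close> wires to one. Being copied by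
  \<open>dup\<close> and discarded by \<open>del\<close> is what makes tuples of them behave like
  elements of a cartesian product.\<close>

definition functionals :: "nat \<Rightarrow> 'a set" where
  "functionals w = {x. arr x \<and> src x = w \<and> tgt x = 1 \<and> x \<fatsemi> dup = pair w x x \<and> x \<fatsemi> del = dels w}"

lemma functionalD:
  assumes "x \<in> functionals w"
  shows "arr x" "src x = w" "tgt x = Suc 0" "x \<fatsemi> dup = pair w x x" "x \<fatsemi> del = dels w"
  using assms by (simp_all add: functionals_def)

lemma tuple_type:
  "set xs \<subseteq> functionals w \<Longrightarrow> arr (tuple w xs) \<and> src (tuple w xs) = w \<and> tgt (tuple w xs) = length xs"
  by (induction xs) (auto simp: functionalD[of _ w])

lemma tuple_append:
  assumes "set xs \<subseteq> functionals w" "set ys \<subseteq> functionals w"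
  shows "tuple w (xs @ ys) = pair w (tuple w xs) (tuple w ys)"
  using assms
  by (induction xs) (simp_all add: pair_dels pair_assoc functionalD[of _ w] tuple_type)

text \<open>The convolution structure: to add two arrows, copy the input, apply both and merge the
  results.\<close>

definition arrow_ops :: "nat \<Rightarrow> ('k, 'a) module_ops" where
  "arrow_ops w = \<lparr> madd = (\<lambda>x y. pair w x y \<fatsemi> merge), mzero = dels w \<fatsemi> nil, mscale = (\<lambda>a x. x \<fatsemi> scale a),
     mshift = (\<lambda>x. x \<fatsemi> shift), munshift = (\<lambda>x. x \<fatsemi> unshift) \<rparr>"

lemma functional_linear:
  assumes x: "x \<in> functionals w" and r: "linear r" shows "x \<fatsemi> r \<in> functionals w"
proof -
  note [simp] = functionalD[OF x] linearD[OF r]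
  have "(x \<fatsemi> r) \<fatsemi> dup = (x \<fatsemi> dup) \<fatsemi> (r \<boxplus> r)" by (simp add: seq_seq del: functionalD(4)[OF x])
  also have "\<dots> = pair w (x \<fatsemi> r) (x \<fatsemi> r)" by (simp add: pair_seq)
  finally show ?thesis by (simp add: functionals_def seq_seq)
qed

lemma functional_add:
  assumes x: "x \<in> functionals w" and y: "y \<in> functionals w"
  shows "pair w x y \<fatsemi> merge \<in> functionals w"
proof -
  note [simp] = functionalD[OF x] functionalD[OF y]
  let ?M = "\<I> 1 \<boxplus> (\<X> 1 1 \<boxplus> \<I> 1)"
  have "(pair w x y \<fatsemi> merge) \<fatsemi> dup = ((pair w x y \<fatsemi> (dup \<boxplus> dup)) \<fatsemi> ?M) \<fatsemi> (merge \<boxplus> merge)"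
    by (simp add: seq_seq bialgebra_eqs)
  also have "pair w x y \<fatsemi> (dup \<boxplus> dup) = pair w x (pair w (pair w x y) y)"
    by (simp add: pair_seq pair_assoc)
  \<comment> \<open>The components are x, x, y, y at this point, and \<open>?M\<close> exchanges the
    middle two.\<close>
  also have "\<dots> \<fatsemi> ?M = pair w (pair w x y) (pair w x y)"
  proof -
    have "pair w (pair w x y) y \<fatsemi> (\<X> 1 1 \<boxplus> \<I> 1) = pair w (pair w y x) y"
      using pair_swap[of x y w 1 1] by (subst pair_seq) simp_all
    then have "pair w x (pair w (pair w x y) y) \<fatsemi> ?M = pair w x (pair w (pair w y x) y)"
      by (subst pair_seq) simp_all
    then show ?thesis by (simp add: pair_assoc)
  qed
  also have "\<dots> \<fatsemi> (merge \<boxplus> merge) = pair w (pair w x y \<fatsemi> merge) (pair w x y \<fatsemi> merge)"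
    by (simp add: pair_seq)
  finally have 1: "(pair w x y \<fatsemi> merge) \<fatsemi> dup = pair w (pair w x y \<fatsemi> merge) (pair w x y \<fatsemi> merge)" .
  have "(pair w x y \<fatsemi> merge) \<fatsemi> del = dels w"
    by (simp add: seq_seq bialgebra_eqs pair_seq pair_dels)
  with 1 show ?thesis by (simp add: functionals_def)
qed

lemma functional_zero: "dels w \<fatsemi> nil \<in> functionals w"
proof -
  have "(dels w \<fatsemi> nil) \<fatsemi> dup = pair w (dels w) (dels w) \<fatsemi> (nil \<boxplus> nil)"
    by (simp add: seq_seq bialgebra_eqs pair_dels)
  also have "\<dots> = pair w (dels w \<fatsemi> nil) (dels w \<fatsemi> nil)" by (simp add: pair_seq)
  finally show ?thesis by (simp add: functionals_def seq_seq bialgebra_eqs)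
qed

text \<open>A tuple is pushed through the term one generator at a time. Duplication, deletion and
  exchange are absorbed because the components are comonoid homomorphisms, the other generators
  because functionals are closed under the module operations.\<close>

lemma tuple_act:
  assumes "fn_term t" "has_type ih_arity t m n" "length xs = m" "set xs \<subseteq> functionals w"
  shows "set (act (arrow_ops w) t xs) \<subseteq> functionals w \<and> tuple w xs \<fatsemi> \<lbrakk>t\<rbrakk> = tuple w (act (arrow_ops w) t xs)"
  using assms
proof (induction t arbitrary: m n xs)
  case (Gen g)
  from Gen(2,3) have "ih_arity g = (length xs, n)" by simp
  from fn_gen_cases[OF Gen(1) this] show ?case
    using Gen(4)
    by cases (simp_all add: functionalD[of _ w] pair_dels arrow_ops_def functional_add functional_zero
        functional_linear linear_shift linear_scale linear_unshift)
next
  case Tw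
  then obtain x y where xs: "xs = [x, y]" by (auto simp: numeral_2_eq_2 length_Suc_conv)
  with Tw show ?case using pair_swap[of x y w 1 1] by (simp add: functionalD[of _ w] pair_dels)
next
  case (Seq t u)
  then obtain k where ty: "has_type ih_arity t m k" "has_type ih_arity u k n" by auto
  let ?ys = "act (arrow_ops w) t xs"
  have ys: "set ?ys \<subseteq> functionals w" "tuple w xs \<fatsemi> \<lbrakk>t\<rbrakk> = tuple w ?ys" "length ?ys = k"
    using Seq.IH(1)[OF _ ty(1) Seq.prems(3,4)] Seq.prems(1) length_act[OF _ ty(1) Seq.prems(3)] by simp_all
  have "tuple w xs \<fatsemi> \<lbrakk>t ;; u\<rbrakk> = (tuple w xs \<fatsemi> \<lbrakk>t\<rbrakk>) \<fatsemi> \<lbrakk>u\<rbrakk>"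
    using Seq.prems tuple_type[of xs w] eval_type[OF ty(1)] eval_type[OF ty(2)] by (simp add: seq_seq)
  then show ?case
    using Seq.IH(2)[OF _ ty(2) ys(3,1)] ys(2) Seq.prems by simp
next
  case (Tens t u)
  from Tens.prems(2,3) show ?case
  proof (rule has_type_tensE)
    fix a b c d ys zs
    assume 1: "has_type ih_arity t a b" "has_type ih_arity u c d" "m = a + c" "n = b + d"
      "xs = ys @ zs" "length ys = a" "length zs = c"
    have sub: "set ys \<subseteq> functionals w" "set zs \<subseteq> functionals w" using Tens.prems 1 by auto
    have t: "set (act (arrow_ops w) t ys) \<subseteq> functionals w" "tuple w ys \<fatsemi> \<lbrakk>t\<rbrakk> = tuple w (act (arrow_ops w) t ys)"
      using Tens.IH(1)[OF _ 1(1,6) sub(1)] Tens.prems by auto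
    have u: "set (act (arrow_ops w) u zs) \<subseteq> functionals w" "tuple w zs \<fatsemi> \<lbrakk>u\<rbrakk> = tuple w (act (arrow_ops w) u zs)"
      using Tens.IH(2)[OF _ 1(2,7) sub(2)] Tens.prems by auto
    have "tuple w xs \<fatsemi> \<lbrakk>t \<oplus>\<^sub>t u\<rbrakk> = pair w (tuple w ys \<fatsemi> \<lbrakk>t\<rbrakk>) (tuple w zs \<fatsemi> \<lbrakk>u\<rbrakk>)"
      using tuple_type[OF sub(1)] tuple_type[OF sub(2)] eval_type[OF 1(1)] eval_type[OF 1(2)]
      by (simp add: 1(5-7) tuple_append[OF sub] pair_seq)
    moreover have "act (arrow_ops w) (t \<oplus>\<^sub>t u) xs = act (arrow_ops w) t ys @ act (arrow_ops w) u zs"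
      using act_tens[of t ys b] 1 by simp
    ultimately show ?thesis
      using t u by (simp add: tuple_append)
  qed
qed (auto simp: tuple_type functionalD[of _ w] pair_dels length_Suc_conv)

end

subsection \<open>Function terms are determined by their action\<close>

lemma lookup_single_mult:
  "Poly_Mapping.lookup (Poly_Mapping.single k a * p) e = a * Poly_Mapping.lookup p (e - k)"
  for p :: "'k::field laurent"
proof -
  have "Poly_Mapping.lookup (Poly_Mapping.single k a * p) e =
      (\<Sum>l. (a when k = l) * (\<Sum>q. Poly_Mapping.lookup p q when e = l + q))"
    by (simp add: lookup_mult lookup_single)
  also have "\<dots> = (\<Sum>l. (a * (\<Sum>q. Poly_Mapping.lookup p q when e = l + q)) when k = l)"
    by (intro Sum_any.cong) (simp add: when_def)
  also have "\<dots> = a * (\<Sum>q. Poly_Mapping.lookup p q when q = e - k)"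
    by (simp add: eq_diff_eq add.commute eq_commute[of e])
  also have "\<dots> = a * Poly_Mapping.lookup p (e - k)" by simp
  finally show ?thesis .
qed

definition laurent_ops :: "('k::field, 'k laurent) module_ops" where
  "laurent_ops = \<lparr> madd = (+), mzero = 0, mscale = (\<lambda>a x. cst a * x),
     mshift = (\<lambda>x. spow 1 * x), munshift = (\<lambda>x. spow (- 1) * x) \<rparr>"

text \<open>Coefficient vectors of linear forms. Functions on all of \<open>nat\<close> carry no
  length condition; \<open>functional_of w\<close> reads the indices below \<open>w\<close>.\<close>

definition vec_ops :: "('k::field, nat \<Rightarrow> 'k laurent) module_ops" where
  "vec_ops = \<lparr> madd = (\<lambda>c d i. c i + d i), mzero = (\<lambda>i. 0), mscale = (\<lambda>a c i. cst a * c i),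
     mshift = (\<lambda>c i. spow 1 * c i), munshift = (\<lambda>c i. spow (- 1) * c i) \<rparr>"

context is_prop
begin

lemma tens_dup_nat:
  assumes "src d = a" "tgt d = a + a" "src D = b" "tgt D = b + b" "tgt f = p" "tgt x = q" "tgt g = r" "tgt y = t"
    and "src f = a" "src g = a" "src x = b" "src y = b"
    and [simp]: "arr d" "arr D" "arr f" "arr g" "arr x" "arr y"
  shows "tens_dup a d b D \<fatsemi> ((f \<boxplus> x) \<boxplus> (g \<boxplus> y)) =
    ((d \<fatsemi> (f \<boxplus> g)) \<boxplus> (D \<fatsemi> (x \<boxplus> y))) \<fatsemi> (\<I> p \<boxplus> (\<X> r q \<boxplus> \<I> t))"
proof -
  note [simp] = assms(1-12)
  let ?M = "\<I> a \<boxplus> (\<X> a b \<boxplus> \<I> b)" and ?N = "\<I> p \<boxplus> (\<X> r q \<boxplus> \<I> t)"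
  have "?M \<fatsemi> ((f \<boxplus> x) \<boxplus> (g \<boxplus> y)) = ?M \<fatsemi> (f \<boxplus> ((x \<boxplus> g) \<boxplus> y))" by (simp add: tens_tens)
  also have "\<dots> = f \<boxplus> ((\<X> a b \<fatsemi> (x \<boxplus> g)) \<boxplus> y)" by (simp add: tens_seq)
  also have "\<X> a b \<fatsemi> (x \<boxplus> g) = (g \<boxplus> x) \<fatsemi> \<X> r q" using braid_nat[of g x a b r q] by simp
  also have "f \<boxplus> (((g \<boxplus> x) \<fatsemi> \<X> r q) \<boxplus> y) = (f \<boxplus> ((g \<boxplus> x) \<boxplus> y)) \<fatsemi> ?N" by (simp add: tens_seq)
  also have "f \<boxplus> ((g \<boxplus> x) \<boxplus> y) = (f \<boxplus> g) \<boxplus> (x \<boxplus> y)" by (simp add: tens_tens)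
  finally have M: "?M \<fatsemi> ((f \<boxplus> x) \<boxplus> (g \<boxplus> y)) = ((f \<boxplus> g) \<boxplus> (x \<boxplus> y)) \<fatsemi> ?N" .
  have "tens_dup a d b D \<fatsemi> ((f \<boxplus> x) \<boxplus> (g \<boxplus> y)) = (d \<boxplus> D) \<fatsemi> (?M \<fatsemi> ((f \<boxplus> x) \<boxplus> (g \<boxplus> y)))"
    by (simp add: tens_dup_def seq_seq)
  also have "\<dots> = ((d \<boxplus> D) \<fatsemi> ((f \<boxplus> g) \<boxplus> (x \<boxplus> y))) \<fatsemi> ?N" unfolding M by (simp add: seq_seq)
  finally show ?thesis by (simp add: tens_seq)
qed

end

context ih_model
begin

text \<open>The last assumption says that \<open>g\<close> or \<open>x\<close> has no output, which
  makes the crossing between their outputs trivial. The first wire then separates from the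
  others.\<close>

lemma pair_Suc_0:
  assumes "arr f" "arr x" "arr g" "arr y" "src f = 1" "src g = 1" "src x = n" "src y = n" "tgt g = 0 \<or> tgt x = 0"
  shows "pair (Suc n) (f \<boxplus> x) (g \<boxplus> y) = (dup \<fatsemi> (f \<boxplus> g)) \<boxplus> pair n x y"
proof -
  have "\<I> (tgt f) \<boxplus> (\<X> (tgt g) (tgt x) \<boxplus> \<I> (tgt y)) = \<I> (tgt f + tgt g + (tgt x + tgt y))"
    using assms(9) by (auto simp: tens_ide add_ac)
  then show ?thesis
    using assms by (simp add: pair_def tens_dup_nat)
qed

lemma functional_head: "\<I> 1 \<boxplus> dels n \<in> functionals (Suc n)"
proof -
  have "pair n (dels n) (dels n) = dels n" by (rule pair_dels) simp_all
  then have "pair (Suc n) (\<I> 1 \<boxplus> dels n) (\<I> 1 \<boxplus> dels n) = dup \<boxplus> dels n"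
    by (simp add: pair_Suc_0 tens_ide)
  moreover have "(\<I> 1 \<boxplus> dels n) \<fatsemi> dup = dup \<boxplus> dels n"
    using tens_seq[of "\<I> 1" dup "dels n" "\<I> 0"] by simp
  moreover have "(\<I> 1 \<boxplus> dels n) \<fatsemi> del = del \<boxplus> dels n"
    using tens_seq[of "\<I> 1" del "dels n" "\<I> 0"] by simp
  ultimately show ?thesis by (simp add: functionals_def)
qed

lemma dup_del_del: "dup \<fatsemi> (del \<boxplus> del) = del"
  using tens_seq[of del "\<I> 0" "\<I> 1" del] comonoidD(8)[OF comonoid_1]
    seq_seq[of dup "del \<boxplus> \<I> 1" del] by simp

lemma functional_tail:
  assumes x: "x \<in> functionals n" shows "del \<boxplus> x \<in> functionals (Suc n)"
proof -
  note [simp] = functionalD[OF x]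
  have "pair (Suc n) (del \<boxplus> x) (del \<boxplus> x) = del \<boxplus> (x \<fatsemi> dup)"
    by (simp add: pair_Suc_0 dup_del_del)
  moreover have "(del \<boxplus> x) \<fatsemi> dup = del \<boxplus> (x \<fatsemi> dup)"
    using tens_seq[of del "\<I> 0" x dup] by simp
  moreover have "(del \<boxplus> x) \<fatsemi> del = del \<boxplus> (x \<fatsemi> del)"
    using tens_seq[of del "\<I> 0" x del] by simp
  ultimately show ?thesis by (simp add: functionals_def)
qed

section \<open>The identity as a tuple of projections\<close>

primrec projs :: "nat \<Rightarrow> 'a list" where
  "projs 0 = []"
| "projs (Suc n) = (\<I> 1 \<boxplus> dels n) # map (\<lambda>x. del \<boxplus> x) (projs n)"

lemma length_projs[simp]: "length (projs n) = n"
  by (induction n) simp_all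

lemma functional_projs: "set (projs n) \<subseteq> functionals n"
proof (induction n)
  case (Suc n) then show ?case using functional_head[of n] functional_tail[of _ n] by auto
qed simp

lemma tuple_tail:
  "set xs \<subseteq> functionals n \<Longrightarrow> tuple (Suc n) (map (\<lambda>x. del \<boxplus> x) xs) = del \<boxplus> tuple n xs"
  by (induction xs) (simp_all add: pair_Suc_0 functionalD[of _ n] tuple_type dup_del_del)

text \<open>Hence evaluating a function term amounts to acting on the projections.\<close>

lemma tuple_projs: "tuple n (projs n) = \<I> n"
proof (induction n)
  case (Suc n)
  have "tuple (Suc n) (projs (Suc n)) = pair (Suc n) (\<I> 1 \<boxplus> dels n) (del \<boxplus> \<I> n)"
    by (simp add: tuple_tail[OF functional_projs] Suc)
  also have "\<dots> = (dup \<fatsemi> (\<I> 1 \<boxplus> del)) \<boxplus> pair n (dels n) (\<I> n)"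
    by (rule pair_Suc_0) simp_all
  also have "\<dots> = \<I> (Suc n)"
    using comonoid_counit_right[OF comonoid_1] by (simp add: pair_dels tens_ide)
  finally show ?case .
qed simp

section \<open>Linear forms as finite sums of monomials\<close>

definition functional_monoid :: "nat \<Rightarrow> 'a monoid" where
  "functional_monoid w = \<lparr> carrier = functionals w, monoid.mult = (\<lambda>x y. pair w x y \<fatsemi> merge), one = dels w \<fatsemi> nil \<rparr>"

lemma functional_monoid_simps[simp]:
  "carrier (functional_monoid w) = functionals w"
  "x \<otimes>\<^bsub>functional_monoid w\<^esub> y = pair w x y \<fatsemi> merge"
  "\<one>\<^bsub>functional_monoid w\<^esub> = dels w \<fatsemi> nil"
  by (simp_all add: functional_monoid_def)

text \<open>Makes the library's finite products available, written multiplicatively but meaning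
  convolution sums here.\<close>

lemma comm_monoid_functionals: "comm_monoid (functional_monoid w)"
proof (rule comm_monoidI, unfold functional_monoid_simps)
  fix x y z assume x: "x \<in> functionals w" and y: "y \<in> functionals w" and z: "z \<in> functionals w"
  note [simp] = functionalD[OF x] functionalD[OF y] functionalD[OF z]
  have "pair w (pair w x y \<fatsemi> merge) z = pair w (pair w x y) z \<fatsemi> (merge \<boxplus> \<I> 1)" by (simp add: pair_seq)
  then have "pair w (pair w x y \<fatsemi> merge) z \<fatsemi> merge = pair w (pair w x y) z \<fatsemi> ((merge \<boxplus> \<I> 1) \<fatsemi> merge)"
    by (simp add: seq_seq)
  also have "\<dots> = (pair w x (pair w y z) \<fatsemi> (\<I> 1 \<boxplus> merge)) \<fatsemi> merge"
    by (simp add: add_eqs[simplified] pair_assoc seq_seq)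
  also have "pair w x (pair w y z) \<fatsemi> (\<I> 1 \<boxplus> merge) = pair w x (pair w y z \<fatsemi> merge)" by (simp add: pair_seq)
  finally show "pair w (pair w x y \<fatsemi> merge) z \<fatsemi> merge = pair w x (pair w y z \<fatsemi> merge) \<fatsemi> merge" .
  have "pair w x y \<fatsemi> merge = (pair w x y \<fatsemi> \<X> 1 1) \<fatsemi> merge" by (simp add: seq_seq add_eqs[simplified])
  then show "pair w x y \<fatsemi> merge = pair w y x \<fatsemi> merge" using pair_swap[of x y w 1 1] by simp
  show "pair w x y \<fatsemi> merge \<in> functionals w" by (rule functional_add[OF x y])
next
  fix x assume x: "x \<in> functionals w"
  note [simp] = functionalD[OF x]
  have "pair w (dels w \<fatsemi> nil) x = pair w (dels w) x \<fatsemi> (nil \<boxplus> \<I> 1)" by (simp add: pair_seq)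
  then show "pair w (dels w \<fatsemi> nil) x \<fatsemi> merge = x" by (simp add: pair_dels seq_seq add_eqs[simplified])
qed (rule functional_zero)

abbreviation fsum :: "nat \<Rightarrow> ('i \<Rightarrow> 'a) \<Rightarrow> 'i set \<Rightarrow> 'a" where
  "fsum w \<equiv> finprod (functional_monoid w)"

lemma add_linear:
  assumes x: "x \<in> functionals w" and y: "y \<in> functionals w" and r: "linear r"
  shows "(pair w x y \<fatsemi> merge) \<fatsemi> r = pair w (x \<fatsemi> r) (y \<fatsemi> r) \<fatsemi> merge"
proof -
  note [simp] = functionalD[OF x] functionalD[OF y] linearD[OF r]
  have "(pair w x y \<fatsemi> merge) \<fatsemi> r = (pair w x y \<fatsemi> (r \<boxplus> r)) \<fatsemi> merge" by (simp add: seq_seq)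
  then show ?thesis by (simp add: pair_seq)
qed

lemma fsum_linear:
  assumes r: "linear r" and f: "f \<in> A \<rightarrow> functionals w"
  shows "fsum w f A \<fatsemi> r = fsum w (\<lambda>i. f i \<fatsemi> r) A"
proof -
  interpret comm_monoid "functional_monoid w" by (rule comm_monoid_functionals)
  have zero: "(dels w \<fatsemi> nil) \<fatsemi> r = dels w \<fatsemi> nil"
    using linearD[OF r] by (simp add: seq_seq)
  show ?thesis
  proof (cases "finite A")
    case True
    then show ?thesis using f
    proof (induction A rule: finite_induct)
      case (insert a A)
      have "fsum w f A \<in> functionals w" using finprod_closed[of f A] insert by auto
      then show ?case
        using insert by (simp add: Pi_iff functional_linear[OF _ r] add_linear[OF _ _ r])
    qed (simp add: zero)
  qed (simp add: zero finprod_infinite)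
qed

primrec iter :: "'a \<Rightarrow> nat \<Rightarrow> 'a" where
  "iter r 0 = \<I> 1"
| "iter r (Suc n) = iter r n \<fatsemi> r"

definition shifts :: "int \<Rightarrow> 'a" where
  "shifts e = (if 0 \<le> e then iter shift (nat e) else iter unshift (nat (- e)))"

lemma linear_I: "linear (\<I> 1)"
  by (simp add: linear_def tens_ide)

lemma linear_seq:
  assumes "linear r" "linear t" shows "linear (r \<fatsemi> t)"
proof -
  note [simp] = linearD[OF assms(1)] linearD[OF assms(2)]
  have "merge \<fatsemi> (r \<fatsemi> t) = ((r \<boxplus> r) \<fatsemi> merge) \<fatsemi> t" by (simp flip: seq_seq)
  also have "\<dots> = ((r \<boxplus> r) \<fatsemi> (t \<boxplus> t)) \<fatsemi> merge" by (simp add: seq_seq)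
  finally have 1: "merge \<fatsemi> (r \<fatsemi> t) = ((r \<fatsemi> t) \<boxplus> (r \<fatsemi> t)) \<fatsemi> merge" by (simp add: tens_seq)
  have "(r \<fatsemi> t) \<fatsemi> dup = r \<fatsemi> (dup \<fatsemi> (t \<boxplus> t))" by (simp add: seq_seq)
  also have "\<dots> = (r \<fatsemi> dup) \<fatsemi> (t \<boxplus> t)" by (rule seq_seq[symmetric]) simp_all
  also have "\<dots> = dup \<fatsemi> ((r \<fatsemi> t) \<boxplus> (r \<fatsemi> t))" by (simp add: seq_seq tens_seq)
  finally have 2: "(r \<fatsemi> t) \<fatsemi> dup = dup \<fatsemi> ((r \<fatsemi> t) \<boxplus> (r \<fatsemi> t))" .
  have "nil \<fatsemi> (r \<fatsemi> t) = nil" by (simp flip: seq_seq)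
  moreover have "(r \<fatsemi> t) \<fatsemi> del = del" by (simp add: seq_seq)
  ultimately show ?thesis using 1 2 by (simp add: linear_def)
qed

lemma linear_iter: "linear r \<Longrightarrow> linear (iter r n)"
  by (induction n) (auto simp: linear_seq linear_I[simplified])

lemma linear_shifts: "linear (shifts e)"
  by (simp add: shifts_def linear_iter linear_shift linear_unshift)

text \<open>Away from the change of sign this is the recursion of \<open>iter\<close>; across it a
  shift cancels against an unshift.\<close>

lemma shifts_shift: "shifts e \<fatsemi> shift = shifts (e + 1)" and shifts_unshift: "shifts e \<fatsemi> unshift = shifts (e - 1)"
proof -
  have c: "(x \<fatsemi> shift) \<fatsemi> unshift = x" "(x \<fatsemi> unshift) \<fatsemi> shift = x" if "linear x" for x
    using linearD(1-3)[OF that] by (simp_all add: seq_seq shift_unshift[simplified])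
  note l = linear_iter[OF linear_shift] linear_iter[OF linear_unshift]
  show "shifts e \<fatsemi> shift = shifts (e + 1)"
  proof (cases "0 \<le> e")
    case False
    then obtain k where k: "nat (- e) = Suc k" by (cases "nat (- e)") auto
    then have "nat (- (e + 1)) = k" by simp
    then show ?thesis using False k c(2)[OF l(2)] by (cases "k = 0") (auto simp: shifts_def shift_unshift[simplified])
  qed (auto simp: shifts_def nat_add_distrib)
  show "shifts e \<fatsemi> unshift = shifts (e - 1)"
  proof (cases "0 < e")
    case True
    then obtain k where k: "nat e = Suc k" by (cases "nat e") auto
    then have "nat (e - 1) = k" by simp
    then show ?thesis using True k c(1)[OF l(1)] by (auto simp: shifts_def)
  next
    case False
    then have "nat (- (e - 1)) = Suc (nat (- e))" by simp
    then show ?thesis using False by (cases "e = 0") (auto simp: shifts_def)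
  qed
qed

lemma mono_scale:
  "scale a \<fatsemi> shift = shift \<fatsemi> scale a" "scale a \<fatsemi> unshift = unshift \<fatsemi> scale a"
proof -
  show 1: "scale a \<fatsemi> shift = shift \<fatsemi> scale a" by (simp add: scale_eqs)
  have "scale a \<fatsemi> unshift = unshift \<fatsemi> ((shift \<fatsemi> scale a) \<fatsemi> unshift)"
    by (simp add: shift_unshift[simplified] flip: seq_seq)
  also have "\<dots> = (unshift \<fatsemi> scale a) \<fatsemi> (shift \<fatsemi> unshift)"
    by (simp add: seq_seq flip: 1)
  finally show "scale a \<fatsemi> unshift = unshift \<fatsemi> scale a" by (simp add: shift_unshift[simplified])
qed

definition monom_at :: "nat \<Rightarrow> (nat \<Rightarrow> 'k laurent) \<Rightarrow> nat \<times> int \<Rightarrow> 'a" where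
  "monom_at w c = (\<lambda>(i, e). projs w ! i \<fatsemi> (shifts e \<fatsemi> scale (Poly_Mapping.lookup (c i) e)))"

text \<open>The linear form with coefficients \<open>c\<close>, expanded into monomials: each
  summand is a composite of generators, and sums can be compared by changing the index set.\<close>

definition functional_of :: "nat \<Rightarrow> (nat \<Rightarrow> 'k laurent) \<Rightarrow> 'a" where
  "functional_of w c = fsum w (monom_at w c) (SIGMA i:{..<w}. Poly_Mapping.keys (c i))"

lemma monom_at_functional: "i < w \<Longrightarrow> monom_at w c (i, e) \<in> functionals w"
  using functional_projs[of w] linear_seq[OF linear_shifts linear_scale]
  by (auto simp: monom_at_def subset_iff intro!: functional_linear)

lemma linear_zero:
  assumes "x \<in> functionals w" "linear r"
  shows "x \<fatsemi> (r \<fatsemi> scale 0) = dels w \<fatsemi> nil"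
proof -
  note [simp] = functionalD[OF assms(1)] linearD[OF assms(2)]
  have "r \<fatsemi> (del \<fatsemi> nil) = (r \<fatsemi> del) \<fatsemi> nil" by (rule seq_seq[symmetric]) simp_all
  moreover have "x \<fatsemi> (del \<fatsemi> nil) = (x \<fatsemi> del) \<fatsemi> nil" by (rule seq_seq[symmetric]) simp_all
  ultimately show ?thesis by (simp add: scale_eqs)
qed

text \<open>A zero coefficient contributes the neutral element, so the index set may exceed the
  support. This absorbs cancellation, when two forms are added or multiplied by zero.\<close>

lemma functional_of_superset:
  assumes "finite I" "I \<subseteq> {..<w} \<times> UNIV" "\<And>i. i < w \<Longrightarrow> {i} \<times> Poly_Mapping.keys (c i) \<subseteq> I"
  shows "functional_of w c = fsum w (monom_at w c) I"
proof -
  interpret comm_monoid "functional_monoid w" by (rule comm_monoid_functionals)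
  show ?thesis
    unfolding functional_of_def
  proof (rule finprod_mono_neutral_cong_left)
    show "monom_at w c x = \<one>\<^bsub>functional_monoid w\<^esub>" if x: "x \<in> I - (SIGMA i:{..<w}. Poly_Mapping.keys (c i))" for x
    proof -
      obtain i e where ie: "x = (i, e)" by (cases x)
      then have "i < w" "e \<notin> Poly_Mapping.keys (c i)" using x assms(2) by auto
      with ie show ?thesis
        using linear_zero[OF _ linear_shifts, of "projs w ! i" w] functional_projs[of w]
        by (auto simp: monom_at_def in_keys_iff subset_iff)
    qed
    show "monom_at w c \<in> I \<rightarrow> carrier (functional_monoid w)"
      using assms(2) by (auto simp: monom_at_functional)
  qed (use assms in auto)
qed

lemma functional_of_add:
  "functional_of w (madd vec_ops c d) = madd (arrow_ops w) (functional_of w c) (functional_of w d)"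
proof -
  interpret comm_monoid "functional_monoid w" by (rule comm_monoid_functionals)
  let ?I = "SIGMA i:{..<w}. Poly_Mapping.keys (c i) \<union> Poly_Mapping.keys (d i)"
  have mono: "monom_at w (madd vec_ops c d) x = monom_at w c x \<otimes>\<^bsub>functional_monoid w\<^esub> monom_at w d x"
    if x: "x \<in> ?I" for x
  proof -
    obtain i e where [simp]: "x = (i, e)" and i: "i < w" using x by auto
    have "projs w ! i \<in> functionals w" using functional_projs[of w] i by auto
    then have y: "projs w ! i \<fatsemi> shifts e \<in> functionals w" (is "?y \<in> _")
      by (rule functional_linear[OF _ linear_shifts])
    note [simp] = functionalD(1-3)[OF y] functionalD(1-3)[OF \<open>projs w ! i \<in> functionals w\<close>]
      linearD(1-3)[OF linear_shifts]
    let ?a = "Poly_Mapping.lookup (c i) e" and ?b = "Poly_Mapping.lookup (d i) e"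
    \<comment> \<open>The generator of a sum is a copy, two scalings and a merge; \<open>?y\<close>
      passes through the copy because it is a functional.\<close>
    have "?y \<fatsemi> scale (?a + ?b) = ((?y \<fatsemi> dup) \<fatsemi> (scale ?a \<boxplus> scale ?b)) \<fatsemi> merge"
      by (simp only: scale_eqs(2)[symmetric]) (simp add: seq_seq)
    also have "\<dots> = pair w (?y \<fatsemi> scale ?a) (?y \<fatsemi> scale ?b) \<fatsemi> merge"
      by (simp add: functionalD(4)[OF y] pair_seq)
    finally show ?thesis by (simp add: monom_at_def vec_ops_def lookup_add seq_seq)
  qed
  have fin: "finite ?I" by (intro finite_SigmaI) auto
  have "functional_of w (madd vec_ops c d) = fsum w (monom_at w (madd vec_ops c d)) ?I"
    by (rule functional_of_superset[OF fin]) (auto simp: vec_ops_def in_keys_iff lookup_add)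
  also have "\<dots> = fsum w (\<lambda>x. monom_at w c x \<otimes>\<^bsub>functional_monoid w\<^esub> monom_at w d x) ?I"
  proof (rule finprod_cong')
    show "(\<lambda>x. monom_at w c x \<otimes>\<^bsub>functional_monoid w\<^esub> monom_at w d x) \<in> ?I \<rightarrow> carrier (functional_monoid w)"
      by (auto simp: monom_at_functional functional_add)
  qed (use mono in auto)
  also have "\<dots> = fsum w (monom_at w c) ?I \<otimes>\<^bsub>functional_monoid w\<^esub> fsum w (monom_at w d) ?I"
    by (rule finprod_multf) (auto simp: monom_at_functional)
  also have "fsum w (monom_at w c) ?I = functional_of w c"
    by (rule functional_of_superset[OF fin, symmetric]) auto
  also have "fsum w (monom_at w d) ?I = functional_of w d"
    by (rule functional_of_superset[OF fin, symmetric]) auto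
  finally show ?thesis by (simp add: arrow_ops_def)
qed

lemma functional_of_zero: "functional_of w (mzero vec_ops) = mzero (arrow_ops w)"
proof -
  interpret comm_monoid "functional_monoid w" by (rule comm_monoid_functionals)
  have "(SIGMA i:{..<w}. Poly_Mapping.keys (mzero vec_ops i :: 'k laurent)) = {}" by (auto simp: vec_ops_def)
  then show ?thesis by (simp add: functional_of_def arrow_ops_def)
qed

text \<open>Treats \<open>scale\<close>, \<open>shift\<close> and \<open>unshift\<close> together,
  with \<open>k\<close> equal to 0, 1 and -1. Multiplication by a monomial moves every exponent by
  \<open>k\<close>, so the sums match after re-indexing; if \<open>a\<close> is 0 the new support is
  smaller, and the superset lemma still applies.\<close>

lemma functional_of_monomial:
  assumes r: "linear r" and k: "\<And>e b. (shifts e \<fatsemi> scale b) \<fatsemi> r = shifts (e + k) \<fatsemi> scale (a * b)"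
  shows "functional_of w (\<lambda>i. Poly_Mapping.single k a * c i) = functional_of w c \<fatsemi> r"
proof -
  interpret comm_monoid "functional_monoid w" by (rule comm_monoid_functionals)
  let ?I = "SIGMA i:{..<w}. Poly_Mapping.keys (c i)" and ?h = "\<lambda>(i, e). (i, e + k)"
  let ?d = "\<lambda>i. Poly_Mapping.single k a * c i"
  have eq: "monom_at w ?d (i, e + k) = monom_at w c (i, e) \<fatsemi> r" if i: "i < w" for i e
  proof -
    have "projs w ! i \<in> functionals w" using functional_projs[of w] i by auto
    note [simp] = functionalD(1-3)[OF this] linearD(1-3)[OF linear_shifts] linearD(1-3)[OF r]
    have "(projs w ! i \<fatsemi> (shifts e \<fatsemi> scale b)) \<fatsemi> r = projs w ! i \<fatsemi> (shifts (e + k) \<fatsemi> scale (a * b))" for b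
      by (simp add: seq_seq flip: k)
    then show ?thesis by (simp add: monom_at_def lookup_single_mult)
  qed
  have inj: "inj_on ?h ?I" by (auto simp: inj_on_def)
  have "functional_of w ?d = fsum w (monom_at w ?d) (?h ` ?I)"
  proof (rule functional_of_superset)
    show "{i} \<times> Poly_Mapping.keys (?d i) \<subseteq> ?h ` ?I" if "i < w" for i
    proof clarify
      fix e assume "e \<in> Poly_Mapping.keys (?d i)"
      then have "(i, e - k) \<in> ?I" using that by (auto simp: in_keys_iff lookup_single_mult)
      from imageI[OF this, of ?h] show "(i, e) \<in> ?h ` ?I" by simp
    qed
  qed auto
  also have "\<dots> = fsum w (\<lambda>x. monom_at w ?d (?h x)) ?I"
    by (rule finprod_reindex[OF _ inj]) (auto simp: monom_at_functional)
  also have "\<dots> = fsum w (\<lambda>x. monom_at w c x \<fatsemi> r) ?I"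
    by (rule finprod_cong') (auto simp: eq monom_at_functional intro!: functional_linear r)
  also have "\<dots> = functional_of w c \<fatsemi> r"
    unfolding functional_of_def by (rule fsum_linear[OF r, symmetric]) (auto simp: monom_at_functional)
  finally show ?thesis .
qed

lemma functional_of_scale: "functional_of w (mscale vec_ops a c) = mscale (arrow_ops w) a (functional_of w c)"
proof -
  have "(shifts e \<fatsemi> scale b) \<fatsemi> scale a = shifts (e + 0) \<fatsemi> scale (a * b)" for e b
    using linearD(1-3)[OF linear_shifts] by (simp add: seq_seq scale_eqs)
  from functional_of_monomial[OF linear_scale this, of w c] show ?thesis
    by (simp add: vec_ops_def arrow_ops_def)
qed

lemma functional_of_shift: "functional_of w (mshift vec_ops c) = mshift (arrow_ops w) (functional_of w c)"
proof -
  have "(shifts e \<fatsemi> scale b) \<fatsemi> shift = shifts (e + 1) \<fatsemi> scale (1 * b)" for e b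
    using linearD(1-3)[OF linear_shifts] by (simp add: seq_seq mono_scale flip: shifts_shift)
  from functional_of_monomial[OF linear_shift this, of w c] show ?thesis
    by (simp add: vec_ops_def arrow_ops_def)
qed

lemma functional_of_unshift: "functional_of w (munshift vec_ops c) = munshift (arrow_ops w) (functional_of w c)"
proof -
  have "(shifts e \<fatsemi> scale b) \<fatsemi> unshift = shifts (e + - 1) \<fatsemi> scale (1 * b)" for e b
  proof -
    have "(shifts e \<fatsemi> scale b) \<fatsemi> unshift = (shifts e \<fatsemi> unshift) \<fatsemi> scale b"
      using linearD(1-3)[OF linear_shifts] by (simp add: seq_seq mono_scale)
    then show ?thesis by (simp add: shifts_unshift)
  qed
  from functional_of_monomial[OF linear_unshift this, of w c] show ?thesis
    by (simp add: vec_ops_def arrow_ops_def)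
qed

lemma functional_of_unit:
  assumes "i < w" shows "functional_of w (\<lambda>j. if j = i then 1 else 0) = projs w ! i"
proof -
  interpret comm_monoid "functional_monoid w" by (rule comm_monoid_functionals)
  have x: "projs w ! i \<in> functionals w" using functional_projs[of w] assms by auto
  have "(SIGMA j:{..<w}. Poly_Mapping.keys (if j = i then 1 else 0 :: 'k laurent)) = {(i, 0)}"
    using assms by (auto split: if_splits)
  then have "functional_of w (\<lambda>j. if j = i then 1 else 0) = fsum w (monom_at w (\<lambda>j. if j = i then 1 else 0)) {(i, 0)}"
    by (simp add: functional_of_def)
  also have "\<dots> = monom_at w (\<lambda>j. if j = i then 1 else 0) (i, 0)"
    using finprod_insert[of "{}" "(i, 0)" "monom_at w (\<lambda>j. if j = i then 1 else 0)"] r_one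
      monom_at_functional[OF assms] by (simp del: functional_monoid_simps(2,3))
  also have "\<dots> = projs w ! i"
    using functionalD(1-3)[OF x] by (simp add: monom_at_def shifts_def scale_eqs[simplified])
  finally show ?thesis .
qed

text \<open>The identity is put in front as a tuple of projections and pushed through the term. The
  projections are the forms of the unit vectors, so \<open>act_hom\<close> moves the calculation to
  coefficient vectors, where no arrows occur.\<close>

lemma eval_fn_term:
  assumes "fn_term t" "has_type ih_arity t m n"
  shows "\<lbrakk>t\<rbrakk> = tuple m (map (functional_of m) (act vec_ops t (map (\<lambda>i j. if j = i then 1 else 0) [0..<m])))"
proof -
  let ?us = "map (\<lambda>i j. if j = i then 1 else 0 :: 'k laurent) [0..<m]"
  have p: "projs m = map (functional_of m) ?us"
    by (rule nth_equalityI) (simp_all add: functional_of_unit)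
  have "\<lbrakk>t\<rbrakk> = tuple m (projs m) \<fatsemi> \<lbrakk>t\<rbrakk>"
    using eval_type[OF assms(2)] by (simp add: tuple_projs)
  also have "\<dots> = tuple m (act (arrow_ops m) t (projs m))"
    using tuple_act[OF assms _ functional_projs] by simp
  also have "act (arrow_ops m) t (projs m) = map (functional_of m) (act vec_ops t ?us)"
    unfolding p
    by (rule act_hom[symmetric, OF _ _ _ _ _ assms])
      (simp_all add: functional_of_add functional_of_zero functional_of_scale functional_of_shift functional_of_unshift)
  finally show ?thesis .
qed

text \<open>Completeness for function terms: all equations between them follow from equality of
  matrices. Later proofs verify such equations by calculating with lists of Laurent
  polynomials.\<close>

theorem eval_fn_eq:
  assumes t: "fn_term t" "has_type ih_arity t m n" and u: "fn_term u" "has_type ih_arity u m n"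
    and eq: "\<And>xs. length xs = m \<Longrightarrow> act laurent_ops t xs = act laurent_ops u xs"
  shows "\<lbrakk>t\<rbrakk> = \<lbrakk>u\<rbrakk>"
proof -
  let ?us = "map (\<lambda>i j. if j = i then 1 else 0 :: 'k laurent) [0..<m]"
  \<comment> \<open>Coordinate \<open>i\<close> of the calculation with coefficient vectors is the
    action on the \<open>i\<close>-th unit vector of Laurent polynomials.\<close>
  have coord: "map (\<lambda>c. c i) (act vec_ops v ?us) = act laurent_ops v (map (\<lambda>c. c i) ?us)"
    if "fn_term v" "has_type ih_arity v m n" for v i
    by (rule act_hom[OF _ _ _ _ _ that]) (simp_all add: vec_ops_def laurent_ops_def)
  have "act vec_ops t ?us = act vec_ops u ?us"
  proof (rule nth_equalityI)
    show len: "length (act vec_ops t ?us) = length (act vec_ops u ?us)"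
      using length_act[OF t, of ?us vec_ops] length_act[OF u, of ?us vec_ops] by simp
    fix j assume j: "j < length (act vec_ops t ?us)"
    show "act vec_ops t ?us ! j = act vec_ops u ?us ! j"
    proof
      fix i
      have "map (\<lambda>c. c i) (act vec_ops t ?us) ! j = map (\<lambda>c. c i) (act vec_ops u ?us) ! j"
        using coord[OF t] coord[OF u] eq by simp
      then show "(act vec_ops t ?us ! j) i = (act vec_ops u ?us ! j) i" using j len by simp
    qed
  qed
  then show ?thesis using eval_fn_term[OF t] eval_fn_term[OF u] by simp
qed

end

section \<open>Submodules of free modules over Laurent polynomials\<close>

lemma vadd_commute: "vadd x y = vadd y x"
proof (induction x arbitrary: y)
  case (Cons a x) then show ?case by (cases y) (simp_all add: vadd_def add.commute)
qed (simp add: vadd_def)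

lemma vadd_assoc: "vadd (vadd x y) z = vadd x (vadd y z)"
proof (induction x arbitrary: y z)
  case (Cons a x)
  then show ?case by (cases y; cases z) (simp_all add: vadd_def add.assoc)
qed (simp add: vadd_def)

lemma vadd_left_commute: "vadd x (vadd y z) = vadd y (vadd x z)"
  by (metis vadd_assoc vadd_commute)

lemmas vadd_ac = vadd_assoc vadd_commute vadd_left_commute

lemma vscale_vadd: "vscale a (vadd x y) = vadd (vscale a x) (vscale a y)"
proof (induction x arbitrary: y)
  case (Cons b x) then show ?case by (cases y) (simp_all add: vadd_def vscale_def algebra_simps)
qed simp

lemma vscale_simps[simp]:
  "vscale a (vscale b x) = vscale (a * b) x" "vscale 1 x = x" "vscale 0 x = vzero (length x)"
  "vadd (vscale a x) (vscale b x) = vscale (a + b) x"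
  by (simp_all add: vscale_def vzero_def vadd_def list_eq_iff_nth_eq algebra_simps)

definition vectors :: "nat \<Rightarrow> 'r list list \<Rightarrow> bool" where
  "vectors n G \<longleftrightarrow> (\<forall>v\<in>set G. length v = n)"

lemma vectors_simps[simp]: "vectors n []" "vectors n (v # G) \<longleftrightarrow> length v = n \<and> vectors n G"
  "vectors n (G @ G') \<longleftrightarrow> vectors n G \<and> vectors n G'"
  "vectors (Suc n) (map ((#) a) G) \<longleftrightarrow> vectors n G"
  by (auto simp: vectors_def)

text \<open>The argument \<open>n\<close> gives the empty combination its length.\<close>

fun comb :: "nat \<Rightarrow> 'r::comm_ring_1 list \<Rightarrow> 'r list list \<Rightarrow> 'r list" where
  "comb n (u # us) (v # G) = vadd (vscale u v) (comb n us G)"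
| "comb n us G = vzero n"

definition vspan :: "nat \<Rightarrow> 'r::comm_ring_1 list list \<Rightarrow> 'r list set" where
  "vspan n G = {comb n us G |us. length us = length G}"

definition independent :: "nat \<Rightarrow> 'r::comm_ring_1 list list \<Rightarrow> bool" where
  "independent n G \<longleftrightarrow> (\<forall>us. length us = length G \<longrightarrow> comb n us G = vzero n \<longrightarrow> us = vzero (length G))"

definition submodule :: "nat \<Rightarrow> 'r::comm_ring_1 list set \<Rightarrow> bool" where
  "submodule n S \<longleftrightarrow> (\<forall>x\<in>S. length x = n) \<and> vzero n \<in> S \<and> (\<forall>x\<in>S. \<forall>y\<in>S. vadd x y \<in> S) \<and>
     (\<forall>a. \<forall>x\<in>S. vscale a x \<in> S)"

lemma submoduleD:
  assumes "submodule n S"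
  shows "x \<in> S \<Longrightarrow> length x = n" "vzero n \<in> S" "x \<in> S \<Longrightarrow> y \<in> S \<Longrightarrow> vadd x y \<in> S" "x \<in> S \<Longrightarrow> vscale a x \<in> S"
  using assms by (auto simp: submodule_def)

lemma length_comb[simp]: "vectors n G \<Longrightarrow> length (comb n us G) = n"
  by (induction n us G rule: comb.induct) simp_all

lemma comb_vzero[simp]: "vectors n G \<Longrightarrow> comb n (vzero k) G = vzero n"
proof (induction G arbitrary: k)
  case (Cons v G) then show ?case by (cases k) simp_all
qed simp

lemma comb_vadd:
  "vectors n G \<Longrightarrow> length us = length G \<Longrightarrow> length us' = length G \<Longrightarrow>
    comb n (vadd us us') G = vadd (comb n us G) (comb n us' G)"
proof (induction G arbitrary: us us')
  case (Cons v G)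
  then obtain u vs u' vs' where "us = u # vs" "us' = u' # vs'" by (metis length_Suc_conv list.size(4))
  with Cons show ?case by (simp add: vadd_ac flip: vscale_simps(4))
qed simp

lemma comb_vscale:
  "vectors n G \<Longrightarrow> length us = length G \<Longrightarrow> comb n (vscale a us) G = vscale a (comb n us G)"
proof (induction G arbitrary: us)
  case (Cons v G)
  then obtain u vs where "us = u # vs" by (metis length_Suc_conv list.size(4))
  with Cons show ?case by (simp add: vscale_vadd)
qed simp

lemma comb_append:
  "length us = length G \<Longrightarrow> vectors n G' \<Longrightarrow> comb n (us @ us') (G @ G') = vadd (comb n us G) (comb n us' G')"
proof (induction G arbitrary: us)
  case (Cons v G)
  then obtain u vs where "us = u # vs" by (metis length_Suc_conv list.size(4))
  with Cons show ?case by (simp add: vadd_assoc)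
qed simp

lemma comb_Cons0: "comb (Suc n) us (map ((#) 0) G) = 0 # comb n us G"
proof (induction G arbitrary: us)
  case (Cons v G) then show ?case by (cases us) simp_all
qed simp

lemma submodule_vspan: assumes "vectors n G" shows "submodule n (vspan n G)"
  unfolding submodule_def
proof (intro conjI ballI allI)
  show "vzero n \<in> vspan n G"
    unfolding vspan_def by (rule CollectI, rule exI[of _ "vzero (length G)"]) (simp add: assms)
next
  fix x y assume "x \<in> vspan n G" "y \<in> vspan n G"
  then obtain us vs where "x = comb n us G" "y = comb n vs G" "length us = length G" "length vs = length G"
    unfolding vspan_def by blast
  then show "vadd x y \<in> vspan n G"
    unfolding vspan_def by (intro CollectI exI[of _ "vadd us vs"]) (simp add: comb_vadd assms)
next
  fix a x assume "x \<in> vspan n G"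
  then obtain us where "x = comb n us G" "length us = length G" unfolding vspan_def by blast
  then show "vscale a x \<in> vspan n G"
    unfolding vspan_def by (intro CollectI exI[of _ "vscale a us"]) (simp add: comb_vscale assms)
qed (auto simp: vspan_def assms)

text \<open>The Euclidean size: one more than the difference of the extreme exponents, hence
  unchanged under multiplication by powers of \<open>s\<close>, and 0 exactly for the zero
  polynomial.\<close>

definition lsize :: "'k::field laurent \<Rightarrow> nat" where
  "lsize p = (if p = 0 then 0 else nat (Max (Poly_Mapping.keys p) - Min (Poly_Mapping.keys p)) + 1)"

lemma lsize_le:
  assumes "Poly_Mapping.keys p \<subseteq> {a..<b}" shows "lsize p \<le> nat (b - a)"
proof (cases "p = 0")
  case False
  then have "Poly_Mapping.keys p \<noteq> {}" by simp
  define M m where "M = Max (Poly_Mapping.keys p)" and "m = Min (Poly_Mapping.keys p)"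
  have "M \<in> {a..<b}" "m \<in> {a..<b}"
    unfolding M_def m_def using \<open>Poly_Mapping.keys p \<noteq> {}\<close> by (intro subsetD[OF assms] Max_in Min_in; simp)+
  then show ?thesis using False by (auto simp: lsize_def simp flip: M_def m_def)
qed (simp add: lsize_def)

text \<open>One step of division: a monomial multiple of \<open>q\<close> cancels the top term of
  \<open>p\<close>. As \<open>q\<close> spans no more exponents than \<open>p\<close>, nothing
  appears below the lowest exponent of \<open>p\<close>.\<close>

lemma laurent_reduce:
  fixes p q :: "'k::field laurent"
  assumes "p \<noteq> 0" "q \<noteq> 0" "lsize q \<le> lsize p"
  shows "\<exists>c. lsize (p - c * q) < lsize p"
proof -
  define a b where "a = Min (Poly_Mapping.keys p)" and "b = Max (Poly_Mapping.keys p)"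
  define a' b' where "a' = Min (Poly_Mapping.keys q)" and "b' = Max (Poly_Mapping.keys q)"
  have ne: "Poly_Mapping.keys p \<noteq> {}" "Poly_Mapping.keys q \<noteq> {}" using assms by auto
  have p: "e \<in> {a..b}" if "Poly_Mapping.lookup p e \<noteq> 0" for e
    using that by (simp add: a_def b_def in_keys_iff)
  have q: "e \<in> {a'..b'}" if "Poly_Mapping.lookup q e \<noteq> 0" for e
    using that by (simp add: a'_def b'_def in_keys_iff)
  have ab: "a \<le> b" "a' \<le> b'" using ne by (simp_all add: a_def b_def a'_def b'_def)
  have "nat (b' - a') \<le> nat (b - a)" using assms by (simp add: lsize_def a_def b_def a'_def b'_def)
  then have size: "b' - a' \<le> b - a" using ab by linarith
  define x where "x = Poly_Mapping.lookup p b / Poly_Mapping.lookup q b'"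
  let ?r = "p - Poly_Mapping.single (b - b') x * q"
  have r: "Poly_Mapping.lookup ?r e = Poly_Mapping.lookup p e - x * Poly_Mapping.lookup q (e - (b - b'))" for e
    by (simp add: lookup_minus lookup_single_mult)
  have "b' \<in> Poly_Mapping.keys q" using ne by (simp add: b'_def)
  then have "Poly_Mapping.lookup ?r b = 0" by (subst r) (simp add: x_def in_keys_iff)
  have "Poly_Mapping.keys ?r \<subseteq> {a..<b}"
  proof
    fix e assume "e \<in> Poly_Mapping.keys ?r"
    then have "Poly_Mapping.lookup ?r e \<noteq> 0" by (simp add: in_keys_iff)
    moreover from this have "e \<noteq> b" using \<open>Poly_Mapping.lookup ?r b = 0\<close> by auto
    ultimately have "Poly_Mapping.lookup p e \<noteq> 0 \<or> Poly_Mapping.lookup q (e - (b - b')) \<noteq> 0"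
      unfolding r by auto
    then show "e \<in> {a..<b}" using p[of e] q[of "e - (b - b')"] \<open>e \<noteq> b\<close> size by auto
  qed
  from lsize_le[OF this] have "lsize ?r < lsize p"
    using ab assms by (simp add: lsize_def flip: a_def b_def)
  then show ?thesis by blast
qed

text \<open>The first entries form an ideal, and as in any Euclidean ring a nonzero element of least
  size generates it.\<close>

lemma head_generator:
  fixes S :: "'k::field laurent list set"
  assumes S: "submodule (Suc n) S"
  obtains v where "v \<in> S" "\<And>w. w \<in> S \<Longrightarrow> \<exists>c. hd w = c * hd v"
proof (cases "\<forall>w\<in>S. hd w = 0")
  case True
  then show thesis using that[of "vzero (Suc n)"] submoduleD(2)[OF S] by auto
next
  case False
  then obtain v0 where "v0 \<in> S \<and> hd v0 \<noteq> 0" by blast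
  from ex_has_least_nat[of "\<lambda>v. v \<in> S \<and> hd v \<noteq> 0", OF this, of "\<lambda>v. lsize (hd v)"]
  obtain v where v: "v \<in> S" "hd v \<noteq> 0" and least: "\<And>w. w \<in> S \<Longrightarrow> hd w \<noteq> 0 \<Longrightarrow> lsize (hd v) \<le> lsize (hd w)"
    by blast
  have hd_diff: "vadd w (vscale (- c) v) \<in> S \<and> hd (vadd w (vscale (- c) v)) = hd w - c * hd v" if w: "w \<in> S" for w c
  proof -
    obtain a x b y where "w = a # x" "v = b # y"
      using submoduleD(1)[OF S w] submoduleD(1)[OF S v(1)] by (metis length_Suc_conv)
    moreover have "vadd w (vscale (- c) v) \<in> S" using submoduleD(3,4)[OF S] w v(1) by blast
    ultimately show ?thesis by simp
  qed
  have "\<exists>c. hd w = c * hd v" if w: "w \<in> S" for w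
  proof -
    \<comment> \<open>Instead of iterating the division, a multiple with remainder of least size is
      chosen; a further step of division would contradict this choice unless the remainder is
      0.\<close>
    obtain c where c: "\<And>c'. lsize (hd w - c * hd v) \<le> lsize (hd w - c' * hd v)"
      using ex_has_least_nat[of "\<lambda>_. True" undefined "\<lambda>c. lsize (hd w - c * hd v)"] by auto
    have "hd w - c * hd v = 0"
    proof (rule ccontr)
      assume nz: "hd w - c * hd v \<noteq> 0"
      then have "lsize (hd v) \<le> lsize (hd w - c * hd v)"
        using least hd_diff[OF w, of c] by metis
      from laurent_reduce[OF nz v(2) this] obtain d where "lsize (hd w - c * hd v - d * hd v) < lsize (hd w - c * hd v)"
        by blast
      then have "lsize (hd w - (c + d) * hd v) < lsize (hd w - c * hd v)" by (simp add: algebra_simps)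
      with c[of "c + d"] show False by simp
    qed
    then show ?thesis by auto
  qed
  with that v show thesis by blast
qed

text \<open>\<open>g\<close> generates the ideal of first entries, and \<open>S'\<close> is the
  kernel of the first coordinate with that coordinate dropped. If \<open>g\<close> is 0, the rest of
  the pivot vector is normalised to 0, so that the pivot contributes nothing.\<close>

lemma echelon_step:
  fixes S :: "'k::field laurent list set"
  assumes S: "submodule (Suc n) S"
  obtains g v S' where "length v = n" "submodule n S'" "g = 0 \<Longrightarrow> v = vzero n"
    "S = {vadd (vscale a (g # v)) (0 # y) |a y. y \<in> S'}"
proof -
  obtain w where w: "w \<in> S" and gen: "\<And>x. x \<in> S \<Longrightarrow> \<exists>c. hd x = c * hd w" by (rule head_generator[OF S]) blast
  obtain g v' where w_eq: "w = g # v'" "length v' = n" using submoduleD(1)[OF S w] by (metis length_Suc_conv)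
  define v where "v = (if g = 0 then vzero n else v')"
  have gv: "g # v \<in> S" using w submoduleD(2)[OF S] by (auto simp: v_def w_eq)
  have len: "length v = n" by (simp add: v_def w_eq)
  define S' where "S' = {y. 0 # y \<in> S}"
  have sub: "submodule n S'"
    unfolding submodule_def
  proof (intro conjI ballI allI)
    show "length x = n" if "x \<in> S'" for x using submoduleD(1)[OF S, of "0 # x"] that by (simp add: S'_def)
    show "vzero n \<in> S'" using submoduleD(2)[OF S] by (simp add: S'_def)
    show "vadd x y \<in> S'" if "x \<in> S'" "y \<in> S'" for x y
      using submoduleD(3)[OF S, of "0 # x" "0 # y"] that by (simp add: S'_def)
    show "vscale a x \<in> S'" if "x \<in> S'" for a x
      using submoduleD(4)[OF S, of "0 # x" a] that by (simp add: S'_def)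
  qed
  have S_eq: "S = {vadd (vscale a (g # v)) (0 # y) |a y. y \<in> S'}"
  proof (intro equalityI subsetI)
    fix x assume x: "x \<in> S"
    obtain b z where x_eq: "x = b # z" "length z = n" using submoduleD(1)[OF S x] by (metis length_Suc_conv)
    obtain c where c: "b = c * g" using gen[OF x] by (auto simp: x_eq w_eq)
    let ?y = "vadd z (vscale (- c) v)"
    have "vadd x (vscale (- c) (g # v)) \<in> S" using submoduleD(3,4)[OF S] x gv by blast
    then have "?y \<in> S'" by (simp add: S'_def x_eq c)
    moreover have "x = vadd (vscale c (g # v)) (0 # ?y)"
    proof -
      have "vadd (vscale c v) ?y = vadd z (vadd (vscale c v) (vscale (- c) v))" by (simp only: vadd_ac)
      then show ?thesis by (simp add: x_eq c len)
    qed
    ultimately show "x \<in> {vadd (vscale a (g # v)) (0 # y) |a y. y \<in> S'}" by blast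
  next
    fix x assume "x \<in> {vadd (vscale a (g # v)) (0 # y) |a y. y \<in> S'}"
    then obtain a y where "x = vadd (vscale a (g # v)) (0 # y)" "0 # y \<in> S" by (auto simp: S'_def)
    then show "x \<in> S" using submoduleD(3,4)[OF S] gv by blast
  qed
  show thesis by (rule that[OF len sub _ S_eq]) (simp add: v_def)
qed

lemma vspan_Cons0:
  "vspan (Suc n) ((g # v) # map ((#) 0) G) = {vadd (vscale a (g # v)) (0 # y) |a y. y \<in> vspan n G}"
proof (intro equalityI subsetI)
  fix x assume "x \<in> vspan (Suc n) ((g # v) # map ((#) 0) G)"
  then obtain us where us: "x = comb (Suc n) us ((g # v) # map ((#) 0) G)" "length us = Suc (length G)"
    by (auto simp: vspan_def)
  then obtain a vs where "us = a # vs" "length vs = length G" by (metis length_Suc_conv)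
  then show "x \<in> {vadd (vscale a (g # v)) (0 # y) |a y. y \<in> vspan n G}"
    using us by (auto simp: comb_Cons0 vspan_def)
next
  fix x assume "x \<in> {vadd (vscale a (g # v)) (0 # y) |a y. y \<in> vspan n G}"
  then obtain a us where "x = vadd (vscale a (g # v)) (0 # comb n us G)" "length us = length G"
    by (auto simp: vspan_def)
  then have "x = comb (Suc n) (a # us) ((g # v) # map ((#) 0) G)" "length (a # us) = length ((g # v) # map ((#) 0) G)"
    by (simp_all add: comb_Cons0)
  then show "x \<in> vspan (Suc n) ((g # v) # map ((#) 0) G)" unfolding vspan_def by blast
qed

text \<open>The theorem on submodules of free modules over a principal ideal domain, by induction on
  the rank. A zero pivot is dropped; a nonzero one stays independent of the rest, since a g = 0 in
  the first coordinate forces a = 0.\<close>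

theorem submodule_basis:
  fixes S :: "'k::field laurent list set"
  assumes "submodule n S" shows "\<exists>G. vectors n G \<and> vspan n G = S \<and> independent n G"
  using assms
proof (induction n arbitrary: S)
  case 0
  then have "S = {[]}" using submoduleD[OF 0] by fastforce
  then show ?case by (intro exI[of _ "[]"]) (auto simp: vspan_def independent_def)
next
  case (Suc n)
  obtain g v S' where gv: "length v = n" "submodule n S'" "g = 0 \<Longrightarrow> v = vzero n"
    "S = {vadd (vscale a (g # v)) (0 # y) |a y. y \<in> S'}" by (rule echelon_step[OF Suc.prems]) blast
  obtain G where G: "vectors n G" "vspan n G = S'" "independent n G" using Suc.IH[OF gv(2)] by blast
  show ?case
  proof (cases "g = 0")
    case True
    have "vspan (Suc n) (map ((#) 0) G) = {0 # y |y. y \<in> S'}"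
      by (auto simp: vspan_def comb_Cons0 G(2)[symmetric])
    also have "\<dots> = S"
      using gv(3)[OF True] submoduleD(1)[OF gv(2)] by (auto simp: gv(4) True) (metis vadd_vzero(2))+
    finally have "vspan (Suc n) (map ((#) 0) G) = S" .
    moreover have "independent (Suc n) (map ((#) 0) G)"
      using G(3) by (auto simp: independent_def comb_Cons0)
    ultimately show ?thesis using G(1) by (intro exI[of _ "map ((#) 0) G"]) simp
  next
    case False
    have "independent (Suc n) ((g # v) # map ((#) 0) G)"
      unfolding independent_def
    proof (intro allI impI)
      fix us assume us: "length us = length ((g # v) # map ((#) 0) G)"
        and 0: "comb (Suc n) us ((g # v) # map ((#) 0) G) = vzero (Suc n)"
      obtain a vs where a: "us = a # vs" "length vs = length G" using us by (metis length_Suc_conv length_map list.size(4))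
      have "a * g = 0" using 0 by (simp add: a comb_Cons0)
      then have "a = 0" using False by simp
      then have "comb n vs G = vzero n" using 0 G(1) gv(1) by (simp add: a comb_Cons0)
      then have "vs = vzero (length G)" using G(3) a(2) by (simp add: independent_def)
      then show "us = vzero (length ((g # v) # map ((#) 0) G))" by (simp add: a \<open>a = 0\<close>)
    qed
    moreover have "vspan (Suc n) ((g # v) # map ((#) 0) G) = S" by (simp add: vspan_Cons0 G(2) gv(4))
    ultimately show ?thesis using G(1) gv(1) by (intro exI[of _ "(g # v) # map ((#) 0) G"]) simp
  qed
qed


section \<open>Terms for linear maps\<close>

lemma laurent_ops_simps[simp]:
  "madd laurent_ops x y = x + y" "mzero laurent_ops = 0" "mscale laurent_ops a x = cst a * x"
  "mshift laurent_ops x = spow 1 * x" "munshift laurent_ops x = spow (- 1) * x"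
  by (simp_all add: laurent_ops_def)

lemma has_type_pow: "has_type ar t 1 1 \<Longrightarrow> has_type ar (pow_term t n) 1 1"
  by (induction n) auto

lemma has_type_sum: "(\<And>t. t \<in> set ts \<Longrightarrow> has_type ih_arity t 1 1) \<Longrightarrow> has_type ih_arity (sum_term ts) 1 1"
proof (induction ts rule: sum_term.induct)
  case (3 t t' ts)
  then have "has_type ih_arity (t \<oplus>\<^sub>t sum_term (t' # ts)) (1 + 1) (1 + 1)"
    by (intro has_type.intros) auto
  then show ?case unfolding sum_term.simps by (intro has_type.intros) (auto simp: numeral_2_eq_2)
qed auto

lemma has_type_s_pow: "has_type ih_arity (s_pow i) 1 1"
  unfolding s_pow_def by (cases "0 \<le> i") (simp_all only: if_True if_False has_type_pow, simp_all add: has_type_pow[simplified])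

lemma has_type_laurent_term: "has_type ih_arity (laurent_term p u v) 1 1"
  unfolding laurent_term_def
  using has_type_s_pow by (intro has_type_sum) auto

lemma has_type_mirror: "has_type ih_arity t m n \<Longrightarrow> has_type ih_arity (mirror t) n m"
proof (induction t arbitrary: m n)
  case (Gen g) then show ?case by (cases g) (auto simp: prod.swap_def prod_eq_iff)
qed (auto, blast+)

lemma fn_term_mirror_laurent: "fn_term (mirror (laurent_term p u v))"
proof -
  have pow: "fn_term (mirror t) \<Longrightarrow> fn_term (mirror (pow_term t n))" for t :: "'a ih_gen smterm" and n
    by (induction n) auto
  have "(\<And>t. t \<in> set ts \<Longrightarrow> fn_term (mirror t)) \<Longrightarrow> fn_term (mirror (sum_term ts))" for ts :: "'a ih_gen smterm list"
    by (induction ts rule: sum_term.induct) auto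
  have "fn_term (mirror (s_pow i ;; scal_t a))" for i and a :: 'a
    using pow[of s_t] pow[of s_op] by (simp add: s_pow_def)
  then show ?thesis unfolding laurent_term_def
    by (intro \<open>\<And>ts. (\<And>t. t \<in> set ts \<Longrightarrow> fn_term (mirror t)) \<Longrightarrow> fn_term (mirror (sum_term ts))\<close>) auto
qed

lemma sem_fn_term:
  "fn_term t \<Longrightarrow> has_type ih_arity t m n \<Longrightarrow> sem t = {(xs, act laurent_ops t xs) |xs. length xs = m}"
proof (induction t arbitrary: m n)
  case (Gen g)
  have "(xs, ys) \<in> gen_rel g \<longleftrightarrow> length xs = m \<and> ys = act_gen laurent_ops g xs" for xs ys
  proof (cases "length xs = m")
    case True
    with Gen(2) have "ih_arity g = (length xs, n)" by simp
    from fn_gen_cases[OF Gen(1) this] show ?thesis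
    proof cases
      case (7 x)
      have "(\<exists>u. x = spow 1 * u \<and> ys = [u]) \<longleftrightarrow> ys = [spow (- 1) * x]"
        by (auto intro!: exI[of _ "spow (- 1) * x"])
      then show ?thesis using True by (auto simp: 7)
    qed (use True in auto)
  next
    case False
    then show ?thesis using linrelD(1)[OF sem_linrel[OF Gen(2)]] by auto
  qed
  then show ?case by auto
next
  case (Seq t u)
  then obtain k where ty: "has_type ih_arity t m k" "has_type ih_arity u k n" by auto
  have "length (act laurent_ops t xs) = k" if "length xs = m" for xs
    using length_act[OF _ ty(1)] that Seq.prems(1) by simp
  moreover have "sem t = {(xs, act laurent_ops t xs) |xs. length xs = m}"
    "sem u = {(xs, act laurent_ops u xs) |xs. length xs = k}"
    using Seq.IH(1)[OF _ ty(1)] Seq.IH(2)[OF _ ty(2)] Seq.prems(1) by simp_all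
  ultimately have "(xs, ys) \<in> sem (t ;; u) \<longleftrightarrow> length xs = m \<and> ys = act laurent_ops (t ;; u) xs" for xs ys
    by (auto simp: mem_seq)
  then show ?case by auto
next
  case (Tens t u)
  then obtain a b c d where ty: "has_type ih_arity t a b" "has_type ih_arity u c d" "m = a + c" "n = b + d" by auto
  have st: "sem t = {(xs, act laurent_ops t xs) |xs. length xs = a}"
    and su: "sem u = {(xs, act laurent_ops u xs) |xs. length xs = c}"
    using Tens.IH(1)[OF _ ty(1)] Tens.IH(2)[OF _ ty(2)] Tens.prems(1) by auto
  have "(xs, ys) \<in> sem (t \<oplus>\<^sub>t u) \<longleftrightarrow> length xs = m \<and> ys = act laurent_ops (t \<oplus>\<^sub>t u) xs" for xs ys
  proof
    assume "(xs, ys) \<in> sem (t \<oplus>\<^sub>t u)"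
    then show "length xs = m \<and> ys = act laurent_ops (t \<oplus>\<^sub>t u) xs"
      by (auto simp: mem_tens st su ty(3) term_src[OF ty(1)])
  next
    assume *: "length xs = m \<and> ys = act laurent_ops (t \<oplus>\<^sub>t u) xs"
    then obtain x x' where "xs = x @ x'" "length x = a" "length x' = c" using ty(3) length_addE by blast
    then show "(xs, ys) \<in> sem (t \<oplus>\<^sub>t u)"
      using * by (auto simp: mem_tens st su term_src[OF ty(1)])
  qed
  then show ?case by auto
next
  case Tw
  then show ?case by (auto simp: braid_small numeral_2_eq_2 length_Suc_conv)
qed (auto simp: LinRel_ide)

text \<open>Mirrored, since forward terms denote reversed graphs. The zero polynomial needs its own
  interval because the extrema of its empty support are unspecified.\<close>

definition laurent_map :: "'k::field laurent \<Rightarrow> 'k ih_gen smterm" where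
  "laurent_map c = mirror (laurent_term c
     (if c = 0 then 0 else Min (Poly_Mapping.keys c)) (if c = 0 then 0 else Max (Poly_Mapping.keys c)))"

lemma laurent_map[simp]: "has_type ih_arity (laurent_map c) 1 1" "fn_term (laurent_map c)"
  unfolding laurent_map_def by (rule has_type_mirror[OF has_type_laurent_term] fn_term_mirror_laurent)+

lemma has_type_laurent_map: "has_type ih_arity (laurent_map c) m n \<longleftrightarrow> m = 1 \<and> n = 1"
  using laurent_map(1)[of c] has_type_unique by blast

lemma term_src_laurent_map[simp]: "term_src (laurent_map c) = 1"
  by (rule term_src[OF laurent_map(1)])

text \<open>Read off the relational semantics: the relation of the term is the graph of its action
  and also, by the calculation for \<open>laurent_term\<close>, the graph of multiplication by
  \<open>c\<close>. No second induction over the sum is needed.\<close>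

lemma act_laurent_map[simp]: "act laurent_ops (laurent_map c) [x] = [c * x]"
proof -
  have "Poly_Mapping.keys c \<subseteq> {(if c = 0 then 0 else Min (Poly_Mapping.keys c))..(if c = 0 then 0 else Max (Poly_Mapping.keys c))}"
    by auto
  then have "sem (laurent_map c) = (mulrel c)\<inverse>"
    by (simp only: laurent_map_def sem_mirror sem_laurent_term)
  moreover have "([x], act laurent_ops (laurent_map c) [x]) \<in> sem (laurent_map c)"
    by (simp add: sem_fn_term[OF laurent_map(2,1)])
  ultimately show ?thesis by (auto simp: mulrel_def)
qed

text \<open>\<open>add_vec_term v\<close> maps \<open>(u, x)\<close> to \<open>u v + x\<close>: the wire carrying \<open>u\<close> is passed through the
  wires of \<open>x\<close>.\<close>

primrec add_vec_term :: "'k::field laurent list \<Rightarrow> 'k ih_gen smterm" where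
  "add_vec_term [] = zero_op"
| "add_vec_term (c # v) = ((((add_op \<oplus>\<^sub>t Id) ;; (laurent_map c \<oplus>\<^sub>t Tw)) ;; (copy_op \<oplus>\<^sub>t Id)) \<oplus>\<^sub>t id_term (length v)) ;;
     (Id \<oplus>\<^sub>t add_vec_term v)"

primrec zeros_term :: "nat \<Rightarrow> 'k ih_gen smterm" where
  "zeros_term 0 = Id\<^sub>0"
| "zeros_term (Suc n) = disc_op \<oplus>\<^sub>t zeros_term n"

primrec comb_term :: "nat \<Rightarrow> 'k::field laurent list list \<Rightarrow> 'k ih_gen smterm" where
  "comb_term n [] = zeros_term n"
| "comb_term n (v # G) = (Id \<oplus>\<^sub>t comb_term n G) ;; add_vec_term v"

lemma has_type_add_vec: "has_type ih_arity (add_vec_term v) (Suc (length v)) (length v)"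
proof (induction v)
  case (Cons c v)
  have "has_type ih_arity ((add_op \<oplus>\<^sub>t Id) ;; (laurent_map c \<oplus>\<^sub>t Tw)) 2 3"
    by (auto simp: has_type_laurent_map intro!: exI[of _ 3])
  then have "has_type ih_arity (((add_op \<oplus>\<^sub>t Id) ;; (laurent_map c \<oplus>\<^sub>t Tw)) ;; (copy_op \<oplus>\<^sub>t Id)) 2 2"
    by (rule has_type.intros) auto
  then have "has_type ih_arity ((((add_op \<oplus>\<^sub>t Id) ;; (laurent_map c \<oplus>\<^sub>t Tw)) ;; (copy_op \<oplus>\<^sub>t Id)) \<oplus>\<^sub>t id_term (length v))
      (2 + length v) (2 + length v)"
    by (rule has_type.intros) simp
  moreover have "has_type ih_arity (Id \<oplus>\<^sub>t add_vec_term v) (1 + Suc (length v)) (1 + length v)"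
    using Cons by (intro has_type.intros)
  ultimately show ?case by (auto intro!: exI[of _ "2 + length v"] simp del: has_type_simps simp: has_type_simps(5))
qed auto

lemma fn_term_add_vec[simp]: "fn_term (add_vec_term v)"
  by (induction v) auto

lemma act_add_vec: "length x = length v \<Longrightarrow> act laurent_ops (add_vec_term v) (u # x) = vadd (vscale u v) x"
proof (induction v arbitrary: x)
  case (Cons c v)
  then obtain a y where "x = a # y" "length y = length v" by (metis length_Suc_conv list.size(4))
  with Cons show ?case by (simp add: numeral_2_eq_2 mult.commute[of u c])
qed simp

lemma zeros_term[simp]: "has_type ih_arity (zeros_term n) m k \<longleftrightarrow> m = 0 \<and> k = n" "fn_term (zeros_term n)"
  "act laurent_ops (zeros_term n) [] = vzero n"
  by (induction n arbitrary: m k) auto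

lemma has_type_comb: "vectors n G \<Longrightarrow> has_type ih_arity (comb_term n G) (length G) n"
proof (induction G)
  case (Cons v G)
  then have "has_type ih_arity (Id \<oplus>\<^sub>t comb_term n G) (1 + length G) (1 + n)" by (intro has_type.intros) simp
  then show ?case using has_type_add_vec[of v] Cons by (auto simp del: has_type_simps simp: has_type_simps(5))
qed simp

lemma fn_term_comb[simp]: "fn_term (comb_term n G)"
  by (induction G) auto

lemma act_comb: "vectors n G \<Longrightarrow> length us = length G \<Longrightarrow> act laurent_ops (comb_term n G) us = comb n us G"
proof (induction G arbitrary: us)
  case (Cons v G)
  then obtain u vs where "us = u # vs" "length vs = length G" by (metis length_Suc_conv list.size(4))
  with Cons show ?case by (simp add: act_add_vec)
qed simp

lemma act_linear:
  assumes t: "fn_term t" "has_type ih_arity t m n"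
  shows "length x = m \<Longrightarrow> length y = m \<Longrightarrow> act laurent_ops t (vadd x y) = vadd (act laurent_ops t x) (act laurent_ops t y)"
    "length x = m \<Longrightarrow> act laurent_ops t (vscale a x) = vscale a (act laurent_ops t x)"
    "act laurent_ops t (vzero m) = vzero n"
  using linrelD(3-5)[OF sem_linrel[OF t(2)]] by (auto simp: sem_fn_term[OF t])

lemma act_comb_map:
  assumes t: "fn_term t" "has_type ih_arity t m n" and G: "vectors m G" and us: "length us = length G"
  shows "act laurent_ops t (comb m us G) = comb n us (map (act laurent_ops t) G)"
  using G us
proof (induction G arbitrary: us)
  case (Cons v G)
  then obtain u vs where "us = u # vs" "length vs = length G" by (metis length_Suc_conv list.size(4))
  with Cons show ?case by (simp add: act_linear(1,2)[OF t])
qed (simp add: act_linear(3)[OF t])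

section \<open>Normal forms of arrows out of \<open>0\<close>\<close>

text \<open>\<open>zero_t\<close> denotes an unconstrained value, so this supplies \<open>n\<close>
  free parameters.\<close>

primrec alls_term :: "nat \<Rightarrow> 'k ih_gen smterm" where
  "alls_term 0 = Id\<^sub>0"
| "alls_term (Suc n) = zero_t \<oplus>\<^sub>t alls_term n"

lemma has_type_alls[simp]: "has_type ih_arity (alls_term n) m k \<longleftrightarrow> m = 0 \<and> k = n"
  by (induction n arbitrary: m k) auto

definition span_term :: "nat \<Rightarrow> 'k::field laurent list list \<Rightarrow> 'k ih_gen smterm" where
  "span_term n G = alls_term (length G) ;; comb_term n G"

lemma has_type_span_term: "vectors n G \<Longrightarrow> has_type ih_arity (span_term n G) 0 n"
  using has_type_comb by (auto simp: span_term_def)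

lemma sem_alls: "sem (alls_term n) = {([], us) |us. length us = n}"
proof (induction n)
  case (Suc n)
  have "(x, y) \<in> sem (alls_term (Suc n)) \<longleftrightarrow> x = [] \<and> length y = Suc n" for x y :: "'a laurent list"
    by (auto simp: mem_tens Suc length_Suc_conv)
  then show ?case by auto
qed (auto simp: ide_small)

lemma sem_span_term: "vectors n G \<Longrightarrow> sem (span_term n G) = {([], y) |y. y \<in> vspan n G}"
  by (auto simp: span_term_def LinRel_seq sem_alls sem_fn_term[OF fn_term_comb has_type_comb]
      act_comb vspan_def relcomp_unfold)

section \<open>Derived laws for the generators that are not functions\<close>

context ih_model
begin

text \<open>In the relational reading \<open>all\<close> produces an arbitrary value,
  \<open>test\<close> demands the value 0, \<open>codup\<close> demands that two values agree, and
  \<open>comerge\<close> splits a value into two summands.\<close>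

abbreviation "all \<equiv> \<gamma> (Fwd Zero)"
abbreviation "test \<equiv> \<gamma> (Fwd Disc)"
abbreviation "codup \<equiv> \<gamma> (Fwd Add)"
abbreviation "comerge \<equiv> \<gamma> (Fwd Copy)"
abbreviation "coscale a \<equiv> \<gamma> (Fwd (Scalar a))"

lemma gen_types'[simp]:
  "src all = 0" "tgt all = 1" "src test = 1" "tgt test = 0" "src codup = 2" "tgt codup = 1"
  "src comerge = 1" "tgt comerge = 2" "src (coscale a) = 1" "tgt (coscale a) = 1"
  by (simp_all add: gen_type)

lemma bones: "all \<fatsemi> del = \<I> 0" "nil \<fatsemi> test = \<I> 0" "all \<fatsemi> test = \<I> 0"
  using eqs[of "zero_t ;; zero_op" "Id\<^sub>0" 0 0] interaction[OF interaction_eqs.black_bone, of 0 0]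
    HA[OF HA_eqs.zero_disc, of 0 0]
  by (simp_all add: IH_Cor_eqs_def)

lemma white_frobenius:
  "(\<I> 1 \<boxplus> dup) \<fatsemi> (codup \<boxplus> \<I> 1) = codup \<fatsemi> dup" "(dup \<boxplus> \<I> 1) \<fatsemi> (\<I> 1 \<boxplus> codup) = codup \<fatsemi> dup"
  using interaction[OF interaction_eqs.white_frob_left, of 2 2] interaction[OF interaction_eqs.white_frob_right, of 2 2]
  by (force simp: numeral_eq_Suc)+

lemma black_frobenius:
  "(comerge \<boxplus> \<I> 1) \<fatsemi> (\<I> 1 \<boxplus> merge) = merge \<fatsemi> comerge" "(\<I> 1 \<boxplus> comerge) \<fatsemi> (merge \<boxplus> \<I> 1) = merge \<fatsemi> comerge"
  using interaction[OF interaction_eqs.black_frob_left, of 2 2] interaction[OF interaction_eqs.black_frob_right, of 2 2]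
  by (force simp: numeral_eq_Suc)+

lemma cup_cap:
  "nil \<fatsemi> comerge = all \<fatsemi> (dup \<fatsemi> (coscale (- 1) \<boxplus> \<I> 1))"
  "merge \<fatsemi> test = (coscale (- 1) \<boxplus> \<I> 1) \<fatsemi> (codup \<fatsemi> del)"
  using interaction[OF interaction_eqs.cup, of 0 2] interaction[OF interaction_eqs.cap, of 2 0]
  by (force simp: numeral_eq_Suc)+

lemma codup_unit: "(all \<boxplus> \<I> 1) \<fatsemi> codup = \<I> 1"
  using HA[OF HA_eqs.add_unit_left, of 1 1] by simp

lemma comerge_counit: "comerge \<fatsemi> (test \<boxplus> \<I> 1) = \<I> 1"
  using HA[OF HA_eqs.copy_unit_left, of 1 1] by simp

text \<open>The law on nonzero polynomials, at a constant, makes \<open>coscale a\<close> a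
  one-sided inverse of \<open>scale a\<close>. The latter is invertible, so this is its
  inverse.\<close>

lemma coscale: assumes "a \<noteq> 0" shows "coscale a = scale (1 / a)"
proof -
  have p: "mirror (laurent_term (cst a) 0 0) = (Gen (Op (Scalar a)) ;; Id)" "laurent_term (cst a) 0 0 = (Id ;; scal_t a)"
    by (simp_all add: laurent_term_def s_pow_def)
  have "cst a \<noteq> 0" using assms by (metis lookup_single_eq lookup_zero)
  from interaction_eqs.poly_op_poly[OF this, of 0 0]
  have "(mirror (laurent_term (cst a) 0 0) ;; laurent_term (cst a) 0 0, Id) \<in> interaction_eqs" by simp
  then have "scale a \<fatsemi> coscale a = \<I> 1"
    unfolding p by (drule_tac interaction[of _ _ 1 1]) simp_all
  moreover have "scale (1 / a) \<fatsemi> scale a = \<I> 1"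
    using assms by (simp add: scale_eqs[simplified])
  ultimately have "scale (1 / a) \<fatsemi> (scale a \<fatsemi> coscale a) = scale (1 / a)" "(scale (1 / a) \<fatsemi> scale a) \<fatsemi> coscale a = coscale a"
    by simp_all
  then show ?thesis by (simp add: seq_seq)
qed

text \<open>Deleting one end of a cup leaves an arbitrary value; the sign on that end is deleted
  along with it.\<close>

lemma all_eq: "all \<fatsemi> (dup \<fatsemi> (coscale (- 1) \<boxplus> \<I> 1)) \<fatsemi> (del \<boxplus> \<I> 1) = all"
proof -
  have "coscale (- 1) \<fatsemi> del = del" using linearD(7)[OF linear_scale] by (simp add: coscale)
  then have "(coscale (- 1) \<boxplus> \<I> 1) \<fatsemi> (del \<boxplus> \<I> 1) = del \<boxplus> \<I> 1" by (simp add: tens_seq)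
  then have "(dup \<fatsemi> (coscale (- 1) \<boxplus> \<I> 1)) \<fatsemi> (del \<boxplus> \<I> 1) = \<I> 1"
    using dup_eqs(2) by (simp add: seq_seq)
  then show ?thesis by (simp add: seq_seq)
qed

text \<open>To split x, choose v arbitrarily and return x - v and v. This is the Frobenius law
  applied to \<open>nil\<close> and x, with the cup \<open>nil ; comerge\<close> rewritten by the
  first cup equation. It removes \<open>comerge\<close> in favour of \<open>all\<close>.\<close>

lemma comerge_eq: "comerge = (\<I> 1 \<boxplus> (all \<fatsemi> (dup \<fatsemi> (coscale (- 1) \<boxplus> \<I> 1)))) \<fatsemi> (merge \<boxplus> \<I> 1)"
proof -
  have u: "(\<I> 1 \<boxplus> nil) \<fatsemi> merge = \<I> 1"
  proof -
    have "\<I> 1 \<boxplus> nil = (nil \<boxplus> \<I> 1) \<fatsemi> \<X> 1 1" using braid_nat[of nil "\<I> 1" 0 1 1 1] by simp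
    then have "(\<I> 1 \<boxplus> nil) \<fatsemi> merge = (nil \<boxplus> \<I> 1) \<fatsemi> (\<X> 1 1 \<fatsemi> merge)" by (simp add: seq_seq)
    then show ?thesis using add_eqs(2,3) by simp
  qed
  have "comerge = ((\<I> 1 \<boxplus> nil) \<fatsemi> merge) \<fatsemi> comerge" unfolding u by simp
  also have "\<dots> = (\<I> 1 \<boxplus> nil) \<fatsemi> (merge \<fatsemi> comerge)" by (rule seq_seq) simp_all
  also have "\<dots> = ((\<I> 1 \<boxplus> nil) \<fatsemi> (\<I> 1 \<boxplus> comerge)) \<fatsemi> (merge \<boxplus> \<I> 1)"
    unfolding black_frobenius(2)[symmetric] by (simp add: seq_seq)
  also have "(\<I> 1 \<boxplus> nil) \<fatsemi> (\<I> 1 \<boxplus> comerge) = \<I> 1 \<boxplus> (nil \<fatsemi> comerge)" by (simp add: tens_seq)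
  finally show ?thesis by (simp add: cup_cap)
qed

text \<open>An arbitrary summand absorbs the other one. This is what makes row operations on free
  parameters possible.\<close>

lemma all_merge: "(all \<boxplus> \<I> 1) \<fatsemi> merge = del \<fatsemi> all"
proof -
  \<comment> \<open>\<open>all\<close> is a cup with one end deleted; in this form the black
    Frobenius law applies to its sum with another value.\<close>
  have "all = nil \<fatsemi> (comerge \<fatsemi> (del \<boxplus> \<I> 1))"
    using all_eq by (simp add: cup_cap flip: seq_seq)
  then have "all \<boxplus> \<I> 1 = (nil \<boxplus> \<I> 1) \<fatsemi> ((comerge \<boxplus> \<I> 1) \<fatsemi> ((del \<boxplus> \<I> 1) \<boxplus> \<I> 1))"
    by (simp add: tens_seq)
  then have "(all \<boxplus> \<I> 1) \<fatsemi> merge = (nil \<boxplus> \<I> 1) \<fatsemi> ((comerge \<boxplus> \<I> 1) \<fatsemi> (((del \<boxplus> \<I> 1) \<boxplus> \<I> 1) \<fatsemi> merge))"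
    by (simp add: seq_seq)
  also have "((del \<boxplus> \<I> 1) \<boxplus> \<I> 1) \<fatsemi> merge = (\<I> 1 \<boxplus> merge) \<fatsemi> (del \<boxplus> \<I> 1)"
    using tens_split1[of del merge] tens_split2[of del merge] by (simp add: tens_tens tens_ide numeral_2_eq_2)
  also have "(nil \<boxplus> \<I> 1) \<fatsemi> ((comerge \<boxplus> \<I> 1) \<fatsemi> ((\<I> 1 \<boxplus> merge) \<fatsemi> (del \<boxplus> \<I> 1))) =
      (nil \<boxplus> \<I> 1) \<fatsemi> (((comerge \<boxplus> \<I> 1) \<fatsemi> (\<I> 1 \<boxplus> merge)) \<fatsemi> (del \<boxplus> \<I> 1))"
    by (simp add: seq_seq)
  also have "\<dots> = ((nil \<boxplus> \<I> 1) \<fatsemi> merge) \<fatsemi> (comerge \<fatsemi> (del \<boxplus> \<I> 1))"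
    unfolding black_frobenius by (simp add: seq_seq)
  also have "\<dots> = comerge \<fatsemi> (del \<boxplus> \<I> 1)" using add_eqs(2) by simp
  also have "\<dots> = (\<I> 1 \<boxplus> (all \<fatsemi> (dup \<fatsemi> (coscale (- 1) \<boxplus> \<I> 1)))) \<fatsemi> ((merge \<fatsemi> del) \<boxplus> \<I> 1)"
    by (subst comerge_eq) (simp add: seq_seq tens_seq)
  also have "(merge \<fatsemi> del) \<boxplus> \<I> 1 = del \<boxplus> (del \<boxplus> \<I> 1)" by (simp add: bialgebra_eqs tens_tens)
  also have "(\<I> 1 \<boxplus> (all \<fatsemi> (dup \<fatsemi> (coscale (- 1) \<boxplus> \<I> 1)))) \<fatsemi> (del \<boxplus> (del \<boxplus> \<I> 1)) = del \<boxplus> all"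
    using all_eq by (simp add: tens_seq)
  also have "\<dots> = del \<fatsemi> all" using tens_split1[of del all] by simp
  finally show ?thesis .
qed

lemma merge_all: "(\<I> 1 \<boxplus> all) \<fatsemi> merge = del \<fatsemi> all"
proof -
  have "\<I> 1 \<boxplus> all = (all \<boxplus> \<I> 1) \<fatsemi> \<X> 1 1" using braid_nat[of all "\<I> 1" 0 1 1 1] by simp
  then have "(\<I> 1 \<boxplus> all) \<fatsemi> merge = (all \<boxplus> \<I> 1) \<fatsemi> (\<X> 1 1 \<fatsemi> merge)" by (simp add: seq_seq)
  then show ?thesis using add_eqs(3) all_merge by simp
qed

text \<open>Two values are identified by copying the first and testing one copy for equality with
  the second; this is white Frobenius with a counit.\<close>

lemma codup_eq: "codup = (dup \<boxplus> \<I> 1) \<fatsemi> (\<I> 1 \<boxplus> (codup \<fatsemi> del))"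
proof -
  have "codup = codup \<fatsemi> (dup \<fatsemi> (\<I> 1 \<boxplus> del))" using comonoid_counit_right[OF comonoid_1] by simp
  also have "\<dots> = ((dup \<boxplus> \<I> 1) \<fatsemi> (\<I> 1 \<boxplus> codup)) \<fatsemi> (\<I> 1 \<boxplus> del)" unfolding white_frobenius by (simp add: seq_seq)
  finally show ?thesis by (simp add: seq_seq tens_seq)
qed

text \<open>Equality of two values is tested by testing their difference for 0. With
  \<open>codup_eq\<close> this reduces \<open>codup\<close> to \<open>test\<close>.\<close>

lemma codup_del: "codup \<fatsemi> del = (scale (- 1) \<boxplus> \<I> 1) \<fatsemi> (merge \<fatsemi> test)"
proof -
  have "(scale (- 1) \<boxplus> \<I> 1) \<fatsemi> (merge \<fatsemi> test) = ((scale (- 1) \<boxplus> \<I> 1) \<fatsemi> (scale (- 1) \<boxplus> \<I> 1)) \<fatsemi> (codup \<fatsemi> del)"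
    by (simp add: cup_cap coscale seq_seq)
  then show ?thesis by (simp add: tens_seq scale_eqs[simplified] tens_ide numeral_2_eq_2)
qed

text \<open>If one copy of a value is tested to be 0, the other copy is 0 too. This is
  \<open>all_merge\<close> mirrored and with the two colours exchanged, and the white Frobenius law
  takes the place of the black one.\<close>

lemma dup_test: "dup \<fatsemi> (test \<boxplus> \<I> 1) = test \<fatsemi> nil"
proof -
  have "nil \<fatsemi> coscale (- 1) = nil" using linearD(5)[OF linear_scale] by (simp add: coscale)
  then have "(nil \<boxplus> \<I> 1) \<fatsemi> (coscale (- 1) \<boxplus> \<I> 1) = nil \<boxplus> \<I> 1" by (simp add: tens_seq)
  then have "((nil \<boxplus> \<I> 1) \<fatsemi> merge) \<fatsemi> test = (nil \<boxplus> \<I> 1) \<fatsemi> (codup \<fatsemi> del)"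
    by (simp add: seq_seq cup_cap) (simp flip: seq_seq)
  then have test: "test = (nil \<boxplus> \<I> 1) \<fatsemi> (codup \<fatsemi> del)" using add_eqs(2) by simp
  have "dup \<fatsemi> (test \<boxplus> \<I> 1) = dup \<fatsemi> (((nil \<boxplus> \<I> 1) \<boxplus> \<I> 1) \<fatsemi> ((codup \<boxplus> \<I> 1) \<fatsemi> (del \<boxplus> \<I> 1)))"
    by (subst test) (simp add: tens_seq)
  also have "\<dots> = (dup \<fatsemi> ((nil \<boxplus> \<I> 1) \<boxplus> \<I> 1)) \<fatsemi> ((codup \<boxplus> \<I> 1) \<fatsemi> (del \<boxplus> \<I> 1))" by (simp add: seq_seq)
  also have "dup \<fatsemi> ((nil \<boxplus> \<I> 1) \<boxplus> \<I> 1) = (nil \<boxplus> \<I> 1) \<fatsemi> (\<I> 1 \<boxplus> dup)"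
    using tens_split1[of nil dup] tens_split2[of nil dup] by (simp add: tens_tens tens_ide numeral_2_eq_2)
  also have "((nil \<boxplus> \<I> 1) \<fatsemi> (\<I> 1 \<boxplus> dup)) \<fatsemi> ((codup \<boxplus> \<I> 1) \<fatsemi> (del \<boxplus> \<I> 1))
      = (nil \<boxplus> \<I> 1) \<fatsemi> (((\<I> 1 \<boxplus> dup) \<fatsemi> (codup \<boxplus> \<I> 1)) \<fatsemi> (del \<boxplus> \<I> 1))" by (simp add: seq_seq)
  also have "\<dots> = (nil \<boxplus> \<I> 1) \<fatsemi> (codup \<fatsemi> (dup \<fatsemi> (del \<boxplus> \<I> 1)))"
    unfolding white_frobenius by (simp add: seq_seq)
  also have "\<dots> = (nil \<boxplus> \<I> 1) \<fatsemi> codup" using dup_eqs(2) by simp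
  also have "\<dots> = ((nil \<fatsemi> dup) \<boxplus> \<I> 1) \<fatsemi> (\<I> 1 \<boxplus> (codup \<fatsemi> del))"
    by (subst codup_eq) (simp add: tens_seq flip: seq_seq)
  also have "(nil \<fatsemi> dup) \<boxplus> \<I> 1 = nil \<boxplus> (nil \<boxplus> \<I> 1)" by (simp add: bialgebra_eqs tens_tens)
  also have "(nil \<boxplus> (nil \<boxplus> \<I> 1)) \<fatsemi> (\<I> 1 \<boxplus> (codup \<fatsemi> del)) = nil \<boxplus> test"
    by (simp add: tens_seq flip: test[simplified])
  also have "\<dots> = test \<fatsemi> nil" using tens_split2[of nil test] by simp
  finally show ?thesis .
qed

text \<open>The yanking equation for the cup \<open>all ; dup\<close> and the cap
  \<open>codup ; del\<close>, which allows wires to be bent back.\<close>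

lemma snake: "(\<I> 1 \<boxplus> (all \<fatsemi> dup)) \<fatsemi> ((codup \<fatsemi> del) \<boxplus> \<I> 1) = \<I> 1"
proof -
  have "(\<I> 1 \<boxplus> (all \<fatsemi> dup)) \<fatsemi> ((codup \<fatsemi> del) \<boxplus> \<I> 1) =
      ((\<I> 1 \<boxplus> all) \<fatsemi> (\<I> 1 \<boxplus> dup)) \<fatsemi> ((codup \<boxplus> \<I> 1) \<fatsemi> (del \<boxplus> \<I> 1))"
    by (simp add: tens_seq)
  also have "\<dots> = (\<I> 1 \<boxplus> all) \<fatsemi> (((\<I> 1 \<boxplus> dup) \<fatsemi> (codup \<boxplus> \<I> 1)) \<fatsemi> (del \<boxplus> \<I> 1))" by (simp add: seq_seq)
  also have "\<dots> = ((\<I> 1 \<boxplus> all) \<fatsemi> codup) \<fatsemi> (dup \<fatsemi> (del \<boxplus> \<I> 1))"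
    unfolding white_frobenius by (simp add: seq_seq)
  also have "(\<I> 1 \<boxplus> all) \<fatsemi> codup = \<I> 1"
  proof -
    have "\<I> 1 \<boxplus> all = (all \<boxplus> \<I> 1) \<fatsemi> \<X> 1 1" using braid_nat[of all "\<I> 1" 0 1 1 1] by simp
    then have "(\<I> 1 \<boxplus> all) \<fatsemi> codup = (all \<boxplus> \<I> 1) \<fatsemi> (\<X> 1 1 \<fatsemi> codup)" by (simp add: seq_seq)
    also have "\<X> 1 1 \<fatsemi> codup = codup" using HA[OF HA_eqs.add_comm, of 2 1] by simp
    finally show ?thesis by (simp only: codup_unit)
  qed
  finally show ?thesis using dup_eqs(2) by simp
qed

text \<open>For nonzero p, the condition p u = 0 is the condition u = 0. Each forward generator in
  the term of \<open>p\<close> preserves \<open>test\<close>, hence so does the whole term;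
  composing with the mirror image and cancelling gives the claim for the latter.\<close>

lemma laurent_map_test: assumes "p \<noteq> 0" shows "\<lbrakk>laurent_map p\<rbrakk> \<fatsemi> test = test"
proof -
  define u v where "u = Min (Poly_Mapping.keys p)" and "v = Max (Poly_Mapping.keys p)"
  let ?p = "laurent_term p u v"
  note ty[simp] = eval_type[OF has_type_laurent_term, simplified]
    eval_type[OF has_type_mirror[OF has_type_laurent_term], simplified]
  have s_test: "shift \<fatsemi> test = test" "unshift \<fatsemi> test = test" "coscale a \<fatsemi> test = test" for a
  proof -
    show 1: "unshift \<fatsemi> test = test" using HA[OF HA_eqs.map_disc[of s_t undefined], of 1 0] by simp
    have "shift \<fatsemi> (unshift \<fatsemi> test) = (shift \<fatsemi> unshift) \<fatsemi> test" by (simp add: seq_seq)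
    then show "shift \<fatsemi> test = test" unfolding 1 using shift_unshift by simp
    show "coscale a \<fatsemi> test = test" using HA[OF HA_eqs.map_disc[of "scal_t a" a], of 1 0] by simp
  qed
  have pow: "\<lbrakk>pow_term t n\<rbrakk> \<fatsemi> test = test" if t: "\<lbrakk>t\<rbrakk> \<fatsemi> test = test" "has_type ih_arity t 1 1" for t n
    using eval_type[OF t(2)] eval_type[OF has_type_pow[OF t(2)]] t(1)
    by (induction n) (simp_all add: seq_seq)
  have s_pow: "\<lbrakk>s_pow i\<rbrakk> \<fatsemi> test = test" for i
    using pow[of s_t] pow[of s_op] s_test by (simp add: s_pow_def)
  have sum: "\<lbrakk>sum_term ts\<rbrakk> \<fatsemi> test = test"
    if "\<And>t. t \<in> set ts \<Longrightarrow> \<lbrakk>t\<rbrakk> \<fatsemi> test = test \<and> has_type ih_arity t 1 1" for ts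
    using that
  proof (induction ts rule: sum_term.induct)
    case 1 then show ?case by (simp add: seq_seq bones)
  next
    case (3 t t' ts)
    have ty: "has_type ih_arity t 1 1" "has_type ih_arity (sum_term (t' # ts)) 1 1"
      using 3(2) has_type_sum[of "t' # ts"] by auto
    note [simp] = eval_type[OF ty(1), simplified] eval_type[OF ty(2), simplified]
    have "codup \<fatsemi> test = test \<boxplus> test" using HA[OF HA_eqs.add_disc, of 2 0] by simp
    moreover have "\<lbrakk>t\<rbrakk> \<fatsemi> test = test" "\<lbrakk>sum_term (t' # ts)\<rbrakk> \<fatsemi> test = test" using 3 by auto
    moreover have "comerge \<fatsemi> (test \<boxplus> test) = test"
      using tens_split1[of test test] comerge_counit by (simp flip: seq_seq)
    ultimately show ?case by (simp add: seq_seq tens_seq numeral_2_eq_2)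
  qed simp
  have p_test: "\<lbrakk>?p\<rbrakk> \<fatsemi> test = test"
    unfolding laurent_term_def
  proof (rule sum)
    fix t assume "t \<in> set (map (\<lambda>i. s_pow i ;; scal_t (Poly_Mapping.lookup p i)) [u..v])"
    then obtain i where "t = s_pow i ;; scal_t (Poly_Mapping.lookup p i)" by auto
    then show "\<lbrakk>t\<rbrakk> \<fatsemi> test = test \<and> has_type ih_arity t 1 1"
      using s_pow s_test eval_type[OF has_type_s_pow[of i]] has_type_s_pow[of i] by (auto simp: seq_seq)
  qed
  have "Poly_Mapping.keys p \<subseteq> {u..v}" by (auto simp: u_def v_def)
  from interaction[OF interaction_eqs.poly_op_poly[OF assms this], of 1 1]
  have "\<lbrakk>mirror ?p\<rbrakk> \<fatsemi> \<lbrakk>?p\<rbrakk> = \<I> 1"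
    using has_type_laurent_term[of p u v] has_type_mirror[OF has_type_laurent_term[of p u v]] by auto
  \<comment> \<open>The forward term is inserted in front of \<open>test\<close>, where it is
    absorbed, so that its mirror image meets it on the left.\<close>
  then have "\<lbrakk>mirror ?p\<rbrakk> \<fatsemi> (\<lbrakk>?p\<rbrakk> \<fatsemi> test) = test" by (simp flip: seq_seq)
  then have "\<lbrakk>mirror ?p\<rbrakk> \<fatsemi> test = test" unfolding p_test .
  then show ?thesis using assms by (simp add: laurent_map_def u_def v_def)
qed

end

section \<open>Row operations on spanning lists\<close>

lemma vspan_appendI: assumes "vectors n G1" "vectors n G2" "v \<in> vspan n G2" shows "v \<in> vspan n (G1 @ G2)"
proof -
  obtain us where "v = comb n us G2" "length us = length G2" using assms(3) by (auto simp: vspan_def)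
  then have "v = comb n (vzero (length G1) @ us) (G1 @ G2)" "length (vzero (length G1) @ us) = length (G1 @ G2)"
    using assms by (simp_all add: comb_append)
  then show ?thesis unfolding vspan_def by blast
qed

lemma vspan_mem: assumes "vectors n G" "v \<in> set G" shows "v \<in> vspan n G"
proof -
  obtain G1 G2 where G: "G = G1 @ v # G2" using assms(2) by (meson split_list)
  have "v = comb n (1 # vzero (length G2)) (v # G2)" using assms(1) by (simp add: G)
  then have "v \<in> vspan n (v # G2)"
    unfolding vspan_def by (intro CollectI exI[of _ "1 # vzero (length G2)"]) simp
  then show ?thesis unfolding G using assms(1) G by (intro vspan_appendI) simp_all
qed

primrec unit_vectors :: "nat \<Rightarrow> 'r::comm_ring_1 list list" where
  "unit_vectors 0 = []"
| "unit_vectors (Suc n) = (1 # vzero n) # map ((#) 0) (unit_vectors n)"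

lemma unit_vectors[simp]: "vectors n (unit_vectors n)" "length (unit_vectors n) = n"
  by (induction n) simp_all

lemma comb_unit_vectors: "length us = n \<Longrightarrow> comb n us (unit_vectors n) = us"
proof (induction n arbitrary: us)
  case (Suc n)
  then obtain u vs where "us = u # vs" "length vs = n" by (metis length_Suc_conv)
  with Suc show ?case by (simp add: comb_Cons0)
qed simp

text \<open>The shear (a, b) to (a, r a + b) of two parameters; in front of a linear combination it
  becomes an elementary row operation.\<close>

definition transvection :: "'k::field laurent \<Rightarrow> 'k ih_gen smterm" where
  "transvection r = (add_op \<oplus>\<^sub>t Id) ;; (Id \<oplus>\<^sub>t ((laurent_map r \<oplus>\<^sub>t Id) ;; copy_op))"

context ih_model
begin

abbreviation "alls n \<equiv> \<lbrakk>alls_term n\<rbrakk>"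

lemma alls_type[simp]: "arr (alls n)" "src (alls n) = 0" "tgt (alls n) = n"
  using eval_type[of "alls_term n" 0 n] by simp_all

lemma state_type[simp]:
  assumes "vectors n G"
  shows "arr \<lbrakk>span_term n G\<rbrakk>" "src \<lbrakk>span_term n G\<rbrakk> = 0" "tgt \<lbrakk>span_term n G\<rbrakk> = n"
    "arr \<lbrakk>comb_term n G\<rbrakk>" "src \<lbrakk>comb_term n G\<rbrakk> = length G" "tgt \<lbrakk>comb_term n G\<rbrakk> = n"
  using eval_type[OF has_type_span_term[OF assms]] eval_type[OF has_type_comb[OF assms]] by simp_all

lemma add_vec_type[simp]: "arr \<lbrakk>add_vec_term v\<rbrakk>" "src \<lbrakk>add_vec_term v\<rbrakk> = Suc (length v)" "tgt \<lbrakk>add_vec_term v\<rbrakk> = length v"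
  using eval_type[OF has_type_add_vec[of v]] by simp_all

lemma span_term_Cons:
  assumes "vectors n (v # G)"
  shows "\<lbrakk>span_term n (v # G)\<rbrakk> = (all \<boxplus> \<lbrakk>span_term n G\<rbrakk>) \<fatsemi> \<lbrakk>add_vec_term v\<rbrakk>"
proof -
  have [simp]: "length v = n" "vectors n G" using assms by simp_all
  have "\<lbrakk>span_term n (v # G)\<rbrakk> = ((all \<boxplus> alls (length G)) \<fatsemi> (\<I> 1 \<boxplus> \<lbrakk>comb_term n G\<rbrakk>)) \<fatsemi> \<lbrakk>add_vec_term v\<rbrakk>"
    by (simp add: span_term_def seq_seq)
  then show ?thesis by (simp add: tens_seq span_term_def)
qed

lemma span_term_cong:
  assumes "vectors n G" "vectors n G'" "length v = n" "\<lbrakk>span_term n G\<rbrakk> = \<lbrakk>span_term n G'\<rbrakk>"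
  shows "\<lbrakk>span_term n (v # G)\<rbrakk> = \<lbrakk>span_term n (v # G')\<rbrakk>"
  using assms by (simp add: span_term_Cons)

text \<open>Free parameters may be transformed by any function term \<open>t\<close> that fixes a
  pair of arbitrary values. The assumption \<open>eq\<close> says that inserting \<open>t\<close>
  replaces \<open>G\<close> by \<open>G'\<close>, and \<open>eval_fn_eq\<close> turns this into an
  equation of arrows.\<close>

lemma span_term_change:
  assumes G: "vectors n G" "vectors n G'" "length G = Suc (Suc k)" "length G' = Suc (Suc k)"
    and t: "fn_term t" "has_type ih_arity t 2 2" "(all \<boxplus> all) \<fatsemi> \<lbrakk>t\<rbrakk> = all \<boxplus> all"
    and eq: "\<And>a b us. length us = k \<Longrightarrow> comb n (act laurent_ops t [a, b] @ us) G = comb n (a # b # us) G'"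
  shows "\<lbrakk>span_term n G'\<rbrakk> = \<lbrakk>span_term n G\<rbrakk>"
proof -
  let ?t = "(t \<oplus>\<^sub>t id_term k) ;; comb_term n G"
  have tk: "has_type ih_arity (t \<oplus>\<^sub>t id_term k) (2 + k) (2 + k)" using t(2) by (rule has_type.intros) simp
  have ty: "has_type ih_arity ?t (2 + k) n"
    using tk has_type_comb[OF G(1)] G(3) by (simp del: has_type_simps) (rule has_type.intros)
  have "\<lbrakk>?t\<rbrakk> = \<lbrakk>comb_term n G'\<rbrakk>"
  proof (rule eval_fn_eq[OF _ ty])
    fix xs :: "'k laurent list" assume "length xs = 2 + k"
    then obtain a b us where xs: "xs = a # b # us" "length us = k"
      by (metis add_2_eq_Suc length_Suc_conv)
    have "length (act laurent_ops t [a, b]) = 2" using length_act[OF t(1,2), of "[a, b]"] by simp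
    then show "act laurent_ops ?t xs = act laurent_ops (comb_term n G') xs"
      using eq[of us a b] xs G by (simp add: act_comb term_src[OF t(2)] numeral_2_eq_2)
  qed (use t has_type_comb[OF G(2)] G(4) in simp_all)
  then have M: "\<lbrakk>t \<oplus>\<^sub>t id_term k\<rbrakk> \<fatsemi> \<lbrakk>comb_term n G\<rbrakk> = \<lbrakk>comb_term n G'\<rbrakk>" by simp
  have A: "alls (Suc (Suc k)) \<fatsemi> \<lbrakk>t \<oplus>\<^sub>t id_term k\<rbrakk> = alls (Suc (Suc k))"
  proof -
    have "alls (Suc (Suc k)) = (all \<boxplus> all) \<boxplus> alls k" by (simp add: tens_tens)
    then show ?thesis using eval_type[OF t(2)] t(3) by (simp add: tens_seq)
  qed
  have "\<lbrakk>span_term n G'\<rbrakk> = alls (Suc (Suc k)) \<fatsemi> (\<lbrakk>t \<oplus>\<^sub>t id_term k\<rbrakk> \<fatsemi> \<lbrakk>comb_term n G\<rbrakk>)"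
    unfolding M by (simp add: span_term_def G)
  also have "\<dots> = (alls (Suc (Suc k)) \<fatsemi> \<lbrakk>t \<oplus>\<^sub>t id_term k\<rbrakk>) \<fatsemi> \<lbrakk>comb_term n G\<rbrakk>"
    using eval_type[OF tk] G by (intro seq_seq[symmetric]) simp_all
  finally show ?thesis unfolding A by (simp add: span_term_def G)
qed

lemma span_term_swap:
  assumes "vectors n (v # w # G)"
  shows "\<lbrakk>span_term n (v # w # G)\<rbrakk> = \<lbrakk>span_term n (w # v # G)\<rbrakk>"
proof (rule span_term_change[where t = Tw and k = "length G"])
  show "(all \<boxplus> all) \<fatsemi> \<lbrakk>Tw\<rbrakk> = all \<boxplus> all" using braid_nat[of all all 0 0 1 1] by simp
qed (use assms in \<open>simp_all add: vadd_ac\<close>)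

lemma transvection: "has_type ih_arity (transvection r) 2 2" "fn_term (transvection r)"
  "act laurent_ops (transvection r) [a, b] = [a, r * a + b]"
  by (auto simp: transvection_def has_type_laurent_map numeral_2_eq_2 intro!: exI[of _ 3])

text \<open>The second parameter is arbitrary, so it absorbs the multiple of the first added to it.
  The copy of the first that produced this multiple is thereby deleted.\<close>

lemma all_all_transvection: "(all \<boxplus> all) \<fatsemi> \<lbrakk>transvection r\<rbrakk> = all \<boxplus> all"
proof -
  define L where "L = \<lbrakk>laurent_map r\<rbrakk>"
  have [simp]: "arr L" "src L = 1" "tgt L = 1" using eval_type[OF laurent_map(1)[of r]] by (simp_all add: L_def)
  have "\<lbrakk>laurent_map r ;; zero_op\<rbrakk> = \<lbrakk>zero_op\<rbrakk>"
    by (rule eval_fn_eq[of _ 1 0]) (auto simp: has_type_laurent_map length_Suc_conv)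
  then have L_del: "L \<fatsemi> del = del" by (simp add: L_def)
  have "(\<I> 1 \<boxplus> all) \<fatsemi> ((L \<boxplus> \<I> 1) \<fatsemi> merge) = (L \<boxplus> all) \<fatsemi> merge"
    by (simp add: tens_seq flip: seq_seq)
  also have "\<dots> = L \<fatsemi> ((\<I> 1 \<boxplus> all) \<fatsemi> merge)"
    using tens_split1[of L all] by (simp add: seq_seq)
  also have "\<dots> = (L \<fatsemi> del) \<fatsemi> all" using merge_all by (simp add: seq_seq)
  finally have 1: "(\<I> 1 \<boxplus> all) \<fatsemi> ((L \<boxplus> \<I> 1) \<fatsemi> merge) = del \<boxplus> all"
    using tens_split1[of del all] by (simp add: L_del)
  have "(all \<boxplus> all) \<fatsemi> \<lbrakk>transvection r\<rbrakk> = (all \<boxplus> all) \<fatsemi> ((dup \<boxplus> \<I> 1) \<fatsemi> (\<I> 1 \<boxplus> ((L \<boxplus> \<I> 1) \<fatsemi> merge)))"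
    by (simp add: transvection_def L_def)
  also have "\<dots> = ((all \<boxplus> all) \<fatsemi> (dup \<boxplus> \<I> 1)) \<fatsemi> (\<I> 1 \<boxplus> ((L \<boxplus> \<I> 1) \<fatsemi> merge))"
    by (simp add: seq_seq)
  also have "(all \<boxplus> all) \<fatsemi> (dup \<boxplus> \<I> 1) = (all \<fatsemi> dup) \<fatsemi> (\<I> 1 \<boxplus> (\<I> 1 \<boxplus> all))"
    using tens_split1[of "all \<fatsemi> dup" all] by (simp add: tens_seq tens_ide_ide numeral_2_eq_2)
  also have "((all \<fatsemi> dup) \<fatsemi> (\<I> 1 \<boxplus> (\<I> 1 \<boxplus> all))) \<fatsemi> (\<I> 1 \<boxplus> ((L \<boxplus> \<I> 1) \<fatsemi> merge)) =
      (all \<fatsemi> dup) \<fatsemi> ((\<I> 1 \<boxplus> (\<I> 1 \<boxplus> all)) \<fatsemi> (\<I> 1 \<boxplus> ((L \<boxplus> \<I> 1) \<fatsemi> merge)))"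
    by (simp add: seq_seq)
  also have "(\<I> 1 \<boxplus> (\<I> 1 \<boxplus> all)) \<fatsemi> (\<I> 1 \<boxplus> ((L \<boxplus> \<I> 1) \<fatsemi> merge)) = \<I> 1 \<boxplus> (del \<boxplus> all)"
    using 1 by (simp add: tens_seq)
  also have "\<dots> = (\<I> 1 \<boxplus> del) \<fatsemi> (\<I> 1 \<boxplus> all)"
    using tens_split1[of "\<I> 1 \<boxplus> del" all] by (simp add: tens_tens)
  also have "(all \<fatsemi> dup) \<fatsemi> ((\<I> 1 \<boxplus> del) \<fatsemi> (\<I> 1 \<boxplus> all)) = all \<fatsemi> ((dup \<fatsemi> (\<I> 1 \<boxplus> del)) \<fatsemi> (\<I> 1 \<boxplus> all))"
    by (simp add: seq_seq)
  also have "\<dots> = all \<boxplus> all"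
    using comonoid_counit_right[OF comonoid_1] tens_split1[of all all] by simp
  finally show ?thesis .
qed

lemma span_term_transvect:
  assumes "vectors n (v # w # G)"
  shows "\<lbrakk>span_term n (vadd v (vscale r w) # w # G)\<rbrakk> = \<lbrakk>span_term n (v # w # G)\<rbrakk>"
proof (rule span_term_change[where t = "transvection r" and k = "length G"])
  fix a b and us :: "'k laurent list"
  show "comb n (act laurent_ops (transvection r) [a, b] @ us) (v # w # G) = comb n (a # b # us) (vadd v (vscale r w) # w # G)"
    by (simp add: transvection vscale_vadd vadd_ac mult.commute flip: vscale_simps(4))
qed (use assms all_all_transvection transvection in simp_all)

lemma span_term_zero:
  assumes "vectors n G" shows "\<lbrakk>span_term n (vzero n # G)\<rbrakk> = \<lbrakk>span_term n G\<rbrakk>"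
proof -
  let ?t = "zero_op \<oplus>\<^sub>t comb_term n G"
  have ty: "has_type ih_arity ?t (Suc (length G)) n"
    using has_type.intros(6)[of ih_arity zero_op 1 0, OF _ has_type_comb[OF assms]] by simp
  have "\<lbrakk>?t\<rbrakk> = \<lbrakk>comb_term n (vzero n # G)\<rbrakk>"
  proof (rule eval_fn_eq[OF _ ty])
    fix xs :: "'k laurent list" assume "length xs = Suc (length G)"
    then obtain a us where xs: "xs = a # us" "length us = length G" by (metis length_Suc_conv)
    have "act laurent_ops (comb_term n (vzero n # G)) xs = comb n xs (vzero n # G)"
      using assms xs by (intro act_comb) simp_all
    then show "act laurent_ops ?t xs = act laurent_ops (comb_term n (vzero n # G)) xs"
      using xs assms by (simp add: act_comb)
  qed (use has_type_comb[of n "vzero n # G"] assms in simp_all)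
  then show ?thesis
    using assms by (simp add: span_term_def tens_seq bones del: comb_term.simps flip: \<open>\<lbrakk>?t\<rbrakk> = _\<close>)
qed

lemma span_term_move:
  "vectors n (G1 @ v # G2) \<Longrightarrow> \<lbrakk>span_term n (G1 @ v # G2)\<rbrakk> = \<lbrakk>span_term n (v # G1 @ G2)\<rbrakk>"
proof (induction G1)
  case (Cons a G1)
  then have "\<lbrakk>span_term n ((a # G1) @ v # G2)\<rbrakk> = \<lbrakk>span_term n (a # v # G1 @ G2)\<rbrakk>"
    using span_term_cong[of n "G1 @ v # G2" "v # G1 @ G2" a] by simp
  also have "\<dots> = \<lbrakk>span_term n (v # a # G1 @ G2)\<rbrakk>"
    using Cons by (intro span_term_swap) simp
  finally show ?case by simp
qed simp

lemma span_term_append_commute: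
  "vectors n (G @ G') \<Longrightarrow> \<lbrakk>span_term n (G @ G')\<rbrakk> = \<lbrakk>span_term n (G' @ G)\<rbrakk>"
proof (induction G)
  case (Cons a G)
  then have "\<lbrakk>span_term n ((a # G) @ G')\<rbrakk> = \<lbrakk>span_term n (a # G' @ G)\<rbrakk>"
    using span_term_cong[of n "G @ G'" "G' @ G" a] by simp
  also have "\<dots> = \<lbrakk>span_term n (G' @ a # G)\<rbrakk>"
    using Cons by (intro span_term_move[symmetric]) simp
  finally show ?case .
qed simp

lemma span_term_add:
  assumes "vectors n (w # G)" "v \<in> set G"
  shows "\<lbrakk>span_term n (vadd w (vscale r v) # G)\<rbrakk> = \<lbrakk>span_term n (w # G)\<rbrakk>"
proof -
  obtain G1 G2 where G: "G = G1 @ v # G2" using assms(2) by (meson split_list)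
  have vec: "vectors n (w # v # G1 @ G2)" "vectors n (G1 @ v # G2)" using assms by (simp_all add: G)
  have move: "\<lbrakk>span_term n (x # G)\<rbrakk> = \<lbrakk>span_term n (x # v # G1 @ G2)\<rbrakk>" if "length x = n" for x
    unfolding G using vec that by (intro span_term_cong span_term_move) simp_all
  show ?thesis using span_term_transvect[OF vec(1)] vec move by simp
qed

lemma span_term_comb:
  "vectors n (w # G) \<Longrightarrow> set G2 \<subseteq> set G \<Longrightarrow> length us = length G2 \<Longrightarrow>
    \<lbrakk>span_term n (vadd w (comb n us G2) # G)\<rbrakk> = \<lbrakk>span_term n (w # G)\<rbrakk>"
proof (induction G2 arbitrary: us w)
  case (Cons v G2)
  then obtain u vs where us: "us = u # vs" "length vs = length G2" by (metis length_Suc_conv list.size(4))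
  have v: "v \<in> set G" "length v = n" using Cons.prems by (auto simp: vectors_def)
  have "\<lbrakk>span_term n (vadd (vadd w (vscale u v)) (comb n vs G2) # G)\<rbrakk> = \<lbrakk>span_term n (vadd w (vscale u v) # G)\<rbrakk>"
    using Cons.prems us v by (intro Cons.IH) auto
  also have "\<dots> = \<lbrakk>span_term n (w # G)\<rbrakk>" using Cons.prems v by (intro span_term_add) auto
  finally show ?case by (simp add: us vadd_assoc)
qed simp

lemma span_term_redundant:
  assumes "vectors n G" "v \<in> vspan n G" shows "\<lbrakk>span_term n (v # G)\<rbrakk> = \<lbrakk>span_term n G\<rbrakk>"
proof -
  obtain us where us: "v = comb n us G" "length us = length G" using assms(2) by (auto simp: vspan_def)
  have "\<lbrakk>span_term n (vadd (vzero n) (comb n us G) # G)\<rbrakk> = \<lbrakk>span_term n (vzero n # G)\<rbrakk>"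
    using assms us by (intro span_term_comb) simp_all
  then show ?thesis using assms us by (simp add: span_term_zero)
qed

text \<open>Both sides are compared with the concatenation of the lists: over \<open>G'\<close> the
  vectors of \<open>G\<close> are redundant, and conversely.\<close>

theorem span_term_eqI:
  assumes G: "vectors n G" and G': "vectors n G'" and eq: "vspan n G = vspan n G'"
  shows "\<lbrakk>span_term n G\<rbrakk> = \<lbrakk>span_term n G'\<rbrakk>"
proof -
  have absorb: "\<lbrakk>span_term n (H @ H')\<rbrakk> = \<lbrakk>span_term n H'\<rbrakk>"
    if "vectors n H" "vectors n H'" "set H \<subseteq> vspan n H'" for H H'
    using that
  proof (induction H)
    case (Cons v H)
    then have "\<lbrakk>span_term n (v # (H @ H'))\<rbrakk> = \<lbrakk>span_term n (H @ H')\<rbrakk>"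
      by (intro span_term_redundant vspan_appendI) auto
    with Cons show ?case by simp
  qed simp
  have subset: "set G \<subseteq> vspan n G'" and subset': "set G' \<subseteq> vspan n G"
    using vspan_mem[OF G] vspan_mem[OF G'] eq by blast+
  have "\<lbrakk>span_term n G'\<rbrakk> = \<lbrakk>span_term n (G @ G')\<rbrakk>"
    using absorb[OF G G' subset] by simp
  also have "\<dots> = \<lbrakk>span_term n (G' @ G)\<rbrakk>" using G G' by (intro span_term_append_commute) simp
  also have "\<dots> = \<lbrakk>span_term n G\<rbrakk>" using absorb[OF G' G subset'] by simp
  finally show ?thesis by simp
qed


subsection \<open>Closure under composition\<close>

text \<open>Free parameters followed by an arbitrary function term. This is easier to preserve under
  composition than the span form, into which \<open>state_span_term\<close> converts it when
  needed.\<close>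

definition state :: "nat \<Rightarrow> 'a \<Rightarrow> bool" where
  "state n x \<longleftrightarrow> (\<exists>d t. fn_term t \<and> has_type ih_arity t d n \<and> x = alls d \<fatsemi> \<lbrakk>t\<rbrakk>)"

lemma stateI: "fn_term t \<Longrightarrow> has_type ih_arity t d n \<Longrightarrow> state n (alls d \<fatsemi> \<lbrakk>t\<rbrakk>)"
  unfolding state_def by blast

lemma state_types: "state n x \<Longrightarrow> arr x \<and> src x = 0 \<and> tgt x = n"
  unfolding state_def using eval_type by force

lemma state_fn:
  assumes "state m x" "fn_term t" "has_type ih_arity t m n" shows "state n (x \<fatsemi> \<lbrakk>t\<rbrakk>)"
proof -
  obtain d u where u: "fn_term u" "has_type ih_arity u d m" "x = alls d \<fatsemi> \<lbrakk>u\<rbrakk>" using assms(1) by (auto simp: state_def)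
  have "x \<fatsemi> \<lbrakk>t\<rbrakk> = alls d \<fatsemi> \<lbrakk>u ;; t\<rbrakk>"
    using eval_type[OF u(2)] eval_type[OF assms(3)] u(3) by (simp add: seq_seq)
  moreover have "has_type ih_arity (u ;; t) d n" using u(2) assms(3) by (rule has_type.intros)
  ultimately show ?thesis using stateI[of "u ;; t" d n] u(1) assms(2) by simp
qed

text \<open>The vectors are the images of the unit vectors, that is, the rows of the matrix of the
  function term.\<close>

lemma state_span_term:
  assumes "state n x" shows "\<exists>G. vectors n G \<and> x = \<lbrakk>span_term n G\<rbrakk>"
proof -
  obtain d t where t: "fn_term t" "has_type ih_arity t d n" "x = alls d \<fatsemi> \<lbrakk>t\<rbrakk>" using assms by (auto simp: state_def)
  define G where "G = map (act laurent_ops t) (unit_vectors d)"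
  have G: "vectors n G" "length G = d"
    using length_act[OF t(1,2), of _ laurent_ops] unit_vectors(1)[of d] by (auto simp: G_def vectors_def)
  have "\<lbrakk>t\<rbrakk> = \<lbrakk>comb_term n G\<rbrakk>"
  proof (rule eval_fn_eq[OF t(1,2)])
    fix xs :: "'k laurent list" assume xs: "length xs = d"
    have "act laurent_ops t (comb d xs (unit_vectors d)) = comb n xs G"
      unfolding G_def using xs by (intro act_comb_map[OF t(1,2)]) simp_all
    then show "act laurent_ops t xs = act laurent_ops (comb_term n G) xs"
      using G xs by (simp add: act_comb comb_unit_vectors)
  qed (use has_type_comb[OF G(1)] G in simp_all)
  then show ?thesis using G t(3) by (intro exI[of _ G]) (simp add: span_term_def)
qed

text \<open>The idle wires on both sides make the property pass to tensors, whose factors are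
  applied one after the other while the remaining wires wait.\<close>

definition closed :: "'a \<Rightarrow> bool" where
  "closed a \<longleftrightarrow> arr a \<and> (\<forall>k l x. state (k + (src a + l)) x \<longrightarrow> state (k + (tgt a + l)) (x \<fatsemi> (\<I> k \<boxplus> (a \<boxplus> \<I> l))))"

lemma closed_seq: assumes "closed a" "closed b" "tgt a = src b" shows "closed (a \<fatsemi> b)"
  unfolding closed_def
proof (intro conjI allI impI)
  have [simp]: "arr a" "arr b" using assms by (auto simp: closed_def)
  show "arr (a \<fatsemi> b)" using assms(3) by simp
  fix k l x assume x: "state (k + (src (a \<fatsemi> b) + l)) x"
  have "state (k + (tgt b + l)) ((x \<fatsemi> (\<I> k \<boxplus> (a \<boxplus> \<I> l))) \<fatsemi> (\<I> k \<boxplus> (b \<boxplus> \<I> l)))"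
    using assms x unfolding closed_def by simp
  also have "(x \<fatsemi> (\<I> k \<boxplus> (a \<boxplus> \<I> l))) \<fatsemi> (\<I> k \<boxplus> (b \<boxplus> \<I> l)) = x \<fatsemi> (\<I> k \<boxplus> ((a \<fatsemi> b) \<boxplus> \<I> l))"
    using state_types[OF x] assms(3) by (simp add: seq_seq tens_seq)
  finally show "state (k + (tgt (a \<fatsemi> b) + l)) (x \<fatsemi> (\<I> k \<boxplus> ((a \<fatsemi> b) \<boxplus> \<I> l)))" using assms(3) by simp
qed

lemma closed_tens: assumes "closed a" "closed b" shows "closed (a \<boxplus> b)"
  unfolding closed_def
proof (intro conjI allI impI)
  have [simp]: "arr a" "arr b" using assms by (auto simp: closed_def)
  show "arr (a \<boxplus> b)" by simp
  fix k l x assume x: "state (k + (src (a \<boxplus> b) + l)) x"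
  then have "state (k + (src a + (src b + l))) x" by (simp add: add_ac)
  then have "state (k + (tgt a + (src b + l))) (x \<fatsemi> (\<I> k \<boxplus> (a \<boxplus> \<I> (src b + l))))"
    using assms(1) unfolding closed_def by blast
  then have "state ((k + tgt a) + (src b + l)) (x \<fatsemi> (\<I> k \<boxplus> (a \<boxplus> \<I> (src b + l))))" by (simp add: add_ac)
  then have "state ((k + tgt a) + (tgt b + l)) ((x \<fatsemi> (\<I> k \<boxplus> (a \<boxplus> \<I> (src b + l)))) \<fatsemi> (\<I> (k + tgt a) \<boxplus> (b \<boxplus> \<I> l)))"
    using assms(2) unfolding closed_def by blast
  also have "(x \<fatsemi> (\<I> k \<boxplus> (a \<boxplus> \<I> (src b + l)))) \<fatsemi> (\<I> (k + tgt a) \<boxplus> (b \<boxplus> \<I> l)) =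
      x \<fatsemi> ((\<I> k \<boxplus> (a \<boxplus> \<I> (src b + l))) \<fatsemi> (\<I> k \<boxplus> (\<I> (tgt a) \<boxplus> (b \<boxplus> \<I> l))))"
    using state_types[OF x] by (simp add: seq_seq tens_ide_ide add_ac)
  also have "(\<I> k \<boxplus> (a \<boxplus> \<I> (src b + l))) \<fatsemi> (\<I> k \<boxplus> (\<I> (tgt a) \<boxplus> (b \<boxplus> \<I> l))) = \<I> k \<boxplus> ((a \<boxplus> b) \<boxplus> \<I> l)"
    by (simp add: tens_seq tens_tens)
  finally show "state (k + (tgt (a \<boxplus> b) + l)) (x \<fatsemi> (\<I> k \<boxplus> ((a \<boxplus> b) \<boxplus> \<I> l)))" by (simp add: add_ac)
qed

lemma closed_fn: assumes "fn_term t" "has_type ih_arity t m n" shows "closed \<lbrakk>t\<rbrakk>"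
  unfolding closed_def
proof (intro conjI allI impI)
  note [simp] = eval_type[OF assms(2)]
  show "arr \<lbrakk>t\<rbrakk>" by simp
  fix k l x assume x: "state (k + (src \<lbrakk>t\<rbrakk> + l)) x"
  have "has_type ih_arity (id_term k \<oplus>\<^sub>t (t \<oplus>\<^sub>t id_term l)) (k + (m + l)) (k + (n + l))"
    using assms(2) by (intro has_type.intros(6)) simp_all
  from state_fn[OF _ _ this] x assms(1)
  show "state (k + (tgt \<lbrakk>t\<rbrakk> + l)) (x \<fatsemi> (\<I> k \<boxplus> (\<lbrakk>t\<rbrakk> \<boxplus> \<I> l)))" by simp
qed

lemma fn_term_braid1[simp]: "fn_term (braid1_term n)"
  by (induction n) auto

lemma fn_term_braid[simp]: "fn_term (braid_term m n)"
  by (induction m) auto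

lemma closed_all: "closed all"
  unfolding closed_def
proof (intro conjI allI impI)
  fix k l x assume "state (k + (src all + l)) x"
  then obtain d t where t: "fn_term t" "has_type ih_arity t d (k + l)" "x = alls d \<fatsemi> \<lbrakk>t\<rbrakk>" by (auto simp: state_def)
  note [simp] = eval_type[OF t(2)]
  \<comment> \<open>The new parameter is created in front of the old ones and braided past the first
    \<open>k\<close> outputs.\<close>
  let ?t = "(Id \<oplus>\<^sub>t t) ;; (braid_term 1 k \<oplus>\<^sub>t id_term l)"
  have b: "has_type ih_arity (braid_term 1 k \<oplus>\<^sub>t id_term l) ((1 + k) + l) ((k + 1) + l)"
    by (intro has_type.intros(6) has_type_braid) simp
  have "has_type ih_arity (Id \<oplus>\<^sub>t t) (1 + d) (1 + (k + l))"
    by (intro has_type.intros t)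
  with b have ty: "has_type ih_arity ?t (Suc d) (k + (1 + l))"
    by (intro has_type.intros(5)[of _ _ _ "1 + k + l"]) (simp_all del: has_type_simps add: add_ac)
  have "\<I> k \<boxplus> all = (all \<boxplus> \<I> k) \<fatsemi> \<X> 1 k" using braid_nat[of all "\<I> k" 0 k 1 k] by simp
  then have "\<I> k \<boxplus> (all \<boxplus> \<I> l) = ((all \<boxplus> \<I> k) \<fatsemi> \<X> 1 k) \<boxplus> \<I> l"
    by (simp flip: tens_tens)
  also have "\<dots> = ((all \<boxplus> \<I> k) \<boxplus> \<I> l) \<fatsemi> (\<X> 1 k \<boxplus> \<I> l)" by (simp add: tens_seq)
  finally have e: "\<I> k \<boxplus> (all \<boxplus> \<I> l) = (all \<boxplus> \<I> (k + l)) \<fatsemi> (\<X> 1 k \<boxplus> \<I> l)"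
    by (simp add: tens_tens tens_ide)
  have "x \<fatsemi> (all \<boxplus> \<I> (k + l)) = all \<boxplus> x"
    using tens_split2[of all x] t(3) by simp
  also have "\<dots> = alls (Suc d) \<fatsemi> (\<I> 1 \<boxplus> \<lbrakk>t\<rbrakk>)" by (simp add: t(3) tens_seq)
  finally have "x \<fatsemi> (\<I> k \<boxplus> (all \<boxplus> \<I> l)) = alls (Suc d) \<fatsemi> \<lbrakk>?t\<rbrakk>"
  proof -
    assume *: "x \<fatsemi> (all \<boxplus> \<I> (k + l)) = alls (Suc d) \<fatsemi> (\<I> 1 \<boxplus> \<lbrakk>t\<rbrakk>)"
    have "x \<fatsemi> (\<I> k \<boxplus> (all \<boxplus> \<I> l)) = (x \<fatsemi> (all \<boxplus> \<I> (k + l))) \<fatsemi> (\<X> 1 k \<boxplus> \<I> l)"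
      unfolding e using t(3) by (simp add: seq_seq)
    also have "\<dots> = alls (Suc d) \<fatsemi> ((\<I> 1 \<boxplus> \<lbrakk>t\<rbrakk>) \<fatsemi> \<lbrakk>braid_term 1 k \<oplus>\<^sub>t id_term l\<rbrakk>)"
      unfolding * by (simp add: seq_seq del: braid_term.simps One_nat_def)
    finally show ?thesis by (simp del: alls_term.simps braid_term.simps One_nat_def)
  qed
  then show "state (k + (tgt all + l)) (x \<fatsemi> (\<I> k \<boxplus> (all \<boxplus> \<I> l)))"
    using stateI[OF _ ty] t(1) by simp
qed simp

text \<open>The crux of closure. In echelon form the first coordinate equals g u, where u is the
  parameter of the pivot vector. If g is 0, that coordinate is the constant 0 and the black bone
  removes it. Otherwise the test of g u becomes a test of u, which fixes u to be 0 and eliminates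
  the pivot.\<close>

lemma state_test_head:
  assumes "state (Suc n) x" shows "state n (x \<fatsemi> (test \<boxplus> \<I> n))"
proof -
  obtain H where H: "vectors (Suc n) H" "x = \<lbrakk>span_term (Suc n) H\<rbrakk>" using state_span_term[OF assms] by blast
  obtain g v S' where gv: "length v = n" "submodule n S'" "g = 0 \<Longrightarrow> v = vzero n"
    "vspan (Suc n) H = {vadd (vscale a (g # v)) (0 # y) |a y. y \<in> S'}"
    by (rule echelon_step[OF submodule_vspan[OF H(1)]]) blast
  obtain G where G: "vectors n G" "vspan n G = S'" using submodule_basis[OF gv(2)] by blast
  let ?G = "(g # v) # map ((#) 0) G" and ?A = "alls (length G)"
  have x: "x = \<lbrakk>span_term (Suc n) ?G\<rbrakk>"
    unfolding H(2) using H(1) G gv by (intro span_term_eqI) (simp_all add: vspan_Cons0)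
  show ?thesis
  proof (cases "g = 0")
    case True
    \<comment> \<open>The pivot is the zero vector and has been removed, so the first coordinate is
      constantly 0.\<close>
    let ?t = "disc_op \<oplus>\<^sub>t comb_term n G"
    have ty: "has_type ih_arity ?t (length G) (Suc n)"
      using has_type.intros(6)[of ih_arity disc_op 0 1, OF _ has_type_comb[OF G(1)]] by simp
    have "\<lbrakk>?t\<rbrakk> = \<lbrakk>comb_term (Suc n) (map ((#) 0) G)\<rbrakk>"
      by (rule eval_fn_eq[OF _ ty])
        (use G(1) has_type_comb[of "Suc n" "map ((#) 0) G"] in \<open>simp_all add: act_comb comb_Cons0\<close>)
    then have "x = ?A \<fatsemi> (nil \<boxplus> \<lbrakk>comb_term n G\<rbrakk>)"
      using x True gv(3) span_term_zero[of "Suc n" "map ((#) 0) G"] G(1) by (simp add: span_term_def)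
    then have "x \<fatsemi> (test \<boxplus> \<I> n) = ?A \<fatsemi> ((nil \<fatsemi> test) \<boxplus> \<lbrakk>comb_term n G\<rbrakk>)"
      using G(1) by (simp add: seq_seq tens_seq)
    then show ?thesis using stateI[OF _ has_type_comb[OF G(1)]] G(1) by (simp add: bones)
  next
    case False
    let ?d = "length G"
    \<comment> \<open>The pivot parameter is copied: one copy, times \<open>g\<close>, is the first
      coordinate, and the other is the coefficient of \<open>v\<close>.\<close>
    let ?t = "(add_op \<oplus>\<^sub>t id_term ?d) ;; (laurent_map g \<oplus>\<^sub>t comb_term n (v # G))"
    let ?u = "(disc_op \<oplus>\<^sub>t id_term ?d) ;; comb_term n (v # G)"
    let ?M = "\<lbrakk>comb_term n (v # G)\<rbrakk>"
    have vG: "vectors n (v # G)" using G gv by simp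
    note [simp del] = comb_term.simps
    note [simp] = state_type(4-6)[OF vG] eval_type[OF laurent_map(1)[of g], simplified]
    have "has_type ih_arity (add_op \<oplus>\<^sub>t id_term ?d) (1 + ?d) (2 + ?d)" by (rule has_type.intros) simp_all
    moreover have "has_type ih_arity (laurent_map g \<oplus>\<^sub>t comb_term n (v # G)) (1 + Suc ?d) (1 + n)"
      using has_type.intros(6)[OF laurent_map(1)[of g] has_type_comb[OF vG]] by simp
    ultimately have ty: "has_type ih_arity ?t (Suc ?d) (Suc n)"
      by (intro has_type.intros(5)[of _ _ _ "2 + ?d"]) (simp_all del: has_type_simps)
    have tyu: "has_type ih_arity ?u ?d n"
      using has_type_comb[OF vG] has_type.intros(6)[of ih_arity disc_op 0 1 "id_term ?d" ?d ?d]
      by (intro has_type.intros(5)[of _ _ _ "Suc ?d"]) (simp_all del: has_type_simps(5,6))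
    have "\<lbrakk>?t\<rbrakk> = \<lbrakk>comb_term (Suc n) ?G\<rbrakk>"
    proof (rule eval_fn_eq[OF _ ty])
      fix xs :: "'k laurent list" assume "length xs = Suc ?d"
      then obtain a us where xs: "xs = a # us" "length us = ?d" by (metis length_Suc_conv)
      have "act laurent_ops (comb_term (Suc n) ?G) xs = comb (Suc n) xs ?G"
        using vG xs by (intro act_comb) simp_all
      moreover have "act laurent_ops (comb_term n (v # G)) xs = comb n xs (v # G)"
        using vG xs by (intro act_comb) simp_all
      ultimately show "act laurent_ops ?t xs = act laurent_ops (comb_term (Suc n) ?G) xs"
        using xs by (simp add: comb_Cons0 mult.commute)
    qed (use has_type_comb[of "Suc n" ?G] vG in simp_all)
    then have "x = (all \<boxplus> ?A) \<fatsemi> ((dup \<boxplus> \<I> ?d) \<fatsemi> (\<lbrakk>laurent_map g\<rbrakk> \<boxplus> ?M))"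
      using x by (simp add: span_term_def)
    then have "x \<fatsemi> (test \<boxplus> \<I> n) = ((all \<fatsemi> dup) \<boxplus> ?A) \<fatsemi> ((\<lbrakk>laurent_map g\<rbrakk> \<boxplus> ?M) \<fatsemi> (test \<boxplus> \<I> n))"
      by (simp add: seq_seq tens_seq flip: seq_seq[of "all \<boxplus> ?A"])
    also have "(\<lbrakk>laurent_map g\<rbrakk> \<boxplus> ?M) \<fatsemi> (test \<boxplus> \<I> n) = test \<boxplus> ?M"
      using laurent_map_test[OF False] by (simp add: tens_seq)
    also have "\<dots> = ((test \<boxplus> \<I> 1) \<boxplus> \<I> ?d) \<fatsemi> ?M"
      using tens_split1[of test ?M] by (simp add: tens_tens tens_ide)
    also have "((all \<fatsemi> dup) \<boxplus> ?A) \<fatsemi> (((test \<boxplus> \<I> 1) \<boxplus> \<I> ?d) \<fatsemi> ?M) =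
       ((all \<fatsemi> (dup \<fatsemi> (test \<boxplus> \<I> 1))) \<boxplus> ?A) \<fatsemi> ?M"
      by (simp add: seq_seq tens_seq numeral_2_eq_2 flip: seq_seq[of "(all \<fatsemi> dup) \<boxplus> ?A"])
    \<comment> \<open>The tested parameter becomes the constant 0 for the coefficient of
      \<open>v\<close> as well, and the scalar \<open>all ; test\<close> disappears.\<close>
    also have "all \<fatsemi> (dup \<fatsemi> (test \<boxplus> \<I> 1)) = (all \<fatsemi> test) \<fatsemi> nil"
      using dup_test by (simp add: seq_seq)
    also have "((all \<fatsemi> test) \<fatsemi> nil) \<boxplus> ?A = ?A \<fatsemi> (nil \<boxplus> \<I> ?d)"
      using tens_split2[of nil ?A] by (simp add: bones)
    also have "(?A \<fatsemi> (nil \<boxplus> \<I> ?d)) \<fatsemi> ?M = ?A \<fatsemi> \<lbrakk>?u\<rbrakk>" by (simp add: seq_seq)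
    finally show ?thesis using stateI[OF _ tyu] by simp
  qed
qed

lemma closed_test: "closed test"
  unfolding closed_def
proof (intro conjI allI impI)
  fix k l x assume x: "state (k + (src test + l)) x"
  have "\<I> k \<boxplus> test = \<X> k 1 \<fatsemi> (test \<boxplus> \<I> k)" using braid_nat[of "\<I> k" test k 1 k 0] by simp
  then have "\<I> k \<boxplus> (test \<boxplus> \<I> l) = (\<X> k 1 \<fatsemi> (test \<boxplus> \<I> k)) \<boxplus> \<I> l"
    by (simp flip: tens_tens)
  also have "\<dots> = (\<X> k 1 \<boxplus> \<I> l) \<fatsemi> ((test \<boxplus> \<I> k) \<boxplus> \<I> l)" by (simp add: tens_seq)
  finally have e: "\<I> k \<boxplus> (test \<boxplus> \<I> l) = (\<X> k 1 \<boxplus> \<I> l) \<fatsemi> (test \<boxplus> \<I> (k + l))"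
    by (simp add: tens_tens tens_ide)
  have "has_type ih_arity (braid_term k 1 \<oplus>\<^sub>t id_term l) ((k + 1) + l) ((1 + k) + l)"
    by (intro has_type.intros(6) has_type_braid) simp
  from state_fn[OF _ _ this, of x] x have "state (Suc (k + l)) (x \<fatsemi> (\<X> k 1 \<boxplus> \<I> l))" by simp
  from state_test_head[OF this]
  show "state (k + (tgt test + l)) (x \<fatsemi> (\<I> k \<boxplus> (test \<boxplus> \<I> l)))"
    unfolding e using state_types[OF x] by (simp add: seq_seq)
qed simp

text \<open>Besides function terms only \<open>all\<close> and \<open>test\<close> have to be
  treated directly. The Frobenius laws express \<open>codup\<close> and \<open>comerge\<close> by
  them, a nonzero scalar is inverted, and the mirror of the scalar 0 is
  \<open>test ; all\<close>.\<close>

lemma closed_gen: "closed (\<gamma> g)"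
proof -
  have fn: "closed (\<gamma> g)" if "fn_term (Gen g)" for g
    using closed_fn[OF that, of "fst (ih_arity g)" "snd (ih_arity g)"] by simp
  have I: "closed (\<I> 1)" using closed_fn[of Id 1 1] by simp
  have cd: "closed (coscale a)" for a
  proof (cases "a = 0")
    case True
    have "coscale 0 = test \<fatsemi> all" using HA[OF HA_eqs.scal_zero, of 1 1] by simp
    then show ?thesis using True closed_seq[OF closed_test closed_all] by simp
  qed (simp add: coscale fn)
  have codup: "closed codup"
    by (subst codup_eq, unfold codup_del, intro closed_seq closed_tens fn I closed_test) auto
  have comerge: "closed comerge"
    by (subst comerge_eq, intro closed_seq closed_tens fn I closed_all cd) auto
  show ?thesis
  proof (cases g)
    case (Fwd b)
    then show ?thesis
      by (cases b) (use codup comerge closed_all closed_test cd fn in auto)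
  qed (use fn in auto)
qed

lemma closed_eval: "has_type ih_arity t m n \<Longrightarrow> closed \<lbrakk>t\<rbrakk>"
proof (induction rule: has_type.induct)
  case (5 t m n u k)
  then show ?case using eval_type[OF 5(1)] eval_type[OF 5(2)] by (simp add: closed_seq)
qed (use closed_gen closed_tens closed_fn[of Id\<^sub>0 0 0] closed_fn[of Id 1 1] closed_fn[of Tw 2 2] in simp_all)

text \<open>\<open>closed_eval\<close> is applied to the empty state \<open>\<I> 0\<close> without
  idle wires.\<close>

theorem span_normal_form:
  assumes "has_type ih_arity t 0 n"
  shows "\<exists>G. vectors n G \<and> \<lbrakk>t\<rbrakk> = \<lbrakk>span_term n G\<rbrakk>"
proof (rule state_span_term)
  note [simp] = eval_type[OF assms]
  have "state 0 (\<I> 0)" using stateI[of Id\<^sub>0 0 0] by simp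
  then have "state (0 + (tgt \<lbrakk>t\<rbrakk> + 0)) (\<I> 0 \<fatsemi> (\<I> 0 \<boxplus> (\<lbrakk>t\<rbrakk> \<boxplus> \<I> 0)))"
    using closed_eval[OF assms] unfolding closed_def by (metis add_0 add_0_right eval_type[OF assms])
  then show "state n \<lbrakk>t\<rbrakk>" by simp
qed

text \<open>Recovers \<open>t\<close> from its version with one input bent to the outputs, by a
  context that does not depend on \<open>t\<close>. Equality of the bent arrows therefore gives
  equality of the original ones.\<close>

lemma unbend:
  assumes "has_type ih_arity t (Suc m) n"
  shows "\<lbrakk>t\<rbrakk> = (\<I> 1 \<boxplus> \<lbrakk>((zero_t ;; add_op) \<oplus>\<^sub>t id_term m) ;; (Id \<oplus>\<^sub>t t)\<rbrakk>) \<fatsemi> ((codup \<fatsemi> del) \<boxplus> \<I> n)"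
proof -
  note [simp] = eval_type[OF assms]
  have c: "\<I> 2 \<boxplus> \<lbrakk>t\<rbrakk> = \<I> 1 \<boxplus> (\<I> 1 \<boxplus> \<lbrakk>t\<rbrakk>)" by (simp add: tens_ide_ide numeral_2_eq_2)
  have "(\<I> 1 \<boxplus> (((all \<fatsemi> dup) \<boxplus> \<I> m) \<fatsemi> (\<I> 1 \<boxplus> \<lbrakk>t\<rbrakk>))) \<fatsemi> ((codup \<fatsemi> del) \<boxplus> \<I> n)
    = (\<I> 1 \<boxplus> ((all \<fatsemi> dup) \<boxplus> \<I> m)) \<fatsemi> ((\<I> 2 \<boxplus> \<lbrakk>t\<rbrakk>) \<fatsemi> ((codup \<fatsemi> del) \<boxplus> \<I> n))"
  proof -
    have "\<I> 1 \<boxplus> (((all \<fatsemi> dup) \<boxplus> \<I> m) \<fatsemi> (\<I> 1 \<boxplus> \<lbrakk>t\<rbrakk>)) =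
        (\<I> 1 \<boxplus> ((all \<fatsemi> dup) \<boxplus> \<I> m)) \<fatsemi> (\<I> 1 \<boxplus> (\<I> 1 \<boxplus> \<lbrakk>t\<rbrakk>))"
      by (simp add: tens_seq)
    then show ?thesis unfolding c by (simp add: seq_seq)
  qed
  also have "(\<I> 2 \<boxplus> \<lbrakk>t\<rbrakk>) \<fatsemi> ((codup \<fatsemi> del) \<boxplus> \<I> n) = ((codup \<fatsemi> del) \<boxplus> \<I> (Suc m)) \<fatsemi> \<lbrakk>t\<rbrakk>"
    using tens_split2[of "codup \<fatsemi> del" "\<lbrakk>t\<rbrakk>"] tens_split1[of "codup \<fatsemi> del" "\<lbrakk>t\<rbrakk>"] by simp
  also have "(\<I> 1 \<boxplus> ((all \<fatsemi> dup) \<boxplus> \<I> m)) \<fatsemi> (((codup \<fatsemi> del) \<boxplus> \<I> (Suc m)) \<fatsemi> \<lbrakk>t\<rbrakk>)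
    = (((\<I> 1 \<boxplus> (all \<fatsemi> dup)) \<boxplus> \<I> m) \<fatsemi> (((codup \<fatsemi> del) \<boxplus> \<I> 1) \<boxplus> \<I> m)) \<fatsemi> \<lbrakk>t\<rbrakk>"
    by (simp add: seq_seq tens_tens tens_ide)
  also have "\<dots> = \<lbrakk>t\<rbrakk>" using snake by (simp add: tens_seq tens_ide)
  finally show ?thesis by simp
qed

end

section \<open>\<open>IH\<^sup>C\<^sup>o\<^sup>r\<close> and linear relations\<close>

lemma term_class_Id: "term_class ar E (Id \<oplus>\<^sub>t Id\<^sub>0) = term_class ar E Id"
  by (rule term_class_eqI, rule sm_cong.tens_unit_right, rule has_type.intros)

lemma eval_presented:
  "has_type ar t m n \<Longrightarrow> eval (presented_prop ar E) (\<lambda>g. term_class ar E (Gen g)) t = term_class ar E t"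
proof (induction rule: has_type.induct)
  case 2
  show ?case by (simp add: presented_ide)
next
  case 3
  show ?case by (simp add: presented_ide term_class_Id)
next
  case 4
  interpret is_prop "presented_prop ar E" by (rule presented_is_prop)
  let ?P = "presented_prop ar E"
  have Id: "term_class ar E Id = ide ?P 1"
    by (simp add: presented_ide term_class_Id)
  have "term_class ar E Tw \<in> hom (presented_prop ar E) 2 2" by (auto simp: presented_hom)
  then have [simp]: "arr (term_class ar E Tw)" "src (term_class ar E Tw) = 2" "tgt (term_class ar E Tw) = 2"
    by (simp_all add: hom_iff)
  \<comment> \<open>\<open>braid_term 1 1\<close> is not literally \<open>Tw\<close>: the recursion
    surrounds it with identities, which are cancelled here by the prop laws.\<close>
  have "braid ?P 1 1 = term_class ar E (braid_term 1 1)" by (simp add: presented_braid)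
  also have "\<dots> = (ide ?P 1 \<boxplus>\<^bsub>?P\<^esub> ide ?P 1) \<fatsemi>\<^bsub>?P\<^esub>
      (((term_class ar E Tw \<boxplus>\<^bsub>?P\<^esub> ide ?P 0) \<fatsemi>\<^bsub>?P\<^esub> (ide ?P 1 \<boxplus>\<^bsub>?P\<^esub> ide ?P 1)) \<boxplus>\<^bsub>?P\<^esub> ide ?P 0)"
  proof -
    have "ide ?P 1 \<boxplus>\<^bsub>?P\<^esub> ide ?P 1 = term_class ar E (Id \<oplus>\<^sub>t id_term 1)"
      using presented_tens[of ar Id 1 1 "id_term 1" 1 1 E] Id by (simp add: presented_ide)
    moreover have "ide ?P 1 \<boxplus>\<^bsub>?P\<^esub> ide ?P 1 = term_class ar E (Id \<oplus>\<^sub>t Id)"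
      using presented_tens[of ar Id 1 1 Id 1 1 E] Id by simp
    moreover have "term_class ar E Tw \<boxplus>\<^bsub>?P\<^esub> ide ?P 0 = term_class ar E (Tw \<oplus>\<^sub>t Id\<^sub>0)"
      using presented_tens[of ar Tw 2 2 Id\<^sub>0 0 0 E] by (simp add: presented_ide)
    moreover have "term_class ar E (Tw \<oplus>\<^sub>t Id\<^sub>0) \<fatsemi>\<^bsub>?P\<^esub> term_class ar E (Id \<oplus>\<^sub>t Id) =
        term_class ar E ((Tw \<oplus>\<^sub>t Id\<^sub>0) ;; (Id \<oplus>\<^sub>t Id))"
      by (rule presented_seq[of ar _ 2 2 _ 2]) auto
    moreover have "term_class ar E ((Tw \<oplus>\<^sub>t Id\<^sub>0) ;; (Id \<oplus>\<^sub>t Id)) \<boxplus>\<^bsub>?P\<^esub> ide ?P 0 =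
        term_class ar E (((Tw \<oplus>\<^sub>t Id\<^sub>0) ;; (Id \<oplus>\<^sub>t Id)) \<oplus>\<^sub>t Id\<^sub>0)"
      using presented_tens[of ar "(Tw \<oplus>\<^sub>t Id\<^sub>0) ;; (Id \<oplus>\<^sub>t Id)" 2 2 Id\<^sub>0 0 0 E] by (auto simp: presented_ide)
    moreover have "term_class ar E (Id \<oplus>\<^sub>t id_term 1) \<fatsemi>\<^bsub>?P\<^esub>
        term_class ar E (((Tw \<oplus>\<^sub>t Id\<^sub>0) ;; (Id \<oplus>\<^sub>t Id)) \<oplus>\<^sub>t Id\<^sub>0) = term_class ar E (braid_term 1 1)"
      by (subst presented_seq[of ar _ 2 2 _ 2]) auto
    ultimately show ?thesis by metis
  qed
  also have "\<dots> = term_class ar E Tw" by (simp add: tens_ide numeral_2_eq_2[symmetric])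
  finally show ?case by simp
next
  case (5 t m n u k)
  then show ?case by (simp add: presented_seq)
next
  case (6 t m n u m' n')
  then show ?case by (simp add: presented_tens)
qed simp

abbreviation ih_class :: "'k::field ih_gen smterm \<Rightarrow> 'k ih_gen smterm set" where
  "ih_class \<equiv> term_class ih_arity IH_Cor_eqs"

lemma eval_IH: "has_type ih_arity t m n \<Longrightarrow> eval IH_Cor (\<lambda>g. ih_class (Gen g)) t = ih_class t"
  unfolding IH_Cor_def by (rule eval_presented)

text \<open>The presented prop is its own model, so whatever was calculated in
  \<open>ih_model\<close> is derivable from the equations.\<close>

lemma ih_model_IH: "ih_model (IH_Cor :: 'k::field ih_gen smterm set prop_cat) (\<lambda>g. ih_class (Gen g))"
proof (intro ih_model.intro prop_model.intro prop_model_axioms.intro ih_model_axioms.intro)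
  show "is_prop (IH_Cor :: 'k ih_gen smterm set prop_cat)" unfolding IH_Cor_def by (rule presented_is_prop)
  show "ih_class (Gen g) \<in> hom IH_Cor (fst (ih_arity g)) (snd (ih_arity g))" for g :: "'k ih_gen"
    unfolding IH_Cor_def by (auto simp: presented_hom)
  fix t u :: "'k ih_gen smterm" and m n
  assume "(t, u) \<in> IH_Cor_eqs" "has_type ih_arity t m n" "has_type ih_arity u m n"
  then show "eval IH_Cor (\<lambda>g. ih_class (Gen g)) t = eval IH_Cor (\<lambda>g. ih_class (Gen g)) u"
    using eval_IH term_class_eqI[OF sm_cong.eqn] by metis
qed

text \<open>Induction on the number of inputs, each of which is bent to the outputs. Without inputs,
  soundness lets \<open>sem\<close> recover the span of a normal form, and the span determines the
  arrow.\<close>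

theorem completeness:
  assumes "has_type ih_arity t m n" "has_type ih_arity u m n" "sem t = sem u"
  shows "ih_class t = ih_class u"
  using assms
proof (induction m arbitrary: n t u)
  case 0
  interpret ih_model IH_Cor "\<lambda>g. ih_class (Gen g) :: 'a ih_gen smterm set" by (rule ih_model_IH)
  let ?ev = "eval IH_Cor (\<lambda>g. ih_class (Gen g) :: 'a ih_gen smterm set)"
  have nf: "\<exists>G. vectors n G \<and> ih_class v = ih_class (span_term n G) \<and> sem v = {([], y) |y. y \<in> vspan n G}"
    if v: "has_type ih_arity v 0 n" for v :: "'a ih_gen smterm"
  proof -
    obtain G where G: "vectors n G" "?ev (v) = ?ev (span_term n G)" using span_normal_form[OF v] by blast
    then have eq: "ih_class v = ih_class (span_term n G)"
      using eval_IH[OF v] eval_IH[OF has_type_span_term[OF G(1)]] by simp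
    have "sem v = sem (span_term n G)" using soundness[OF term_class_eqD[OF v eq]] .
    then show ?thesis using G(1) eq by (auto simp: sem_span_term)
  qed
  obtain G where G: "vectors n G" "ih_class t = ih_class (span_term n G)" "sem t = {([], y) |y. y \<in> vspan n G}"
    using nf[OF 0(1)] by blast
  obtain G' where G': "vectors n G'" "ih_class u = ih_class (span_term n G')" "sem u = {([], y) |y. y \<in> vspan n G'}"
    using nf[OF 0(2)] by blast
  have "vspan n G = vspan n G'" using G(3) G'(3) 0(3) by auto
  from span_term_eqI[OF G(1) G'(1) this] show ?case
    using G G' eval_IH[OF has_type_span_term[OF G(1)]] eval_IH[OF has_type_span_term[OF G'(1)]] by simp
next
  case (Suc m)
  interpret ih_model IH_Cor "\<lambda>g. ih_class (Gen g) :: 'a ih_gen smterm set" by (rule ih_model_IH)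
  let ?ev = "eval IH_Cor (\<lambda>g. ih_class (Gen g) :: 'a ih_gen smterm set)"
  let ?b = "\<lambda>t. ((zero_t ;; add_op) \<oplus>\<^sub>t id_term m) ;; (Id \<oplus>\<^sub>t t)"
  have ty: "has_type ih_arity (?b v) m (Suc n)" if "has_type ih_arity v (Suc m) n" for v :: "'a ih_gen smterm"
  proof (rule has_type.intros)
    show "has_type ih_arity ((zero_t ;; add_op) \<oplus>\<^sub>t id_term m) m (1 + Suc m)" by (auto intro!: exI[of _ 0])
    show "has_type ih_arity (Id \<oplus>\<^sub>t v) (1 + Suc m) (Suc n)" using has_type.intros(6)[OF has_type.intros(3) that] by simp
  qed
  have b: "ih_class (?b t) = ih_class (?b u)"
    by (rule Suc.IH[OF ty[OF Suc.prems(1)] ty[OF Suc.prems(2)]]) (simp add: Suc.prems(3))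
  have "?ev (?b t) = ?ev (?b u)"
    unfolding eval_IH[OF ty[OF Suc.prems(1)]] eval_IH[OF ty[OF Suc.prems(2)]] by (rule b)
  \<comment> \<open>\<open>unbend\<close> writes both arrows as the same context around equal
    arrows.\<close>
  then have "?ev t = ?ev u" unfolding unbend[OF Suc.prems(1)] unbend[OF Suc.prems(2)] by (rule arg_cong)
  then show ?case unfolding eval_IH[OF Suc.prems(1)] eval_IH[OF Suc.prems(2)] .
qed

lemma comb_take_drop:
  assumes "vectors (m + n) G" "length us = length G"
  shows "comb (m + n) us G = comb m us (map (take m) G) @ comb n us (map (drop m) G)"
  using assms
proof (induction G arbitrary: us)
  case (Cons v G)
  then obtain u vs where us: "us = u # vs" "length vs = length G" by (metis length_Suc_conv list.size(4))
  have v: "length v = m + n" "vectors (m + n) G" using Cons.prems by auto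
  then have "vectors m (map (take m) G)" by (auto simp: vectors_def)
  moreover have "vscale u v = vscale u (take m v) @ vscale u (drop m v)"
    by (metis append_take_drop_id vec_simps(12))
  ultimately show ?case using Cons.IH[of vs] us v by simp
qed simp

text \<open>The rows of a basis are split in two, so that a linear relation becomes a span of linear maps.\<close>

lemma linrel_basis:
  fixes S :: "('k::field laurent list \<times> 'k laurent list) set"
  assumes "linrel m n S"
  obtains G G' where "vectors m G" "vectors n G'" "length G' = length G"
    "S = {(comb m us G, comb n us G') |us. length us = length G}"
    "\<And>us. length us = length G \<Longrightarrow> comb m us G = vzero m \<Longrightarrow> comb n us G' = vzero n \<Longrightarrow> us = vzero (length G)"
proof -
  let ?S = "{x @ y |x y. (x, y) \<in> S}"
  have "submodule (m + n) ?S"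
    unfolding submodule_def
  proof (intro conjI ballI allI)
    show "vzero (m + n) \<in> ?S" using linrelD(3)[OF assms] by (auto simp flip: vzero_append)
    show "length x = m + n" if "x \<in> ?S" for x using linrelD(1,2)[OF assms] that by auto
    show "vadd x y \<in> ?S" if xy: "x \<in> ?S" "y \<in> ?S" for x y
    proof -
      obtain a b where 1: "x = a @ b" "(a, b) \<in> S" using xy(1) by blast
      obtain c d where 2: "y = c @ d" "(c, d) \<in> S" using xy(2) by blast
      have "vadd x y = vadd a c @ vadd b d"
        using 1 2 linrelD(1)[OF assms 1(2)] linrelD(1)[OF assms 2(2)] by simp
      then show ?thesis using linrelD(4)[OF assms 1(2) 2(2)] by blast
    qed
    show "vscale r x \<in> ?S" if x: "x \<in> ?S" for r x
    proof -
      obtain a b where 1: "x = a @ b" "(a, b) \<in> S" using x by blast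
      then show ?thesis using linrelD(5)[OF assms 1(2), of r] by auto
    qed
  qed
  from submodule_basis[OF this] obtain G where G: "vectors (m + n) G" "vspan (m + n) G = ?S" "independent (m + n) G"
    by blast
  let ?G1 = "map (take m) G" and ?G2 = "map (drop m) G"
  have v: "vectors m ?G1" "vectors n ?G2" using G(1) by (auto simp: vectors_def)
  have eq: "S = {(comb m us ?G1, comb n us ?G2) |us. length us = length ?G1}"
  proof (intro equalityI subsetI)
    fix z assume z: "z \<in> S"
    obtain x y where xy: "z = (x, y)" by (cases z)
    then have "x @ y \<in> vspan (m + n) G" using z G(2) by blast
    then obtain us where us: "x @ y = comb m us ?G1 @ comb n us ?G2" "length us = length G"
      using comb_take_drop[OF G(1)] by (auto simp: vspan_def)
    moreover have "length x = m" using linrelD(1)[OF assms] z xy by blast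
    ultimately have "x = comb m us ?G1" "y = comb n us ?G2" using v by simp_all
    then show "z \<in> {(comb m us ?G1, comb n us ?G2) |us. length us = length ?G1}" using us(2) xy by auto
  next
    fix z assume "z \<in> {(comb m us ?G1, comb n us ?G2) |us. length us = length ?G1}"
    then obtain us where us: "z = (comb m us ?G1, comb n us ?G2)" "length us = length G" by auto
    have "comb (m + n) us G \<in> vspan (m + n) G" using us(2) by (auto simp: vspan_def)
    then have "comb (m + n) us G \<in> ?S" by (simp only: G(2))
    then obtain x y where xy: "comb m us ?G1 @ comb n us ?G2 = x @ y" "(x, y) \<in> S"
      using comb_take_drop[OF G(1) us(2)] by auto
    moreover have "length x = m" using linrelD(1)[OF assms xy(2)] .
    ultimately show "z \<in> S" using v us by simp
  qed
  have ind: "us = vzero (length ?G1)" if "length us = length ?G1" "comb m us ?G1 = vzero m" "comb n us ?G2 = vzero n" for us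
    using that comb_take_drop[OF G(1), of us] G(3) by (simp add: independent_def)
  show thesis by (rule that[OF v _ eq ind]) simp_all
qed

text \<open>If the rows (x i, y i) span the relation, it is the converse of u to the combination of
  the x i, followed by u to the combination of the y i.\<close>

lemma LinRel_full:
  fixes S :: "('k::field laurent list \<times> 'k laurent list) set"
  assumes "linrel m n S" shows "\<exists>t. has_type ih_arity t m n \<and> sem t = S"
proof -
  obtain G G' where G: "vectors m G" "vectors n G'" "length G' = length G"
    "S = {(comb m us G, comb n us G') |us. length us = length G}"
    by (rule linrel_basis[OF assms]) blast
  let ?t = "mirror (comb_term m G) ;; comb_term n G'"
  have "has_type ih_arity ?t m n"
    using has_type_mirror[OF has_type_comb[OF G(1)]] has_type_comb[OF G(2)] G(3) by (auto intro: has_type.intros(5) simp del: has_type_simps)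
  moreover have "sem ?t = S"
  proof -
    have "sem (comb_term m G) = {(us, comb m us G) |us. length us = length G}"
      "sem (comb_term n G') = {(us, comb n us G') |us. length us = length G}"
      using G(1-3) by (auto simp: sem_fn_term[OF fn_term_comb has_type_comb] act_comb)
    then have "(x, y) \<in> sem ?t \<longleftrightarrow> (x, y) \<in> S" for x y
      by (auto simp: G(4) mem_seq sem_mirror)
    then show ?thesis by auto
  qed
  ultimately show ?thesis by blast
qed

text \<open>By soundness all members of a class denote the same relation, so the union is that
  relation and no representative has to be chosen.\<close>

definition class_sem :: "'k::field ih_gen smterm set \<Rightarrow> ('k laurent list \<times> 'k laurent list) set" where
  "class_sem X = \<Union> (sem ` X)"

lemma class_sem[simp]: assumes "has_type ih_arity t m n" shows "class_sem (ih_class t) = sem t"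
proof -
  have "sem u = sem t" if u: "u \<in> ih_class t" for u
  proof -
    obtain m n where "sm_cong ih_arity IH_Cor_eqs m n t u" using u unfolding mem_term_class by blast
    from soundness[OF this] show ?thesis by simp
  qed
  moreover have "ih_class t \<noteq> {}" using sm_cong.refl[OF assms] mem_term_class by blast
  ultimately show ?thesis unfolding class_sem_def by (intro SUP_eq_const)
qed

lemma IH_hom: "hom IH_Cor m n = ih_class ` {t. has_type ih_arity t m n}"
  unfolding IH_Cor_def by (rule presented_hom)

lemma IH_homE:
  assumes "X \<in> hom IH_Cor m n"
  obtains t where "has_type ih_arity t m n" "X = ih_class t"
  using assms by (auto simp: IH_hom)

lemma IH_transport:
  "prop_transport LinRel (IH_Cor :: 'k::field ih_gen smterm set prop_cat) class_sem"
proof -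
  interpret P: is_prop "IH_Cor :: 'k ih_gen smterm set prop_cat" unfolding IH_Cor_def by (rule presented_is_prop)
  interpret L: prop_model LinRel ih_arity "gen_rel :: 'k ih_gen \<Rightarrow> _" by (rule sem_model)
  show ?thesis
  proof (intro prop_transport.intro prop_transport_axioms.intro)
    show "is_prop (LinRel :: ('k laurent list \<times> 'k laurent list) set prop_cat)" by (rule LinRel_is_prop)
    show "bij_betw class_sem (hom (IH_Cor :: 'k ih_gen smterm set prop_cat) m n) (hom LinRel m n)" for m n
      unfolding bij_betw_def
    proof
      show "inj_on class_sem (hom (IH_Cor :: 'k ih_gen smterm set prop_cat) m n)"
      proof (rule inj_onI)
        fix X Y :: "'k ih_gen smterm set"
        assume XY: "X \<in> hom IH_Cor m n" "Y \<in> hom IH_Cor m n" "class_sem X = class_sem Y"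
        obtain t where t: "has_type ih_arity t m n" "X = ih_class t" by (rule IH_homE[OF XY(1)])
        obtain u where u: "has_type ih_arity u m n" "Y = ih_class u" by (rule IH_homE[OF XY(2)])
        show "X = Y" using completeness[OF t(1) u(1)] XY(3) t u by simp
      qed
      show "class_sem ` hom (IH_Cor :: 'k ih_gen smterm set prop_cat) m n = hom LinRel m n"
      proof (intro equalityI subsetI)
        fix S :: "('k laurent list \<times> 'k laurent list) set" assume "S \<in> hom LinRel m n"
        then obtain t :: "'k ih_gen smterm" where "has_type ih_arity t m n" "sem t = S" using LinRel_full[of m n S] by (auto simp: LinRel_hom)
        then show "S \<in> class_sem ` hom (IH_Cor :: 'k ih_gen smterm set prop_cat) m n"
          by (auto simp: IH_hom image_image intro!: rev_image_eqI[of t])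
      qed (auto simp: IH_hom LinRel_hom sem_linrel)
    qed
    show "class_sem (ide (IH_Cor :: 'k ih_gen smterm set prop_cat) m) = ide LinRel m" for m
      by (simp add: IH_Cor_def presented_ide class_sem[of _ m m])
    show "class_sem (braid (IH_Cor :: 'k ih_gen smterm set prop_cat) m n) = braid LinRel m n" for m n
      by (simp add: IH_Cor_def presented_braid class_sem[OF has_type_braid])
    show "class_sem (X \<fatsemi>\<^bsub>IH_Cor\<^esub> Y) = class_sem X \<fatsemi>\<^bsub>LinRel\<^esub> class_sem Y"
      if XY: "X \<in> hom IH_Cor m n" "Y \<in> hom IH_Cor n k" for X Y :: "'k ih_gen smterm set" and m n k
    proof -
      obtain t where t: "has_type ih_arity t m n" "X = ih_class t" by (rule IH_homE[OF XY(1)])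
      obtain u where u: "has_type ih_arity u n k" "Y = ih_class u" by (rule IH_homE[OF XY(2)])
      have "X \<fatsemi>\<^bsub>IH_Cor\<^esub> Y = ih_class (t ;; u)"
        unfolding t(2) u(2) IH_Cor_def by (rule presented_seq[OF t(1) u(1)])
      then show ?thesis using class_sem[OF has_type.intros(5)[OF t(1) u(1)]] t u by simp
    qed
    show "class_sem (X \<boxplus>\<^bsub>IH_Cor\<^esub> Y) = class_sem X \<boxplus>\<^bsub>LinRel\<^esub> class_sem Y"
      if XY: "X \<in> hom IH_Cor m n" "Y \<in> hom IH_Cor m' n'" for X Y :: "'k ih_gen smterm set" and m n m' n'
    proof -
      obtain t where t: "has_type ih_arity t m n" "X = ih_class t" by (rule IH_homE[OF XY(1)])
      obtain u where u: "has_type ih_arity u m' n'" "Y = ih_class u" by (rule IH_homE[OF XY(2)])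
      have "X \<boxplus>\<^bsub>IH_Cor\<^esub> Y = ih_class (t \<oplus>\<^sub>t u)"
        unfolding t(2) u(2) IH_Cor_def by (rule presented_tens[OF t(1) u(1)])
      then show ?thesis using class_sem[OF has_type.intros(6)[OF t(1) u(1)]] t u by simp
    qed
  qed (rule P.ide_hom P.seq_hom P.tens_hom P.braid_hom; assumption?)+
qed

theorem IH_Cor_isomorphic_LinRel:
  "props_isomorphic (IH_Cor :: 'k::field ih_gen smterm set prop_cat)
     (LinRel :: ('k laurent list \<times> 'k laurent list) set prop_cat)"
  by (rule prop_transport.isomorphic[OF IH_transport])

section \<open>Corelations and linear relations\<close>

text \<open>A cospan is sent to the set of pairs \<open>(u A, u B)\<close>, i.e. to the row space of \<open>[A B]\<close>.\<close>

definition row_act :: "'r::comm_ring_1 mat \<Rightarrow> 'r list \<Rightarrow> 'r list" where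
  "row_act A u = map (\<lambda>j. \<Sum>i = 0..<dim_row A. u ! i * A $$ (i, j)) [0..<dim_col A]"

definition cospan_rel :: "'r::comm_ring_1 cospan \<Rightarrow> ('r list \<times> 'r list) set" where
  "cospan_rel = (\<lambda>(A, B). {(row_act A u, row_act B u) |u. length u = dim_row A})"

definition mat_of_vecs :: "nat \<Rightarrow> 'r list list \<Rightarrow> 'r mat" where
  "mat_of_vecs n G = mat (length G) n (\<lambda>(i, j). G ! i ! j)"

lemma mat_of_vecs_carrier[simp]: "mat_of_vecs n G \<in> carrier_mat (length G) n"
  "dim_row (mat_of_vecs n G) = length G" "dim_col (mat_of_vecs n G) = n"
  by (simp_all add: mat_of_vecs_def)

lemma length_row_act[simp]: "length (row_act A u) = dim_col A"
  by (simp add: row_act_def)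

lemma row_act_nth[simp]: "j < dim_col A \<Longrightarrow> row_act A u ! j = (\<Sum>i = 0..<dim_row A. u ! i * A $$ (i, j))"
  by (simp add: row_act_def)

lemma vec_nth[simp]: "i < n \<Longrightarrow> vzero n ! i = 0"
  "i < length x \<Longrightarrow> i < length y \<Longrightarrow> vadd x y ! i = x ! i + y ! i"
  "i < length x \<Longrightarrow> vscale a x ! i = a * x ! i"
  by (simp_all add: vzero_def vadd_def vscale_def)

lemma row_act_mat_of_vecs:
  assumes "vectors n G" "length us = length G" shows "row_act (mat_of_vecs n G) us = comb n us G"
proof (rule nth_equalityI)
  fix j assume "j < length (row_act (mat_of_vecs n G) us)"
  then have j: "j < n" by simp
  have "comb n us G ! j = (\<Sum>i = 0..<length G. us ! i * G ! i ! j)"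
    using assms
  proof (induction G arbitrary: us)
    case (Cons v G)
    then obtain u vs where us: "us = u # vs" "length vs = length G" by (metis length_Suc_conv list.size(4))
    with Cons j show ?case by (simp add: sum.atLeast0_lessThan_Suc_shift del: sum.op_ivl_Suc)
  qed (use j in simp)
  then show "row_act (mat_of_vecs n G) us ! j = comb n us G ! j"
    using j by (simp add: mat_of_vecs_def)
qed (use assms in simp)

lemma row_act_mult:
  assumes "A \<in> carrier_mat a b" "B \<in> carrier_mat b c" "length u = a"
  shows "row_act (A * B) u = row_act B (row_act A u)"
proof (rule nth_equalityI)
  fix j assume "j < length (row_act (A * B) u)"
  then have j: "j < c" using assms by simp
  have "row_act (A * B) u ! j = (\<Sum>i = 0..<a. \<Sum>k = 0..<b. u ! i * (A $$ (i, k) * B $$ (k, j)))"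
    using assms j by (simp add: scalar_prod_def sum_distrib_left)
  also have "\<dots> = (\<Sum>k = 0..<b. (\<Sum>i = 0..<a. u ! i * A $$ (i, k)) * B $$ (k, j))"
    by (subst sum.swap) (simp add: sum_distrib_right mult.assoc)
  also have "\<dots> = row_act B (row_act A u) ! j" using assms j by simp
  finally show "row_act (A * B) u ! j = row_act B (row_act A u) ! j" .
qed (use assms in simp)

lemma row_act_one[simp]: "length u = n \<Longrightarrow> row_act (1\<^sub>m n) u = u"
proof (rule nth_equalityI)
  fix j assume "length u = n" "j < length (row_act (1\<^sub>m n) u)"
  then have j: "j < n" by simp
  have "(\<Sum>i = 0..<n. u ! i * (if i = j then 1 else 0)) = (\<Sum>i = 0..<n. if i = j then u ! j else 0)"
    by (intro sum.cong) auto
  then show "row_act (1\<^sub>m n) u ! j = u ! j" using j by simp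
qed simp

lemma row_act_linear:
  assumes "A \<in> carrier_mat d m"
  shows "length u = d \<Longrightarrow> length v = d \<Longrightarrow> row_act A (vadd u v) = vadd (row_act A u) (row_act A v)"
    and "length u = d \<Longrightarrow> row_act A (vscale a u) = vscale a (row_act A u)"
    and "row_act A (vzero d) = vzero m"
proof -
  show "length u = d \<Longrightarrow> length v = d \<Longrightarrow> row_act A (vadd u v) = vadd (row_act A u) (row_act A v)"
    using assms by (intro nth_equalityI) (simp_all add: sum.distrib distrib_right)
  show "length u = d \<Longrightarrow> row_act A (vscale a u) = vscale a (row_act A u)"
    using assms by (intro nth_equalityI) (simp_all add: sum_distrib_left mult.assoc)
  show "row_act A (vzero d) = vzero m"
    using assms by (intro nth_equalityI) simp_all
qed

lemma Mat_simps[simp]: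
  "hom Mat m n = carrier_mat n m" "ide Mat m = 1\<^sub>m m" "A \<fatsemi>\<^bsub>Mat\<^esub> B = B * A"
  "A \<boxplus>\<^bsub>Mat\<^esub> B = four_block_mat A (0\<^sub>m (dim_row A) (dim_col B)) (0\<^sub>m (dim_row B) (dim_col A)) B"
  "braid Mat m n = four_block_mat (0\<^sub>m n m) (1\<^sub>m n) (1\<^sub>m m) (0\<^sub>m m n)"
  by (simp_all add: Mat_def)

lemma copair_carrier[simp]: "A \<in> carrier_mat d m \<Longrightarrow> B \<in> carrier_mat d n \<Longrightarrow> copair A B \<in> carrier_mat d (m + n)"
  by (rule carrier_matI) (simp_all add: copair_def)

lemma row_act_copair:
  assumes "A \<in> carrier_mat d m" "B \<in> carrier_mat d n"
  shows "row_act (copair A B) u = row_act A u @ row_act B u"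
  using assms by (intro nth_equalityI) (auto simp: copair_def nth_append)

lemma mat_eq_row_act:
  assumes "A \<in> carrier_mat d m" "B \<in> carrier_mat d m" "\<And>u. length u = d \<Longrightarrow> row_act A u = row_act B u"
  shows "A = B"
proof (rule eq_matI)
  fix i j assume ij: "i < dim_row B" "j < dim_col B"
  let ?u = "map (\<lambda>k. if k = i then 1 else 0) [0..<d]"
  have "(\<Sum>k = 0..<d. ?u ! k * C $$ (k, j)) = C $$ (i, j)" for C :: "'a mat"
  proof -
    have "(\<Sum>k = 0..<d. ?u ! k * C $$ (k, j)) = (\<Sum>k = 0..<d. if k = i then C $$ (i, j) else 0)"
      by (intro sum.cong) auto
    then show ?thesis using ij assms(2) by simp
  qed
  then have "row_act A ?u ! j = A $$ (i, j)" "row_act B ?u ! j = B $$ (i, j)"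
    using ij assms(1,2) by simp_all
  then show "A $$ (i, j) = B $$ (i, j)" using assms(3)[of ?u] by simp
qed (use assms in auto)

lemma mult_copair:
  assumes "L \<in> carrier_mat c d" "A \<in> carrier_mat d m" "B \<in> carrier_mat d n"
  shows "L * copair A B = copair (L * A) (L * B)"
proof (rule mat_eq_row_act[of _ c "m + n"])
  have C: "copair A B \<in> carrier_mat d (m + n)" using assms by simp
  then show "L * copair A B \<in> carrier_mat c (m + n)" using assms(1) by (rule mult_carrier_mat[rotated])
  show "copair (L * A) (L * B) \<in> carrier_mat c (m + n)" using assms by (intro copair_carrier) auto
  fix u :: "'a list" assume u: "length u = c"
  have "row_act (copair (L * A) (L * B)) u = row_act (L * A) u @ row_act (L * B) u"
    using assms by (intro row_act_copair) auto
  then show "row_act (L * copair A B) u = row_act (copair (L * A) (L * B)) u"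
    using assms by (simp add: row_act_mult[OF assms(1) C u] row_act_mult[OF assms(1,2) u]
        row_act_mult[OF assms(1,3) u] row_act_copair[OF assms(2,3)])
qed

lemma copair_inj:
  assumes "A \<in> carrier_mat d m" "A' \<in> carrier_mat d m" "B \<in> carrier_mat d n" "B' \<in> carrier_mat d n"
    and eq: "copair A B = copair A' B'"
  shows "A = A' \<and> B = B'"
proof
  have e: "copair A B $$ (i, j) = copair A' B' $$ (i, j)" for i j using eq by simp
  show "A = A'"
  proof (rule eq_matI)
    fix i j assume "i < dim_row A'" "j < dim_col A'"
    then show "A $$ (i, j) = A' $$ (i, j)" using e[of i j] assms(1-4) by (simp add: copair_def)
  qed (use assms in auto)
  show "B = B'"
  proof (rule eq_matI)
    fix i j assume "i < dim_row B'" "j < dim_col B'"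
    then show "B $$ (i, j) = B' $$ (i, j)" using e[of i "m + j"] assms(1-4) by (simp add: copair_def)
  qed (use assms in auto)
qed

text \<open>Applied to unit vectors, the inclusion of relations gives a coefficient vector for every
  row of \<open>[A B]\<close>. These vectors are the rows of \<open>L\<close>.\<close>

lemma mat_factor:
  assumes A: "A \<in> carrier_mat d m" "B \<in> carrier_mat d n" and A': "A' \<in> carrier_mat d' m" "B' \<in> carrier_mat d' n"
    and sub: "cospan_rel (A, B) \<subseteq> cospan_rel (A', B')"
  obtains L where "L \<in> carrier_mat d d'" "A = L * A'" "B = L * B'"
proof -
  let ?e = "\<lambda>i. map (\<lambda>k. if k = i then 1 else 0 :: 'a) [0..<d]"
  have "\<exists>v. length v = d' \<and> row_act A (?e i) = row_act A' v \<and> row_act B (?e i) = row_act B' v" for i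
  proof -
    have "(row_act A (?e i), row_act B (?e i)) \<in> cospan_rel (A, B)"
      using A by (auto simp: cospan_rel_def intro!: exI[of _ "?e i"])
    then have "(row_act A (?e i), row_act B (?e i)) \<in> cospan_rel (A', B')" using sub by blast
    then show ?thesis using A' by (auto simp: cospan_rel_def)
  qed
  then obtain V where V: "\<And>i. length (V i) = d'" "\<And>i. row_act A (?e i) = row_act A' (V i)"
    "\<And>i. row_act B (?e i) = row_act B' (V i)" by metis
  define L where "L = mat d d' (\<lambda>(i, k). V i ! k)"
  have unit: "(\<Sum>k = 0..<d. ?e i ! k * C $$ (k, j)) = C $$ (i, j)" if "i < d" for C :: "'a mat" and i j
  proof -
    have "(\<Sum>k = 0..<d. ?e i ! k * C $$ (k, j)) = (\<Sum>k = 0..<d. if k = i then C $$ (i, j) else 0)"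
      by (intro sum.cong) auto
    then show ?thesis using that by simp
  qed
  have LC: "C = L * C'" if C: "C \<in> carrier_mat d p" "C' \<in> carrier_mat d' p" "\<And>i. row_act C (?e i) = row_act C' (V i)"
    for C C' :: "'a mat" and p
  proof (rule eq_matI)
    fix i j assume "i < dim_row (L * C')" "j < dim_col (L * C')"
    then have ij: "i < d" "j < p" using C by (simp_all add: L_def)
    have "C $$ (i, j) = row_act C (?e i) ! j"
      using ij C(1) unit[OF ij(1), of C j] by (subst row_act_nth) simp_all
    also have "\<dots> = row_act C' (V i) ! j" unfolding C(3) ..
    also have "\<dots> = (L * C') $$ (i, j)"
      using ij C(1,2) by (simp add: L_def scalar_prod_def)
    finally show "C $$ (i, j) = (L * C') $$ (i, j)" .
  qed (use C in \<open>auto simp: L_def\<close>)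
  show thesis
    by (rule that[of L]) (use LC[OF A(1) A'(1) V(2)] LC[OF A(2) A'(2) V(3)] in \<open>auto simp: L_def\<close>)
qed

lemma cospan_rel_mult:
  assumes "L \<in> carrier_mat d d'" "A \<in> carrier_mat d' m" "B \<in> carrier_mat d' n"
  shows "cospan_rel (L * A, L * B) \<subseteq> cospan_rel (A, B)"
proof
  fix z assume "z \<in> cospan_rel (L * A, L * B)"
  then obtain u where u: "z = (row_act (L * A) u, row_act (L * B) u)" "length u = d"
    using assms by (auto simp: cospan_rel_def)
  then have "z = (row_act A (row_act L u), row_act B (row_act L u))" "length (row_act L u) = d'"
    using row_act_mult[OF assms(1,2)] row_act_mult[OF assms(1,3)] assms by simp_all
  then show "z \<in> cospan_rel (A, B)" using assms by (auto simp: cospan_rel_def)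
qed

section \<open>Epimorphisms and isomorphism classes of cospans\<close>

lemma epi_cancel:
  assumes "is_epi Mat m d X" "g \<in> carrier_mat k d" "h \<in> carrier_mat k d" "g * X = h * X"
  shows "g = h"
  using assms by (simp add: is_epi_def)

text \<open>Composition in \<open>Mat\<close> is reversed multiplication, so epi means cancellable
  on the right of a product. A vector in the left kernel is a one-row matrix annihilating
  \<open>X\<close>; conversely, two factors that agree after \<open>X\<close> differ by rows in that
  kernel.\<close>

lemma epi_iff:
  "is_epi Mat m d X \<longleftrightarrow> X \<in> carrier_mat d m \<and> (\<forall>u. length u = d \<longrightarrow> row_act X u = vzero m \<longrightarrow> u = vzero d)"
proof (intro iffI conjI allI impI)
  assume epi: "is_epi Mat m d X"
  then show X: "X \<in> carrier_mat d m" by (simp add: is_epi_def)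
  fix u assume u: "length u = d" "row_act X u = vzero m"
  let ?g = "mat_of_vecs d [u]"
  have g: "?g \<in> carrier_mat 1 d" using mat_of_vecs_carrier(1)[of d "[u]"] by simp
  have "row_act (?g * X) w = row_act (0\<^sub>m 1 d * X) w" if w: "length w = 1" for w
  proof -
    obtain a where a: "w = [a]" using w by (auto simp: length_Suc_conv)
    have "row_act ?g w = vscale a u" using u a row_act_mat_of_vecs[of d "[u]" w] by simp
    then have "row_act (?g * X) w = vzero m"
      using row_act_mult[OF g X w] u X by (simp add: row_act_linear(2)[OF X])
    moreover have "row_act (0\<^sub>m 1 d * X) w = vzero m"
      using X by (intro nth_equalityI) simp_all
    ultimately show ?thesis by simp
  qed
  then have "?g * X = 0\<^sub>m 1 d * X" using X g by (intro mat_eq_row_act[of _ 1 m]) auto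
  then have "?g = 0\<^sub>m 1 d" using epi_cancel[OF epi g] by simp
  then have g0: "?g $$ (0, j) = 0\<^sub>m 1 d $$ (0, j)" for j by simp
  have "u ! j = 0" if "j < d" for j using that g0[of j] by (simp add: mat_of_vecs_def)
  then show "u = vzero d" using u by (intro nth_equalityI) simp_all
next
  assume inj: "X \<in> carrier_mat d m \<and> (\<forall>u. length u = d \<longrightarrow> row_act X u = vzero m \<longrightarrow> u = vzero d)"
  then have X: "X \<in> carrier_mat d m" by simp
  have "g = h" if gh: "g \<in> carrier_mat k d" "h \<in> carrier_mat k d" "g * X = h * X" for g h :: "'a mat" and k
  proof (rule mat_eq_row_act[OF gh(1,2)])
    fix u :: "'a list" assume u: "length u = k"
    let ?v = "vadd (row_act g u) (vscale (- 1) (row_act h u))"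
    have "row_act X ?v = vadd (row_act (g * X) u) (vscale (- 1) (row_act (h * X) u))"
      using gh(1,2) u by (simp add: row_act_linear[OF X] row_act_mult[OF gh(1) X u] row_act_mult[OF gh(2) X u])
    also have "\<dots> = vzero m"
      unfolding gh(3) using X gh by (intro nth_equalityI) simp_all
    finally have "?v = vzero d" using inj gh by simp
    then have "?v ! j = 0" if "j < d" for j using that by simp
    then show "row_act g u = row_act h u" using gh by (intro nth_equalityI) (simp_all add: algebra_simps)
  qed
  then show "is_epi Mat m d X" using X by (auto simp: is_epi_def)
qed

lemma append_eq_vzero: "length x = m \<Longrightarrow> x @ y = vzero (m + n) \<longleftrightarrow> x = vzero m \<and> y = vzero n"
proof -
  assume "length x = m"
  then have "x @ y = vzero m @ vzero n \<longleftrightarrow> x = vzero m \<and> y = vzero n" by (simp del: vzero_append)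
  then show ?thesis by simp
qed

lemma jointly_epic_iff:
  "(A, B) \<in> jointly_epic_cospans m n \<longleftrightarrow> (\<exists>d. A \<in> carrier_mat d m \<and> B \<in> carrier_mat d n \<and>
     (\<forall>u. length u = d \<longrightarrow> row_act A u = vzero m \<longrightarrow> row_act B u = vzero n \<longrightarrow> u = vzero d))"
proof -
  have "row_act (copair A B) u = vzero (m + n) \<longleftrightarrow> row_act A u = vzero m \<and> row_act B u = vzero n"
    if AB: "A \<in> carrier_mat d m" "B \<in> carrier_mat d n" for d u
    using AB by (simp add: row_act_copair[OF AB] append_eq_vzero)
  then have "is_epi Mat (m + n) d (copair A B) \<longleftrightarrow>
      (\<forall>u. length u = d \<longrightarrow> row_act A u = vzero m \<longrightarrow> row_act B u = vzero n \<longrightarrow> u = vzero d)"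
    if "A \<in> carrier_mat d m" "B \<in> carrier_mat d n" for d
    using that by (simp add: epi_iff imp_conjL)
  then show ?thesis by (simp add: jointly_epic_cospans_def cong: conj_cong)
qed

lemma jointly_epicE:
  assumes "x \<in> jointly_epic_cospans m n"
  obtains A B d where "x = (A, B)" "A \<in> carrier_mat d m" "B \<in> carrier_mat d n"
    "is_epi Mat (m + n) d (copair A B)"
  using assms by (auto simp: jointly_epic_cospans_def)

lemma linrel_cospan:
  assumes A: "A \<in> carrier_mat d m" and B: "B \<in> carrier_mat d n"
  shows "linrel m n (cospan_rel (A, B))"
proof (rule linrelI)
  show "length x = m \<and> length y = n" if "(x, y) \<in> cospan_rel (A, B)" for x y
    using that A B by (auto simp: cospan_rel_def)
  show "(vzero m, vzero n) \<in> cospan_rel (A, B)"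
    using row_act_linear(3)[OF A] row_act_linear(3)[OF B] A by (auto simp: cospan_rel_def intro!: exI[of _ "vzero d"])
  show "(vadd x x', vadd y y') \<in> cospan_rel (A, B)"
    if xy: "(x, y) \<in> cospan_rel (A, B)" "(x', y') \<in> cospan_rel (A, B)" for x y x' y'
  proof -
    obtain u u' where "x = row_act A u" "y = row_act B u" "x' = row_act A u'" "y' = row_act B u'" "length u = d" "length u' = d"
      using xy A by (auto simp: cospan_rel_def)
    then show ?thesis
      using A by (auto simp: cospan_rel_def row_act_linear[OF A] row_act_linear[OF B] intro!: exI[of _ "vadd u u'"])
  qed
  show "(vscale a x, vscale a y) \<in> cospan_rel (A, B)" if xy: "(x, y) \<in> cospan_rel (A, B)" for a x y
  proof -
    obtain u where "x = row_act A u" "y = row_act B u" "length u = d"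
      using xy A by (auto simp: cospan_rel_def)
    then show ?thesis
      using A by (auto simp: cospan_rel_def row_act_linear[OF A] row_act_linear[OF B] intro!: exI[of _ "vscale a u"])
  qed
qed

lemma linrel_jointly_epic: "x \<in> jointly_epic_cospans m n \<Longrightarrow> linrel m n (cospan_rel x)"
  by (auto elim!: jointly_epicE intro: linrel_cospan)

text \<open>Shows that factorisations obtained from \<open>mat_factor\<close> in opposite directions
  compose to an identity.\<close>

lemma epi_left_inverse:
  assumes epi: "is_epi Mat (m + n) d (copair A B)" and A: "A \<in> carrier_mat d m" "B \<in> carrier_mat d n"
    and K: "K \<in> carrier_mat d d" "K * A = A" "K * B = B"
  shows "K = 1\<^sub>m d"
proof -
  have "K * copair A B = copair A B" using mult_copair[OF K(1) A] K(2,3) by simp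
  also have "\<dots> = 1\<^sub>m d * copair A B" using left_mult_one_mat[OF copair_carrier[OF A]] by simp
  finally show ?thesis by (rule epi_cancel[OF epi K(1) one_carrier_mat])
qed

text \<open>Equal row spaces give a factorisation in each direction. The two factors are mutually
  inverse because both copairings are epi, so isomorphism classes correspond to relations.\<close>

lemma cospan_iso_iff:
  assumes x: "x \<in> jointly_epic_cospans m n"
  shows "(x, z) \<in> cospan_iso \<longleftrightarrow> z \<in> jointly_epic_cospans m n \<and> cospan_rel z = cospan_rel x"
proof
  obtain A B d where AB: "x = (A, B)" "A \<in> carrier_mat d m" "B \<in> carrier_mat d n"
    "is_epi Mat (m + n) d (copair A B)" by (rule jointly_epicE[OF x])
  assume "(x, z) \<in> cospan_iso"
  then obtain d0 d' U V where U: "A \<in> carrier_mat d0 (dim_col A)" "U \<in> carrier_mat d' d0" "V \<in> carrier_mat d0 d'"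
    "V * U = 1\<^sub>m d0" "U * V = 1\<^sub>m d'" "z = (U * A, U * B)"
    by (auto simp: cospan_iso_def is_iso_def AB(1))
  then have [simp]: "d0 = d" using AB by auto
  have VA: "V * (U * A) = A" "V * (U * B) = B"
    using U AB by (simp_all flip: assoc_mult_mat[of V d d' U d])
  have "cospan_rel z \<subseteq> cospan_rel x" using cospan_rel_mult[of U d' d A m B n] U AB by simp
  moreover have "cospan_rel x \<subseteq> cospan_rel z"
    using cospan_rel_mult[of V d d' "U * A" m "U * B" n] U AB VA by simp
  moreover have "u = vzero d'"
    if u: "length u = d'" "row_act (U * A) u = vzero m" "row_act (U * B) u = vzero n" for u
  proof -
    have "row_act U u = vzero d"
      using AB(4) u U AB(2,3) by (simp add: epi_iff row_act_copair row_act_mult[of U d' d])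
    moreover have "row_act (U * V) u = row_act V (row_act U u)" using U(2,3) u(1) by (intro row_act_mult) simp_all
    moreover have "row_act (U * V) u = u" using U(5) u(1) by simp
    ultimately show ?thesis using row_act_linear(3)[of V d d'] U(3) by simp
  qed
  then have "z \<in> jointly_epic_cospans m n"
    unfolding U(6) jointly_epic_iff using U AB by (intro exI[of _ d']) auto
  ultimately show "z \<in> jointly_epic_cospans m n \<and> cospan_rel z = cospan_rel x" by blast
next
  assume z: "z \<in> jointly_epic_cospans m n \<and> cospan_rel z = cospan_rel x"
  obtain A B d where AB: "x = (A, B)" "A \<in> carrier_mat d m" "B \<in> carrier_mat d n"
    "is_epi Mat (m + n) d (copair A B)" by (rule jointly_epicE[OF x])
  obtain A' B' d' where AB': "z = (A', B')" "A' \<in> carrier_mat d' m" "B' \<in> carrier_mat d' n"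
    "is_epi Mat (m + n) d' (copair A' B')" using z by (auto elim: jointly_epicE)
  obtain L where L: "L \<in> carrier_mat d d'" "A = L * A'" "B = L * B'"
    by (rule mat_factor[OF AB(2,3) AB'(2,3)]) (use z AB(1) AB'(1) in auto)
  obtain L' where L': "L' \<in> carrier_mat d' d" "A' = L' * A" "B' = L' * B"
    by (rule mat_factor[OF AB'(2,3) AB(2,3)]) (use z AB(1) AB'(1) in auto)
  have 1: "L * L' = 1\<^sub>m d"
    by (rule epi_left_inverse[OF AB(4,2,3)]) (use L L' AB in \<open>simp_all add: assoc_mult_mat[of L d d' L' d]\<close>)
  have 2: "L' * L = 1\<^sub>m d'"
    by (rule epi_left_inverse[OF AB'(4,2,3)]) (use L L' AB' in \<open>simp_all add: assoc_mult_mat[of L' d' d L d']\<close>)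
  have "is_iso Mat d d' L'" using L L' 1 2 by (auto simp: is_iso_def)
  then have "\<exists>m n d d' U. A \<in> hom Mat m d \<and> B \<in> hom Mat n d \<and> is_iso Mat d d' U \<and>
      A' = A \<fatsemi>\<^bsub>Mat\<^esub> U \<and> B' = B \<fatsemi>\<^bsub>Mat\<^esub> U"
    using AB(2,3) L' by (intro exI[of _ m] exI[of _ n] exI[of _ d] exI[of _ d'] exI[of _ L']) simp
  then show "(x, z) \<in> cospan_iso" by (simp add: cospan_iso_def AB(1) AB'(1))
qed

lemma cospan_iso_image:
  "x \<in> jointly_epic_cospans m n \<Longrightarrow> cospan_iso `` {x} = {z \<in> jointly_epic_cospans m n. cospan_rel z = cospan_rel x}"
  using cospan_iso_iff by blast

text \<open>A basis is taken as the list of rows of \<open>[A B]\<close>: its independence is joint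
  epicness.\<close>

lemma jointly_epic_exists:
  fixes S :: "('k::field laurent list \<times> 'k laurent list) set"
  assumes "linrel m n S" shows "\<exists>x \<in> jointly_epic_cospans m n. cospan_rel x = S"
proof -
  obtain G G' where G: "vectors m G" "vectors n G'" "length G' = length G"
    "S = {(comb m us G, comb n us G') |us. length us = length G}"
    "\<And>us. length us = length G \<Longrightarrow> comb m us G = vzero m \<Longrightarrow> comb n us G' = vzero n \<Longrightarrow> us = vzero (length G)"
    by (rule linrel_basis[OF assms]) blast
  let ?x = "(mat_of_vecs m G, mat_of_vecs n G')"
  have "mat_of_vecs n G' \<in> carrier_mat (length G) n" using G(3) by (metis mat_of_vecs_carrier(1))
  then have "?x \<in> jointly_epic_cospans m n"
    unfolding jointly_epic_iff using G(1-3,5) by (intro exI[of _ "length G"]) (simp add: row_act_mat_of_vecs)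
  moreover have "cospan_rel ?x = S"
  proof -
    have "row_act (mat_of_vecs m G) us = comb m us G \<and> row_act (mat_of_vecs n G') us = comb n us G'"
      if "length us = length G" for us using that G(1-3) by (simp add: row_act_mat_of_vecs)
    then have "(\<exists>us. z = (row_act (mat_of_vecs m G) us, row_act (mat_of_vecs n G') us) \<and> length us = length G) \<longleftrightarrow>
        (\<exists>us. z = (comb m us G, comb n us G') \<and> length us = length G)" for z by (intro ex_cong1) auto
    then show ?thesis by (simp add: cospan_rel_def G(4))
  qed
  ultimately show ?thesis by blast
qed

section \<open>Pushouts and composites of corelations\<close>

lemma pushoutD:
  assumes "is_pushout Mat n d d' e B A' P Q"
  shows "B \<in> carrier_mat d n" "A' \<in> carrier_mat d' n" "P \<in> carrier_mat e d" "Q \<in> carrier_mat e d'" "P * B = Q * A'"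
    and "p \<in> carrier_mat k d \<Longrightarrow> q \<in> carrier_mat k d' \<Longrightarrow> p * B = q * A' \<Longrightarrow>
      \<exists>!u. u \<in> carrier_mat k e \<and> u * P = p \<and> u * Q = q"
  using assms by (simp_all add: is_pushout_def)

text \<open>A row vector of length \<open>e\<close> is an arrow from \<open>e\<close> to 1. The
  universal property at the object 1 thus turns a pushout of matrices into a pullback of row
  vectors.\<close>

lemma pushout_rel:
  assumes po: "is_pushout Mat n d d' e B A' P Q" and u: "length u = d" "length v = d'"
  shows "row_act B u = row_act A' v \<longleftrightarrow> (\<exists>w. length w = e \<and> u = row_act P w \<and> v = row_act Q w)"
proof
  have c: "B \<in> carrier_mat d n" "A' \<in> carrier_mat d' n" "P \<in> carrier_mat e d" "Q \<in> carrier_mat e d'" "P * B = Q * A'"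
    by (rule pushoutD[OF po])+
  assume eq: "row_act B u = row_act A' v"
  let ?p = "mat_of_vecs d [u]" and ?q = "mat_of_vecs d' [v]"
  have p: "?p \<in> carrier_mat 1 d" "?q \<in> carrier_mat 1 d'" using mat_of_vecs_carrier(1)[of _ "[_]"] by simp_all
  have act: "row_act ?p [a] = vscale a u" "row_act ?q [a] = vscale a v" for a
    using row_act_mat_of_vecs[of d "[u]" "[a]"] row_act_mat_of_vecs[of d' "[v]" "[a]"] u by simp_all
  have "?p * B = ?q * A'"
  proof (rule mat_eq_row_act[of _ 1 n])
    fix w :: "'a list" assume "length w = 1"
    then obtain a where "w = [a]" by (auto simp: length_Suc_conv)
    then show "row_act (?p * B) w = row_act (?q * A') w"
      using row_act_mult[OF p(1) c(1), of w] row_act_mult[OF p(2) c(2), of w] eq u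
      by (simp add: act row_act_linear[OF c(1)] row_act_linear[OF c(2)])
  qed (use p c in auto)
  then obtain W where W: "W \<in> carrier_mat 1 e" "W * P = ?p" "W * Q = ?q"
    using pushoutD(6)[OF po p] by blast
  have "u = row_act P (row_act W [1])" "v = row_act Q (row_act W [1])"
    using row_act_mult[OF W(1) c(3), of "[1]"] row_act_mult[OF W(1) c(4), of "[1]"] W act[of 1] by simp_all
  then show "\<exists>w. length w = e \<and> u = row_act P w \<and> v = row_act Q w"
    using W(1) by (intro exI[of _ "row_act W [1]"]) auto
next
  have c: "B \<in> carrier_mat d n" "A' \<in> carrier_mat d' n" "P \<in> carrier_mat e d" "Q \<in> carrier_mat e d'" "P * B = Q * A'"
    by (rule pushoutD[OF po])+
  assume "\<exists>w. length w = e \<and> u = row_act P w \<and> v = row_act Q w"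
  then obtain w where "length w = e" "u = row_act P w" "v = row_act Q w" by blast
  then show "row_act B u = row_act A' v"
    using row_act_mult[OF c(3,1), of w] row_act_mult[OF c(4,2), of w] c(5) by simp
qed

text \<open>The pairs (u, v) with u B = v A' form a submodule of a free module; a basis of it
  supplies the rows of \<open>[P Q]\<close>. Factorisations through these rows exist because row
  spaces are included, and are unique because \<open>[P Q]\<close> is epi.\<close>

lemma pushout_exists:
  fixes B A' :: "'k::field laurent mat"
  assumes B: "B \<in> carrier_mat d n" and A': "A' \<in> carrier_mat d' n"
  shows "\<exists>e P Q. is_pushout Mat n d d' e B A' P Q"
proof -
  let ?K = "{(u, v). length u = d \<and> length v = d' \<and> row_act B u = row_act A' v}"
  have K: "linrel d d' ?K"
    by (rule linrelI) (auto simp: row_act_linear[OF B] row_act_linear[OF A'])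
  then obtain x where x: "x \<in> jointly_epic_cospans d d'" "cospan_rel x = ?K"
    using jointly_epic_exists[OF K] by blast
  obtain P Q e where PQ: "x = (P, Q)" "P \<in> carrier_mat e d" "Q \<in> carrier_mat e d'"
    "is_epi Mat (d + d') e (copair P Q)" by (rule jointly_epicE[OF x(1)])
  have "P * B = Q * A'"
  proof (rule mat_eq_row_act[of _ e n])
    fix w :: "'k laurent list" assume w: "length w = e"
    then have "(row_act P w, row_act Q w) \<in> cospan_rel x" using PQ by (auto simp: cospan_rel_def)
    then show "row_act (P * B) w = row_act (Q * A') w"
      unfolding x(2) using row_act_mult[OF PQ(2) B w] row_act_mult[OF PQ(3) A' w] by simp
  qed (use PQ B A' in auto)
  moreover have "\<exists>!u. u \<in> carrier_mat k e \<and> u * P = p \<and> u * Q = q"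
    if pq: "p \<in> carrier_mat k d" "q \<in> carrier_mat k d'" "p * B = q * A'" for k p q
  proof -
    have "cospan_rel (p, q) \<subseteq> cospan_rel (P, Q)"
    proof
      fix z assume "z \<in> cospan_rel (p, q)"
      then obtain w where w: "z = (row_act p w, row_act q w)" "length w = k" using pq by (auto simp: cospan_rel_def)
      then have "z \<in> ?K"
        using row_act_mult[OF pq(1) B w(2)] row_act_mult[OF pq(2) A' w(2)] pq by simp
      then show "z \<in> cospan_rel (P, Q)" using x(2) PQ(1) by simp
    qed
    then obtain L where L: "L \<in> carrier_mat k e" "p = L * P" "q = L * Q"
      by (rule mat_factor[OF pq(1,2) PQ(2,3)]) blast
    moreover have "u = L" if u: "u \<in> carrier_mat k e" "u * P = p" "u * Q = q" for u
    proof -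
      have "u * copair P Q = L * copair P Q" using u L PQ by (simp add: mult_copair)
      then show ?thesis by (rule epi_cancel[OF PQ(4) u(1) L(1)])
    qed
    ultimately show ?thesis by blast
  qed
  ultimately have "is_pushout Mat n d d' e B A' P Q"
    using B A' PQ unfolding is_pushout_def by simp
  then show ?thesis by blast
qed

lemma pushout_relcomp:
  assumes po: "is_pushout Mat n d d' e B A' P Q" and A: "A \<in> carrier_mat d m" and B': "B' \<in> carrier_mat d' k"
  shows "cospan_rel (P * A, Q * B') = cospan_rel (A, B) O cospan_rel (A', B')"
proof -
  have c: "B \<in> carrier_mat d n" "A' \<in> carrier_mat d' n" "P \<in> carrier_mat e d" "Q \<in> carrier_mat e d'"
    by (rule pushoutD[OF po])+
  show ?thesis
  proof (intro equalityI subsetI)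
    fix z assume "z \<in> cospan_rel (P * A, Q * B')"
    then obtain w where w: "z = (row_act (P * A) w, row_act (Q * B') w)" "length w = e"
      using c by (auto simp: cospan_rel_def)
    have eq: "row_act B (row_act P w) = row_act A' (row_act Q w)"
      using pushout_rel[OF po, of "row_act P w" "row_act Q w"] w(2) c by auto
    have "z = (row_act A (row_act P w), row_act B' (row_act Q w))"
      using w row_act_mult[OF c(3) A] row_act_mult[OF c(4) B'] by simp
    moreover have "(row_act A (row_act P w), row_act B (row_act P w)) \<in> cospan_rel (A, B)"
      "(row_act A' (row_act Q w), row_act B' (row_act Q w)) \<in> cospan_rel (A', B')"
      using A c by (auto simp: cospan_rel_def)
    ultimately show "z \<in> cospan_rel (A, B) O cospan_rel (A', B')" using eq by auto
  next
    fix z assume "z \<in> cospan_rel (A, B) O cospan_rel (A', B')"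
    then obtain u v where uv: "z = (row_act A u, row_act B' v)" "length u = d" "length v = d'" "row_act B u = row_act A' v"
      using A c by (auto simp: cospan_rel_def)
    then obtain w where "length w = e" "u = row_act P w" "v = row_act Q w" using pushout_rel[OF po] by blast
    then have "z = (row_act (P * A) w, row_act (Q * B') w)" "length w = e"
      using uv row_act_mult[OF c(3) A] row_act_mult[OF c(4) B'] by simp_all
    then show "z \<in> cospan_rel (P * A, Q * B')" using c by (auto simp: cospan_rel_def)
  qed
qed

text \<open>Splitting off a split mono does not change the row space: \<open>M\<close> and its left
  inverse give the two inclusions. The row space of the pushout cospan is the composite relation by
  \<open>pushout_relcomp\<close>.\<close>

lemma corel_composite_iff:
  fixes x y z :: "'k::field laurent cospan"
  assumes x: "x \<in> jointly_epic_cospans m n" and y: "y \<in> jointly_epic_cospans n k"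
  shows "is_corel_composite x y z \<longleftrightarrow> z \<in> jointly_epic_cospans m k \<and> cospan_rel z = cospan_rel x O cospan_rel y"
proof -
  obtain A B d where AB: "x = (A, B)" "A \<in> carrier_mat d m" "B \<in> carrier_mat d n" by (rule jointly_epicE[OF x])
  obtain A' B' d' where AB': "y = (A', B')" "A' \<in> carrier_mat d' n" "B' \<in> carrier_mat d' k" by (rule jointly_epicE[OF y])
  obtain C D where z: "z = (C, D)" by (cases z)
  show ?thesis
  proof
    assume "is_corel_composite x y z"
    then obtain m0 n0 k0 d0 d0' e c P Q M where
      co: "A \<in> carrier_mat d0 m0" "B' \<in> carrier_mat d0' k0" "is_pushout Mat n0 d0 d0' e B A' P Q"
        "C \<in> carrier_mat c m0" "D \<in> carrier_mat c k0" "is_epi Mat (m0 + k0) c (copair C D)" "is_split_mono Mat c e M"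
        "M * copair C D = copair (P * A) (Q * B')"
      unfolding is_corel_composite_def AB(1) AB'(1) z by auto
    have [simp]: "d0 = d" "m0 = m" "d0' = d'" "k0 = k" using co(1,2) AB AB' by auto
    have c: "P \<in> carrier_mat e d" "Q \<in> carrier_mat e d'" using pushoutD(3,4)[OF co(3)] by simp_all
    obtain r where M: "M \<in> carrier_mat e c" "r \<in> carrier_mat c e" "r * M = 1\<^sub>m c"
      using co(7) by (auto simp: is_split_mono_def)
    have PA: "P * A = M * C \<and> Q * B' = M * D"
    proof (rule copair_inj[of _ e m _ _ k])
      show "copair (P * A) (Q * B') = copair (M * C) (M * D)"
        using co(4,5,8) M(1) by (simp add: mult_copair)
    qed (use c AB AB' M co in auto)
    have "C = r * (P * A)" "D = r * (Q * B')"
      using PA M co(4,5) by (simp_all flip: assoc_mult_mat[of r c e M c])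
    then have "cospan_rel (C, D) \<subseteq> cospan_rel (P * A, Q * B')"
      using cospan_rel_mult[of r c e "P * A" m "Q * B'" k] M c AB AB' by simp
    moreover have "cospan_rel (P * A, Q * B') \<subseteq> cospan_rel (C, D)"
      using cospan_rel_mult[of M e c C m D k] M co PA by simp
    moreover have "z \<in> jointly_epic_cospans m k"
      using co unfolding z jointly_epic_cospans_def by auto
    ultimately show "z \<in> jointly_epic_cospans m k \<and> cospan_rel z = cospan_rel x O cospan_rel y"
      using pushout_relcomp[OF co(3), of A m B' k] AB AB' z by auto
  next
    assume zr: "z \<in> jointly_epic_cospans m k \<and> cospan_rel z = cospan_rel x O cospan_rel y"
    then obtain c where CD: "C \<in> carrier_mat c m" "D \<in> carrier_mat c k" "is_epi Mat (m + k) c (copair C D)"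
      by (auto simp: z jointly_epic_cospans_def)
    obtain e P Q where po: "is_pushout Mat n d d' e B A' P Q" using pushout_exists[OF AB(3) AB'(2)] by blast
    have c: "P \<in> carrier_mat e d" "Q \<in> carrier_mat e d'" by (rule pushoutD[OF po])+
    have PA: "P * A \<in> carrier_mat e m" "Q * B' \<in> carrier_mat e k" using c AB AB' by auto
    have eq: "cospan_rel (P * A, Q * B') = cospan_rel (C, D)"
      using pushout_relcomp[OF po AB(2) AB'(3)] zr AB AB' z by simp
    obtain M where M: "M \<in> carrier_mat e c" "P * A = M * C" "Q * B' = M * D"
      by (rule mat_factor[OF PA CD(1,2)]) (use eq in auto)
    obtain r where r: "r \<in> carrier_mat c e" "C = r * (P * A)" "D = r * (Q * B')"
      by (rule mat_factor[OF CD(1,2) PA]) (use eq in auto)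
    \<comment> \<open>\<open>r * M\<close> fixes both \<open>C\<close> and \<open>D\<close>, and
      \<open>[C D]\<close> is epi; so \<open>M\<close> is a split mono, as a composite
      requires.\<close>
    have "r * M = 1\<^sub>m c"
      by (rule epi_left_inverse[OF CD(3,1,2)])
        (use M r CD in \<open>simp_all add: assoc_mult_mat[of r c e M c]\<close>)
    then have "is_split_mono Mat c e M" using M(1) r(1) by (auto simp: is_split_mono_def)
    moreover have "M * copair C D = copair (P * A) (Q * B')" using M CD by (simp add: mult_copair)
    ultimately show "is_corel_composite x y z"
      unfolding is_corel_composite_def AB(1) AB'(1) z prod.case Mat_simps
      by (intro exI conjI) (rule AB AB' po CD | assumption)+
  qed
qed

section \<open>The corelation prop read as relations\<close>

definition corel_rel :: "'r::comm_ring_1 cospan set \<Rightarrow> ('r list \<times> 'r list) set" where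
  "corel_rel X = \<Union> (cospan_rel ` X)"

definition corel_class :: "nat \<Rightarrow> nat \<Rightarrow> ('k::field laurent list \<times> 'k laurent list) set \<Rightarrow> 'k laurent cospan set" where
  "corel_class m n S = {z \<in> jointly_epic_cospans m n. cospan_rel z = S}"

lemma corel_rel_class: "linrel m n S \<Longrightarrow> corel_rel (corel_class m n S) = S"
  using jointly_epic_exists[of m n S] by (auto simp: corel_rel_def corel_class_def)

lemma cospan_iso_class:
  "x \<in> jointly_epic_cospans m n \<Longrightarrow> cospan_iso `` {x} = corel_class m n (cospan_rel x)"
  by (simp add: cospan_iso_image corel_class_def)

lemma Corel_hom: "hom Corel_Mat m n = corel_class m n ` {S. linrel m n S}"
proof (intro equalityI subsetI)
  fix X :: "'a laurent cospan set" assume "X \<in> hom Corel_Mat m n"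
  then obtain x where "x \<in> jointly_epic_cospans m n" "X = cospan_iso `` {x}"
    by (auto simp: Corel_Mat_def quotient_def)
  then show "X \<in> corel_class m n ` {S. linrel m n S}" using cospan_iso_class linrel_jointly_epic by blast
next
  fix X :: "'a laurent cospan set" assume "X \<in> corel_class m n ` {S. linrel m n S}"
  then obtain S where "linrel m n S" "X = corel_class m n S" by blast
  moreover then obtain x where x: "x \<in> jointly_epic_cospans m n" "cospan_rel x = S" using jointly_epic_exists by blast
  ultimately have "X = cospan_iso `` {x}" by (simp add: cospan_iso_class[OF x(1)])
  then show "X \<in> hom Corel_Mat m n" using x(1) by (auto simp: Corel_Mat_def quotient_def)
qed

lemma Corel_seq:
  assumes "linrel m n S" "linrel n k T"
  shows "corel_class m n S \<fatsemi>\<^bsub>Corel_Mat\<^esub> corel_class n k T = corel_class m k (S O T)"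
proof -
  obtain x y where xy: "x \<in> corel_class m n S" "y \<in> corel_class n k T"
    using jointly_epic_exists[OF assms(1)] jointly_epic_exists[OF assms(2)] by (auto simp: corel_class_def)
  have "is_corel_composite x y z \<longleftrightarrow> z \<in> corel_class m k (S O T)"
    if "x \<in> corel_class m n S" "y \<in> corel_class n k T" for x y z
    using that corel_composite_iff[of x m n y k z] by (auto simp: corel_class_def)
  then have "(\<exists>x \<in> corel_class m n S. \<exists>y \<in> corel_class n k T. is_corel_composite x y z) \<longleftrightarrow> z \<in> corel_class m k (S O T)" for z
    using xy by blast
  then show ?thesis by (simp add: Corel_Mat_def)
qed

lemma sum_split: "(\<Sum>i = 0..<d + d'. f i) = (\<Sum>i = 0..<d. f i) + (\<Sum>i = 0..<d'. f (d + i))"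
  for f :: "nat \<Rightarrow> 'a::comm_monoid_add"
  by (induction d') (simp_all add: add.assoc)

lemma row_act_tens:
  assumes "A \<in> carrier_mat d m" "A' \<in> carrier_mat d' m'" "length u = d" "length u' = d'"
  shows "row_act (A \<boxplus>\<^bsub>Mat\<^esub> A') (u @ u') = row_act A u @ row_act A' u'"
proof (rule nth_equalityI)
  fix j assume "j < length (row_act (A \<boxplus>\<^bsub>Mat\<^esub> A') (u @ u'))"
  then have j: "j < m + m'" using assms by simp
  show "row_act (A \<boxplus>\<^bsub>Mat\<^esub> A') (u @ u') ! j = (row_act A u @ row_act A' u') ! j"
    using j assms by (auto simp: nth_append sum_split)
qed (use assms in simp)

lemma jointly_epic_tens:
  assumes x: "(A, B) \<in> jointly_epic_cospans m n" and y: "(A', B') \<in> jointly_epic_cospans m' n'"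
  shows "(A \<boxplus>\<^bsub>Mat\<^esub> A', B \<boxplus>\<^bsub>Mat\<^esub> B') \<in> jointly_epic_cospans (m + m') (n + n')"
    and "cospan_rel (A \<boxplus>\<^bsub>Mat\<^esub> A', B \<boxplus>\<^bsub>Mat\<^esub> B') = cospan_rel (A, B) \<boxplus>\<^bsub>LinRel\<^esub> cospan_rel (A', B')"
proof -
  obtain d where d: "A \<in> carrier_mat d m" "B \<in> carrier_mat d n"
    "\<And>u. length u = d \<Longrightarrow> row_act A u = vzero m \<Longrightarrow> row_act B u = vzero n \<Longrightarrow> u = vzero d"
    using x by (auto simp: jointly_epic_iff)
  obtain d' where d': "A' \<in> carrier_mat d' m'" "B' \<in> carrier_mat d' n'"
    "\<And>u. length u = d' \<Longrightarrow> row_act A' u = vzero m' \<Longrightarrow> row_act B' u = vzero n' \<Longrightarrow> u = vzero d'"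
    using y by (auto simp: jointly_epic_iff)
  have car: "A \<boxplus>\<^bsub>Mat\<^esub> A' \<in> carrier_mat (d + d') (m + m')" "B \<boxplus>\<^bsub>Mat\<^esub> B' \<in> carrier_mat (d + d') (n + n')"
    using d d' by auto
  have inj: "u = vzero (d + d')"
    if u: "length u = d + d'" "row_act (A \<boxplus>\<^bsub>Mat\<^esub> A') u = vzero (m + m')" "row_act (B \<boxplus>\<^bsub>Mat\<^esub> B') u = vzero (n + n')" for u
  proof -
    obtain v v' where v: "u = v @ v'" "length v = d" "length v' = d'" using u(1) by (rule length_addE)
    have "row_act A v @ row_act A' v' = vzero m @ vzero m'" "row_act B v @ row_act B' v' = vzero n @ vzero n'"
      using u(2,3) row_act_tens[OF d(1) d'(1) v(2,3)] row_act_tens[OF d(2) d'(2) v(2,3)] v(1) by simp_all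
    then have "v = vzero d" "v' = vzero d'" using d d' v by (simp_all add: append_eq_vzero)
    then show ?thesis using v(1) by simp
  qed
  then show "(A \<boxplus>\<^bsub>Mat\<^esub> A', B \<boxplus>\<^bsub>Mat\<^esub> B') \<in> jointly_epic_cospans (m + m') (n + n')"
    unfolding jointly_epic_iff using car by blast
  show "cospan_rel (A \<boxplus>\<^bsub>Mat\<^esub> A', B \<boxplus>\<^bsub>Mat\<^esub> B') = cospan_rel (A, B) \<boxplus>\<^bsub>LinRel\<^esub> cospan_rel (A', B')"
  proof (intro equalityI subsetI)
    fix z assume "z \<in> cospan_rel (A \<boxplus>\<^bsub>Mat\<^esub> A', B \<boxplus>\<^bsub>Mat\<^esub> B')"
    then obtain u where u: "z = (row_act (A \<boxplus>\<^bsub>Mat\<^esub> A') u, row_act (B \<boxplus>\<^bsub>Mat\<^esub> B') u)" "length u = d + d'"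
      using car by (auto simp: cospan_rel_def simp del: Mat_simps)
    obtain v v' where v: "u = v @ v'" "length v = d" "length v' = d'" using u(2) by (rule length_addE)
    have "z = (row_act A v @ row_act A' v', row_act B v @ row_act B' v')"
      using u(1) row_act_tens[OF d(1) d'(1) v(2,3)] row_act_tens[OF d(2) d'(2) v(2,3)] v(1) by simp
    moreover have "(row_act A v, row_act B v) \<in> cospan_rel (A, B)" "(row_act A' v', row_act B' v') \<in> cospan_rel (A', B')"
      using v d d' by (auto simp: cospan_rel_def)
    ultimately show "z \<in> cospan_rel (A, B) \<boxplus>\<^bsub>LinRel\<^esub> cospan_rel (A', B')" by (auto simp: LinRel_tens)
  next
    fix z assume "z \<in> cospan_rel (A, B) \<boxplus>\<^bsub>LinRel\<^esub> cospan_rel (A', B')"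
    then obtain v v' where v: "z = (row_act A v @ row_act A' v', row_act B v @ row_act B' v')" "length v = d" "length v' = d'"
      using d d' by (auto simp: LinRel_tens cospan_rel_def)
    then have "z = (row_act (A \<boxplus>\<^bsub>Mat\<^esub> A') (v @ v'), row_act (B \<boxplus>\<^bsub>Mat\<^esub> B') (v @ v'))"
      using row_act_tens[OF d(1) d'(1) v(2,3)] row_act_tens[OF d(2) d'(2) v(2,3)] by simp
    moreover have "length (v @ v') = dim_row (A \<boxplus>\<^bsub>Mat\<^esub> A')" using v d d' by simp
    ultimately show "z \<in> cospan_rel (A \<boxplus>\<^bsub>Mat\<^esub> A', B \<boxplus>\<^bsub>Mat\<^esub> B')"
      unfolding cospan_rel_def prod.case by blast
  qed
qed

lemma Corel_tens:
  assumes "linrel m n S" "linrel m' n' T"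
  shows "corel_class m n S \<boxplus>\<^bsub>Corel_Mat\<^esub> corel_class m' n' T = corel_class (m + m') (n + n') (S \<boxplus>\<^bsub>LinRel\<^esub> T)"
proof -
  obtain x y where xy: "x \<in> corel_class m n S" "y \<in> corel_class m' n' T"
    using jointly_epic_exists[OF assms(1)] jointly_epic_exists[OF assms(2)] by (auto simp: corel_class_def)
  have "cospan_iso `` {(A \<boxplus>\<^bsub>Mat\<^esub> A', B \<boxplus>\<^bsub>Mat\<^esub> B')} = corel_class (m + m') (n + n') (S \<boxplus>\<^bsub>LinRel\<^esub> T)"
    if "(A, B) \<in> corel_class m n S" "(A', B') \<in> corel_class m' n' T" for A B A' B'
  proof -
    have je: "(A, B) \<in> jointly_epic_cospans m n" "(A', B') \<in> jointly_epic_cospans m' n'"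
      and rel: "cospan_rel (A, B) = S" "cospan_rel (A', B') = T" using that by (simp_all add: corel_class_def)
    show ?thesis
      unfolding cospan_iso_class[OF jointly_epic_tens(1)[OF je]] jointly_epic_tens(2)[OF je] rel ..
  qed
  note eq = this
  have "(\<Union>x\<in>corel_class m n S. \<Union>y\<in>corel_class m' n' T. case x of (A, B) \<Rightarrow> case y of (A', B') \<Rightarrow>
      cospan_iso `` {(A \<boxplus>\<^bsub>Mat\<^esub> A', B \<boxplus>\<^bsub>Mat\<^esub> B')}) = corel_class (m + m') (n + n') (S \<boxplus>\<^bsub>LinRel\<^esub> T)"
  proof (rule UN2_const[OF xy])
    fix x y :: "'a laurent cospan" assume xy: "x \<in> corel_class m n S" "y \<in> corel_class m' n' T"
    obtain A B A' B' where [simp]: "x = (A, B)" "y = (A', B')" by (cases x, cases y)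
    show "(case x of (A, B) \<Rightarrow> case y of (A', B') \<Rightarrow> cospan_iso `` {(A \<boxplus>\<^bsub>Mat\<^esub> A', B \<boxplus>\<^bsub>Mat\<^esub> B')}) =
        corel_class (m + m') (n + n') (S \<boxplus>\<^bsub>LinRel\<^esub> T)"
      using eq[of A B A' B'] xy by simp
  qed
  then show ?thesis by (simp add: Corel_Mat_def case_prod_unfold del: Mat_simps)
qed

lemma Corel_ide: "ide Corel_Mat m = corel_class m m (ide LinRel m)"
proof -
  let ?x = "(1\<^sub>m m, 1\<^sub>m m) :: 'a laurent cospan"
  have "?x \<in> jointly_epic_cospans m m" unfolding jointly_epic_iff by (intro exI[of _ m]) simp
  moreover have "cospan_rel ?x = ide LinRel m" 
    unfolding cospan_rel_def LinRel_ide prod.case by (intro Collect_cong ex_cong1) auto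
  ultimately show ?thesis using cospan_iso_class[of ?x m m] by (simp add: Corel_Mat_def)
qed

text \<open>Row vectors travel against the direction of the arrow, which is why the argument is
  split as \<open>n + m\<close>, the target of the braiding.\<close>

lemma row_act_braid:
  assumes "length u = n" "length v = m"
  shows "row_act (braid Mat m n) (u @ v) = v @ u"
proof (rule nth_equalityI)
  fix j assume "j < length (row_act (braid Mat m n) (u @ v) :: 'a list)"
  then have j: "j < m + n" by simp
  have unit: "(\<Sum>i = 0..<k. w ! i * (if i = l then 1 else 0)) = (if l < k then w ! l else 0)" for w :: "'a list" and k l
  proof -
    have "(\<Sum>i = 0..<k. w ! i * (if i = l then 1 else 0)) = (\<Sum>i = 0..<k. if i = l then w ! l else 0)"
      by (intro sum.cong) auto
    then show ?thesis by simp
  qed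
  show "row_act (braid Mat m n) (u @ v) ! j = (v @ u) ! j"
    using j assms unit[of u "j - m" n] unit[of v j m]
    by (auto simp: nth_append sum_split one_mat_def)
qed (use assms in simp)

lemma Corel_braid: "braid Corel_Mat m n = corel_class (m + n) (n + m) (braid LinRel m n)"
proof -
  let ?x = "(braid Mat m n, 1\<^sub>m (n + m)) :: 'a laurent cospan"
  have car: "braid Mat m n \<in> carrier_mat (n + m) (m + n)" by auto
  have "?x \<in> jointly_epic_cospans (m + n) (n + m)"
    unfolding jointly_epic_iff using car by (intro exI[of _ "n + m"]) (simp del: Mat_simps)
  moreover have "cospan_rel ?x = braid LinRel m n"
  proof (intro equalityI subsetI)
    fix z assume "z \<in> cospan_rel ?x"
    then obtain u where u: "z = (row_act (braid Mat m n) u, u)" "length u = n + m" by (auto simp: cospan_rel_def)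
    then obtain v w where "u = v @ w" "length v = n" "length w = m" by (metis length_addE)
    then show "z \<in> braid LinRel m n" using u row_act_braid[of v n w m] by (auto simp: LinRel_braid simp del: Mat_simps)
  next
    fix z :: "'a laurent list \<times> 'a laurent list" assume "z \<in> braid LinRel m n"
    then obtain v w where "z = (w @ v, v @ w)" "length v = n" "length w = m" by (auto simp: LinRel_braid)
    then have "z = (row_act (braid Mat m n) (v @ w), row_act (1\<^sub>m (n + m)) (v @ w))" "length (v @ w) = dim_row (braid Mat m n :: 'a laurent mat)"
      using row_act_braid[of v n w m] by (simp_all del: Mat_simps(5)) auto
    then show "z \<in> cospan_rel ?x" unfolding cospan_rel_def prod.case by blast
  qed
  ultimately show ?thesis using cospan_iso_class[of ?x] by (simp add: Corel_Mat_def)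
qed

lemma Corel_transport:
  "prop_transport LinRel (Corel_Mat :: 'k::field laurent cospan set prop_cat) corel_rel"
proof -
  interpret L: is_prop "LinRel :: ('k laurent list \<times> 'k laurent list) set prop_cat" by (rule LinRel_is_prop)
  have hom: "\<exists>S. linrel m n S \<and> X = corel_class m n S" if "X \<in> hom Corel_Mat m n" for X :: "'k laurent cospan set" and m n
    using that by (auto simp: Corel_hom)
  have homI: "corel_class m n S \<in> hom Corel_Mat m n" if "linrel m n S" for S :: "('k laurent list \<times> 'k laurent list) set" and m n
    using that by (auto simp: Corel_hom)
  have ide: "linrel m m (ide LinRel m :: ('k laurent list \<times> 'k laurent list) set)" for m
    using L.ide_hom[of m] by (simp add: LinRel_hom)
  have braid: "linrel (m + n) (n + m) (braid LinRel m n :: ('k laurent list \<times> 'k laurent list) set)" for m n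
    using L.braid_hom[of m n] by (simp add: LinRel_hom)
  have tens: "linrel (m + m') (n + n') (S \<boxplus>\<^bsub>LinRel\<^esub> T)" if "linrel m n S" "linrel m' n' T"
    for S T :: "('k laurent list \<times> 'k laurent list) set" and m n m' n'
    using L.tens_hom[of S m n T m' n'] that by (simp add: LinRel_hom)
  note seq = linrel_relcomp
  show ?thesis
  proof (intro prop_transport.intro prop_transport_axioms.intro)
    show "is_prop (LinRel :: ('k laurent list \<times> 'k laurent list) set prop_cat)" by (rule LinRel_is_prop)
    show "bij_betw corel_rel (hom (Corel_Mat :: 'k laurent cospan set prop_cat) m n) (hom LinRel m n)" for m n
    proof (rule bij_betwI[where g = "corel_class m n"])
      show "corel_rel \<in> hom (Corel_Mat :: 'k laurent cospan set prop_cat) m n \<rightarrow> hom LinRel m n"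
        using hom by (auto simp: corel_rel_class LinRel_hom dest!: hom)
      show "corel_class m n \<in> hom LinRel m n \<rightarrow> hom (Corel_Mat :: 'k laurent cospan set prop_cat) m n"
        using homI by (auto simp: LinRel_hom)
    qed (auto simp: corel_rel_class LinRel_hom dest!: hom)
    show "ide (Corel_Mat :: 'k laurent cospan set prop_cat) m \<in> hom Corel_Mat m m"
      "corel_rel (ide (Corel_Mat :: 'k laurent cospan set prop_cat) m) = ide LinRel m" for m
      by (simp_all add: Corel_ide homI ide corel_rel_class)
    show "braid (Corel_Mat :: 'k laurent cospan set prop_cat) m n \<in> hom Corel_Mat (m + n) (n + m)"
      "corel_rel (braid (Corel_Mat :: 'k laurent cospan set prop_cat) m n) = braid LinRel m n" for m n
      by (simp_all add: Corel_braid homI braid corel_rel_class)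
    fix X Y :: "'k laurent cospan set" and m n k m' n'
    assume "X \<in> hom Corel_Mat m n"
    then obtain S where S: "linrel m n S" "X = corel_class m n S" using hom by blast
    { assume "Y \<in> hom Corel_Mat n k"
      then obtain T where T: "linrel n k T" "Y = corel_class n k T" using hom by blast
      show "X \<fatsemi>\<^bsub>Corel_Mat\<^esub> Y \<in> hom Corel_Mat m k"
        by (simp add: S T Corel_seq[OF S(1) T(1)] homI seq[OF S(1) T(1)])
      show "corel_rel (X \<fatsemi>\<^bsub>Corel_Mat\<^esub> Y) = corel_rel X \<fatsemi>\<^bsub>LinRel\<^esub> corel_rel Y"
        by (simp add: S T Corel_seq[OF S(1) T(1)] corel_rel_class[OF S(1)] corel_rel_class[OF T(1)]
            corel_rel_class[OF seq[OF S(1) T(1)]] LinRel_seq) }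
    { assume "Y \<in> hom Corel_Mat m' n'"
      then obtain T where T: "linrel m' n' T" "Y = corel_class m' n' T" using hom by blast
      show "X \<boxplus>\<^bsub>Corel_Mat\<^esub> Y \<in> hom Corel_Mat (m + m') (n + n')"
        by (simp add: S T Corel_tens[OF S(1) T(1)] homI tens[OF S(1) T(1)])
      show "corel_rel (X \<boxplus>\<^bsub>Corel_Mat\<^esub> Y) = corel_rel X \<boxplus>\<^bsub>LinRel\<^esub> corel_rel Y"
        by (simp add: S T Corel_tens[OF S(1) T(1)] corel_rel_class[OF S(1)] corel_rel_class[OF T(1)]
            corel_rel_class[OF tens[OF S(1) T(1)]]) }
  qed
qed

theorem theorem4p10:
  shows "props_isomorphic (Corel_Mat :: 'k::field laurent cospan set prop_cat)
           (IH_Cor :: 'k ih_gen smterm set prop_cat)"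
  by (rule props_isomorphic_trans[OF prop_transport.isomorphic[OF Corel_transport]
      props_isomorphic_sym[OF IH_Cor_isomorphic_LinRel]])

end
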